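(* Let $S$ be a complex manifold, let $p:X\to S$ be a holomorphic submersion which is also a fibration, and let $\gamma:I\to S$ be a path in $S$. Then $Q_\gamma$, with the left action of $\Pi_1(X_{\gamma(0)})$ and the right action of $\Pi_1(X_{\gamma(1)})$ defined in the context, is a Morita equivalence between $\Pi_1(X_{\gamma(0)})$ and $\Pi_1(X_{\gamma(1)})$.
   Context: $X_s=p^{-1}(s)$; $I=[0,1]$; "fibration" means Serre fibration. **Lie groupoids and Morita equivalences.** All Lie groupoids are holomorphic: $\mathcal{G}$ has complex manifolds of objects $\mathcal{G}^{(0)}$ and arrows $\mathcal{G}^{(1)}$, and source and target $s,t$ are holomorphic submersions. Arrows are multiplied in path order: $g.h$ is defined when $t(g)=s(h)$. A left action of $\mathcal{G}$ on a complex manifold $Q$ with moment map $\mu:Q\to\mathcal{G}^{(0)}$ assigns $g*x$ when $t(g)=\mu(x)$, with $\mu(g*x)=s(g)$ and $g*(g'*x)=(g.g')*x$, identities acting trivially. A right action of $\mathcal{H}$ with moment map $\nu$ assigns $x*h$ when $\nu(x)=s(h)$, with $\nu(x*h)=t(h)$ and the analogous axioms. A Morita equivalence between $\mathcal{G}$ and $\mathcal{H}$ is a complex manifold $Q$ with commuting holomorphic actions, left of $\mathcal{G}$ with moment map $\mu_0:Q\to\mathcal{G}^{(0)}$ and right of $\mathcal{H}$ with moment map $\mu_1:Q\to\mathcal{H}^{(0)}$, such that $\mu_1$ is a left principal $\mathcal{G}$-bundle (a surjective submersion whose fibres are preserved by $\mathcal{G}$, and $\mathcal{G}\times_{\mathcal{G}^{(0)}}Q\to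 Q\times_{\mathcal{H}^{(0)}}Q$, $(g,x)\mapsto(g*x,x)$, is an isomorphism) and $\mu_0$ is likewise a right principal $\mathcal{H}$-bundle. **Fundamental groupoid.** For a complex manifold $Y$, $\Pi_1(Y)$ is the holomorphic Lie groupoid of homotopy classes (fixing endpoints) of paths in $Y$; the charts on arrows come from the local homeomorphism $(t,s):\Pi_1(Y)\to Y\times Y$, where $s$ is the start point and $t$ the end point. $[\alpha].[\beta]$ means first $\alpha$, then $\beta$. **Definition of $Q_\gamma$.** Choose a contractible open $\mathbb{D}\subset S\times\mathbb{C}$ containing the graph $\{(\gamma(t),t):t\in I\}$, and let $\Gamma:\mathbb{D}\to S$ be the projection. Let $\Gamma^*X=X\times_S\mathbb{D}$, with projection $\pi:\Gamma^*X\to\mathbb{D}$ (a holomorphic submersion), and let $\pi_*:\Pi_1(\Gamma^*X)\to\Pi_1(\mathbb{D})$ be the induced holomorphic submersion. Let $e$ be the path $t\mapsto(\gamma(t),t)$ in $\mathbb{D}$. Define $Q_\gamma=\pi_*^{-1}([e])$, a complex submanifold of the space of arrows of $\Pi_1(\Gamma^*X)$ (the choice of $\mathbb{D}$ does not matter). **Actions.** The fibres of $\pi$ over $(\gamma(0),0)$ and $(\gamma(1),1)$ are identified with $X_{\gamma(0)}$ and $X_{\gamma(1)}$; let $\iota_0:\Pi_1(X_{\gamma(0)})\to\Pi_1(\Gamma^*X)$ and $\iota_1:\Pi_1(X_{\gamma(1)})\to\Pi_1(\Gamma^*X)$ be induced by inclusion. The moment maps are $\mu_0([\alpha])=\alpha(0)\in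 X_{\gamma(0)}$ and $\mu_1([\alpha])=\alpha(1)\in X_{\gamma(1)}$. The actions are $[g_0]*[\alpha]=\iota_0[g_0].[\alpha]$ and $[\alpha]*[g_1]=[\alpha].\iota_1[g_1]$. *)

theory Defs
  imports "HOL-Analysis.Analysis"
begin

section \<open>Holomorphic maps between open subsets of complex coordinate spaces\<close>

text \<open>
  The dimensions of fibres, fibre products and arrow spaces vary, so \<open>\<complex>^n\<close> is realised, as in
  \<open>Euclidean_space\<close>, as the sequences that vanish from index \<open>n\<close> on. In particular
  \<open>\<complex>^k \<subseteq> \<complex>^n\<close> for \<open>k \<le> n\<close>.
\<close>

definition cspace :: "nat \<Rightarrow> (nat \<Rightarrow> complex) topology" where
  "cspace n = subtopology (product_topology (\<lambda>_. euclidean) UNIV) {z. \<forall>i\<ge>n. z i = 0}"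

definition cnorm :: "nat \<Rightarrow> (nat \<Rightarrow> complex) \<Rightarrow> real" where
  "cnorm n z = (\<Sum>i<n. cmod (z i))"

text \<open>
  \<open>A\<close> is the complex Jacobian matrix (\<open>A j i = \<partial>F\<^sub>j/\<partial>z\<^sub>i\<close>) of the map \<open>F\<close> from the open set
  \<open>U \<subseteq> \<complex>^n\<close> to \<open>\<complex>^m\<close> at the point \<open>a\<close>.
\<close>

definition has_cderiv ::
  "nat \<Rightarrow> nat \<Rightarrow> (nat \<Rightarrow> complex) set \<Rightarrow> ((nat \<Rightarrow> complex) \<Rightarrow> nat \<Rightarrow> complex) \<Rightarrow>
   (nat \<Rightarrow> complex) \<Rightarrow> (nat \<Rightarrow> nat \<Rightarrow> complex) \<Rightarrow> bool" where
  "has_cderiv n m U F a A \<longleftrightarrow>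
     (\<forall>j<m. \<forall>\<epsilon>>0. \<exists>\<delta>>0. \<forall>z\<in>U. cnorm n (\<lambda>i. z i - a i) < \<delta> \<longrightarrow>
        cmod (F z j - F a j - (\<Sum>i<n. A j i * (z i - a i))) \<le> \<epsilon> * cnorm n (\<lambda>i. z i - a i))"

definition cholomorphic_on ::
  "nat \<Rightarrow> nat \<Rightarrow> (nat \<Rightarrow> complex) set \<Rightarrow> ((nat \<Rightarrow> complex) \<Rightarrow> nat \<Rightarrow> complex) \<Rightarrow> bool" where
  "cholomorphic_on n m U F \<longleftrightarrow> (\<forall>a\<in>U. \<exists>A. has_cderiv n m U F a A)"


section \<open>Complex manifolds\<close>

record 'a chart =
  cdim :: nat
  cdom :: "'a set"
  cmap :: "'a \<Rightarrow> nat \<Rightarrow> complex"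

record 'a cmanifold =
  Top :: "'a topology"
  Atlas :: "'a chart set"

definition is_chart :: "'a topology \<Rightarrow> 'a chart \<Rightarrow> bool" where
  "is_chart T c \<longleftrightarrow>
     openin T (cdom c) \<and>
     openin (cspace (cdim c)) (cmap c ` cdom c) \<and>
     homeomorphic_map (subtopology T (cdom c))
       (subtopology (cspace (cdim c)) (cmap c ` cdom c)) (cmap c)"

text \<open>The coordinate expression of a map \<open>f\<close> with respect to charts \<open>c\<close>, \<open>d\<close>, and its domain.\<close>

definition coord_dom :: "'a chart \<Rightarrow> 'b chart \<Rightarrow> ('a \<Rightarrow> 'b) \<Rightarrow> (nat \<Rightarrow> complex) set" where
  "coord_dom c d f = cmap c ` {x \<in> cdom c. f x \<in> cdom d}"

definition coord_rep ::
  "'a chart \<Rightarrow> 'b chart \<Rightarrow> ('a \<Rightarrow> 'b) \<Rightarrow> (nat \<Rightarrow> complex) \<Rightarrow> nat \<Rightarrow> complex" where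
  "coord_rep c d f = cmap d \<circ> f \<circ> inv_into (cdom c) (cmap c)"

definition holomorphic_in_charts :: "'a chart \<Rightarrow> 'b chart \<Rightarrow> ('a \<Rightarrow> 'b) \<Rightarrow> bool" where
  "holomorphic_in_charts c d f \<longleftrightarrow>
     cholomorphic_on (cdim c) (cdim d) (coord_dom c d f) (coord_rep c d f)"

text \<open>Different connected components may have different dimensions.\<close>

definition complex_manifold :: "'a cmanifold \<Rightarrow> bool" where
  "complex_manifold M \<longleftrightarrow>
     Hausdorff_space (Top M) \<and> second_countable (Top M) \<and>
     (\<forall>c\<in>Atlas M. is_chart (Top M) c) \<and>
     (\<Union>c\<in>Atlas M. cdom c) = topspace (Top M) \<and>
     (\<forall>c\<in>Atlas M. \<forall>d\<in>Atlas M. holomorphic_in_charts c d id)"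

definition holomorphic_map :: "'a cmanifold \<Rightarrow> 'b cmanifold \<Rightarrow> ('a \<Rightarrow> 'b) \<Rightarrow> bool" where
  "holomorphic_map M N f \<longleftrightarrow>
     continuous_map (Top M) (Top N) f \<and>
     (\<forall>c\<in>Atlas M. \<forall>d\<in>Atlas N. holomorphic_in_charts c d f)"

definition biholomorphic_map :: "'a cmanifold \<Rightarrow> 'b cmanifold \<Rightarrow> ('a \<Rightarrow> 'b) \<Rightarrow> bool" where
  "biholomorphic_map M N f \<longleftrightarrow>
     holomorphic_map M N f \<and>
     (\<exists>g. holomorphic_map N M g \<and>
        (\<forall>x\<in>topspace (Top M). g (f x) = x) \<and> (\<forall>y\<in>topspace (Top N). f (g y) = y))"

definition holomorphic_submersion :: "'a cmanifold \<Rightarrow> 'b cmanifold \<Rightarrow> ('a \<Rightarrow> 'b) \<Rightarrow> bool" where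
  "holomorphic_submersion M N f \<longleftrightarrow>
     holomorphic_map M N f \<and>
     (\<forall>x\<in>topspace (Top M). \<forall>c\<in>Atlas M. \<forall>d\<in>Atlas N. x \<in> cdom c \<and> f x \<in> cdom d \<longrightarrow>
        (\<exists>A. has_cderiv (cdim c) (cdim d) (coord_dom c d f) (coord_rep c d f) (cmap c x) A \<and>
             (\<forall>w. \<exists>v. \<forall>j<cdim d. (\<Sum>i<cdim c. A j i * v i) = w j)))"

definition complex_line :: "complex cmanifold" where
  "complex_line =
     \<lparr>Top = euclidean,
      Atlas = {\<lparr>cdim = 1, cdom = UNIV, cmap = (\<lambda>z i. if i = 0 then z else 0)\<rparr>}\<rparr>"

definition chart_prod :: "'a chart \<Rightarrow> 'b chart \<Rightarrow> ('a \<times> 'b) chart" where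
  "chart_prod c d =
     \<lparr>cdim = cdim c + cdim d, cdom = cdom c \<times> cdom d,
      cmap = (\<lambda>(x, y) i. if i < cdim c then cmap c x i else cmap d y (i - cdim c))\<rparr>"

definition manifold_prod :: "'a cmanifold \<Rightarrow> 'b cmanifold \<Rightarrow> ('a \<times> 'b) cmanifold"
    (infixr \<open>\<times>\<^sub>M\<close> 80) where
  "M \<times>\<^sub>M N =
     \<lparr>Top = prod_topology (Top M) (Top N),
      Atlas = {chart_prod c d | c d. c \<in> Atlas M \<and> d \<in> Atlas N}\<rparr>"

definition maximal_atlas :: "'a cmanifold \<Rightarrow> 'a chart set" where
  "maximal_atlas M =
     {c. is_chart (Top M) c \<and>
         (\<forall>d\<in>Atlas M. holomorphic_in_charts c d id \<and> holomorphic_in_charts d c id)}"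

text \<open>
  The structure induced on a subset \<open>N\<close> of the manifold \<open>M\<close>: the subspace topology, with the
  restrictions to \<open>N\<close> of those charts \<open>c\<close> of \<open>M\<close> that carry \<open>N \<inter> cdom c\<close> to a slice \<open>\<complex>^k\<close>. These
  cover \<open>N\<close>, that is \<open>complex_manifold (submanifold M N)\<close> holds, precisely when \<open>N\<close> is an (embedded)
  complex submanifold. Fibres, fibre products and open subsets carry this structure.
\<close>

definition submanifold :: "'a cmanifold \<Rightarrow> 'a set \<Rightarrow> 'a cmanifold" where
  "submanifold M N =
     \<lparr>Top = subtopology (Top M) N,
      Atlas = {\<lparr>cdim = k, cdom = cdom c \<inter> N, cmap = cmap c\<rparr> | c k.
                 c \<in> maximal_atlas M \<and> k \<le> cdim c \<and>
                 cmap c ` (cdom c \<inter> N) = cmap c ` cdom c \<inter> topspace (cspace k)}\<rparr>"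

definition fibre_prod ::
  "'a cmanifold \<Rightarrow> 'b cmanifold \<Rightarrow> ('a \<Rightarrow> 'c) \<Rightarrow> ('b \<Rightarrow> 'c) \<Rightarrow> ('a \<times> 'b) cmanifold" where
  "fibre_prod M N f g = submanifold (M \<times>\<^sub>M N) {(x, y). f x = g y}"

definition fibre :: "'a cmanifold \<Rightarrow> ('a \<Rightarrow> 'b) \<Rightarrow> 'b \<Rightarrow> 'a cmanifold" where
  "fibre M f y = submanifold M {x. f x = y}"

text \<open>The complex structure that a local homeomorphism \<open>f\<close> from the space \<open>T\<close> to \<open>N\<close> induces on \<open>T\<close>.\<close>

definition local_homeo_manifold :: "'a topology \<Rightarrow> ('a \<Rightarrow> 'b) \<Rightarrow> 'b cmanifold \<Rightarrow> 'a cmanifold" where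
  "local_homeo_manifold T f N =
     \<lparr>Top = T,
      Atlas = {\<lparr>cdim = cdim d, cdom = {x \<in> W. f x \<in> cdom d}, cmap = cmap d \<circ> f\<rparr> | W d.
                 openin T W \<and> openin (Top N) (f ` W) \<and>
                 homeomorphic_map (subtopology T W) (subtopology (Top N) (f ` W)) f \<and>
                 d \<in> Atlas N}\<rparr>"


section \<open>Serre fibrations\<close>

definition unit_cube :: "nat \<Rightarrow> (nat \<Rightarrow> real) topology" where
  "unit_cube n = product_topology (\<lambda>_. top_of_set {0..1}) {..<n}"

definition serre_fibration :: "'a topology \<Rightarrow> 'b topology \<Rightarrow> ('a \<Rightarrow> 'b) \<Rightarrow> bool" where
  "serre_fibration E B p \<longleftrightarrow>
     continuous_map E B p \<and>
     (\<forall>n f h.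
        continuous_map (unit_cube n) E f \<and>
        continuous_map (prod_topology (unit_cube n) (top_of_set {0..1::real})) B h \<and>
        (\<forall>x\<in>topspace (unit_cube n). h (x, 0) = p (f x)) \<longrightarrow>
        (\<exists>k. continuous_map (prod_topology (unit_cube n) (top_of_set {0..1::real})) E k \<and>
             (\<forall>x\<in>topspace (unit_cube n). k (x, 0) = f x) \<and>
             (\<forall>x\<in>topspace (unit_cube n). \<forall>t\<in>{0..1}. p (k (x, t)) = h (x, t))))"


section \<open>Lie groupoids and Morita equivalences\<close>

record ('o, 'a) groupoid =
  Obj :: "'o cmanifold"
  Arr :: "'a cmanifold"
  gsrc :: "'a \<Rightarrow> 'o"
  gtgt :: "'a \<Rightarrow> 'o"
  gid :: "'o \<Rightarrow> 'a"
  gmul :: "'a \<Rightarrow> 'a \<Rightarrow> 'a"  \<comment> \<open>path order: \<open>gmul g h\<close> is defined when \<open>gtgt g = gsrc h\<close>\<close>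
  ginv :: "'a \<Rightarrow> 'a"

abbreviation objects :: "('o, 'a) groupoid \<Rightarrow> 'o set" where
  "objects G \<equiv> topspace (Top (Obj G))"

abbreviation arrows :: "('o, 'a) groupoid \<Rightarrow> 'a set" where
  "arrows G \<equiv> topspace (Top (Arr G))"

definition lie_groupoid :: "('o, 'a) groupoid \<Rightarrow> bool" where
  "lie_groupoid G \<longleftrightarrow>
     complex_manifold (Obj G) \<and> complex_manifold (Arr G) \<and>
     holomorphic_submersion (Arr G) (Obj G) (gsrc G) \<and>
     holomorphic_submersion (Arr G) (Obj G) (gtgt G) \<and>
     holomorphic_map (Obj G) (Arr G) (gid G) \<and>
     holomorphic_map (fibre_prod (Arr G) (Arr G) (gtgt G) (gsrc G)) (Arr G)
       (\<lambda>(g, h). gmul G g h) \<and>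
     holomorphic_map (Arr G) (Arr G) (ginv G) \<and>
     (\<forall>x\<in>objects G. gsrc G (gid G x) = x \<and> gtgt G (gid G x) = x) \<and>
     (\<forall>g\<in>arrows G. \<forall>h\<in>arrows G. gtgt G g = gsrc G h \<longrightarrow>
        gsrc G (gmul G g h) = gsrc G g \<and> gtgt G (gmul G g h) = gtgt G h) \<and>
     (\<forall>g\<in>arrows G. \<forall>h\<in>arrows G. \<forall>k\<in>arrows G. gtgt G g = gsrc G h \<and> gtgt G h = gsrc G k \<longrightarrow>
        gmul G (gmul G g h) k = gmul G g (gmul G h k)) \<and>
     (\<forall>g\<in>arrows G.
        gmul G (gid G (gsrc G g)) g = g \<and> gmul G g (gid G (gtgt G g)) = g \<and>
        gsrc G (ginv G g) = gtgt G g \<and> gtgt G (ginv G g) = gsrc G g \<and>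
        gmul G g (ginv G g) = gid G (gsrc G g) \<and> gmul G (ginv G g) g = gid G (gtgt G g))"

definition left_action ::
  "('o, 'a) groupoid \<Rightarrow> 'q cmanifold \<Rightarrow> ('q \<Rightarrow> 'o) \<Rightarrow> ('a \<Rightarrow> 'q \<Rightarrow> 'q) \<Rightarrow> bool" where
  "left_action G Q \<mu> act \<longleftrightarrow>
     holomorphic_map Q (Obj G) \<mu> \<and>
     holomorphic_map (fibre_prod (Arr G) Q (gtgt G) \<mu>) Q (\<lambda>(g, x). act g x) \<and>
     (\<forall>g\<in>arrows G. \<forall>x\<in>topspace (Top Q). gtgt G g = \<mu> x \<longrightarrow> \<mu> (act g x) = gsrc G g) \<and>
     (\<forall>g\<in>arrows G. \<forall>g'\<in>arrows G. \<forall>x\<in>topspace (Top Q). gtgt G g = gsrc G g' \<and> gtgt G g' = \<mu> x \<longrightarrow>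
        act g (act g' x) = act (gmul G g g') x) \<and>
     (\<forall>x\<in>topspace (Top Q). act (gid G (\<mu> x)) x = x)"

definition right_action ::
  "('o, 'a) groupoid \<Rightarrow> 'q cmanifold \<Rightarrow> ('q \<Rightarrow> 'o) \<Rightarrow> ('q \<Rightarrow> 'a \<Rightarrow> 'q) \<Rightarrow> bool" where
  "right_action H Q \<nu> act \<longleftrightarrow>
     holomorphic_map Q (Obj H) \<nu> \<and>
     holomorphic_map (fibre_prod Q (Arr H) \<nu> (gsrc H)) Q (\<lambda>(x, h). act x h) \<and>
     (\<forall>x\<in>topspace (Top Q). \<forall>h\<in>arrows H. \<nu> x = gsrc H h \<longrightarrow> \<nu> (act x h) = gtgt H h) \<and>
     (\<forall>x\<in>topspace (Top Q). \<forall>h\<in>arrows H. \<forall>h'\<in>arrows H. \<nu> x = gsrc H h \<and> gtgt H h = gsrc H h' \<longrightarrow>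
        act (act x h) h' = act x (gmul H h h')) \<and>
     (\<forall>x\<in>topspace (Top Q). act x (gid H (\<nu> x)) = x)"

text \<open>
  \<open>\<pi>\<close> from \<open>Q\<close> to \<open>B\<close> is a left principal \<open>G\<close>-bundle for the left action \<open>act\<close> with moment map \<open>\<mu>\<close>.
\<close>

definition left_principal_bundle ::
  "('o, 'a) groupoid \<Rightarrow> 'q cmanifold \<Rightarrow> ('q \<Rightarrow> 'o) \<Rightarrow> ('a \<Rightarrow> 'q \<Rightarrow> 'q) \<Rightarrow>
   'b cmanifold \<Rightarrow> ('q \<Rightarrow> 'b) \<Rightarrow> bool" where
  "left_principal_bundle G Q \<mu> act B \<pi> \<longleftrightarrow>
     left_action G Q \<mu> act \<and>
     holomorphic_submersion Q B \<pi> \<and> \<pi> ` topspace (Top Q) = topspace (Top B) \<and>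
     (\<forall>g\<in>arrows G. \<forall>x\<in>topspace (Top Q). gtgt G g = \<mu> x \<longrightarrow> \<pi> (act g x) = \<pi> x) \<and>
     biholomorphic_map (fibre_prod (Arr G) Q (gtgt G) \<mu>) (fibre_prod Q Q \<pi> \<pi>)
       (\<lambda>(g, x). (act g x, x))"

definition right_principal_bundle ::
  "('o, 'a) groupoid \<Rightarrow> 'q cmanifold \<Rightarrow> ('q \<Rightarrow> 'o) \<Rightarrow> ('q \<Rightarrow> 'a \<Rightarrow> 'q) \<Rightarrow>
   'b cmanifold \<Rightarrow> ('q \<Rightarrow> 'b) \<Rightarrow> bool" where
  "right_principal_bundle H Q \<nu> act B \<pi> \<longleftrightarrow>
     right_action H Q \<nu> act \<and>
     holomorphic_submersion Q B \<pi> \<and> \<pi> ` topspace (Top Q) = topspace (Top B) \<and>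
     (\<forall>x\<in>topspace (Top Q). \<forall>h\<in>arrows H. \<nu> x = gsrc H h \<longrightarrow> \<pi> (act x h) = \<pi> x) \<and>
     biholomorphic_map (fibre_prod Q (Arr H) \<nu> (gsrc H)) (fibre_prod Q Q \<pi> \<pi>)
       (\<lambda>(x, h). (x, act x h))"

definition morita_equivalence ::
  "('o, 'a) groupoid \<Rightarrow> ('p, 'b) groupoid \<Rightarrow> 'q cmanifold \<Rightarrow>
   ('q \<Rightarrow> 'o) \<Rightarrow> ('a \<Rightarrow> 'q \<Rightarrow> 'q) \<Rightarrow> ('q \<Rightarrow> 'p) \<Rightarrow> ('q \<Rightarrow> 'b \<Rightarrow> 'q) \<Rightarrow> bool" where
  "morita_equivalence G H Q \<mu>0 lact \<mu>1 ract \<longleftrightarrow>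
     lie_groupoid G \<and> lie_groupoid H \<and> complex_manifold Q \<and>
     left_action G Q \<mu>0 lact \<and> right_action H Q \<mu>1 ract \<and>
     (\<forall>g\<in>arrows G. \<forall>x\<in>topspace (Top Q). \<forall>h\<in>arrows H. gtgt G g = \<mu>0 x \<and> \<mu>1 x = gsrc H h \<longrightarrow>
        ract (lact g x) h = lact g (ract x h)) \<and>
     left_principal_bundle G Q \<mu>0 lact (Obj H) \<mu>1 \<and>
     right_principal_bundle H Q \<mu>1 ract (Obj G) \<mu>0"


section \<open>The fundamental groupoid\<close>

text \<open>
  Homotopy classes of paths relative to the endpoints. Paths are maps on \<open>[0,1]\<close>; the values of
  a representing function elsewhere are irrelevant. (The library's \<open>homotopic_paths\<close> and
  \<open>joinpaths\<close> require a topological type class rather than an abstract topology.)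
\<close>

definition path_class :: "'a topology \<Rightarrow> (real \<Rightarrow> 'a) \<Rightarrow> (real \<Rightarrow> 'a) set" where
  "path_class Y \<alpha> =
     {\<beta>. homotopic_with (\<lambda>r. r 0 = \<alpha> 0 \<and> r 1 = \<alpha> 1) (top_of_set {0..1}) Y \<alpha> \<beta>}"

definition path_classes :: "'a topology \<Rightarrow> (real \<Rightarrow> 'a) set set" where
  "path_classes Y = path_class Y ` {\<alpha>. pathin Y \<alpha>}"

definition path_cat :: "(real \<Rightarrow> 'a) \<Rightarrow> (real \<Rightarrow> 'a) \<Rightarrow> real \<Rightarrow> 'a" where
  "path_cat \<alpha> \<beta> = (\<lambda>t. if t \<le> 1/2 then \<alpha> (2 * t) else \<beta> (2 * t - 1))"

definition class_start :: "(real \<Rightarrow> 'a) set \<Rightarrow> 'a" where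
  "class_start c = (SOME \<alpha>. \<alpha> \<in> c) 0"

definition class_end :: "(real \<Rightarrow> 'a) set \<Rightarrow> 'a" where
  "class_end c = (SOME \<alpha>. \<alpha> \<in> c) 1"

text \<open>
  In the next three definitions all sets in the union coincide, so the union is the class of any
  one choice of representatives.
\<close>

definition class_mul :: "'a topology \<Rightarrow> (real \<Rightarrow> 'a) set \<Rightarrow> (real \<Rightarrow> 'a) set \<Rightarrow> (real \<Rightarrow> 'a) set" where
  "class_mul Y c d = (\<Union>\<alpha>\<in>c. \<Union>\<beta>\<in>d. path_class Y (path_cat \<alpha> \<beta>))"

definition class_inv :: "'a topology \<Rightarrow> (real \<Rightarrow> 'a) set \<Rightarrow> (real \<Rightarrow> 'a) set" where
  "class_inv Y c = (\<Union>\<alpha>\<in>c. path_class Y (\<lambda>t. \<alpha> (1 - t)))"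

text \<open>The map on path classes induced by a continuous map \<open>f\<close> into \<open>Y\<close>.\<close>

definition class_map :: "'b topology \<Rightarrow> ('a \<Rightarrow> 'b) \<Rightarrow> (real \<Rightarrow> 'a) set \<Rightarrow> (real \<Rightarrow> 'b) set" where
  "class_map Y f c = (\<Union>\<alpha>\<in>c. path_class Y (f \<circ> \<alpha>))"

text \<open>
  The usual topology on the arrows: the sets \<open>path_nbhd Y U V \<alpha>\<close> of all classes \<open>[\<beta>.\<alpha>.\<delta>]\<close>, with \<open>\<beta>\<close>
  a path in \<open>U\<close> ending at \<open>\<alpha>(0)\<close> and \<open>\<delta>\<close> a path in \<open>V\<close> starting at \<open>\<alpha>(1)\<close>, for open
  neighbourhoods \<open>U\<close> of \<open>\<alpha>(0)\<close> and \<open>V\<close> of \<open>\<alpha>(1)\<close>, form a neighbourhood base at \<open>[\<alpha>]\<close>. On a manifold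
  this makes \<open>(t, s)\<close> a local homeomorphism.
\<close>

definition path_nbhd ::
  "'a topology \<Rightarrow> 'a set \<Rightarrow> 'a set \<Rightarrow> (real \<Rightarrow> 'a) \<Rightarrow> (real \<Rightarrow> 'a) set set" where
  "path_nbhd Y U V \<alpha> =
     {path_class Y (path_cat \<beta> (path_cat \<alpha> \<delta>)) | \<beta> \<delta>.
        pathin (subtopology Y U) \<beta> \<and> \<beta> 1 = \<alpha> 0 \<and> pathin (subtopology Y V) \<delta> \<and> \<delta> 0 = \<alpha> 1}"

definition path_class_open :: "'a topology \<Rightarrow> (real \<Rightarrow> 'a) set set \<Rightarrow> bool" where
  "path_class_open Y W \<longleftrightarrow>
     W \<subseteq> path_classes Y \<and>
     (\<forall>\<alpha>. pathin Y \<alpha> \<and> path_class Y \<alpha> \<in> W \<longrightarrow>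
        (\<exists>U V. openin Y U \<and> openin Y V \<and> \<alpha> 0 \<in> U \<and> \<alpha> 1 \<in> V \<and> path_nbhd Y U V \<alpha> \<subseteq> W))"

definition path_class_top :: "'a topology \<Rightarrow> (real \<Rightarrow> 'a) set topology" where
  "path_class_top Y = topology (path_class_open Y)"

lemma path_nbhd_Int: "path_nbhd Y (U \<inter> U') (V \<inter> V') \<alpha> \<subseteq> path_nbhd Y U V \<alpha> \<inter> path_nbhd Y U' V' \<alpha>"
proof -
  have sub: "pathin (subtopology Y A) \<beta>" "pathin (subtopology Y B) \<beta>"
    if "pathin (subtopology Y (A \<inter> B)) \<beta>" for A B \<beta>
    using that unfolding pathin_def continuous_map_in_subtopology by auto
  show ?thesis
    unfolding path_nbhd_def using sub by blast
qed

lemma istopology_path_class_open: "istopology (path_class_open Y)"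
  unfolding istopology_def
proof (intro conjI allI impI)
  fix W W' assume W: "path_class_open Y W" and W': "path_class_open Y W'"
  show "path_class_open Y (W \<inter> W')"
    unfolding path_class_open_def
  proof (intro conjI allI impI)
    show "W \<inter> W' \<subseteq> path_classes Y"
      using W unfolding path_class_open_def by blast
    fix \<alpha> assume \<alpha>: "pathin Y \<alpha> \<and> path_class Y \<alpha> \<in> W \<inter> W'"
    obtain U V where UV: "openin Y U" "openin Y V" "\<alpha> 0 \<in> U" "\<alpha> 1 \<in> V" "path_nbhd Y U V \<alpha> \<subseteq> W"
      using W \<alpha> unfolding path_class_open_def by blast
    obtain U' V' where UV': "openin Y U'" "openin Y V'" "\<alpha> 0 \<in> U'" "\<alpha> 1 \<in> V'"
        "path_nbhd Y U' V' \<alpha> \<subseteq> W'"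
      using W' \<alpha> unfolding path_class_open_def by blast
    have "openin Y (U \<inter> U')" "openin Y (V \<inter> V')"
      using UV(1,2) UV'(1,2) by (simp_all add: openin_Int)
    moreover have "path_nbhd Y (U \<inter> U') (V \<inter> V') \<alpha> \<subseteq> W \<inter> W'"
      using path_nbhd_Int[of Y U U' V V' \<alpha>] UV(5) UV'(5) by blast
    ultimately show "\<exists>U V. openin Y U \<and> openin Y V \<and> \<alpha> 0 \<in> U \<and> \<alpha> 1 \<in> V \<and>
        path_nbhd Y U V \<alpha> \<subseteq> W \<inter> W'"
      using UV(3,4) UV'(3,4) by blast
  qed
next
  fix \<K> assume K: "\<forall>K\<in>\<K>. path_class_open Y K"
  show "path_class_open Y (\<Union>\<K>)"
    unfolding path_class_open_def
  proof (intro conjI allI impI)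
    show "\<Union>\<K> \<subseteq> path_classes Y"
      using K unfolding path_class_open_def by blast
    fix \<alpha> assume \<alpha>: "pathin Y \<alpha> \<and> path_class Y \<alpha> \<in> \<Union>\<K>"
    then obtain W where W: "W \<in> \<K>" "path_class Y \<alpha> \<in> W" "path_class_open Y W"
      using K by blast
    then obtain U V where "openin Y U" "openin Y V" "\<alpha> 0 \<in> U" "\<alpha> 1 \<in> V" "path_nbhd Y U V \<alpha> \<subseteq> W"
      using \<alpha> unfolding path_class_open_def by blast
    with W(1) show "\<exists>U V. openin Y U \<and> openin Y V \<and> \<alpha> 0 \<in> U \<and> \<alpha> 1 \<in> V \<and>
        path_nbhd Y U V \<alpha> \<subseteq> \<Union>\<K>"
      by blast
  qed
qed

lemma openin_path_class_top [simp]: "openin (path_class_top Y) = path_class_open Y"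
  by (simp add: path_class_top_def istopology_path_class_open topology_inverse')

definition fundamental_groupoid :: "'a cmanifold \<Rightarrow> ('a, (real \<Rightarrow> 'a) set) groupoid" (\<open>\<Pi>\<^sub>1\<close>) where
  "\<Pi>\<^sub>1 Y =
     \<lparr>Obj = Y,
      Arr = local_homeo_manifold (path_class_top (Top Y)) (\<lambda>c. (class_end c, class_start c)) (Y \<times>\<^sub>M Y),
      gsrc = class_start,
      gtgt = class_end,
      gid = (\<lambda>y. path_class (Top Y) (\<lambda>_. y)),
      gmul = class_mul (Top Y),
      ginv = class_inv (Top Y)\<rparr>"


section \<open>The bibundle of a path\<close>

text \<open>\<open>D\<close> is an admissible choice of the auxiliary domain: \<open>S \<times> \<complex>\<close> is the ambient manifold.\<close>

definition graph_nbhd :: "'s cmanifold \<Rightarrow> (real \<Rightarrow> 's) \<Rightarrow> ('s \<times> complex) set \<Rightarrow> bool" where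
  "graph_nbhd S \<gamma> D \<longleftrightarrow>
     openin (Top (S \<times>\<^sub>M complex_line)) D \<and>
     contractible_space (subtopology (Top (S \<times>\<^sub>M complex_line)) D) \<and>
     (\<forall>t\<in>{0..1}. (\<gamma> t, complex_of_real t) \<in> D)"

definition dom_manifold :: "'s cmanifold \<Rightarrow> ('s \<times> complex) set \<Rightarrow> ('s \<times> complex) cmanifold" where
  "dom_manifold S D = submanifold (S \<times>\<^sub>M complex_line) D"

text \<open>\<open>\<Gamma>\<^sup>*X\<close>, where \<open>\<Gamma>\<close> is \<open>fst\<close>; its projection \<open>\<pi>\<close> to \<open>D\<close> is \<open>snd\<close>.\<close>

definition Gamma_pullback ::
  "'x cmanifold \<Rightarrow> 's cmanifold \<Rightarrow> ('x \<Rightarrow> 's) \<Rightarrow> ('s \<times> complex) set \<Rightarrow> ('x \<times> 's \<times> complex) cmanifold"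
  where "Gamma_pullback X S p D = fibre_prod X (dom_manifold S D) p fst"

definition Q_path ::
  "'x cmanifold \<Rightarrow> 's cmanifold \<Rightarrow> ('x \<Rightarrow> 's) \<Rightarrow> ('s \<times> complex) set \<Rightarrow> (real \<Rightarrow> 's) \<Rightarrow>
   (real \<Rightarrow> 'x \<times> 's \<times> complex) set cmanifold" where
  "Q_path X S p D \<gamma> =
     fibre (Arr (\<Pi>\<^sub>1 (Gamma_pullback X S p D)))
       (class_map (Top (dom_manifold S D)) snd)
       (path_class (Top (dom_manifold S D)) (\<lambda>t. (\<gamma> t, complex_of_real t)))"

text \<open>
  The map on path classes induced by the inclusion of \<open>X\<^bsub>\<gamma>(t)\<^esub>\<close> as the fibre of \<open>\<Gamma>\<^sup>*X\<close> over
  \<open>(\<gamma>(t), t)\<close>; used for \<open>t = 0\<close> and \<open>t = 1\<close>.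
\<close>

definition fibre_incl ::
  "'x cmanifold \<Rightarrow> 's cmanifold \<Rightarrow> ('x \<Rightarrow> 's) \<Rightarrow> ('s \<times> complex) set \<Rightarrow> (real \<Rightarrow> 's) \<Rightarrow> real \<Rightarrow>
   (real \<Rightarrow> 'x) set \<Rightarrow> (real \<Rightarrow> 'x \<times> 's \<times> complex) set" where
  "fibre_incl X S p D \<gamma> t =
     class_map (Top (Gamma_pullback X S p D)) (\<lambda>x. (x, \<gamma> t, complex_of_real t))"

definition Q_left_moment :: "(real \<Rightarrow> 'x \<times> 's \<times> complex) set \<Rightarrow> 'x" where
  "Q_left_moment c = fst (class_start c)"

definition Q_right_moment :: "(real \<Rightarrow> 'x \<times> 's \<times> complex) set \<Rightarrow> 'x" where
  "Q_right_moment c = fst (class_end c)"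

definition Q_left_act ::
  "'x cmanifold \<Rightarrow> 's cmanifold \<Rightarrow> ('x \<Rightarrow> 's) \<Rightarrow> ('s \<times> complex) set \<Rightarrow> (real \<Rightarrow> 's) \<Rightarrow>
   (real \<Rightarrow> 'x) set \<Rightarrow> (real \<Rightarrow> 'x \<times> 's \<times> complex) set \<Rightarrow> (real \<Rightarrow> 'x \<times> 's \<times> complex) set" where
  "Q_left_act X S p D \<gamma> g c =
     gmul (\<Pi>\<^sub>1 (Gamma_pullback X S p D)) (fibre_incl X S p D \<gamma> 0 g) c"

definition Q_right_act ::
  "'x cmanifold \<Rightarrow> 's cmanifold \<Rightarrow> ('x \<Rightarrow> 's) \<Rightarrow> ('s \<times> complex) set \<Rightarrow> (real \<Rightarrow> 's) \<Rightarrow>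
   (real \<Rightarrow> 'x \<times> 's \<times> complex) set \<Rightarrow> (real \<Rightarrow> 'x) set \<Rightarrow> (real \<Rightarrow> 'x \<times> 's \<times> complex) set" where
  "Q_right_act X S p D \<gamma> c g =
     gmul (\<Pi>\<^sub>1 (Gamma_pullback X S p D)) c (fibre_incl X S p D \<gamma> 1 g)"

end

theory Submission
  imports Defs "HOL-Complex_Analysis.Complex_Analysis"
begin

text \<open>
  Write \<open>Z\<close> for \<open>\<Gamma>\<^sup>*X\<close>, \<open>d\<^sub>t\<close> for the point \<open>(\<gamma>(t), t)\<close>, \<open>F\<^sub>t\<close> for the fibre over \<open>d\<^sub>t\<close>, and \<open>\<iota>\<^sub>t\<close>
  for the map that the inclusion of \<open>F\<^sub>t\<close> induces on path classes.

  The base \<open>D\<close> is contractible, so it has exactly one path class between any two points, and a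
  class of \<open>Z\<close> lies in \<open>Q\<close> as soon as its ends lie over \<open>d\<^sub>0\<close> and \<open>d\<^sub>1\<close> (\<open>Q_eq\<close>). Hence \<open>Q\<close> is a
  fibre of the submersion that projects the two ends of a class to \<open>D\<close>: the end point map is a
  local homeomorphism, and \<open>Z \<rightarrow> D\<close> is a submersion. Moving one end in its fibre and lifting along
  the end point map shows that the moment maps are submersions (\<open>submersion_moments\<close>); lifting \<open>e\<close>
  or its reverse along the fibration \<open>Z \<rightarrow> D\<close> shows that they are onto (\<open>moments_onto\<close>). The
  actions are restrictions of the multiplication of \<open>\<Pi>\<^sub>1(Z)\<close>.

  The heart of the matter is principality. If \<open>c\<close> and \<open>c'\<close> in \<open>Q\<close> have the same right end, then
  \<open>c'.c\<inverse>\<close> is a class of \<open>Z\<close> with both ends in \<open>F\<^sub>0\<close>, and the arrow that carries \<open>c\<close> to \<open>c'\<close> is its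
  preimage under \<open>\<iota>\<^sub>0\<close>. So it must be shown that \<open>\<iota>\<^sub>t\<close> is a bijection from the path classes of \<open>F\<^sub>t\<close>
  to the classes of \<open>Z\<close> with both ends in \<open>F\<^sub>t\<close>, with holomorphic inverse. Bijectivity expresses
  that \<open>\<pi>\<^sub>1\<close> and \<open>\<pi>\<^sub>2\<close> of \<open>D\<close> vanish: the projection to \<open>D\<close> of a path, or of a homotopy, can be
  contracted, and the contraction lifts (\<open>incl_surj\<close>, \<open>incl_inj\<close>). The inverse is continuous since
  small classes of \<open>Z\<close> with ends in \<open>F\<^sub>t\<close> come from small classes of \<open>F\<^sub>t\<close>
  (\<open>small_class_in_fibre\<close>), and a continuous map into path classes is holomorphic once its two
  ends are (\<open>hol_at_into_Arr\<close>).

  Three foundations support this. Functions with independent differentials extend to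
  coordinates (\<open>submersion_normal_form_coords\<close>), so that their zero sets are submanifolds, and
  being a submersion is the same as having local holomorphic sections. The path classes of a
  manifold form a manifold, where second countability is the delicate point
  (\<open>second_countable_path_class_top\<close>). The identities of the groupoid of path classes all come
  from maps out of convex sets (\<open>path_class_convex\<close>).
\<close>

abbreviation pts :: "'a cmanifold => 'a set" where "pts M \<equiv> topspace (Top M)"

abbreviation Path :: "'a cmanifold => (real => 'a) set cmanifold" where "Path Y \<equiv> Arr (\<Pi>\<^sub>1 Y)"

abbreviation square :: "(real \<times> real) set" where "square \<equiv> {0..1} \<times> {0..1}"

section \<open>Complex coordinate spaces\<close>

definition Ec :: "nat => (nat => complex) set" where
  "Ec n = {z. \<forall>i\<ge>n. z i = 0}"

lemma topspace_cspace: "topspace (cspace n) = Ec n"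
  by (simp add: cspace_def Ec_def)

lemma Ec_mono: "m \<le> n ==> Ec m \<subseteq> Ec n"
  by (auto simp: Ec_def)

definition cdist :: "nat => (nat => complex) => (nat => complex) => real" where
  "cdist n z w = cnorm n (\<lambda>i. z i - w i)"

lemma cnorm_nonneg [simp]: "0 \<le> cnorm n z"
  by (simp add: cnorm_def sum_nonneg)

lemma cdist_nonneg [simp]: "0 \<le> cdist n z w"
  by (simp add: cdist_def)

lemma cdist_self [simp]: "cdist n z z = 0"
  by (simp add: cdist_def cnorm_def)

lemma coord_le_cdist: "i < n ==> cmod (z i - w i) \<le> cdist n z w"
  unfolding cdist_def cnorm_def by (rule member_le_sum) auto

lemma continuous_cdist: "continuous_on UNIV (\<lambda>z. cdist n z w)"
  unfolding cdist_def cnorm_def by (intro continuous_intros) auto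

lemma openin_cspace_cball: "openin (cspace n) {z \<in> Ec n. cdist n z w < r}"
proof -
  have "open {z. cdist n z w < r}"
    by (rule open_Collect_less) (auto intro: continuous_cdist)
  then show ?thesis
    unfolding cspace_def euclidean_product_topology openin_subtopology
    by (auto simp: Ec_def)
qed

text \<open>
  Although it is a subspace of an infinite product, \<open>cspace n\<close> carries the metric topology of
  \<open>cdist n\<close>: only the first \<open>n\<close> coordinates vary.
\<close>

lemma openin_cspace:
  "openin (cspace n) U \<longleftrightarrow>
     U \<subseteq> Ec n \<and> (\<forall>a\<in>U. \<exists>\<delta>>0. \<forall>z\<in>Ec n. cdist n z a < \<delta> --> z \<in> U)"
proof
  assume L: "openin (cspace n) U"
  then have sub: "U \<subseteq> Ec n"
    using openin_subset topspace_cspace by metis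
  moreover have "\<exists>\<delta>>0. \<forall>z\<in>Ec n. cdist n z a < \<delta> --> z \<in> U" if "a \<in> U" for a
  proof -
    obtain T where T: "openin (product_topology (\<lambda>_. euclidean) UNIV) T" "U = T \<inter> Ec n"
      using L unfolding cspace_def openin_subtopology Ec_def by blast
    have "a \<in> T" using that T(2) by blast
    from product_topology_open_contains_basis[OF T(1) this]
    obtain X where X': "a \<in> (\<Pi>\<^sub>E i\<in>UNIV. X i)" "\<forall>i. openin euclidean (X i)" "(\<Pi>\<^sub>E i\<in>UNIV. X i) \<subseteq> T"
      by (elim exE conjE) rule
    have X: "\<And>i. a i \<in> X i" "\<And>i. open (X i)" "\<And>z. (\<And>i. z i \<in> X i) ==> z \<in> T"
      using X' by (auto simp: PiE_UNIV_domain)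
    have "\<exists>e>0. \<forall>w. cmod (w - a i) < e --> w \<in> X i" for i
    proof -
      show ?thesis using X(1)[of i] X(2)[of i] unfolding open_dist by (auto simp: dist_norm)
    qed
    then obtain e where e: "\<And>i. e i > 0" "\<And>i w. cmod (w - a i) < e i ==> w \<in> X i"
      by metis
    define \<delta> where "\<delta> = Min (insert 1 (e ` {..<n}))"
    have "\<delta> > 0" using e(1) by (auto simp: \<delta>_def)
    moreover have "z \<in> U" if z: "z \<in> Ec n" "cdist n z a < \<delta>" for z
    proof -
      have "z i \<in> X i" for i
      proof (cases "i < n")
        case True
        then have "cmod (z i - a i) < \<delta>" "\<delta> \<le> e i"
          using coord_le_cdist[OF True, of z a] z(2) True
        by (auto simp: \<delta>_def intro: le_less_trans)
        then show ?thesis using e(2) by auto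
      next
        case False
        then have "z i = a i" using z(1) \<open>a \<in> U\<close> sub by (auto simp: Ec_def)
        then show ?thesis using X(1) by simp
      qed
      then have "z \<in> T" using X(3) by blast
      then show ?thesis using z(1) T(2) by auto
    qed
    ultimately show ?thesis by blast
  qed
  ultimately show "U \<subseteq> Ec n \<and> (\<forall>a\<in>U. \<exists>\<delta>>0. \<forall>z\<in>Ec n. cdist n z a < \<delta> --> z \<in> U)"
    by blast
next
  assume R: "U \<subseteq> Ec n \<and> (\<forall>a\<in>U. \<exists>\<delta>>0. \<forall>z\<in>Ec n. cdist n z a < \<delta> --> z \<in> U)"
  show "openin (cspace n) U"
  proof (subst openin_subopen, intro ballI)
    fix a assume a: "a \<in> U"
    then obtain \<delta> where "\<delta> > 0" "\<forall>z\<in>Ec n. cdist n z a < \<delta> --> z \<in> U" using R by blast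
    then show "\<exists>T. openin (cspace n) T \<and> a \<in> T \<and> T \<subseteq> U"
      using openin_cspace_cball[of n a \<delta>] a R
      by (intro exI[of _ "{z \<in> Ec n. cdist n z a < \<delta>}"]) auto
  qed
qed

lemma continuous_map_into_cspace:
  "continuous_map T (cspace n) f \<longleftrightarrow>
     (\<forall>i. continuous_map T euclidean (\<lambda>x. f x i)) \<and> f ` topspace T \<subseteq> Ec n"
  unfolding cspace_def continuous_map_in_subtopology continuous_map_componentwise_UNIV
  by (auto simp: Ec_def)

lemma continuous_map_cspace_coord: "continuous_map (cspace n) euclidean (\<lambda>z. z i)"
proof -
  have "continuous_map (cspace n) (cspace n) (\<lambda>z. z)" by simp
  then show ?thesis unfolding continuous_map_into_cspace by blast
qed

section \<open>Complex differentiability in coordinates\<close>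

text \<open>
  \<open>k :: 'a => nat => complex\<close> is a system of \<open>n\<close> coordinates on a set \<open>W\<close>. Working with the
  coordinate functions instead of a coordinate expression makes the inverse of the chart
  disappear from the calculus.
\<close>

definition negligible_at ::
  "nat => ('a => nat => complex) => 'a set => 'a => ('a => complex) => bool" where
  "negligible_at n k W a \<phi> \<longleftrightarrow>
     (\<forall>\<epsilon>>0. \<exists>\<delta>>0. \<forall>y\<in>W. cdist n (k y) (k a) < \<delta> --> cmod (\<phi> y) \<le> \<epsilon> * cdist n (k y) (k a))"

definition has_row ::
  "nat => ('a => nat => complex) => 'a set => ('a => complex) => 'a => (nat => complex) => bool" where
  "has_row n k W u a A \<longleftrightarrow>
     negligible_at n k W a (\<lambda>y. u y - u a - (\<Sum>i<n. A i * (k y i - k a i)))"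

definition cdiff ::
  "nat => ('a => nat => complex) => 'a set => ('a => complex) => 'a => bool" where
  "cdiff n k W u a \<longleftrightarrow> (\<exists>A. has_row n k W u a A)"

lemma cdiffI: "has_row n k W u a A ==> cdiff n k W u a"
  unfolding cdiff_def by (rule exI)

lemma has_cderiv_iff_rows:
  "has_cderiv n m U F a A \<longleftrightarrow> (\<forall>j<m. has_row n (\<lambda>z. z) U (\<lambda>z. F z j) a (A j))"
  unfolding has_cderiv_def has_row_def negligible_at_def cdist_def by simp

lemma negligible_add:
  assumes "negligible_at n k W a f" "negligible_at n k W a g"
  shows "negligible_at n k W a (\<lambda>y. f y + g y)"
  unfolding negligible_at_def
proof (intro allI impI)
  fix e :: real assume "e > 0"
  then have "e/2 > 0" by simp
  obtain d1 where d1: "d1>0" "\<forall>y\<in>W. cdist n (k y) (k a) < d1 --> cmod (f y) \<le> e/2 * cdist n (k y) (k a)"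
    using assms(1) \<open>e/2 > 0\<close> unfolding negligible_at_def by blast
  obtain d2 where d2: "d2>0" "\<forall>y\<in>W. cdist n (k y) (k a) < d2 --> cmod (g y) \<le> e/2 * cdist n (k y) (k a)"
    using assms(2) \<open>e/2 > 0\<close> unfolding negligible_at_def by blast
  have "cmod (f y + g y) \<le> e * cdist n (k y) (k a)"
    if y: "y \<in> W" "cdist n (k y) (k a) < min d1 d2" for y
  proof -
    have "cmod (f y) \<le> e/2 * cdist n (k y) (k a)" "cmod (g y) \<le> e/2 * cdist n (k y) (k a)"
      using d1(2) d2(2) y by auto
    then show ?thesis using norm_triangle_ineq[of "f y" "g y"] by (simp add: field_simps)
  qed
  then show "\<exists>\<delta>>0. \<forall>y\<in>W. cdist n (k y) (k a) < \<delta> --> cmod (f y + g y) \<le> e * cdist n (k y) (k a)"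
    using d1(1) d2(1) by (intro exI[of _ "min d1 d2"]) auto
qed

lemma negligible_cmult:
  assumes "negligible_at n k W a f"
  shows "negligible_at n k W a (\<lambda>y. c * f y)"
  unfolding negligible_at_def
proof (intro allI impI)
  fix e :: real assume "e > 0"
  then have "e / (cmod c + 1) > 0" by (simp add: add_nonneg_pos)
  then obtain d where d: "d>0" "\<forall>y\<in>W. cdist n (k y) (k a) < d --> cmod (f y) \<le> e / (cmod c + 1) * cdist n (k y) (k a)"
    using assms(1) unfolding negligible_at_def by blast
  have "cmod (c * f y) \<le> e * cdist n (k y) (k a)"
    if y: "y \<in> W" "cdist n (k y) (k a) < d" for y
  proof -
    have "cmod (c * f y) \<le> (cmod c + 1) * (e / (cmod c + 1) * cdist n (k y) (k a))"
      unfolding norm_mult using d(2) y by (intro mult_mono) auto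
    then show ?thesis by (simp add: add_nonneg_eq_0_iff)
  qed
  then show "\<exists>\<delta>>0. \<forall>y\<in>W. cdist n (k y) (k a) < \<delta> --> cmod (c * f y) \<le> e * cdist n (k y) (k a)"
    using d(1) by auto
qed

lemma negligible_zero: "negligible_at n k W a (\<lambda>y. 0)"
  unfolding negligible_at_def by (auto intro!: exI[of _ 1])

lemma negligible_sum:
  "(\<And>j. j < (m::nat) ==> negligible_at n k W a (f j)) ==> negligible_at n k W a (\<lambda>y. \<Sum>j<m. f j y)"
  by (induction m) (auto intro: negligible_zero negligible_add)

lemma negligible_local:
  assumes "negligible_at n k W a f" and "d > 0"
    and "\<And>y. y \<in> W' ==> cdist n (k y) (k a) < d ==> y \<in> W \<and> g y = f y"
  shows "negligible_at n k W' a g"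
  unfolding negligible_at_def
proof (intro allI impI)
  fix e :: real assume "e > 0"
  then obtain d1 where d1: "d1>0" "\<forall>y\<in>W. cdist n (k y) (k a) < d1 --> cmod (f y) \<le> e * cdist n (k y) (k a)"
    using assms(1) unfolding negligible_at_def by blast
  then show "\<exists>\<delta>>0. \<forall>y\<in>W'. cdist n (k y) (k a) < \<delta> --> cmod (g y) \<le> e * cdist n (k y) (k a)"
    using assms(2,3) by (intro exI[of _ "min d d1"]) auto
qed

lemma negligible_cong:
  "(\<And>y. y \<in> W ==> g y = f y) ==> negligible_at n k W a f ==> negligible_at n k W a g"
  by (rule negligible_local[where d=1]) auto

text \<open>Precomposition with a map that is Lipschitz at the point preserves negligibility.\<close>

lemma negligible_compose:
  assumes "negligible_at m l V (f a) \<psi>" and "f ` W \<subseteq> V"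
    and "d > 0" and L: "\<And>y. y \<in> W ==> cdist n (k y) (k a) < d ==>
           cdist m (l (f y)) (l (f a)) \<le> L * cdist n (k y) (k a)"
  shows "negligible_at n k W a (\<lambda>y. \<psi> (f y))"
  unfolding negligible_at_def
proof (intro allI impI)
  fix e :: real assume "e > 0"
  define M where "M = max L 1"
  have M: "M > 0" "L \<le> M" by (auto simp: M_def)
  have "e / M > 0" using M \<open>e > 0\<close> by simp
  then obtain d1 where d1: "d1>0"
    "\<forall>y\<in>V. cdist m (l y) (l (f a)) < d1 --> cmod (\<psi> y) \<le> e / M * cdist m (l y) (l (f a))"
    using assms(1) unfolding negligible_at_def by blast
  have "cmod (\<psi> (f y)) \<le> e * cdist n (k y) (k a)"
    if y: "y \<in> W" "cdist n (k y) (k a) < min d (d1 / M)" for y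
  proof -
    have 1: "cdist m (l (f y)) (l (f a)) \<le> M * cdist n (k y) (k a)"
      using L[of y] y mult_right_mono[OF M(2) cdist_nonneg[of n "k y" "k a"]] by auto
    also have "\<dots> < d1" using y M by (simp add: field_simps)
    finally have "cmod (\<psi> (f y)) \<le> e / M * cdist m (l (f y)) (l (f a))"
      using d1(2) assms(2) y by auto
    also have "\<dots> \<le> e / M * (M * cdist n (k y) (k a))"
      using 1 \<open>e / M > 0\<close> by (intro mult_left_mono) auto
    finally show ?thesis using M by simp
  qed
  then show "\<exists>\<delta>>0. \<forall>y\<in>W. cdist n (k y) (k a) < \<delta> --> cmod (\<psi> (f y)) \<le> e * cdist n (k y) (k a)"
    using assms(3) d1(1) M by (intro exI[of _ "min d (d1 / M)"]) auto
qed

lemma has_row_local: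
  assumes "has_row n k W u a A" and "d > 0" "v a = u a"
    and "\<And>y. y \<in> W' ==> cdist n (k y) (k a) < d ==> y \<in> W \<and> v y = u y"
  shows "has_row n k W' v a A"
  using assms unfolding has_row_def by (intro negligible_local[OF assms(1)[unfolded has_row_def] assms(2)]) auto

lemma has_row_subset: "has_row n k W u a A ==> W' \<subseteq> W ==> has_row n k W' u a A"
  by (erule has_row_local[where d=1]) auto

lemma cdiff_local:
  assumes "cdiff n k W u a" and "d > 0" "v a = u a"
    and "\<And>y. y \<in> W' ==> cdist n (k y) (k a) < d ==> y \<in> W \<and> v y = u y"
  shows "cdiff n k W' v a"
  using assms has_row_local[of n k W u a _ d v W'] unfolding cdiff_def by blast

lemma cdiff_subset: "cdiff n k W u a ==> W' \<subseteq> W ==> cdiff n k W' u a"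
  by (erule cdiff_local[where d=1]) auto

lemma cdiff_cong: "cdiff n k W u a ==> a \<in> W ==> (\<And>y. y \<in> W ==> v y = u y) ==> cdiff n k W v a"
  by (erule cdiff_local[where d=1]) auto

lemma has_row_const: "has_row n k W (\<lambda>y. c) a (\<lambda>i. 0)"
  by (simp add: has_row_def negligible_zero)

lemma cdiff_const: "cdiff n k W (\<lambda>y. c) a"
  unfolding cdiff_def by (rule exI, rule has_row_const)

lemma has_row_coord:
  assumes "j < n" shows "has_row n k W (\<lambda>y. k y j) a (\<lambda>i. if i = j then 1 else 0)"
proof -
  have "(\<Sum>i<n. (if i = j then 1 else 0) * (k y i - k a i)) = k y j - k a j" for y
    using assms by (subst sum.cong[where h="\<lambda>i. if i = j then k y i - k a i else 0" and B="{..<n}"]) auto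
  then show ?thesis by (simp add: has_row_def negligible_zero)
qed

lemma cdiff_coord: "j < n ==> cdiff n k W (\<lambda>y. k y j) a"
  unfolding cdiff_def by (rule exI, erule has_row_coord)

lemma has_row_diff:
  assumes "has_row n k W u a A" "has_row n k W v a B"
  shows "has_row n k W (\<lambda>y. u y - v y) a (\<lambda>i. A i - B i)"
  unfolding has_row_def
proof (rule negligible_cong)
  show "negligible_at n k W a (\<lambda>y. (u y - u a - (\<Sum>i<n. A i * (k y i - k a i))) +
      (-1) * (v y - v a - (\<Sum>i<n. B i * (k y i - k a i))))"
    using assms unfolding has_row_def by (intro negligible_add negligible_cmult)
qed (simp add: algebra_simps sum.distrib sum_subtractf)

lemma has_row_Lipschitz:
  assumes "has_row n k W u a A"
  shows "\<exists>d>0. \<forall>y\<in>W. cdist n (k y) (k a) < d -->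
           cmod (u y - u a) \<le> (1 + (\<Sum>i<n. cmod (A i))) * cdist n (k y) (k a)"
proof -
  obtain d where d: "d>0" "\<forall>y\<in>W. cdist n (k y) (k a) < d -->
      cmod (u y - u a - (\<Sum>i<n. A i * (k y i - k a i))) \<le> 1 * cdist n (k y) (k a)"
    using assms unfolding has_row_def negligible_at_def by (meson zero_less_one)
  have "cmod (u y - u a) \<le> (1 + (\<Sum>i<n. cmod (A i))) * cdist n (k y) (k a)"
    if "y \<in> W" "cdist n (k y) (k a) < d" for y
  proof -
    have "cmod (\<Sum>i<n. A i * (k y i - k a i)) \<le> (\<Sum>i<n. cmod (A i) * cdist n (k y) (k a))"
      by (intro sum_norm_le) (auto simp: norm_mult intro!: mult_left_mono coord_le_cdist)
    moreover have "cmod (u y - u a - (\<Sum>i<n. A i * (k y i - k a i))) \<le> cdist n (k y) (k a)"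
      using d(2) that by simp
    ultimately show ?thesis
      using norm_triangle_sub[of "u y - u a" "\<Sum>i<n. A i * (k y i - k a i)"]
      by (simp add: sum_distrib_right[symmetric] distrib_right)
  qed
  then show ?thesis using d(1) by auto
qed

lemma cdiff_Lipschitz:
  assumes "\<And>j. j < m ==> cdiff n k W (\<lambda>y. F y j) a"
  shows "\<exists>d>0. \<exists>L\<ge>0. \<forall>y\<in>W. cdist n (k y) (k a) < d --> cdist m (F y) (F a) \<le> L * cdist n (k y) (k a)"
  using assms
proof (induction m)
  case 0
  then show ?case by (intro exI[of _ 1] conjI) (auto simp: cdist_def cnorm_def sum_nonneg)
next
  case (Suc m)
  obtain d L where d: "d > 0" "L \<ge> 0"
    "\<forall>y\<in>W. cdist n (k y) (k a) < d --> cdist m (F y) (F a) \<le> L * cdist n (k y) (k a)"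
    using Suc by force
  obtain A where A: "has_row n k W (\<lambda>y. F y m) a A" using Suc.prems[of m] unfolding cdiff_def by blast
  define K where "K = 1 + (\<Sum>i<n. cmod (A i))"
  have K: "K \<ge> 0" by (simp add: K_def sum_nonneg add_nonneg_nonneg)
  obtain e where e: "e > 0"
    "\<forall>y\<in>W. cdist n (k y) (k a) < e --> cmod (F y m - F a m) \<le> K * cdist n (k y) (k a)"
    using has_row_Lipschitz[OF A] K_def by auto
  have "cdist (Suc m) (F y) (F a) = cdist m (F y) (F a) + cmod (F y m - F a m)" for y
    by (simp add: cdist_def cnorm_def)
  then show ?case using d e K
    by (intro exI[of _ "min d e"] conjI exI[of _ "L + K"] ballI impI)
      (auto simp: distrib_right intro!: add_mono)
qed

text \<open>The chain rule.\<close>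

lemma has_row_compose:
  assumes u: "has_row m l V u (f a) B" and f: "\<And>j. j < m ==> has_row n k W (\<lambda>y. l (f y) j) a (A j)"
    and "f ` W \<subseteq> V"
  shows "has_row n k W (\<lambda>y. u (f y)) a (\<lambda>i. \<Sum>j<m. B j * A j i)"
  unfolding has_row_def
proof (rule negligible_cong)
  obtain d L where "d > 0" "\<forall>y\<in>W. cdist n (k y) (k a) < d -->
      cdist m (l (f y)) (l (f a)) \<le> L * cdist n (k y) (k a)"
    using cdiff_Lipschitz[of m n k W "\<lambda>y. l (f y)" a] f unfolding cdiff_def by blast
  then have "negligible_at n k W a (\<lambda>y. u (f y) - u (f a) - (\<Sum>j<m. B j * (l (f y) j - l (f a) j)))"
    using negligible_compose[OF u[unfolded has_row_def] assms(3)] by blast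
  then show "negligible_at n k W a (\<lambda>y. (u (f y) - u (f a) - (\<Sum>j<m. B j * (l (f y) j - l (f a) j))) +
     (\<Sum>j<m. B j * (l (f y) j - l (f a) j - (\<Sum>i<n. A j i * (k y i - k a i)))))"
    using f unfolding has_row_def by (intro negligible_add negligible_sum negligible_cmult) auto
  have "(\<Sum>i<n. (\<Sum>j<m. B j * A j i) * (k y i - k a i)) = (\<Sum>j<m. B j * (\<Sum>i<n. A j i * (k y i - k a i)))" for y
    unfolding sum_distrib_left sum_distrib_right by (subst sum.swap) (simp add: mult.assoc)
  then show "u (f y) - u (f a) - (\<Sum>i<n. (\<Sum>j<m. B j * A j i) * (k y i - k a i)) =
    (u (f y) - u (f a) - (\<Sum>j<m. B j * (l (f y) j - l (f a) j))) +
     (\<Sum>j<m. B j * (l (f y) j - l (f a) j - (\<Sum>i<n. A j i * (k y i - k a i))))" for y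
    by (simp add: right_diff_distrib sum_subtractf)
qed

lemma cdiff_compose:
  assumes "cdiff m l V u (f a)" "\<And>j. j < m ==> cdiff n k W (\<lambda>y. l (f y) j) a" "f ` W \<subseteq> V"
  shows "cdiff n k W (\<lambda>y. u (f y)) a"
proof -
  obtain B where B: "has_row m l V u (f a) B" using assms(1) unfolding cdiff_def by blast
  obtain A where "\<And>j. j < m ==> has_row n k W (\<lambda>y. l (f y) j) a (A j)"
    using assms(2) unfolding cdiff_def by metis
  from has_row_compose[of m l V u f a B n k W A, OF B this assms(3)] show ?thesis
    unfolding cdiff_def by blast
qed

text \<open>Where the coordinates fill a neighbourhood, a row of partial derivatives is unique.\<close>

lemma has_row_unique:
  assumes A: "has_row n k W u a A" and B: "has_row n k W u a B"
    and fill: "d > 0" "{z \<in> Ec n. cdist n z (k a) < d} \<subseteq> k ` W" "k a \<in> Ec n" and i: "i < n"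
  shows "A i = B i"
proof (rule ccontr)
  assume ne: "A i \<noteq> B i"
  have N: "negligible_at n k W a (\<lambda>y. - (\<Sum>i<n. (A i - B i) * (k y i - k a i)))"
    using has_row_diff[OF A B] unfolding has_row_def by simp
  have "cmod (A i - B i) / 2 > 0" using ne by simp
  then obtain e where e: "e > 0" "\<forall>y\<in>W. cdist n (k y) (k a) < e -->
     cmod (- (\<Sum>i<n. (A i - B i) * (k y i - k a i))) \<le> cmod (A i - B i) / 2 * cdist n (k y) (k a)"
    using N unfolding negligible_at_def by blast
  define t where "t = min d e / 2"
  have t: "t > 0" "t < d" "t < e" using e fill by (auto simp: t_def)
  define z where "z = (k a)(i := k a i + complex_of_real t)"
  have zs: "z j - k a j = (if j = i then complex_of_real t else 0)" for j by (simp add: z_def)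
  have dz: "cdist n z (k a) = t"
  proof -
    have "cdist n z (k a) = (\<Sum>j<n. if j = i then t else 0)"
      unfolding cdist_def cnorm_def zs using t by (intro sum.cong) auto
    then show ?thesis using i by simp
  qed
  have "z \<in> Ec n" using fill(3) i by (auto simp: Ec_def z_def)
  then obtain y where y: "y \<in> W" "k y = z" using fill(2) dz t by blast
  have "(\<Sum>j<n. (A j - B j) * (z j - k a j)) = (\<Sum>j<n. if j = i then (A i - B i) * t else 0)"
    unfolding zs by (intro sum.cong) auto
  then have "(\<Sum>j<n. (A j - B j) * (z j - k a j)) = (A i - B i) * t" using i by simp
  moreover have "cmod (- (\<Sum>j<n. (A j - B j) * (z j - k a j))) \<le> cmod (A i - B i) / 2 * cdist n z (k a)"
    using e(2)[rule_format, OF y(1)] unfolding y(2) dz using t(3) by simp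
  ultimately have "cmod (A i - B i) * t \<le> cmod (A i - B i) / 2 * t"
    unfolding dz using t(1) by (simp add: norm_mult)
  then show False using t ne by (simp add: field_simps)
qed

lemma cdiff_continuous_map:
  assumes "openin (cspace n) U" "F ` U \<subseteq> Ec m"
    and "\<And>a j. a \<in> U ==> j < m ==> cdiff n (\<lambda>z. z) U (\<lambda>z. F z j) a"
  shows "continuous_map (subtopology (cspace n) U) (cspace m) F"
  unfolding continuous_map
proof (intro conjI allI impI)
  have sub: "U \<subseteq> Ec n" using assms(1) openin_cspace by blast
  then have ts: "topspace (subtopology (cspace n) U) = U" by (auto simp: topspace_cspace)
  then show "F ` topspace (subtopology (cspace n) U) \<subseteq> topspace (cspace m)"
    using assms(2) by (simp add: topspace_cspace)
  fix V assume V: "openin (cspace m) V"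
  have "openin (cspace n) {x \<in> U. F x \<in> V}"
    unfolding openin_cspace
  proof (intro conjI ballI)
    fix a assume a: "a \<in> {x \<in> U. F x \<in> V}"
    obtain d1 where d1: "d1 > 0" "\<forall>z\<in>Ec n. cdist n z a < d1 --> z \<in> U"
      using assms(1) a unfolding openin_cspace by blast
    obtain d2 where d2: "d2 > 0" "\<forall>z\<in>Ec m. cdist m z (F a) < d2 --> z \<in> V"
      using V a unfolding openin_cspace by blast
    obtain d L where d: "d > 0" "L \<ge> 0" "\<forall>y\<in>U. cdist n y a < d --> cdist m (F y) (F a) \<le> L * cdist n y a"
      using cdiff_Lipschitz[of m n "\<lambda>z. z" U F a] assms(3) a by auto
    define r where "r = min (min d d1) (d2 / (L + 1))"
    have r: "r > 0" using d d1 d2 by (simp add: r_def)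
    have "z \<in> {x \<in> U. F x \<in> V}" if z: "z \<in> Ec n" "cdist n z a < r" for z
    proof -
      have zU: "z \<in> U" using d1 z by (auto simp: r_def)
      have "cdist m (F z) (F a) \<le> L * cdist n z a" using d z zU by (auto simp: r_def)
      also have "\<dots> \<le> (L + 1) * cdist n z a" by (simp add: mult_right_mono)
      also have "\<dots> < d2" using z d by (simp add: r_def field_simps)
      finally show ?thesis using d2 zU assms(2) by auto
    qed
    then show "\<exists>\<delta>>0. \<forall>z\<in>Ec n. cdist n z a < \<delta> --> z \<in> {x \<in> U. F x \<in> V}" using r by blast
  qed (use sub in auto)
  then show "openin (subtopology (cspace n) U) {x \<in> topspace (subtopology (cspace n) U). F x \<in> V}"
    unfolding ts using assms(1) by (simp add: openin_open_subtopology)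
qed

section \<open>Straightening a submersion\<close>

definition bihol ::
  "nat => (nat => complex) set => (nat => complex) set =>
   ((nat => complex) => nat => complex) => ((nat => complex) => nat => complex) => bool" where
  "bihol n U V \<Phi> \<Psi> \<longleftrightarrow>
     openin (cspace n) U \<and> openin (cspace n) V \<and> \<Phi> ` U \<subseteq> V \<and> \<Psi> ` V \<subseteq> U \<and>
     (\<forall>z\<in>U. \<Psi> (\<Phi> z) = z) \<and> (\<forall>w\<in>V. \<Phi> (\<Psi> w) = w) \<and>
     (\<forall>z\<in>U. \<forall>j<n. cdiff n (\<lambda>z. z) U (\<lambda>z. \<Phi> z j) z) \<and>
     (\<forall>w\<in>V. \<forall>j<n. cdiff n (\<lambda>z. z) V (\<lambda>w. \<Psi> w j) w)"

lemma bihol_continuous: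
  assumes "bihol n U V \<Phi> \<Psi>"
  shows "continuous_map (subtopology (cspace n) U) (cspace n) \<Phi>"
    and "continuous_map (subtopology (cspace n) V) (cspace n) \<Psi>"
proof -
  have "U \<subseteq> Ec n" "V \<subseteq> Ec n" using assms openin_cspace unfolding bihol_def by blast+
  then show "continuous_map (subtopology (cspace n) U) (cspace n) \<Phi>"
    "continuous_map (subtopology (cspace n) V) (cspace n) \<Psi>"
    using assms unfolding bihol_def by (auto intro!: cdiff_continuous_map)
qed

lemma bihol_cdiff:
  assumes "bihol n U V \<Phi> \<Psi>"
  shows "\<And>z j. z \<in> U ==> j < n ==> cdiff n (\<lambda>z. z) U (\<lambda>z. \<Phi> z j) z"
    and "\<And>w j. w \<in> V ==> j < n ==> cdiff n (\<lambda>z. z) V (\<lambda>w. \<Psi> w j) w"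
  using assms unfolding bihol_def by auto

lemma bihol_sym: "bihol n U V \<Phi> \<Psi> ==> bihol n V U \<Psi> \<Phi>"
  unfolding bihol_def by blast

lemma bihol_compose:
  assumes 1: "bihol n U V \<Phi> \<Psi>" and 2: "bihol n V1 W \<Phi>' \<Psi>'" and sub: "V1 \<subseteq> V"
  shows "bihol n {z \<in> U. \<Phi> z \<in> V1} W (\<lambda>z. \<Phi>' (\<Phi> z)) (\<lambda>w. \<Psi> (\<Psi>' w))"
proof -
  have oU: "openin (cspace n) U" and V1: "openin (cspace n) V1"
    using 1 2 unfolding bihol_def by blast+
  have UE: "U \<subseteq> Ec n" using oU openin_cspace by blast
  have "openin (subtopology (cspace n) U) {z \<in> topspace (subtopology (cspace n) U). \<Phi> z \<in> V1}"
    by (rule openin_continuous_map_preimage[OF bihol_continuous(1)[OF 1] V1])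
  then have o: "openin (cspace n) {z \<in> U. \<Phi> z \<in> V1}"
    using oU UE by (simp add: openin_open_subtopology topspace_cspace Int_absorb1)
  have d1: "cdiff n (\<lambda>z. z) {z \<in> U. \<Phi> z \<in> V1} (\<lambda>z. \<Phi>' (\<Phi> z) j) z"
    if "z \<in> U" "\<Phi> z \<in> V1" "j < n" for z j
  proof (rule cdiff_compose[where m=n and l="\<lambda>z. z" and V=V1 and f=\<Phi> and u="\<lambda>z. \<Phi>' z j"])
    show "cdiff n (\<lambda>z. z) V1 (\<lambda>z. \<Phi>' z j) (\<Phi> z)" using bihol_cdiff(1)[OF 2] that by simp
    fix i assume "i < n"
    then have "cdiff n (\<lambda>z. z) U (\<lambda>z. \<Phi> z i) z" using bihol_cdiff(1)[OF 1] that by simp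
    then show "cdiff n (\<lambda>z. z) {z \<in> U. \<Phi> z \<in> V1} (\<lambda>z. \<Phi> z i) z" by (rule cdiff_subset) auto
  qed auto
  have d2: "cdiff n (\<lambda>z. z) W (\<lambda>w. \<Psi> (\<Psi>' w) j) w" if "w \<in> W" "j < n" for w j
  proof (rule cdiff_compose[where m=n and l="\<lambda>z. z" and V=V and f=\<Psi>' and u="\<lambda>z. \<Psi> z j"])
    have "\<Psi>' w \<in> V" using 2 sub that unfolding bihol_def by blast
    then show "cdiff n (\<lambda>z. z) V (\<lambda>z. \<Psi> z j) (\<Psi>' w)" using bihol_cdiff(2)[OF 1] that by simp
    show "cdiff n (\<lambda>z. z) W (\<lambda>z. \<Psi>' z i) w" if "i < n" for i
      using bihol_cdiff(2)[OF 2] that \<open>w \<in> W\<close> by simp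
    show "\<Psi>' ` W \<subseteq> V" using 2 sub unfolding bihol_def by blast
  qed
  have W: "openin (cspace n) W" using 2 unfolding bihol_def by blast
  have "\<Psi>' w \<in> V1 \<and> \<Psi>' w \<in> V \<and> \<Phi>' (\<Psi>' w) = w" if "w \<in> W" for w
    using 2 sub that unfolding bihol_def by blast
  then have "\<Psi> (\<Psi>' w) \<in> {z \<in> U. \<Phi> z \<in> V1} \<and> \<Phi>' (\<Phi> (\<Psi> (\<Psi>' w))) = w" if "w \<in> W" for w
    using 1 that unfolding bihol_def by auto
  moreover have "\<Phi>' (\<Phi> z) \<in> W \<and> \<Psi> (\<Psi>' (\<Phi>' (\<Phi> z))) = z" if "z \<in> U" "\<Phi> z \<in> V1" for z
    using 1 2 that unfolding bihol_def by auto
  ultimately show ?thesis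
    unfolding bihol_def using o W d1 d2 by auto
qed

definition swap_coords :: "nat => nat => (nat => complex) => nat => complex" where
  "swap_coords i j z = (\<lambda>k. if k = i then z j else if k = j then z i else z k)"

lemma bihol_swap:
  assumes "openin (cspace n) U" "i < n" "j < n"
  shows "bihol n U (swap_coords i j ` U) (swap_coords i j) (swap_coords i j)"
proof -
  have inv: "swap_coords i j (swap_coords i j z) = z" for z
    by (auto simp: swap_coords_def)
  have cont: "continuous_map (cspace n) (cspace n) (swap_coords i j)"
    unfolding continuous_map_into_cspace
  proof
    show "\<forall>k. continuous_map (cspace n) euclidean (\<lambda>x. swap_coords i j x k)"
      by (simp add: swap_coords_def continuous_map_cspace_coord)
    show "swap_coords i j ` topspace (cspace n) \<subseteq> Ec n"
      using assms by (auto simp: swap_coords_def topspace_cspace Ec_def)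
  qed
  have sub: "U \<subseteq> Ec n" using assms(1) openin_cspace by blast
  have "swap_coords i j ` U = {z \<in> topspace (cspace n). swap_coords i j z \<in> U}"
  proof (intro set_eqI iffI)
    fix z assume "z \<in> swap_coords i j ` U"
    then show "z \<in> {z \<in> topspace (cspace n). swap_coords i j z \<in> U}"
      using sub cont inv unfolding continuous_map_def by (auto simp: topspace_cspace)
  next
    fix z assume "z \<in> {z \<in> topspace (cspace n). swap_coords i j z \<in> U}"
    then show "z \<in> swap_coords i j ` U" using inv by (metis (mono_tags) image_eqI mem_Collect_eq)
  qed
  then have o: "openin (cspace n) (swap_coords i j ` U)"
    using openin_continuous_map_preimage[OF cont assms(1)] by simp
  have d: "cdiff n (\<lambda>z. z) W (\<lambda>z. swap_coords i j z k) a" if "k < n" for k W a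
    unfolding swap_coords_def using that assms cdiff_coord[of _ n "\<lambda>z. z" W a]
    by (cases "k = i"; cases "k = j") simp_all
  show ?thesis
    unfolding bihol_def using o d inv assms(1) by auto
qed

lemma cdist_upd_le:
  assumes "i < n"
  shows "cdist n (z(i := w)) (z'(i := w')) \<le> cdist n z z' + cmod (w - w')"
proof -
  have "cdist n (z(i := w)) (z'(i := w')) \<le> (\<Sum>j<n. cmod (z j - z' j) + (if j = i then cmod (w - w') else 0))"
    unfolding cdist_def cnorm_def by (rule sum_mono) auto
  also have "\<dots> = cdist n z z' + cmod (w - w')"
    using assms by (simp add: sum.distrib cdist_def cnorm_def)
  finally show ?thesis .
qed

lemma Ec_upd: "z \<in> Ec n ==> i < n ==> z(i := w) \<in> Ec n"
  by (auto simp: Ec_def)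

lemma has_row_affine: "has_row n k W (\<lambda>y. c + (\<Sum>i<n. A i * (k y i - b i))) a A"
proof -
  have "c + (\<Sum>i<n. A i * (k y i - b i)) - (c + (\<Sum>i<n. A i * (k a i - b i)))
      - (\<Sum>i<n. A i * (k y i - k a i)) = 0" for y
    by (simp add: algebra_simps sum_subtractf)
  then show ?thesis unfolding has_row_def by (simp add: negligible_zero)
qed

text \<open>The entries of the row are the partial derivatives in the sense of one complex variable.\<close>

lemma has_row_partial:
  assumes "openin (cspace n) U" "i < n" "z(i := w) \<in> U" and row: "has_row n (\<lambda>z. z) U f (z(i := w)) B"
  shows "((\<lambda>w. f (z(i := w))) has_field_derivative B i) (at w)"
  unfolding has_field_derivative_def has_derivative_at_alt
proof (intro conjI allI impI)
  show "bounded_linear ((*) (B i))" by (rule bounded_linear_mult_right)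
  fix e :: real assume "e > 0"
  obtain r where r: "r > 0" "\<forall>y\<in>Ec n. cdist n y (z(i := w)) < r --> y \<in> U"
    using assms(1,3) unfolding openin_cspace by blast
  have zw: "z(i := w) \<in> Ec n" using assms(1,3) openin_cspace by blast
  obtain d where d: "d > 0" "\<forall>y\<in>U. cdist n y (z(i := w)) < d -->
      cmod (f y - f (z(i := w)) - (\<Sum>j<n. B j * (y j - (z(i := w)) j))) \<le> e * cdist n y (z(i := w))"
    using row \<open>e > 0\<close> unfolding has_row_def negligible_at_def by blast
  have "cmod (f (z(i := w')) - f (z(i := w)) - B i * (w' - w)) \<le> e * cmod (w' - w)"
    if w': "cmod (w' - w) < min d r" for w'
  proof -
    have le: "cdist n (z(i := w')) (z(i := w)) \<le> cmod (w' - w)"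
      using cdist_upd_le[OF assms(2), of z w' z w] by simp
    have E: "z(i := w') \<in> Ec n" using Ec_upd[OF zw assms(2), of w'] by simp
    then have "z(i := w') \<in> U" using r le w' by auto
    then have "cmod (f (z(i := w')) - f (z(i := w)) - (\<Sum>j<n. B j * ((z(i := w')) j - (z(i := w)) j)))
        \<le> e * cdist n (z(i := w')) (z(i := w))"
      using d(2) le w' by auto
    moreover have "(\<Sum>j<n. B j * ((z(i := w')) j - (z(i := w)) j)) = (\<Sum>j<n. if j = i then B i * (w' - w) else 0)"
      by (rule sum.cong) auto
    moreover have "e * cdist n (z(i := w')) (z(i := w)) \<le> e * cmod (w' - w)"
      using le \<open>e > 0\<close> by simp
    ultimately show ?thesis using assms(2) by simp
  qed
  then show "\<exists>d>0. \<forall>y. norm (y - w) < d -->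
      norm (f (z(i := y)) - f (z(i := w)) - B i * (y - w)) \<le> e * norm (y - w)"
    using d(1) r(1) by (intro exI[of _ "min d r"]) auto
qed

text \<open>
  If \<open>\<partial>f/\<partial>z\<^sub>i\<close> does not vanish at \<open>a\<close>, replacing the \<open>i\<close>-th coordinate by \<open>f\<close> is a local
  biholomorphism. Only differentiability at each point is available, but the remainder
  \<open>e(z) = f z - f a - A (z - a)\<close> is small near \<open>a\<close>, and for fixed other coordinates it is a
  holomorphic function of \<open>z\<^sub>i\<close>; by Cauchy's inequality its derivative is small as well, so that
  Newton's iteration in the single variable \<open>z\<^sub>i\<close> is a contraction.
\<close>

lemma straighten_coordinate:
  assumes U: "openin (cspace n) U" and a: "a \<in> U" and i: "i < n"
    and f: "\<And>z. z \<in> U ==> cdiff n (\<lambda>z. z) U f z"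
    and A: "has_row n (\<lambda>z. z) U f a A" and nz: "A i \<noteq> 0"
  shows "\<exists>U' V \<Psi>. bihol n U' V (\<lambda>z. z(i := f z)) \<Psi> \<and> a \<in> U' \<and> U' \<subseteq> U"
proof -
  define m where "m = cmod (A i)"
  have m: "m > 0" using nz by (simp add: m_def)
  have UE: "U \<subseteq> Ec n" using U openin_cspace by blast
  obtain r0 where r0: "r0 > 0" "\<And>z. z \<in> Ec n ==> cdist n z a < r0 ==> z \<in> U"
    using U a unfolding openin_cspace by blast
  define e where "e z = f z - f a - (\<Sum>j<n. A j * (z j - a j))" for z
  have "m / 12 > 0" using m by simp
  then obtain \<delta> where \<delta>: "\<delta> > 0" "\<And>z. z \<in> U ==> cdist n z a < \<delta> ==> cmod (e z) \<le> m / 12 * cdist n z a"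
    using A unfolding has_row_def negligible_at_def e_def by blast
  \<comment> \<open>On the ball of radius \<open>3\<rho>\<close> the remainder is at most \<open>m\<rho>/4\<close>; Cauchy's inequality on discs of radius
    \<open>\<rho>\<close> then bounds its derivative by \<open>m/4\<close>.\<close>
  define \<rho> where "\<rho> = min r0 \<delta> / 4"
  have \<rho>: "\<rho> > 0" "3 * \<rho> < r0" "3 * \<rho> < \<delta>" using r0 \<delta> by (auto simp: \<rho>_def)
  have near: "z(i := w) \<in> U \<and> cmod (e (z(i := w))) \<le> m * \<rho> / 4"
    if "z \<in> Ec n" "cdist n z a < \<rho>" "cmod (w - a i) < 2 * \<rho>" for z w
  proof -
    have "cdist n (z(i := w)) a < 3 * \<rho>"
      using cdist_upd_le[OF i, of z w a "a i"] that by simp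
    then have "z(i := w) \<in> U" "cmod (e (z(i := w))) \<le> m / 12 * cdist n (z(i := w)) a"
      "cdist n (z(i := w)) a \<le> 3 * \<rho>"
      using r0(2) \<delta>(2) \<rho> Ec_upd[OF that(1) i] by auto
    moreover have "m / 12 * cdist n (z(i := w)) a \<le> m / 12 * (3 * \<rho>)"
      using \<open>cdist n (z(i := w)) a \<le> 3 * \<rho>\<close> m by (intro mult_left_mono) auto
    moreover have "m / 12 * (3 * \<rho>) = m * \<rho> / 4" by simp
    ultimately show ?thesis by linarith
  qed
  have e_row: "has_row n (\<lambda>z. z) U e b (\<lambda>j. B j - A j)" if "has_row n (\<lambda>z. z) U f b B" for b B
    using has_row_diff[OF that has_row_affine[of n "\<lambda>z. z" U "f a" A a b]]
    unfolding e_def by (simp add: diff_diff_add)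
  have key1: "cmod (B i - A i) \<le> m / 4"
    if z: "z \<in> Ec n" "cdist n z a < \<rho>" and w: "cmod (w - a i) < \<rho>"
      and B: "has_row n (\<lambda>z. z) U f (z(i := w)) B" for z w B
  proof -
    let ?H = "\<lambda>w. e (z(i := w))"
    have D: "\<exists>D. (?H has_field_derivative D) (at w')" if "cmod (w' - a i) < 2 * \<rho>" for w'
    proof -
      have zU: "z(i := w') \<in> U" using near[OF z that] by blast
      then obtain C where C: "has_row n (\<lambda>z. z) U f (z(i := w')) C" using f unfolding cdiff_def by blast
      show ?thesis using has_row_partial[OF U i zU e_row[OF C]] by blast
    qed
    have sub: "cmod (w' - a i) < 2 * \<rho>" if "cmod (w - w') \<le> \<rho>" for w'
      using norm_triangle_ineq[of "w' - w" "w - a i"] w that by (simp add: norm_minus_commute)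
    have hol: "?H holomorphic_on cball w \<rho>"
      unfolding holomorphic_on_def field_differentiable_def
    proof
      fix x assume "x \<in> cball w \<rho>"
      then have "cmod (x - a i) < 2 * \<rho>" using sub by (simp add: dist_norm)
      then show "\<exists>f'. (?H has_field_derivative f') (at x within cball w \<rho>)"
        using D DERIV_subset by blast
    qed
    have wU: "z(i := w) \<in> U" using near[OF z, of w] w \<rho>(1) by simp
    have "norm ((deriv ^^ 1) ?H w) \<le> fact 1 * (m * \<rho> / 4) / \<rho> ^ 1"
    proof (rule Cauchy_inequality)
      show "?H holomorphic_on ball w \<rho>" using hol by (rule holomorphic_on_subset) auto
      show "continuous_on (cball w \<rho>) ?H" using hol by (rule holomorphic_on_imp_continuous_on)
      show "norm (?H x) \<le> m * \<rho> / 4" if "norm (w - x) = \<rho>" for x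
        using near z sub that by simp
    qed (rule \<rho>)
    moreover have "deriv ?H w = B i - A i"
      using has_row_partial[OF U i wU e_row[OF B]] by (rule DERIV_imp_deriv)
    ultimately show ?thesis using \<rho> by simp
  qed
  have key2: "cmod (f (z(i := w1)) - f (z(i := w2)) - A i * (w1 - w2)) \<le> m / 4 * cmod (w1 - w2)"
    if z: "z \<in> Ec n" "cdist n z a < \<rho>" and w: "cmod (w1 - a i) < \<rho>" "cmod (w2 - a i) < \<rho>" for z w1 w2
  proof -
    let ?G = "\<lambda>w. f (z(i := w)) - A i * w"
    have "\<exists>D. (?G has_field_derivative D) (at w within ball (a i) \<rho>) \<and> cmod D \<le> m / 4"
      if "w \<in> ball (a i) \<rho>" for w
    proof -
      have w: "cmod (w - a i) < \<rho>" using that by (simp add: dist_norm norm_minus_commute)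
      then have wU: "z(i := w) \<in> U" using near[OF z, of w] \<rho>(1) by simp
      then obtain B where B: "has_row n (\<lambda>z. z) U f (z(i := w)) B" using f unfolding cdiff_def by blast
      have "(?G has_field_derivative (B i - A i)) (at w)"
        by (rule derivative_eq_intros has_row_partial[OF U i wU B] refl | simp)+
      then show ?thesis using key1[OF z w B] DERIV_subset by blast
    qed
    then obtain D where D: "\<And>w. w \<in> ball (a i) \<rho> ==> (?G has_field_derivative D w) (at w within ball (a i) \<rho>)"
      "\<And>w. w \<in> ball (a i) \<rho> ==> cmod (D w) \<le> m / 4"
      by metis
    have "cmod (?G w1 - ?G w2) \<le> m / 4 * cmod (w1 - w2)"
      using w by (intro field_differentiable_bound[OF convex_ball D]) (auto simp: dist_norm norm_minus_commute)
    then show ?thesis by (simp add: algebra_simps)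
  qed
  obtain d K where dK: "d > 0" "K \<ge> 0" "\<And>z. z \<in> U ==> cdist n z a < d ==> cmod (f z - f a) \<le> K * cdist n z a"
    using has_row_Lipschitz[OF A] by (metis add_nonneg_nonneg norm_ge_zero sum_nonneg zero_le_one)
  define \<eta> where "\<eta> = min (min \<rho> d) (m * \<rho> / (8 * (K + 1)))"
  have \<eta>: "\<eta> > 0" "\<eta> \<le> \<rho>" "\<eta> \<le> d" "K * \<eta> \<le> m * \<rho> / 8"
  proof -
    have "K * \<eta> \<le> (K + 1) * (m * \<rho> / (8 * (K + 1)))"
      using dK m \<rho> by (intro mult_mono) (auto simp: \<eta>_def)
    also have "\<dots> = m * \<rho> / 8" using dK by (simp add: field_simps)
    finally show "K * \<eta> \<le> m * \<rho> / 8" .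
  qed (use \<rho> dK m in \<open>auto simp: \<eta>_def\<close>)
  define V where "V = {v \<in> Ec n. cdist n (v(i := a i)) a < \<eta> \<and> cmod (v i - f a) < m * \<rho> / 8}"
  have sol: "\<exists>w. cmod (w - a i) \<le> \<rho> / 2 \<and> f (v(i := w)) = v i" if v: "v \<in> V" for v
  proof -
    let ?z = "v(i := a i)"
    have z: "?z \<in> Ec n" "cdist n ?z a < \<eta>" "cdist n ?z a < \<rho>"
      using v \<eta>(2) i unfolding V_def by (auto simp: Ec_upd)
    let ?T = "\<lambda>w. w - (f (v(i := w)) - v i) / A i"
    have contr: "cmod (?T w1 - ?T w2) \<le> 1 / 4 * cmod (w1 - w2)"
      if "cmod (w1 - a i) < \<rho>" "cmod (w2 - a i) < \<rho>" for w1 w2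
    proof -
      have "w1 - (F1 - c) / b - (w2 - (F2 - c) / b) = - (F1 - F2 - b * (w1 - w2)) / b"
        if "b \<noteq> 0" for F1 F2 b c :: complex
        using that by (simp add: field_simps)
      from this[OF nz] have "?T w1 - ?T w2 = - (f (v(i := w1)) - f (v(i := w2)) - A i * (w1 - w2)) / A i" .
      then have "cmod (?T w1 - ?T w2) = cmod (- (f (v(i := w1)) - f (v(i := w2)) - A i * (w1 - w2))) / m"
        by (simp only: norm_divide m_def)
      also have "\<dots> = cmod (f (v(i := w1)) - f (v(i := w2)) - A i * (w1 - w2)) / m"
        by (simp only: norm_minus_cancel)
      also have "\<dots> \<le> (m / 4 * cmod (w1 - w2)) / m"
        using key2[OF z(1,3) that] m by (intro divide_right_mono) auto
      finally show ?thesis using m by simp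
    qed
    have "?z \<in> U" using r0 z \<rho> by auto
    then have "cmod (f ?z - f a) \<le> m * \<rho> / 8"
      using dK(3)[of ?z] z \<eta>(3,4) mult_left_mono[of "cdist n ?z a" \<eta> K] dK(2) by linarith
    then have "cmod (f ?z - v i) \<le> m * \<rho> / 4"
      using v norm_triangle_ineq4[of "f ?z - f a" "v i - f a"] unfolding V_def by auto
    moreover have "cmod (?T (a i) - a i) = cmod (f ?z - v i) / m"
      by (simp add: norm_divide m_def)
    ultimately have "cmod (?T (a i) - a i) \<le> (m * \<rho> / 4) / m"
      using divide_right_mono[of "cmod (f ?z - v i)" "m * \<rho> / 4" m] m by linarith
    then have Ta: "cmod (?T (a i) - a i) \<le> \<rho> / 4" using m by simp
    have "\<exists>!x\<in>cball (a i) (\<rho>/2). ?T x = x"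
    proof (rule Banach_fix[where c="1/4"])
      show "complete (cball (a i) (\<rho> / 2))" by (simp add: compact_imp_complete)
      show "?T ` cball (a i) (\<rho> / 2) \<subseteq> cball (a i) (\<rho> / 2)"
      proof clarify
        fix w assume "w \<in> cball (a i) (\<rho> / 2)"
        then have w: "cmod (w - a i) \<le> \<rho> / 2" by (simp add: dist_norm norm_minus_commute)
        have "cmod (?T w - a i) \<le> cmod (?T w - ?T (a i)) + cmod (?T (a i) - a i)"
          using dist_triangle[of "?T w" "a i" "?T (a i)"] by (simp only: dist_norm)
        also have "\<dots> \<le> \<rho> / 2" using contr[of w "a i"] Ta w \<rho>(1) by simp
        finally show "?T w \<in> cball (a i) (\<rho> / 2)"
          unfolding mem_cball by (subst dist_commute) (simp only: dist_norm)
      qed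
      show "dist (?T x) (?T y) \<le> 1 / 4 * dist x y"
        if "x \<in> cball (a i) (\<rho> / 2)" "y \<in> cball (a i) (\<rho> / 2)" for x y
      proof -
        have "cmod (x - a i) < \<rho>" "cmod (y - a i) < \<rho>"
          using that \<rho>(1) by (auto simp: dist_norm norm_minus_commute)
        then show ?thesis using contr[of x y] by (simp only: dist_norm)
      qed
    qed (use \<rho>(1) in auto)
    then obtain w where "w \<in> cball (a i) (\<rho>/2)" "?T w = w" by blast
    then have "cmod (w - a i) \<le> \<rho> / 2" "f (v(i := w)) = v i"
      using nz by (auto simp: dist_norm norm_minus_commute)
    then show ?thesis by blast
  qed
  then have "\<forall>v\<in>V. \<exists>w. cmod (w - a i) \<le> \<rho> / 2 \<and> f (v(i := w)) = v i" by blast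
  from bchoice[OF this] obtain \<omega> where
    \<omega>: "\<And>v. v \<in> V ==> cmod (\<omega> v - a i) \<le> \<rho> / 2" "\<And>v. v \<in> V ==> f (v(i := \<omega> v)) = v i"
    by blast
  define \<Psi> where "\<Psi> v = v(i := \<omega> v)" for v
  define U1 where "U1 = {z \<in> Ec n. cdist n z a < 2 * \<rho> \<and> cmod (z i - a i) < \<rho>}"
  define U' where "U' = {z \<in> U1. z(i := f z) \<in> V}"
  have coord_open: "openin (cspace n) {z \<in> Ec n. cmod (z i - c) < r}" for c r
  proof -
    have "openin (cspace n) {z \<in> topspace (cspace n). z i \<in> ball c r}"
      by (rule openin_continuous_map_preimage[OF continuous_map_cspace_coord]) auto
    then show ?thesis by (simp add: topspace_cspace dist_norm norm_minus_commute)
  qed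
  have "U1 = {z \<in> Ec n. cdist n z a < 2 * \<rho>} \<inter> {z \<in> Ec n. cmod (z i - a i) < \<rho>}"
    by (auto simp: U1_def)
  then have U1: "openin (cspace n) U1"
    by (simp only: openin_Int openin_cspace_cball coord_open)
  have U1U: "U1 \<subseteq> U" using r0 \<rho> by (auto simp: U1_def)
  have oV: "openin (cspace n) V"
  proof -
    have c: "continuous_map (cspace n) (cspace n) (\<lambda>v. v(i := a i))"
      unfolding continuous_map_into_cspace
      using i by (auto simp: continuous_map_cspace_coord topspace_cspace Ec_def fun_upd_def)
    have "openin (cspace n) {v \<in> topspace (cspace n). v(i := a i) \<in> {z \<in> Ec n. cdist n z a < \<eta>}}"
      by (rule openin_continuous_map_preimage[OF c openin_cspace_cball])
    moreover have "V = {v \<in> topspace (cspace n). v(i := a i) \<in> {z \<in> Ec n. cdist n z a < \<eta>}} \<inter>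
        {z \<in> Ec n. cmod (z i - f a) < m * \<rho> / 8}"
      using i by (auto simp: V_def topspace_cspace Ec_upd)
    ultimately show ?thesis using coord_open by (simp only: openin_Int)
  qed
  have dPhi: "cdiff n (\<lambda>z. z) W (\<lambda>z. (z(i := f z)) j) z" if "z \<in> U" "j < n" "W \<subseteq> U" for z j W
    using f[THEN cdiff_subset] cdiff_coord[of j n "\<lambda>z. z"] that by (cases "j = i") auto
  have "openin (subtopology (cspace n) U1) {z \<in> topspace (subtopology (cspace n) U1). z(i := f z) \<in> V}"
    using U1 dPhi U1U UE i
    by (intro openin_continuous_map_preimage[OF cdiff_continuous_map oV]) (auto simp: Ec_upd)
  then have oU': "openin (cspace n) U'"
    using U1 U1U UE by (simp add: U'_def openin_open_subtopology topspace_cspace Int_absorb1)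
  have PsiU1: "\<Psi> v \<in> U1" if "v \<in> V" for v
  proof -
    have "cdist n (\<Psi> v) a \<le> cdist n (v(i := a i)) a + cmod (\<omega> v - a i)"
      using cdist_upd_le[OF i, of "v(i := a i)" "\<omega> v" a "a i"] by (simp add: \<Psi>_def)
    then show ?thesis using that \<omega>(1)[OF that] \<eta> \<rho> i by (auto simp: U1_def \<Psi>_def V_def Ec_upd)
  qed
  have PhiPsi: "(\<Psi> v)(i := f (\<Psi> v)) = v" if "v \<in> V" for v
    using \<omega>(2)[OF that] by (auto simp: \<Psi>_def)
  have PsiPhi: "\<Psi> (z(i := f z)) = z" if "z \<in> U'" for z
  proof -
    let ?v = "z(i := f z)"
    have v: "?v \<in> V" "z \<in> Ec n" "cmod (z i - a i) < \<rho>" using that by (auto simp: U'_def U1_def)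
    have v': "?v(i := a i) \<in> Ec n" "cdist n (?v(i := a i)) a < \<rho>"
      using v(1) \<eta> Ec_upd[OF v(2) i] by (auto simp: V_def)
    have w: "cmod (\<omega> ?v - a i) < \<rho>" using \<omega>(1)[OF v(1)] \<rho>(1) by simp
    have "f (?v(i := \<omega> ?v)) = f (?v(i := z i))" using \<omega>(2)[OF v(1)] by simp
    then have "m * cmod (\<omega> ?v - z i) \<le> m / 4 * cmod (\<omega> ?v - z i)"
      using key2[OF v' w v(3)] by (simp add: norm_mult m_def norm_minus_commute)
    then have "\<omega> ?v = z i" using m by (simp add: mult_le_cancel_right)
    then show ?thesis by (simp add: \<Psi>_def)
  qed
  have dPsi: "cdiff n (\<lambda>z. z) V (\<lambda>v. \<Psi> v j) v0" if v0: "v0 \<in> V" and j: "j < n" for v0 j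
  proof (cases "j = i")
    case False
    then show ?thesis using cdiff_coord[OF j, of "\<lambda>z. z"] by (simp add: \<Psi>_def)
  next
    case True
    have z0: "\<Psi> v0 \<in> U" using PsiU1 v0 U1U by blast
    then obtain B where B: "has_row n (\<lambda>z. z) U f (\<Psi> v0) B" using f unfolding cdiff_def by blast
    have v0': "v0(i := a i) \<in> Ec n" "cdist n (v0(i := a i)) a < \<rho>" "cmod (\<omega> v0 - a i) < \<rho>"
      using v0 \<eta> \<rho> \<omega>(1)[OF v0] i by (auto simp: V_def Ec_upd)
    have "cmod (B i - A i) \<le> m / 4" using key1[OF v0', of B] B by (simp add: \<Psi>_def)
    then have Bi: "B i \<noteq> 0" using m by (auto simp: m_def)
    \<comment> \<open>The implicit function is Lipschitz at \<open>v0\<close>: compare the two solutions on the line through \<open>v\<close>.\<close>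
    obtain d' K' where d': "d' > 0" "\<And>z. z \<in> U ==> cdist n z (\<Psi> v0) < d' ==>
        cmod (f z - f (\<Psi> v0)) \<le> K' * cdist n z (\<Psi> v0)" and K': "K' \<ge> 0"
      using has_row_Lipschitz[OF B] by (metis add_nonneg_nonneg norm_ge_zero sum_nonneg zero_le_one)
    define L where "L = (1 + K') / (3 * m / 4)"
    have Lip: "cdist n (\<Psi> v) (\<Psi> v0) \<le> (1 + L) * cdist n v v0"
      if v: "v \<in> V" "cdist n v v0 < d'" for v
    proof -
      have v': "v(i := a i) \<in> Ec n" "cdist n (v(i := a i)) a < \<rho>" "cmod (\<omega> v - a i) < \<rho>"
        using v \<eta> \<rho> \<omega>(1)[OF v(1)] i by (auto simp: V_def Ec_upd)
      have c: "cdist n (v(i := \<omega> v0)) (\<Psi> v0) \<le> cdist n v v0"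
        using cdist_upd_le[OF i, of v "\<omega> v0" v0 "\<omega> v0"] by (simp add: \<Psi>_def)
      have "v(i := \<omega> v0) \<in> U" using near[OF v'(1,2), of "\<omega> v0"] v0' \<rho> by simp
      then have "cmod (f (v(i := \<omega> v0)) - f (\<Psi> v0)) \<le> K' * cdist n (v(i := \<omega> v0)) (\<Psi> v0)"
        using d'(2) c v by simp
      then have "cmod (f (v(i := \<omega> v0)) - v0 i) \<le> K' * cdist n v v0"
        using \<omega>(2)[OF v0] mult_left_mono[OF c K'] by (simp add: \<Psi>_def)
      moreover have "cmod (v i - v0 i) \<le> cdist n v v0" by (rule coord_le_cdist[OF i])
      ultimately have 1: "cmod (v i - f (v(i := \<omega> v0))) \<le> (1 + K') * cdist n v v0"
        using norm_triangle_ineq4[of "v i - v0 i" "f (v(i := \<omega> v0)) - v0 i"] by (simp add: algebra_simps)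
      have 2: "cmod (v i - f (v(i := \<omega> v0)) - A i * (\<omega> v - \<omega> v0)) \<le> m / 4 * cmod (\<omega> v - \<omega> v0)"
        using key2[OF v'(1,2,3) v0'(3)] \<omega>(2)[OF v(1)] by simp
      have "m * cmod (\<omega> v - \<omega> v0) = cmod (A i * (\<omega> v - \<omega> v0))" by (simp add: norm_mult m_def)
      also have "\<dots> \<le> (1 + K') * cdist n v v0 + m / 4 * cmod (\<omega> v - \<omega> v0)"
        using norm_triangle_ineq4[of "v i - f (v(i := \<omega> v0))" "v i - f (v(i := \<omega> v0)) - A i * (\<omega> v - \<omega> v0)"] 1 2
        by simp
      finally have "3 * m / 4 * cmod (\<omega> v - \<omega> v0) \<le> (1 + K') * cdist n v v0" by simp
      then have "cmod (\<omega> v - \<omega> v0) \<le> L * cdist n v v0"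
        using m by (simp add: L_def field_simps)
      then show ?thesis
        using cdist_upd_le[OF i, of v "\<omega> v" v0 "\<omega> v0"] by (simp add: \<Psi>_def algebra_simps)
    qed
    define e0 where "e0 z = f z - f (\<Psi> v0) - (\<Sum>j<n. B j * (z j - \<Psi> v0 j))" for z
    have "negligible_at n (\<lambda>z. z) V v0 (\<lambda>v. e0 (\<Psi> v))"
    proof (rule negligible_compose[where V=U and l="\<lambda>z. z" and d=d' and L="1 + L" and m=n
          and f=\<Psi> and \<psi>=e0])
      show "negligible_at n (\<lambda>z. z) U (\<Psi> v0) e0" using B unfolding has_row_def e0_def .
      show "\<Psi> ` V \<subseteq> U" using PsiU1 U1U by blast
    qed (use d' Lip in auto)
    then have N: "negligible_at n (\<lambda>z. z) V v0 (\<lambda>v. (- 1 / B i) * e0 (\<Psi> v))"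
      by (rule negligible_cmult)
    define C where "C j = (if j = i then 1 / B i else - B j / B i)" for j
    have "has_row n (\<lambda>z. z) V (\<lambda>v. \<Psi> v i) v0 C"
      unfolding has_row_def
    proof (rule negligible_cong[OF _ N])
      fix v assume v: "v \<in> V"
      define R where "R = (\<Sum>j\<in>{..<n} - {i}. B j * (v j - v0 j))"
      have "(\<Sum>j<n. B j * (\<Psi> v j - \<Psi> v0 j)) = B i * (\<omega> v - \<omega> v0) + R"
        using i unfolding R_def by (subst sum.remove[of _ i]) (auto simp: \<Psi>_def intro!: sum.cong)
      then have 1: "e0 (\<Psi> v) = v i - v0 i - (B i * (\<omega> v - \<omega> v0) + R)"
        using \<omega>(2)[OF v] \<omega>(2)[OF v0] by (simp add: e0_def \<Psi>_def)
      have "(\<Sum>j\<in>{..<n} - {i}. C j * (v j - v0 j)) = - R / B i"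
        unfolding R_def sum_negf[symmetric] sum_divide_distrib by (rule sum.cong) (auto simp: C_def)
      then have 2: "(\<Sum>j<n. C j * (v j - v0 j)) = (v i - v0 i) / B i - R / B i"
        using i by (subst sum.remove[of _ i]) (auto simp: C_def)
      then show "\<Psi> v i - \<Psi> v0 i - (\<Sum>j<n. C j * (v j - v0 j)) = (- 1 / B i) * e0 (\<Psi> v)"
        using Bi unfolding 1 2 by (simp add: \<Psi>_def diff_divide_distrib add_divide_distrib)
    qed
    then show ?thesis unfolding cdiff_def True by blast
  qed
  have "a(i := f a) \<in> V" using \<eta>(1) m \<rho> a UE i by (auto simp: V_def Ec_upd)
  then have "a \<in> U'" using a UE \<rho>(1) by (auto simp: U'_def U1_def)
  moreover have "bihol n U' V (\<lambda>z. z(i := f z)) \<Psi>"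
    unfolding bihol_def
  proof (intro conjI ballI allI impI)
    show "\<Psi> ` V \<subseteq> U'" using PsiU1 PhiPsi by (auto simp: U'_def)
    show "cdiff n (\<lambda>z. z) U' (\<lambda>z. (z(i := f z)) j) z" if "z \<in> U'" "j < n" for z j
      using that U1U by (intro dPhi) (auto simp: U'_def)
  qed (use oU' oV PhiPsi PsiPhi dPsi in \<open>auto simp: U'_def\<close>)
  moreover have "U' \<subseteq> U" using U1U by (auto simp: U'_def)
  ultimately show ?thesis by blast
qed

text \<open>
  A submersion becomes a coordinate projection: straighten one component after the other. The
  component \<open>F\<^sub>j\<close> ends up in slot \<open>n - 1 - j\<close>, so that the zero set of \<open>F\<close> is a slice \<open>\<complex>\<^sup>n\<^sup>-\<^sup>m\<close>.
\<close>

lemma submersion_normal_form_coords: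
  assumes U: "openin (cspace n) U" and a: "a \<in> U"
    and "\<And>z j. z \<in> U ==> j < m ==> cdiff n (\<lambda>z. z) U (\<lambda>z. F z j) z"
    and "\<And>j. j < m ==> has_row n (\<lambda>z. z) U (\<lambda>z. F z j) a (A j)"
    and "\<And>w. \<exists>v. \<forall>j<m. (\<Sum>i<n. A j i * v i) = w j"
  shows "m \<le> n \<and> (\<exists>U' V \<Phi> \<Psi>. bihol n U' V \<Phi> \<Psi> \<and> a \<in> U' \<and> U' \<subseteq> U \<and>
           (\<forall>z\<in>U'. \<forall>j<m. \<Phi> z (n - 1 - j) = F z j))"
  using assms(3-)
proof (induction m)
  case 0
  have "bihol n U U (\<lambda>z. z) (\<lambda>z. z)"
    unfolding bihol_def using U cdiff_coord[of _ n "\<lambda>z. z"] by auto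
  then show ?case using a by blast
next
  case (Suc m)
  have UE: "U \<subseteq> Ec n" using U openin_cspace by blast
  have sur: "\<exists>v. \<forall>j<m. (\<Sum>i<n. A j i * v i) = w j" for w
  proof -
    obtain v where "\<forall>j<Suc m. (\<Sum>i<n. A j i * v i) = w j" using Suc.prems(3)[of w] by blast
    then have "\<forall>j<m. (\<Sum>i<n. A j i * v i) = w j" by simp
    then show ?thesis by blast
  qed
  obtain U1 V1 \<Phi> \<Psi> where mn: "m \<le> n" and b1: "bihol n U1 V1 \<Phi> \<Psi>" and aU1: "a \<in> U1" and U1U: "U1 \<subseteq> U"
    and nf: "\<And>z j. z \<in> U1 ==> j < m ==> \<Phi> z (n - 1 - j) = F z j"
    using Suc.IH[OF Suc.prems(1) Suc.prems(2) sur] by auto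
  have oU1: "openin (cspace n) U1" and oV1: "openin (cspace n) V1" and inv: "\<And>z. z \<in> U1 ==> \<Psi> (\<Phi> z) = z"
    and im: "\<Phi> ` U1 \<subseteq> V1" "\<Psi> ` V1 \<subseteq> U1"
    using b1 unfolding bihol_def by blast+
  define f where "f = (\<lambda>w. F (\<Psi> w) m)"
  have df: "cdiff n (\<lambda>z. z) V1 f w" if "w \<in> V1" for w
    unfolding f_def
  proof (rule cdiff_compose[where m=n and V=U and l="\<lambda>z. z" and f=\<Psi> and u="\<lambda>z. F z m"])
    show "cdiff n (\<lambda>z. z) U (\<lambda>z. F z m) (\<Psi> w)"
      using Suc.prems(1)[of "\<Psi> w" m] im U1U that by (simp add: image_subset_iff subset_iff)
    show "cdiff n (\<lambda>z. z) V1 (\<lambda>y. \<Psi> y j) w" if "j < n" for j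
      using bihol_cdiff(2)[OF b1 \<open>w \<in> V1\<close> that] .
  qed (use im U1U in auto)
  have Pa: "\<Phi> a \<in> V1" using aU1 im by blast
  obtain B where B: "has_row n (\<lambda>z. z) V1 f (\<Phi> a) B" using df[OF Pa] unfolding cdiff_def by blast
  \<comment> \<open>In the last \<open>m\<close> slots the rows of \<open>\<Phi>\<close> are those of \<open>F\<close>.\<close>
  have "\<exists>D. \<forall>k<n. has_row n (\<lambda>z. z) U1 (\<lambda>z. \<Phi> z k) a (D k) \<and> (k \<ge> n - m --> D k = A (n - 1 - k))"
  proof -
    have "\<exists>Dk. has_row n (\<lambda>z. z) U1 (\<lambda>z. \<Phi> z k) a Dk \<and> (k \<ge> n - m --> Dk = A (n - 1 - k))"
      if k: "k < n" for k
    proof (cases "k \<ge> n - m")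
      case True
      then have j: "n - 1 - k < m" "n - 1 - (n - 1 - k) = k" using k by linarith+
      have eq: "\<Phi> z k = F z (n - 1 - k)" if "z \<in> U1" for z using nf[OF that j(1)] j(2) by simp
      have "has_row n (\<lambda>z. z) U (\<lambda>z. F z (n - 1 - k)) a (A (n - 1 - k))"
        using Suc.prems(2)[of "n - 1 - k"] j(1) by simp
      then have "has_row n (\<lambda>z. z) U1 (\<lambda>z. \<Phi> z k) a (A (n - 1 - k))"
        by (rule has_row_local[where d=1]) (use eq aU1 U1U in auto)
      then show ?thesis by blast
    next
      case False
      have "cdiff n (\<lambda>z. z) U1 (\<lambda>z. \<Phi> z k) a" using bihol_cdiff(1)[OF b1 aU1 k] .
      then show ?thesis using False unfolding cdiff_def by blast
    qed
    then have "\<forall>k\<in>{..<n}. \<exists>Dk. has_row n (\<lambda>z. z) U1 (\<lambda>z. \<Phi> z k) a Dk \<and> (k \<ge> n - m --> Dk = A (n - 1 - k))"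
      by blast
    from bchoice[OF this] show ?thesis by blast
  qed
  then obtain D where D: "\<And>k. k < n ==> has_row n (\<lambda>z. z) U1 (\<lambda>z. \<Phi> z k) a (D k)"
    "\<And>k. k < n ==> k \<ge> n - m ==> D k = A (n - 1 - k)" by blast
  have "\<exists>i<n - m. B i \<noteq> 0"
  proof (rule ccontr)
    assume "\<not> (\<exists>i<n - m. B i \<noteq> 0)"
    then have B0: "\<And>i. i < n - m ==> B i = 0" by blast
    have "has_row n (\<lambda>z. z) U1 (\<lambda>z. f (\<Phi> z)) a (\<lambda>i. \<Sum>k<n. B k * D k i)"
      using has_row_compose[where l="\<lambda>z. z" and f=\<Phi>, OF B D(1) im(1)] by simp
    then have 1: "has_row n (\<lambda>z. z) U1 (\<lambda>z. F z m) a (\<lambda>i. \<Sum>k<n. B k * D k i)"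
      by (rule has_row_local[where d=1]) (use inv aU1 in \<open>auto simp: f_def\<close>)
    have 2: "has_row n (\<lambda>z. z) U1 (\<lambda>z. F z m) a (A m)"
      using Suc.prems(2)[of m] U1U by (auto intro: has_row_subset)
    obtain \<delta> where "\<delta> > 0" "\<forall>z\<in>Ec n. cdist n z a < \<delta> --> z \<in> U1"
      using oU1 aU1 unfolding openin_cspace by blast
    then have \<delta>: "\<delta> > 0" "{z \<in> Ec n. cdist n z a < \<delta>} \<subseteq> (\<lambda>z. z) ` U1" by auto
    have Am: "A m i = (\<Sum>k<n. B k * D k i)" if "i < n" for i
      using has_row_unique[OF 2 1 \<delta>] that aU1 U1U UE by auto
    obtain v where v: "\<And>j. j < Suc m ==> (\<Sum>i<n. A j i * v i) = (if j = m then 1 else 0)"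
      using Suc.prems(3)[of "\<lambda>j. if j = m then 1 else 0"] by blast
    have "(1::complex) = (\<Sum>i<n. A m i * v i)" using v[of m] by simp
    also have "\<dots> = (\<Sum>i<n. \<Sum>k<n. B k * (D k i * v i))"
      by (rule sum.cong) (auto simp: Am sum_distrib_right mult.assoc)
    also have "\<dots> = (\<Sum>k<n. B k * (\<Sum>i<n. D k i * v i))"
      by (subst sum.swap) (simp add: sum_distrib_left)
    also have "\<dots> = 0"
    proof (rule sum.neutral, rule ballI)
      fix k assume k: "k \<in> {..<n}"
      show "B k * (\<Sum>i<n. D k i * v i) = 0"
      proof (cases "k < n - m")
        case False
        then have j: "n - 1 - k < m" and kn: "k < n" "k \<ge> n - m" using k by auto
        have "(\<Sum>i<n. A (n - 1 - k) i * v i) = 0" using v[of "n - 1 - k"] j by simp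
        then show ?thesis unfolding D(2)[OF kn] by simp
      next
        case True
        then show ?thesis using B0[of k] by simp
      qed
    qed
    finally show False by simp
  qed
  then obtain i where i: "i < n - m" "B i \<noteq> 0" by blast
  define s where "s = n - 1 - m"
  have s: "s < n" "i < n" using i by (auto simp: s_def)
  define V2 where "V2 = swap_coords i s ` V1"
  have b2: "bihol n V1 V2 (swap_coords i s) (swap_coords i s)"
    unfolding V2_def using oV1 s by (intro bihol_swap) auto
  then have b2': "bihol n V2 V1 (swap_coords i s) (swap_coords i s)" by (rule bihol_sym)
  have oV2: "openin (cspace n) V2" and im2: "swap_coords i s ` V2 \<subseteq> V1"
    and inv2: "\<And>z. z \<in> V1 ==> swap_coords i s (swap_coords i s z) = z"
    using b2 unfolding bihol_def by blast+
  define g where "g = (\<lambda>z. f (swap_coords i s z))"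
  have dg: "cdiff n (\<lambda>z. z) V2 g z" if "z \<in> V2" for z
    unfolding g_def
  proof (rule cdiff_compose[where m=n and V=V1 and l="\<lambda>z. z" and f="swap_coords i s" and u=f])
    show "cdiff n (\<lambda>z. z) V1 f (swap_coords i s z)" using df im2 that by blast
    show "cdiff n (\<lambda>z. z) V2 (\<lambda>y. swap_coords i s y j) z" if "j < n" for j
      using bihol_cdiff(1)[OF b2' \<open>z \<in> V2\<close> that] .
  qed (rule im2)
  define b where "b = swap_coords i s (\<Phi> a)"
  have bV2: "b \<in> V2" using Pa by (simp add: b_def V2_def)
  define \<sigma> where "\<sigma> = (\<lambda>k. if k = i then s else if k = s then i else k)"
  have sw: "swap_coords i s z k = z (\<sigma> k)" for z k by (simp add: swap_coords_def \<sigma>_def)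
  have row: "has_row n (\<lambda>z. z) V2 g b (\<lambda>l. \<Sum>k<n. B k * (if l = \<sigma> k then 1 else 0))"
    unfolding g_def
  proof (rule has_row_compose[where V=V1 and l="\<lambda>z. z" and f="swap_coords i s" and u=f])
    show "has_row n (\<lambda>z. z) V1 f (swap_coords i s b) B" using B inv2[OF Pa] by (simp add: b_def)
    show "has_row n (\<lambda>z. z) V2 (\<lambda>y. swap_coords i s y k) b (\<lambda>l. if l = \<sigma> k then 1 else 0)" if "k < n" for k
      unfolding sw using that s by (intro has_row_coord) (auto simp: \<sigma>_def)
  qed (rule im2)
  have "(\<Sum>k<n. B k * (if s = \<sigma> k then 1 else 0)) = B i"
  proof -
    have "(\<Sum>k<n. B k * (if s = \<sigma> k then 1 else 0)) = (\<Sum>k<n. if k = i then B i else 0)"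
      by (rule sum.cong) (auto simp: \<sigma>_def)
    then show ?thesis using s by simp
  qed
  then have "(\<Sum>k<n. B k * (if s = \<sigma> k then 1 else 0)) \<noteq> 0" using i(2) by simp
  from straighten_coordinate[OF oV2 bV2 s(1) dg row this]
  obtain U3 V3 \<Psi>3 where b3: "bihol n U3 V3 (\<lambda>z. z(s := g z)) \<Psi>3" and bU3: "b \<in> U3" and U3: "U3 \<subseteq> V2"
    by blast
  define W2 where "W2 = {z \<in> V1. swap_coords i s z \<in> U3}"
  define W1 where "W1 = {z \<in> U1. \<Phi> z \<in> W2}"
  define \<Phi>' where "\<Phi>' z = (swap_coords i s (\<Phi> z))(s := g (swap_coords i s (\<Phi> z)))" for z
  have b4: "bihol n W2 V3 (\<lambda>z. (swap_coords i s z)(s := g (swap_coords i s z))) (\<lambda>w. swap_coords i s (\<Psi>3 w))"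
    unfolding W2_def by (rule bihol_compose[OF b2 b3 U3])
  have b5: "bihol n W1 V3 \<Phi>' (\<lambda>w. \<Psi> (swap_coords i s (\<Psi>3 w)))"
    unfolding W1_def \<Phi>'_def
    by (rule bihol_compose[OF b1 b4]) (auto simp: W2_def)
  have a5: "a \<in> W1" using aU1 Pa bU3 by (auto simp: W1_def W2_def b_def)
  have s5: "W1 \<subseteq> U" using U1U by (auto simp: W1_def)
  have n5: "\<Phi>' z (n - 1 - j) = F z j" if "z \<in> W1" "j < Suc m" for z j
  proof (cases "j = m")
    case True
    have "z \<in> U1" using that by (simp add: W1_def)
    then have "\<Phi> z \<in> V1" using im(1) by blast
    then have "g (swap_coords i s (\<Phi> z)) = F z m"
      unfolding g_def f_def using inv2 inv[OF \<open>z \<in> U1\<close>] by simp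
    then show ?thesis using True by (simp add: \<Phi>'_def s_def)
  next
    case False
    then have "n - 1 - j \<noteq> s" "n - 1 - j \<noteq> i" "j < m" using that i by (auto simp: s_def)
    then show ?thesis using nf[of z j] that by (simp add: \<Phi>'_def swap_coords_def W1_def)
  qed
  show ?case
  proof (intro conjI exI)
    show "Suc m \<le> n" using i by linarith
    show "bihol n W1 V3 \<Phi>' (\<lambda>w. \<Psi> (swap_coords i s (\<Psi>3 w)))" by (rule b5)
  qed (use a5 s5 n5 in auto)
qed

section \<open>Charts\<close>

lemma is_chartD:
  assumes "is_chart T c"
  shows "openin T (cdom c)" "openin (cspace (cdim c)) (cmap c ` cdom c)" "inj_on (cmap c) (cdom c)"
    "cmap c ` cdom c \<subseteq> Ec (cdim c)"
    and "\<And>O'. openin (cspace (cdim c)) O' ==> openin T {y \<in> cdom c. cmap c y \<in> O'}"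
    and "\<And>W. openin T W ==> openin (cspace (cdim c)) (cmap c ` (W \<inter> cdom c))"
proof -
  have 1: "openin T (cdom c)" and 2: "openin (cspace (cdim c)) (cmap c ` cdom c)"
    and h: "homeomorphic_map (subtopology T (cdom c)) (subtopology (cspace (cdim c)) (cmap c ` cdom c)) (cmap c)"
    using assms unfolding is_chart_def by auto
  show "openin T (cdom c)" "openin (cspace (cdim c)) (cmap c ` cdom c)" by fact+
  have ts: "topspace (subtopology T (cdom c)) = cdom c"
    using 1 openin_subset[OF 1] by auto
  show "inj_on (cmap c) (cdom c)" using homeomorphic_imp_injective_map[OF h] ts by simp
  show "cmap c ` cdom c \<subseteq> Ec (cdim c)" using openin_subset[OF 2] by (simp add: topspace_cspace)
  have "continuous_map (subtopology T (cdom c)) (cspace (cdim c)) (cmap c)"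
    using homeomorphic_imp_continuous_map[OF h] continuous_map_in_subtopology by blast
  then show "openin T {y \<in> cdom c. cmap c y \<in> O'}" if "openin (cspace (cdim c)) O'" for O'
    using openin_trans_full[OF openin_continuous_map_preimage[OF _ that, of "subtopology T (cdom c)" "cmap c"] 1]
    unfolding ts by simp
  show "openin (cspace (cdim c)) (cmap c ` (W \<inter> cdom c))" if W: "openin T W" for W
  proof -
    have "openin (subtopology T (cdom c)) (W \<inter> cdom c)"
      using W by (rule openin_subtopology_Int)
    then have "openin (subtopology (cspace (cdim c)) (cmap c ` cdom c)) (cmap c ` (W \<inter> cdom c))"
      using homeomorphic_imp_open_map[OF h] unfolding open_map_def by blast
    then show ?thesis using openin_trans_full[OF _ 2] by blast
  qed
qed

lemma chart_nbhd:
  assumes c: "is_chart T c" and x: "x \<in> cdom c" "openin T W" "x \<in> W"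
  obtains \<delta> where "\<delta> > 0"
    "\<forall>y\<in>cdom c. cdist (cdim c) (cmap c y) (cmap c x) < \<delta> --> y \<in> W"
    "{z \<in> Ec (cdim c). cdist (cdim c) z (cmap c x) < \<delta>} \<subseteq> cmap c ` (W \<inter> cdom c)"
proof -
  have o: "openin (cspace (cdim c)) (cmap c ` (W \<inter> cdom c))" using is_chartD(6)[OF c x(2)] .
  have "cmap c x \<in> cmap c ` (W \<inter> cdom c)" using x by blast
  then obtain \<delta> where \<delta>: "\<delta> > 0" "\<forall>z\<in>Ec (cdim c). cdist (cdim c) z (cmap c x) < \<delta> --> z \<in> cmap c ` (W \<inter> cdom c)"
    using o unfolding openin_cspace by blast
  have "y \<in> W" if y: "y \<in> cdom c" "cdist (cdim c) (cmap c y) (cmap c x) < \<delta>" for y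
  proof -
    have "cmap c y \<in> Ec (cdim c)" using is_chartD(4)[OF c] y by blast
    then have "cmap c y \<in> cmap c ` (W \<inter> cdom c)" using \<delta> y by blast
    then obtain y' where "y' \<in> W \<inter> cdom c" "cmap c y = cmap c y'" by blast
    then show ?thesis using is_chartD(3)[OF c] y by (auto dest: inj_onD)
  qed
  then have 1: "\<forall>y\<in>cdom c. cdist (cdim c) (cmap c y) (cmap c x) < \<delta> --> y \<in> W" by blast
  have "{z \<in> Ec (cdim c). cdist (cdim c) z (cmap c x) < \<delta>} \<subseteq> cmap c ` (W \<inter> cdom c)"
    using \<delta>(2) by blast
  from that[OF \<delta>(1) 1 this] show thesis .
qed

lemma chart_nbhd_dom:
  assumes c: "is_chart T c" and x: "x \<in> cdom c" "openin T W" "x \<in> W"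
  obtains \<delta> where "\<delta> > 0" "\<forall>y\<in>cdom c. cdist (cdim c) (cmap c y) (cmap c x) < \<delta> --> y \<in> W"
proof -
  obtain \<delta> where \<delta>: "\<delta> > 0" "\<forall>y\<in>cdom c. cdist (cdim c) (cmap c y) (cmap c x) < \<delta> --> y \<in> W"
    "{z \<in> Ec (cdim c). cdist (cdim c) z (cmap c x) < \<delta>} \<subseteq> cmap c ` (W \<inter> cdom c)"
    by (rule chart_nbhd[OF assms])
  from that[OF \<delta>(1,2)] show thesis .
qed

lemma chart_ball_open:
  assumes c: "is_chart T c"
  shows "openin T {y \<in> cdom c. cdist (cdim c) (cmap c y) z < r}"
proof -
  have "{y \<in> cdom c. cdist (cdim c) (cmap c y) z < r} =
      {y \<in> cdom c. cmap c y \<in> {w \<in> Ec (cdim c). cdist (cdim c) w z < r}}"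
    using is_chartD(4)[OF c] by auto
  then show ?thesis using is_chartD(5)[OF c openin_cspace_cball] by simp
qed

text \<open>The topological part of being a chart, at a point and in terms of distances.\<close>

lemma is_chartI:
  assumes D: "openin T (cdom c)" and inj: "inj_on (cmap c) (cdom c)"
    and E: "cmap c ` cdom c \<subseteq> Ec (cdim c)"
    and opn: "\<And>x W. x \<in> cdom c ==> openin T W ==> x \<in> W ==>
       \<exists>\<delta>>0. {z \<in> Ec (cdim c). cdist (cdim c) z (cmap c x) < \<delta>} \<subseteq> cmap c ` (W \<inter> cdom c)"
    and cnt: "\<And>x \<delta>. x \<in> cdom c ==> \<delta> > 0 ==>
       \<exists>W. openin T W \<and> x \<in> W \<and> (\<forall>y\<in>W \<inter> cdom c. cdist (cdim c) (cmap c y) (cmap c x) < \<delta>)"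
  shows "is_chart T c"
proof -
  let ?n = "cdim c"
  have op: "openin (cspace ?n) (cmap c ` (W \<inter> cdom c))" if W: "openin T W" for W
    unfolding openin_cspace
  proof (intro conjI ballI)
    fix a assume "a \<in> cmap c ` (W \<inter> cdom c)"
    then obtain x where "x \<in> cdom c" "x \<in> W" "a = cmap c x" by blast
    then show "\<exists>\<delta>>0. \<forall>z\<in>Ec ?n. cdist ?n z a < \<delta> --> z \<in> cmap c ` (W \<inter> cdom c)"
      using opn[of x W] W by blast
  qed (use E in blast)
  have img: "openin (cspace ?n) (cmap c ` cdom c)" using op[OF D] by simp
  have ts: "topspace (subtopology T (cdom c)) = cdom c"
    "topspace (subtopology (cspace ?n) (cmap c ` cdom c)) = cmap c ` cdom c"
    using D E by (auto simp: openin_subset topspace_cspace dest: openin_subset)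
  have "homeomorphic_map (subtopology T (cdom c)) (subtopology (cspace ?n) (cmap c ` cdom c)) (cmap c)"
  proof (rule bijective_open_imp_homeomorphic_map)
    show "continuous_map (subtopology T (cdom c)) (subtopology (cspace ?n) (cmap c ` cdom c)) (cmap c)"
      unfolding continuous_map_in_subtopology
    proof
      show "continuous_map (subtopology T (cdom c)) (cspace ?n) (cmap c)"
        unfolding continuous_map
      proof (intro conjI allI impI)
        show "cmap c ` topspace (subtopology T (cdom c)) \<subseteq> topspace (cspace ?n)"
          unfolding ts topspace_cspace by (rule E)
        fix O' assume O': "openin (cspace ?n) O'"
        have "openin T {y \<in> cdom c. cmap c y \<in> O'}"
        proof (subst openin_subopen, intro ballI)
          fix x assume x: "x \<in> {y \<in> cdom c. cmap c y \<in> O'}"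
          then obtain \<delta> where \<delta>: "\<delta> > 0" "\<forall>z\<in>Ec ?n. cdist ?n z (cmap c x) < \<delta> --> z \<in> O'"
            using O' unfolding openin_cspace by blast
          obtain W where W: "openin T W" "x \<in> W" "\<forall>y\<in>W \<inter> cdom c. cdist ?n (cmap c y) (cmap c x) < \<delta>"
            using cnt[of x \<delta>] x \<delta> by blast
          have "openin T (W \<inter> cdom c)" using W D by blast
          moreover have "W \<inter> cdom c \<subseteq> {y \<in> cdom c. cmap c y \<in> O'}"
            using W \<delta> E by blast
          ultimately show "\<exists>W. openin T W \<and> x \<in> W \<and> W \<subseteq> {y \<in> cdom c. cmap c y \<in> O'}"
            using W x by blast
        qed
        then show "openin (subtopology T (cdom c)) {y \<in> topspace (subtopology T (cdom c)). cmap c y \<in> O'}"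
          unfolding ts using D by (simp add: openin_open_subtopology)
      qed
    qed (auto simp: ts)
    show "open_map (subtopology T (cdom c)) (subtopology (cspace ?n) (cmap c ` cdom c)) (cmap c)"
      unfolding open_map_def
    proof (intro allI impI)
      fix W assume "openin (subtopology T (cdom c)) W"
      then have "openin T W" "W \<inter> cdom c = W" using D by (auto simp: openin_open_subtopology)
      then show "openin (subtopology (cspace ?n) (cmap c ` cdom c)) (cmap c ` W)"
        using op[of W] img \<open>W \<inter> cdom c = W\<close> by (auto simp: openin_open_subtopology)
    qed
  qed (use ts inj in auto)
  then show ?thesis unfolding is_chart_def using D img by blast
qed

section \<open>Holomorphy at a point\<close>

definition diff_in_charts :: "'a chart => 'b chart => ('a => 'b) => 'a => bool" where
  "diff_in_charts c d f x \<longleftrightarrow>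
     (\<forall>j<cdim d. cdiff (cdim c) (cmap c) {y \<in> cdom c. f y \<in> cdom d} (\<lambda>y. cmap d (f y) j) x)"

lemma has_cderiv_charts:
  assumes inj: "inj_on (cmap c) (cdom c)" and x: "x \<in> cdom c"
  shows "has_cderiv (cdim c) (cdim d) (coord_dom c d f) (coord_rep c d f) (cmap c x) A \<longleftrightarrow>
    (\<forall>j<cdim d. has_row (cdim c) (cmap c) {y \<in> cdom c. f y \<in> cdom d} (\<lambda>y. cmap d (f y) j) x (A j))"
proof -
  have "coord_rep c d f (cmap c y) = cmap d (f y)" if "y \<in> cdom c" for y
    using inj that by (simp add: coord_rep_def inv_into_f_f)
  then show ?thesis using x
    unfolding has_cderiv_iff_rows has_row_def negligible_at_def coord_dom_def by auto
qed

text \<open>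
  The inverse chart in \<open>coord_rep\<close> disappears: a coordinate expression is differentiable when \<open>f\<close>
  is differentiable with respect to the coordinates that the chart provides.
\<close>

lemma holomorphic_in_charts_iff:
  assumes inj: "inj_on (cmap c) (cdom c)"
  shows "holomorphic_in_charts c d f \<longleftrightarrow>
     (\<forall>x\<in>cdom c. f x \<in> cdom d --> diff_in_charts c d f x)"
proof -
  have "(\<exists>A. has_cderiv (cdim c) (cdim d) (coord_dom c d f) (coord_rep c d f) (cmap c x) A) \<longleftrightarrow>
     diff_in_charts c d f x" if "x \<in> cdom c" for x
    unfolding has_cderiv_charts[OF inj that] diff_in_charts_def cdiff_def
  proof
    assume "\<forall>j<cdim d. Ex (has_row (cdim c) (cmap c) {y \<in> cdom c. f y \<in> cdom d} (\<lambda>y. cmap d (f y) j) x)"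
    then have "\<forall>j\<in>{..<cdim d}. \<exists>A. has_row (cdim c) (cmap c) {y \<in> cdom c. f y \<in> cdom d} (\<lambda>y. cmap d (f y) j) x A"
      by simp
    from bchoice[OF this] show "\<exists>A. \<forall>j<cdim d. has_row (cdim c) (cmap c)
        {y \<in> cdom c. f y \<in> cdom d} (\<lambda>y. cmap d (f y) j) x (A j)"
      unfolding Ball_def lessThan_iff .
  qed auto
  then show ?thesis
    unfolding holomorphic_in_charts_def cholomorphic_on_def by (auto simp: coord_dom_def)
qed

text \<open>
  Unlike \<open>topcontinuous_at\<close>, this does not ask where \<open>f\<close> maps points far from \<open>x\<close>, so that it
  applies to local sections and local inverses.
\<close>

definition cont_at :: "'a topology => 'b topology => ('a => 'b) => 'a => bool" where
  "cont_at T T' f x \<longleftrightarrow> x \<in> topspace T \<and> f x \<in> topspace T' \<and>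
     (\<forall>V. openin T' V \<and> f x \<in> V --> (\<exists>W. openin T W \<and> x \<in> W \<and> f ` W \<subseteq> V))"

lemma cont_atD:
  assumes "cont_at T T' f x" "openin T' V" "f x \<in> V"
  obtains W where "openin T W" "x \<in> W" "f ` W \<subseteq> V"
  using assms unfolding cont_at_def by blast

lemma continuous_map_iff_cont_at:
  "continuous_map T T' f \<longleftrightarrow> (\<forall>x\<in>topspace T. cont_at T T' f x)"
proof
  assume c: "continuous_map T T' f"
  show "\<forall>x\<in>topspace T. cont_at T T' f x"
    unfolding cont_at_def
  proof (intro ballI conjI allI impI)
    fix x assume x: "x \<in> topspace T"
    then show "f x \<in> topspace T'" using c continuous_map_image_subset_topspace by blast
    fix V assume V: "openin T' V \<and> f x \<in> V"
    then have "openin T {x \<in> topspace T. f x \<in> V}" using openin_continuous_map_preimage[OF c] by blast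
    then show "\<exists>W. openin T W \<and> x \<in> W \<and> f ` W \<subseteq> V"
      using V x by (intro exI[of _ "{x \<in> topspace T. f x \<in> V}"]) auto
  qed
next
  assume R: "\<forall>x\<in>topspace T. cont_at T T' f x"
  show "continuous_map T T' f"
    unfolding continuous_map
  proof (intro conjI allI impI)
    show "f ` topspace T \<subseteq> topspace T'" using R unfolding cont_at_def by blast
    fix V assume V: "openin T' V"
    show "openin T {x \<in> topspace T. f x \<in> V}"
    proof (subst openin_subopen, intro ballI)
      fix x assume x: "x \<in> {x \<in> topspace T. f x \<in> V}"
      then obtain W where "openin T W" "x \<in> W" "f ` W \<subseteq> V" using R V unfolding cont_at_def by blast
      then show "\<exists>W. openin T W \<and> x \<in> W \<and> W \<subseteq> {x \<in> topspace T. f x \<in> V}"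
        using openin_subset by blast
    qed
  qed
qed

lemma cont_at_compose:
  assumes "cont_at T T' f x" "cont_at T' T'' g (f x)"
  shows "cont_at T T'' (\<lambda>y. g (f y)) x"
  unfolding cont_at_def
proof (intro conjI allI impI)
  fix V assume "openin T'' V \<and> g (f x) \<in> V"
  then obtain V' where V': "openin T' V'" "f x \<in> V'" "g ` V' \<subseteq> V" using cont_atD[OF assms(2)] by blast
  then obtain W where "openin T W" "x \<in> W" "f ` W \<subseteq> V'" using cont_atD[OF assms(1)] by blast
  then show "\<exists>W. openin T W \<and> x \<in> W \<and> (\<lambda>y. g (f y)) ` W \<subseteq> V" using V' by blast
qed (use assms in \<open>auto simp: cont_at_def\<close>)

lemma cont_at_cong:
  assumes "cont_at T T' f x" "openin T W" "x \<in> W" "\<And>y. y \<in> W ==> g y = f y"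
  shows "cont_at T T' g x"
  unfolding cont_at_def
proof (intro conjI allI impI)
  show "x \<in> topspace T" "g x \<in> topspace T'" using assms by (auto simp: cont_at_def)
  fix V assume "openin T' V \<and> g x \<in> V"
  then obtain W' where "openin T W'" "x \<in> W'" "f ` W' \<subseteq> V" using assms(1) assms(4)[OF assms(3)] unfolding cont_at_def by auto
  then show "\<exists>W. openin T W \<and> x \<in> W \<and> g ` W \<subseteq> V"
    using assms by (intro exI[of _ "W \<inter> W'"]) auto
qed

lemma cont_at_id: "x \<in> topspace T ==> cont_at T T (\<lambda>x. x) x"
  unfolding cont_at_def by auto

definition hol_at :: "'a cmanifold => 'b cmanifold => ('a => 'b) => 'a => bool" where
  "hol_at M N f x \<longleftrightarrow> cont_at (Top M) (Top N) f x \<and>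
     (\<forall>c\<in>Atlas M. \<forall>d\<in>Atlas N. x \<in> cdom c \<and> f x \<in> cdom d --> diff_in_charts c d f x)"

lemma hol_at_cont: "hol_at M N f x ==> cont_at (Top M) (Top N) f x"
  by (simp add: hol_at_def)

lemma hol_atD:
  "hol_at M N f x ==> c \<in> Atlas M ==> d \<in> Atlas N ==> x \<in> cdom c ==> f x \<in> cdom d ==> diff_in_charts c d f x"
  by (simp add: hol_at_def)

lemma diff_in_chartsD:
  "diff_in_charts c d f x ==> j < cdim d ==>
     cdiff (cdim c) (cmap c) {y \<in> cdom c. f y \<in> cdom d} (\<lambda>y. cmap d (f y) j) x"
  by (simp add: diff_in_charts_def)

definition charted :: "'a cmanifold => bool" where
  "charted M \<longleftrightarrow> (\<forall>c\<in>Atlas M. is_chart (Top M) c)"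

lemma charted_manifold: "complex_manifold M ==> charted M"
  by (simp add: complex_manifold_def charted_def)

text \<open>
  For maps out of a space that merely has charts, compatible or not, holomorphy is still a
  pointwise matter. This covers the fibre products on which actions and multiplications live.
\<close>

lemma holomorphic_map_iff_hol_at:
  assumes "charted M"
  shows "holomorphic_map M N f \<longleftrightarrow> (\<forall>x\<in>pts M. hol_at M N f x)"
proof -
  have h: "holomorphic_in_charts c d f \<longleftrightarrow> (\<forall>x\<in>cdom c. f x \<in> cdom d --> diff_in_charts c d f x)"
    if "c \<in> Atlas M" for c d
    using assms that by (intro holomorphic_in_charts_iff) (auto simp: charted_def intro: is_chartD)
  have s: "x \<in> pts M" if "c \<in> Atlas M" "x \<in> cdom c" for c x
    using assms that is_chartD(1) openin_subset unfolding charted_def by blast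
  show ?thesis
    unfolding holomorphic_map_def hol_at_def continuous_map_iff_cont_at using h s by blast
qed

lemma diff_in_charts_compose:
  assumes c: "is_chart T c" "x \<in> cdom c" and f: "cont_at T T' f x" and d: "openin T' (cdom d)" "f x \<in> cdom d"
    and 1: "diff_in_charts c d f x" and 2: "diff_in_charts d e g (f x)" and e: "g (f x) \<in> cdom e"
  shows "diff_in_charts c e (\<lambda>y. g (f y)) x"
  unfolding diff_in_charts_def
proof (intro allI impI)
  fix j assume j: "j < cdim e"
  obtain W where W: "openin T W" "x \<in> W" "f ` W \<subseteq> cdom d" using cont_atD[OF f d] by blast
  obtain \<delta> where \<delta>: "\<delta> > 0" "\<forall>y\<in>cdom c. cdist (cdim c) (cmap c y) (cmap c x) < \<delta> --> y \<in> W"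
    by (rule chart_nbhd_dom[OF c W(1,2)])
  let ?W = "{y \<in> cdom c. f y \<in> cdom d \<and> g (f y) \<in> cdom e}"
  have "cdiff (cdim c) (cmap c) ?W (\<lambda>y. cmap e (g (f y)) j) x"
  proof (rule cdiff_compose[where m="cdim d" and l="cmap d" and V="{z \<in> cdom d. g z \<in> cdom e}"
        and f=f and u="\<lambda>z. cmap e (g z) j"])
    show "cdiff (cdim d) (cmap d) {z \<in> cdom d. g z \<in> cdom e} (\<lambda>z. cmap e (g z) j) (f x)"
      using diff_in_chartsD[OF 2 j] .
    fix i assume "i < cdim d"
    from diff_in_chartsD[OF 1 this] show "cdiff (cdim c) (cmap c) ?W (\<lambda>y. cmap d (f y) i) x" by (rule cdiff_subset) auto
  qed auto
  then show "cdiff (cdim c) (cmap c) {y \<in> cdom c. g (f y) \<in> cdom e} (\<lambda>y. cmap e (g (f y)) j) x"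
    by (rule cdiff_local[OF _ \<delta>(1)]) (use \<delta>(2) W(3) in auto)
qed

lemma maximal_atlasD:
  assumes "c \<in> maximal_atlas M"
  shows "is_chart (Top M) c"
    and "\<And>d x. d \<in> Atlas M ==> x \<in> cdom c ==> x \<in> cdom d ==> diff_in_charts c d (\<lambda>x. x) x"
    and "\<And>d x. complex_manifold M ==> d \<in> Atlas M ==> x \<in> cdom c ==> x \<in> cdom d ==> diff_in_charts d c (\<lambda>x. x) x"
proof -
  show c: "is_chart (Top M) c" using assms by (simp add: maximal_atlas_def)
  show "diff_in_charts c d (\<lambda>x. x) x" if "d \<in> Atlas M" "x \<in> cdom c" "x \<in> cdom d" for d x
    using assms that holomorphic_in_charts_iff[OF is_chartD(3)[OF c], of d id]
    by (simp add: maximal_atlas_def id_def)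
  show "diff_in_charts d c (\<lambda>x. x) x"
    if M: "complex_manifold M" "d \<in> Atlas M" "x \<in> cdom c" "x \<in> cdom d" for d x
  proof -
    have "is_chart (Top M) d" using M by (simp add: complex_manifold_def)
    from holomorphic_in_charts_iff[OF is_chartD(3)[OF this], of c id] show ?thesis
      using assms that by (simp add: maximal_atlas_def id_def)
  qed
qed

lemma Atlas_subset_maximal:
  "complex_manifold M ==> c \<in> Atlas M ==> c \<in> maximal_atlas M"
  by (simp add: complex_manifold_def maximal_atlas_def)

lemma manifold_chart_open:
  assumes "complex_manifold M" "c \<in> Atlas M"
  shows "is_chart (Top M) c" "openin (Top M) (cdom c)"
  using assms is_chartD(1)[of "Top M" c] unfolding complex_manifold_def by auto

lemma manifold_chart_at:
  assumes "complex_manifold M" "x \<in> pts M"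
  obtains c where "c \<in> Atlas M" "x \<in> cdom c"
  using assms unfolding complex_manifold_def by blast

lemma chart_subset_topspace: "is_chart (Top M) c ==> x \<in> cdom c ==> x \<in> pts M"
  using is_chartD(1) openin_subset by blast

lemma maximal_atlas_compatible:
  assumes M: "complex_manifold M" and "c \<in> maximal_atlas M" "d \<in> maximal_atlas M" "x \<in> cdom c" "x \<in> cdom d"
  shows "diff_in_charts c d (\<lambda>x. x) x"
proof -
  have xt: "x \<in> pts M" by (rule chart_subset_topspace[OF maximal_atlasD(1)[OF assms(2)] assms(4)])
  obtain e where e: "e \<in> Atlas M" "x \<in> cdom e" by (rule manifold_chart_at[OF M xt])
  have eo: "openin (Top M) (cdom e)"
    by (rule manifold_chart_open(2)[OF M e(1)])
  show ?thesis
    using diff_in_charts_compose[where f="\<lambda>x. x" and g="\<lambda>x. x", OF maximal_atlasD(1)[OF assms(2)] assms(4)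
      cont_at_id[OF xt] eo e(2) maximal_atlasD(2)[OF assms(2) e(1) assms(4) e(2)]
      maximal_atlasD(3)[OF assms(3) M e(1) assms(5) e(2)] assms(5)] .
qed

text \<open>
  By the chain rule, holomorphy can be tested in any chart of the maximal atlas of the target.
\<close>

lemma hol_at_target_chart:
  assumes M: "charted M" and N: "complex_manifold N" and h: "hol_at M N f x"
    and c: "c \<in> Atlas M" "x \<in> cdom c" and d: "d \<in> maximal_atlas N" "f x \<in> cdom d"
  shows "diff_in_charts c d f x"
proof -
  have cc: "is_chart (Top M) c" using M c by (simp add: charted_def)
  have f: "cont_at (Top M) (Top N) f x" using h by (simp add: hol_at_def)
  then have fx: "f x \<in> pts N" by (simp add: cont_at_def)
  obtain e where e: "e \<in> Atlas N" "f x \<in> cdom e" by (rule manifold_chart_at[OF N fx])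
  have eo: "openin (Top N) (cdom e)"
    by (rule manifold_chart_open(2)[OF N e(1)])
  have "diff_in_charts c e f x" by (rule hol_atD[OF h c(1) e(1) c(2) e(2)])
  from diff_in_charts_compose[where g="\<lambda>x. x", OF cc c(2) f eo e(2) this maximal_atlasD(3)[OF d(1) N e(1) d(2) e(2)] d(2)]
  show ?thesis .
qed

lemma hol_at_compose:
  assumes M: "charted M" and N: "complex_manifold N"
    and f: "hol_at M N f x" and g: "hol_at N P g (f x)"
  shows "hol_at M P (\<lambda>y. g (f y)) x"
  unfolding hol_at_def
proof (intro conjI ballI impI)
  have cf: "cont_at (Top M) (Top N) f x" and cg: "cont_at (Top N) (Top P) g (f x)"
    using f g by (auto simp: hol_at_def)
  then show "cont_at (Top M) (Top P) (\<lambda>y. g (f y)) x" by (rule cont_at_compose)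
  fix c e assume c: "c \<in> Atlas M" and e: "e \<in> Atlas P" and x: "x \<in> cdom c \<and> g (f x) \<in> cdom e"
  have ft: "f x \<in> pts N" using cf by (simp add: cont_at_def)
  obtain d where d: "d \<in> Atlas N" "f x \<in> cdom d" by (rule manifold_chart_at[OF N ft])
  have od: "openin (Top N) (cdom d)"
    by (rule manifold_chart_open(2)[OF N d(1)])
  have cc: "is_chart (Top M) c" using M c by (simp add: charted_def)
  have 1: "diff_in_charts c d f x" using hol_atD[OF f c d(1)] x d(2) by simp
  have 2: "diff_in_charts d e g (f x)" using hol_atD[OF g d(1) e d(2)] x by simp
  show "diff_in_charts c e (\<lambda>y. g (f y)) x"
    by (rule diff_in_charts_compose[where g=g, OF cc conjunct1[OF x] cf od d(2) 1 2 conjunct2[OF x]])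
qed

lemma hol_at_cong:
  assumes M: "charted M" and f: "hol_at M N f x" and W: "openin (Top M) W" "x \<in> W" "\<And>y. y \<in> W ==> g y = f y"
  shows "hol_at M N g x"
  unfolding hol_at_def
proof (intro conjI ballI impI)
  show "cont_at (Top M) (Top N) g x" using cont_at_cong[OF _ W] f by (auto simp: hol_at_def)
  fix c d assume c: "c \<in> Atlas M" and d: "d \<in> Atlas N" and x: "x \<in> cdom c \<and> g x \<in> cdom d"
  have cc: "is_chart (Top M) c" using M c by (simp add: charted_def)
  obtain \<delta> where \<delta>: "\<delta> > 0" "\<forall>y\<in>cdom c. cdist (cdim c) (cmap c y) (cmap c x) < \<delta> --> y \<in> W"
    by (rule chart_nbhd_dom[OF cc conjunct1[OF x] W(1,2)])
  have df: "diff_in_charts c d f x" using hol_atD[OF f c d] x W(3)[OF W(2)] by simp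
  show "diff_in_charts c d g x"
    unfolding diff_in_charts_def
  proof (intro allI impI)
    fix j assume "j < cdim d"
    from diff_in_chartsD[OF df this]
    show "cdiff (cdim c) (cmap c) {y \<in> cdom c. g y \<in> cdom d} (\<lambda>y. cmap d (g y) j) x"
      by (rule cdiff_local[OF _ \<delta>(1)]) (use \<delta>(2) W(2,3) in auto)
  qed
qed

text \<open>One pair of charts suffices; continuity at the point is then automatic.\<close>

lemma hol_atI:
  assumes M: "complex_manifold M" and N: "complex_manifold N"
    and c: "c \<in> maximal_atlas M" "x \<in> cdom c" and d: "d \<in> maximal_atlas N"
    and W: "openin (Top M) W" "x \<in> W" "W \<subseteq> cdom c" "f ` W \<subseteq> cdom d"
    and diff: "\<And>j. j < cdim d ==> cdiff (cdim c) (cmap c) W (\<lambda>y. cmap d (f y) j) x"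
  shows "hol_at M N f x"
  unfolding hol_at_def
proof (intro conjI ballI impI)
  have cc: "is_chart (Top M) c" and dd: "is_chart (Top N) d" using c d maximal_atlasD(1) by auto
  have fx: "f x \<in> cdom d" using W by blast
  show cont: "cont_at (Top M) (Top N) f x"
    unfolding cont_at_def
  proof (intro conjI allI impI)
    show "x \<in> pts M" "f x \<in> pts N"
      using chart_subset_topspace[OF cc c(2)] chart_subset_topspace[OF dd fx] by auto
    fix V assume V: "openin (Top N) V \<and> f x \<in> V"
    obtain \<delta> where \<delta>: "\<delta> > 0" "\<forall>y\<in>cdom d. cdist (cdim d) (cmap d y) (cmap d (f x)) < \<delta> --> y \<in> V"
      by (rule chart_nbhd_dom[OF dd fx conjunct1[OF V] conjunct2[OF V]])
    obtain r L where L: "r > 0" "L \<ge> 0" "\<forall>y\<in>W. cdist (cdim c) (cmap c y) (cmap c x) < r -->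
        cdist (cdim d) (cmap d (f y)) (cmap d (f x)) \<le> L * cdist (cdim c) (cmap c y) (cmap c x)"
      using cdiff_Lipschitz[of "cdim d" "cdim c" "cmap c" W "\<lambda>y. cmap d (f y)" x] diff by blast
    define s where "s = min r (\<delta> / (L + 1))"
    have s: "s > 0" using L \<delta> by (simp add: s_def)
    let ?W = "W \<inter> {y \<in> cdom c. cdist (cdim c) (cmap c y) (cmap c x) < s}"
    have "f y \<in> V" if y: "y \<in> ?W" for y
    proof -
      have "cdist (cdim d) (cmap d (f y)) (cmap d (f x)) \<le> L * cdist (cdim c) (cmap c y) (cmap c x)"
        using L y by (auto simp: s_def)
      also have "\<dots> \<le> (L + 1) * cdist (cdim c) (cmap c y) (cmap c x)" by (simp add: mult_right_mono)
      also have "\<dots> < \<delta>" using y L by (auto simp: s_def field_simps)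
      finally show ?thesis using \<delta>(2) y W by blast
    qed
    moreover have "openin (Top M) ?W" using W chart_ball_open[OF cc] by blast
    ultimately show "\<exists>W. openin (Top M) W \<and> x \<in> W \<and> f ` W \<subseteq> V"
      using W c s by (intro exI[of _ ?W]) auto
  qed
  obtain \<delta> where \<delta>: "\<delta> > 0" "\<forall>y\<in>cdom c. cdist (cdim c) (cmap c y) (cmap c x) < \<delta> --> y \<in> W"
    by (rule chart_nbhd_dom[OF cc c(2) W(1,2)])
  have cd: "diff_in_charts c d f x"
    unfolding diff_in_charts_def
  proof (intro allI impI)
    fix j assume "j < cdim d"
    from diff[OF this] show "cdiff (cdim c) (cmap c) {y \<in> cdom c. f y \<in> cdom d} (\<lambda>y. cmap d (f y) j) x"
      by (rule cdiff_local[OF _ \<delta>(1)]) (use \<delta>(2) in auto)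
  qed
  fix c' d' assume c': "c' \<in> Atlas M" and d': "d' \<in> Atlas N" and x: "x \<in> cdom c' \<and> f x \<in> cdom d'"
  have cc': "is_chart (Top M) c'" using M c' by (simp add: complex_manifold_def)
  have xt: "x \<in> pts M" using cont by (simp add: cont_at_def)
  have 1: "diff_in_charts c' c (\<lambda>x. x) x" using maximal_atlasD(3)[OF c(1) M c' c(2)] x by blast
  have 2: "diff_in_charts d d' (\<lambda>x. x) (f x)" using maximal_atlasD(2)[OF d d' fx] x by blast
  have "diff_in_charts c d' f x"
    using diff_in_charts_compose[where g="\<lambda>x. x", OF cc c(2) cont is_chartD(1)[OF dd] fx cd 2] x by blast
  from diff_in_charts_compose[where f="\<lambda>x. x", OF cc' _ cont_at_id[OF xt] is_chartD(1)[OF cc] c(2) 1 this]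
  show "diff_in_charts c' d' f x" using x by blast
qed

lemma hol_at_id: "complex_manifold M ==> x \<in> pts M ==> hol_at M M (\<lambda>x. x) x"
  unfolding hol_at_def
  by (auto simp: cont_at_id intro!: maximal_atlas_compatible Atlas_subset_maximal)

lemma hol_at_const: "x \<in> pts M ==> y \<in> pts N ==> hol_at M N (\<lambda>_. y) x"
  unfolding hol_at_def cont_at_def diff_in_charts_def by (auto intro: cdiff_const)

section \<open>Products\<close>

lemma openin_prod_topology_box:
  assumes "openin (prod_topology X Y) S" "(x, y) \<in> S"
  obtains U V where "openin X U" "openin Y V" "x \<in> U" "y \<in> V" "U \<times> V \<subseteq> S"
  using iffD1[OF openin_prod_topology_alt assms(1), rule_format, OF assms(2)]
  by (elim exE conjE) (rule that)

lemma chart_prod_simps [simp]: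
  "cdim (chart_prod c d) = cdim c + cdim d"
  "cdom (chart_prod c d) = cdom c \<times> cdom d"
  "cmap (chart_prod c d) (x, y) = (\<lambda>i. if i < cdim c then cmap c x i else cmap d y (i - cdim c))"
  by (simp_all add: chart_prod_def)

lemma sum_lessThan_add: "(\<Sum>i<n + m. f i) = (\<Sum>i<n. f i) + (\<Sum>i<m. f (n + i :: nat))" for f :: "nat => 'b::comm_monoid_add"
  by (induction m) (simp_all add: add.assoc)

lemma cdist_concat:
  "cdist (n + m) (\<lambda>i. if i < n then a i else b (i - n)) w = cdist n a w + cdist m b (\<lambda>i. w (n + i))"
  unfolding cdist_def cnorm_def sum_lessThan_add by simp

lemma is_chart_prod:
  assumes c: "is_chart T c" and d: "is_chart T' d"
  shows "is_chart (prod_topology T T') (chart_prod c d)"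
proof (rule is_chartI)
  let ?n = "cdim c" and ?m = "cdim d" and ?e = "chart_prod c d"
  show "openin (prod_topology T T') (cdom ?e)"
    using is_chartD(1)[OF c] is_chartD(1)[OF d] by (simp add: openin_prod_Times_iff)
  have sub: "cmap c x \<in> Ec ?n" "cmap d y \<in> Ec ?m" if "x \<in> cdom c" "y \<in> cdom d" for x y
    using is_chartD(4)[OF c] is_chartD(4)[OF d] that by auto
  show "cmap ?e ` cdom ?e \<subseteq> Ec (cdim ?e)"
    using sub by (force simp: Ec_def)
  have dst: "cdist (?n + ?m) (cmap ?e (x, y)) (cmap ?e (x', y')) = cdist ?n (cmap c x) (cmap c x') + cdist ?m (cmap d y) (cmap d y')" for x y x' y'
    unfolding chart_prod_simps cdist_concat by (simp add: cdist_def cnorm_def)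
  show "inj_on (cmap ?e) (cdom ?e)"
  proof (rule inj_onI, clarsimp)
    fix x y x' y' assume D: "x \<in> cdom c" "y \<in> cdom d" "x' \<in> cdom c" "y' \<in> cdom d"
      and eq: "(\<lambda>i. if i < ?n then cmap c x i else cmap d y (i - ?n)) = (\<lambda>i. if i < ?n then cmap c x' i else cmap d y' (i - ?n))"
    have "cmap c x i = cmap c x' i" for i
      using fun_cong[OF eq, of i] sub[OF D(1,2)] sub[OF D(3,4)] by (cases "i < ?n") (auto simp: Ec_def)
    moreover have "cmap d y i = cmap d y' i" for i
      using fun_cong[OF eq, of "?n + i"] by simp
    ultimately show "x = x' \<and> y = y'"
      using inj_onD[OF is_chartD(3)[OF c] _ D(1,3)] inj_onD[OF is_chartD(3)[OF d] _ D(2,4)]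
      by (simp add: fun_eq_iff)
  qed
  fix q W assume q: "q \<in> cdom ?e" and W: "openin (prod_topology T T') W" "q \<in> W"
  obtain x y where xy: "q = (x, y)" "x \<in> cdom c" "y \<in> cdom d" using q by auto
  obtain U V where UV: "openin T U" "openin T' V" "x \<in> U" "y \<in> V" "U \<times> V \<subseteq> W"
    by (rule openin_prod_topology_box[OF W(1) W(2)[unfolded xy(1)]])
  obtain \<delta>1 where d1: "\<delta>1 > 0" "\<forall>z\<in>cdom c. cdist ?n (cmap c z) (cmap c x) < \<delta>1 --> z \<in> U"
      "{z \<in> Ec ?n. cdist ?n z (cmap c x) < \<delta>1} \<subseteq> cmap c ` (U \<inter> cdom c)"
    by (rule chart_nbhd[OF c xy(2) UV(1,3)])
  obtain \<delta>2 where d2: "\<delta>2 > 0" "\<forall>z\<in>cdom d. cdist ?m (cmap d z) (cmap d y) < \<delta>2 --> z \<in> V"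
      "{z \<in> Ec ?m. cdist ?m z (cmap d y) < \<delta>2} \<subseteq> cmap d ` (V \<inter> cdom d)"
    by (rule chart_nbhd[OF d xy(3) UV(2,4)])
  have "z \<in> cmap ?e ` (W \<inter> cdom ?e)"
    if z: "z \<in> Ec (?n + ?m)" "cdist (?n + ?m) z (cmap ?e q) < min \<delta>1 \<delta>2" for z
  proof -
    define z1 where "z1 i = (if i < ?n then z i else 0)" for i
    define z2 where "z2 i = z (?n + i)" for i
    have z_eq: "z = (\<lambda>i. if i < ?n then z1 i else z2 (i - ?n))"
      by (auto simp: z1_def z2_def)
    have E: "z1 \<in> Ec ?n" "z2 \<in> Ec ?m" using z by (auto simp: z1_def z2_def Ec_def)
    have "cdist ?n z1 (cmap c x) + cdist ?m z2 (cmap d y) < min \<delta>1 \<delta>2"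
    proof -
      have "cdist (?n + ?m) z (cmap ?e q) = cdist ?n z1 (cmap c x) + cdist ?m z2 (cmap d y)"
        unfolding z_eq cdist_concat xy(1) chart_prod_simps by (simp add: cdist_def cnorm_def)
      then show ?thesis using z by simp
    qed
    then have "cdist ?n z1 (cmap c x) < \<delta>1" "cdist ?m z2 (cmap d y) < \<delta>2"
      using cdist_nonneg[of ?n z1 "cmap c x"] cdist_nonneg[of ?m z2 "cmap d y"] by linarith+
    then have "z1 \<in> cmap c ` (U \<inter> cdom c)" "z2 \<in> cmap d ` (V \<inter> cdom d)" using d1 d2 E by blast+
    then obtain x' y' where x': "x' \<in> U \<inter> cdom c" "z1 = cmap c x'" and y': "y' \<in> V \<inter> cdom d" "z2 = cmap d y'"
      by blast
    have "z = cmap ?e (x', y')" by (subst z_eq) (simp only: chart_prod_simps x'(2) y'(2))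
    moreover have "(x', y') \<in> W \<inter> cdom ?e" using x' y' UV(5) by auto
    ultimately show ?thesis by blast
  qed
  then show "\<exists>\<delta>>0. {z \<in> Ec (cdim ?e). cdist (cdim ?e) z (cmap ?e q) < \<delta>} \<subseteq> cmap ?e ` (W \<inter> cdom ?e)"
    using d1(1) d2(1) by (intro exI[of _ "min \<delta>1 \<delta>2"]) auto
next
  let ?n = "cdim c" and ?m = "cdim d" and ?e = "chart_prod c d"
  fix q and \<delta> :: real assume q: "q \<in> cdom ?e" and "\<delta> > 0"
  obtain x y where xy: "q = (x, y)" "x \<in> cdom c" "y \<in> cdom d" using q by auto
  let ?U = "{z \<in> cdom c. cdist ?n (cmap c z) (cmap c x) < \<delta> / 2}"
  let ?V = "{z \<in> cdom d. cdist ?m (cmap d z) (cmap d y) < \<delta> / 2}"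
  have dst: "cdist (?n + ?m) (cmap ?e (x, y)) (cmap ?e (x', y')) = cdist ?n (cmap c x) (cmap c x') + cdist ?m (cmap d y) (cmap d y')" for x y x' y'
    unfolding chart_prod_simps cdist_concat by (simp add: cdist_def cnorm_def)
  have "openin (prod_topology T T') (?U \<times> ?V)"
    unfolding openin_prod_Times_iff using chart_ball_open[OF c] chart_ball_open[OF d] by blast
  moreover have "q \<in> ?U \<times> ?V" using xy \<open>\<delta> > 0\<close> by simp
  moreover have "cdist (cdim ?e) (cmap ?e r) (cmap ?e q) < \<delta>" if "r \<in> ?U \<times> ?V" for r
  proof -
    obtain x' y' where r: "r = (x', y')" by force
    show ?thesis using that unfolding r xy(1) chart_prod_simps(1) dst by auto
  qed
  ultimately show "\<exists>W. openin (prod_topology T T') W \<and> q \<in> W \<and> (\<forall>r\<in>W \<inter> cdom ?e. cdist (cdim ?e) (cmap ?e r) (cmap ?e q) < \<delta>)"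
    by blast
qed

lemma cdiff_fst:
  assumes u: "cdiff (cdim c) (cmap c) W u x" and "V \<subseteq> {q. fst q \<in> W}"
  shows "cdiff (cdim (chart_prod c d)) (cmap (chart_prod c d)) V (\<lambda>q. u (fst q)) (x, y)"
proof (rule cdiff_compose[where m="cdim c" and l="cmap c" and V=W and f=fst and u=u])
  fix j assume j: "j < cdim c"
  then have "cmap c (fst q) j = cmap (chart_prod c d) q j" for q by (cases q) simp
  then show "cdiff (cdim (chart_prod c d)) (cmap (chart_prod c d)) V (\<lambda>q. cmap c (fst q) j) (x, y)"
    using cdiff_coord[of j "cdim (chart_prod c d)" "cmap (chart_prod c d)"] j by simp
qed (use assms in auto)

lemma cdiff_snd:
  assumes u: "cdiff (cdim d) (cmap d) W u y" and "V \<subseteq> {q. snd q \<in> W}"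
  shows "cdiff (cdim (chart_prod c d)) (cmap (chart_prod c d)) V (\<lambda>q. u (snd q)) (x, y)"
proof (rule cdiff_compose[where m="cdim d" and l="cmap d" and V=W and f=snd and u=u])
  fix j assume j: "j < cdim d"
  then have "cmap d (snd q) j = cmap (chart_prod c d) q (cdim c + j)" for q by (cases q) simp
  then show "cdiff (cdim (chart_prod c d)) (cmap (chart_prod c d)) V (\<lambda>q. cmap d (snd q) j) (x, y)"
    using cdiff_coord[of "cdim c + j" "cdim (chart_prod c d)" "cmap (chart_prod c d)"] j by simp
qed (use assms in auto)

lemma manifold_prod_simps [simp]:
  "Top (M \<times>\<^sub>M N) = prod_topology (Top M) (Top N)"
  "Atlas (M \<times>\<^sub>M N) = {chart_prod c d | c d. c \<in> Atlas M \<and> d \<in> Atlas N}"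
  by (simp_all add: manifold_prod_def)

lemma cont_at_pair:
  assumes "cont_at T T1 f x" "cont_at T T2 g x"
  shows "cont_at T (prod_topology T1 T2) (\<lambda>y. (f y, g y)) x"
  unfolding cont_at_def
proof (intro conjI allI impI)
  show "x \<in> topspace T" "(f x, g x) \<in> topspace (prod_topology T1 T2)"
    using assms by (auto simp: cont_at_def)
  fix V assume "openin (prod_topology T1 T2) V \<and> (f x, g x) \<in> V"
  then have V0: "openin (prod_topology T1 T2) V" "(f x, g x) \<in> V" by auto
  obtain V1 V2 where V: "openin T1 V1" "openin T2 V2" "f x \<in> V1" "g x \<in> V2" "V1 \<times> V2 \<subseteq> V"
    by (rule openin_prod_topology_box[OF V0])
  obtain W1 where W1: "openin T W1" "x \<in> W1" "f ` W1 \<subseteq> V1" by (rule cont_atD[OF assms(1) V(1,3)])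
  obtain W2 where W2: "openin T W2" "x \<in> W2" "g ` W2 \<subseteq> V2" by (rule cont_atD[OF assms(2) V(2,4)])
  have "openin T (W1 \<inter> W2)" using W1 W2 by blast
  moreover have "(\<lambda>y. (f y, g y)) ` (W1 \<inter> W2) \<subseteq> V" using W1 W2 V(5) by auto
  ultimately show "\<exists>W. openin T W \<and> x \<in> W \<and> (\<lambda>y. (f y, g y)) ` W \<subseteq> V" using W1 W2 by blast
qed

lemma hol_at_pair:
  assumes f: "hol_at M N1 f x" and g: "hol_at M N2 g x"
  shows "hol_at M (N1 \<times>\<^sub>M N2) (\<lambda>y. (f y, g y)) x"
  unfolding hol_at_def
proof (intro conjI ballI impI)
  show "cont_at (Top M) (Top (N1 \<times>\<^sub>M N2)) (\<lambda>y. (f y, g y)) x"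
    using f g by (simp add: hol_at_def cont_at_pair)
  fix c e assume c: "c \<in> Atlas M" and e: "e \<in> Atlas (N1 \<times>\<^sub>M N2)" and x: "x \<in> cdom c \<and> (f x, g x) \<in> cdom e"
  obtain d1 d2 where d: "d1 \<in> Atlas N1" "d2 \<in> Atlas N2" "e = chart_prod d1 d2" using e by auto
  have 1: "diff_in_charts c d1 f x" "diff_in_charts c d2 g x"
    using hol_atD[OF f c d(1)] hol_atD[OF g c d(2)] x d(3) by auto
  let ?W = "{y \<in> cdom c. (f y, g y) \<in> cdom e}"
  have "cdiff (cdim c) (cmap c) ?W (\<lambda>y. cmap e (f y, g y) j) x" if j: "j < cdim e" for j
  proof (cases "j < cdim d1")
    case True
    then have "cdiff (cdim c) (cmap c) {y \<in> cdom c. f y \<in> cdom d1} (\<lambda>y. cmap d1 (f y) j) x"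
      using diff_in_chartsD[OF 1(1)] by blast
    then have "cdiff (cdim c) (cmap c) ?W (\<lambda>y. cmap d1 (f y) j) x"
      by (rule cdiff_subset) (auto simp: d)
    then show ?thesis using True by (simp add: d)
  next
    case False
    then have "j - cdim d1 < cdim d2" using j d by auto
    then have "cdiff (cdim c) (cmap c) {y \<in> cdom c. g y \<in> cdom d2} (\<lambda>y. cmap d2 (g y) (j - cdim d1)) x"
      using diff_in_chartsD[OF 1(2)] by blast
    then have "cdiff (cdim c) (cmap c) ?W (\<lambda>y. cmap d2 (g y) (j - cdim d1)) x"
      by (rule cdiff_subset) (auto simp: d)
    then show ?thesis using False by (simp add: d)
  qed
  then show "diff_in_charts c e (\<lambda>y. (f y, g y)) x" unfolding diff_in_charts_def by blast
qed

lemma diff_in_charts_fst: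
  assumes "diff_in_charts c e (\<lambda>x. x) x"
  shows "diff_in_charts (chart_prod c d) e fst (x, y)"
  unfolding diff_in_charts_def
proof (intro allI impI)
  fix j assume "j < cdim e"
  then have "cdiff (cdim c) (cmap c) {y \<in> cdom c. y \<in> cdom e} (\<lambda>y. cmap e y j) x"
    using diff_in_chartsD[OF assms] by simp
  then show "cdiff (cdim (chart_prod c d)) (cmap (chart_prod c d)) {q \<in> cdom (chart_prod c d). fst q \<in> cdom e}
      (\<lambda>q. cmap e (fst q) j) (x, y)"
    by (rule cdiff_fst) auto
qed

lemma diff_in_charts_snd:
  assumes "diff_in_charts d e (\<lambda>x. x) y"
  shows "diff_in_charts (chart_prod c d) e snd (x, y)"
  unfolding diff_in_charts_def
proof (intro allI impI)
  fix j assume "j < cdim e"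
  then have "cdiff (cdim d) (cmap d) {y \<in> cdom d. y \<in> cdom e} (\<lambda>y. cmap e y j) y"
    using diff_in_chartsD[OF assms] by simp
  then show "cdiff (cdim (chart_prod c d)) (cmap (chart_prod c d)) {q \<in> cdom (chart_prod c d). snd q \<in> cdom e}
      (\<lambda>q. cmap e (snd q) j) (x, y)"
    by (rule cdiff_snd) auto
qed

lemma cont_at_fst_snd:
  assumes "q \<in> topspace (prod_topology T T')"
  shows "cont_at (prod_topology T T') T fst q" "cont_at (prod_topology T T') T' snd q"
  using assms continuous_map_fst[of T T'] continuous_map_snd[of T T']
  unfolding continuous_map_iff_cont_at by blast+

lemma hol_at_fst:
  assumes "complex_manifold M" "q \<in> pts (M \<times>\<^sub>M N)"
  shows "hol_at (M \<times>\<^sub>M N) M fst q"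
  unfolding hol_at_def
proof (intro conjI ballI impI)
  show "cont_at (Top (M \<times>\<^sub>M N)) (Top M) fst q" using assms cont_at_fst_snd by simp
  fix c e assume "c \<in> Atlas (M \<times>\<^sub>M N)" "e \<in> Atlas M" and q: "q \<in> cdom c \<and> fst q \<in> cdom e"
  then obtain c1 c2 where c: "c1 \<in> Atlas M" "c = chart_prod c1 c2" by auto
  then have "diff_in_charts c1 e (\<lambda>x. x) (fst q)"
    using assms(1) \<open>e \<in> Atlas M\<close> q by (auto intro!: maximal_atlas_compatible Atlas_subset_maximal)
  then show "diff_in_charts c e fst q" using diff_in_charts_fst[of c1 e "fst q" c2 "snd q"] c by simp
qed

lemma hol_at_snd:
  assumes "complex_manifold N" "q \<in> pts (M \<times>\<^sub>M N)"
  shows "hol_at (M \<times>\<^sub>M N) N snd q"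
  unfolding hol_at_def
proof (intro conjI ballI impI)
  show "cont_at (Top (M \<times>\<^sub>M N)) (Top N) snd q" using assms cont_at_fst_snd by simp
  fix c e assume "c \<in> Atlas (M \<times>\<^sub>M N)" "e \<in> Atlas N" and q: "q \<in> cdom c \<and> snd q \<in> cdom e"
  then obtain c1 c2 where c: "c2 \<in> Atlas N" "c = chart_prod c1 c2" by auto
  then have "diff_in_charts c2 e (\<lambda>x. x) (snd q)"
    using assms(1) \<open>e \<in> Atlas N\<close> q by (auto intro!: maximal_atlas_compatible Atlas_subset_maximal)
  then show "diff_in_charts c e snd q" using diff_in_charts_snd[of c2 e "snd q" c1 "fst q"] c by simp
qed

lemma second_countable_prod_topology:
  assumes "second_countable X" "second_countable Y"
  shows "second_countable (prod_topology X Y)"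
proof -
  obtain A where A: "countable A" "\<forall>V\<in>A. openin X V" "\<forall>U x. openin X U \<and> x \<in> U --> (\<exists>V\<in>A. x \<in> V \<and> V \<subseteq> U)"
    using assms(1) unfolding second_countable_def by blast
  obtain B where B: "countable B" "\<forall>V\<in>B. openin Y V" "\<forall>U x. openin Y U \<and> x \<in> U --> (\<exists>V\<in>B. x \<in> V \<and> V \<subseteq> U)"
    using assms(2) unfolding second_countable_def by blast
  let ?C = "(\<lambda>(U, V). U \<times> V) ` (A \<times> B)"
  have "countable ?C" using A B by blast
  moreover have "\<forall>V\<in>?C. openin (prod_topology X Y) V"
    using A B by (auto simp: openin_prod_Times_iff)
  moreover have "\<forall>U q. openin (prod_topology X Y) U \<and> q \<in> U --> (\<exists>V\<in>?C. q \<in> V \<and> V \<subseteq> U)"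
  proof (intro allI impI)
    fix U q assume U0: "openin (prod_topology X Y) U \<and> q \<in> U"
    then have U: "openin (prod_topology X Y) U" "q \<in> U" by auto
    obtain x y where q: "q = (x, y)" by force
    obtain U1 U2 where U12: "openin X U1" "openin Y U2" "x \<in> U1" "y \<in> U2" "U1 \<times> U2 \<subseteq> U"
      by (rule openin_prod_topology_box[OF U(1) U(2)[unfolded q]])
    obtain V1 where V1: "V1 \<in> A" "x \<in> V1" "V1 \<subseteq> U1" using A(3)[rule_format, of U1 x] U12(1,3) by blast
    obtain V2 where V2: "V2 \<in> B" "y \<in> V2" "V2 \<subseteq> U2" using B(3)[rule_format, of U2 y] U12(2,4) by blast
    have "V1 \<times> V2 \<in> ?C" using V1 V2 by blast
    moreover have "q \<in> V1 \<times> V2" "V1 \<times> V2 \<subseteq> U" using V1 V2 U12 q by auto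
    ultimately show "\<exists>V\<in>?C. q \<in> V \<and> V \<subseteq> U" by blast
  qed
  ultimately show ?thesis unfolding second_countable_def by (intro exI[of _ ?C] conjI)
qed

text \<open>Charts at one point suffice to see that an atlas is compatible.\<close>

lemma complex_manifoldI:
  assumes "Hausdorff_space (Top M)" "second_countable (Top M)" "charted M"
    and "pts M \<subseteq> (\<Union>c\<in>Atlas M. cdom c)"
    and "\<And>c d x. c \<in> Atlas M ==> d \<in> Atlas M ==> x \<in> cdom c ==> x \<in> cdom d ==> diff_in_charts c d (\<lambda>x. x) x"
  shows "complex_manifold M"
proof -
  have h: "holomorphic_in_charts c d id" if cd: "c \<in> Atlas M" "d \<in> Atlas M" for c d
  proof -
    have "is_chart (Top M) c" using assms(3) cd by (simp add: charted_def)
    from holomorphic_in_charts_iff[OF is_chartD(3)[OF this], of d id] show ?thesis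
      using assms(5) cd by (simp add: id_def)
  qed
  have "(\<Union>c\<in>Atlas M. cdom c) \<subseteq> pts M"
  proof (rule UN_least)
    fix c assume "c \<in> Atlas M"
    then have "is_chart (Top M) c" using assms(3) by (simp add: charted_def)
    then show "cdom c \<subseteq> pts M" using openin_subset[OF is_chartD(1)] by blast
  qed
  then have "(\<Union>c\<in>Atlas M. cdom c) = pts M" using assms(4) by (rule subset_antisym)
  then show ?thesis
    unfolding complex_manifold_def using assms(1,2,3) h by (simp add: charted_def)
qed

lemma manifold_prod:
  assumes M: "complex_manifold M" and N: "complex_manifold N"
  shows "complex_manifold (M \<times>\<^sub>M N)"
proof (rule complex_manifoldI)
  show "Hausdorff_space (Top (M \<times>\<^sub>M N))"
    using M N by (simp add: complex_manifold_def Hausdorff_space_prod_topology)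
  show "second_countable (Top (M \<times>\<^sub>M N))"
    using M N by (simp add: complex_manifold_def second_countable_prod_topology)
  show "charted (M \<times>\<^sub>M N)"
    using manifold_chart_open(1)[OF M] manifold_chart_open(1)[OF N]
    by (auto simp: charted_def is_chart_prod)
  show "pts (M \<times>\<^sub>M N) \<subseteq> (\<Union>c\<in>Atlas (M \<times>\<^sub>M N). cdom c)"
  proof
    fix q assume "q \<in> pts (M \<times>\<^sub>M N)"
    then obtain x y where q: "q = (x, y)" "x \<in> pts M" "y \<in> pts N" by auto
    obtain c where c: "c \<in> Atlas M" "x \<in> cdom c" by (rule manifold_chart_at[OF M q(2)])
    obtain d where d: "d \<in> Atlas N" "y \<in> cdom d" by (rule manifold_chart_at[OF N q(3)])
    have "chart_prod c d \<in> Atlas (M \<times>\<^sub>M N)" "q \<in> cdom (chart_prod c d)" using c d q by auto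
    then show "q \<in> (\<Union>c\<in>Atlas (M \<times>\<^sub>M N). cdom c)" by blast
  qed
  fix c e q assume c: "c \<in> Atlas (M \<times>\<^sub>M N)" and e: "e \<in> Atlas (M \<times>\<^sub>M N)" and q: "q \<in> cdom c" "q \<in> cdom e"
  have "q \<in> pts (M \<times>\<^sub>M N)"
  proof -
    obtain c1 c2 where cc: "c1 \<in> Atlas M" "c2 \<in> Atlas N" "c = chart_prod c1 c2" using c by auto
    show ?thesis
      using q chart_subset_topspace[OF manifold_chart_open(1)[OF M cc(1)], of "fst q"]
        chart_subset_topspace[OF manifold_chart_open(1)[OF N cc(2)], of "snd q"]
      unfolding cc(3) by (cases q) simp
  qed
  then have "hol_at (M \<times>\<^sub>M N) (M \<times>\<^sub>M N) (\<lambda>q. (fst q, snd q)) q"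
    using hol_at_fst[OF M, of q N] hol_at_snd[OF N, of q M] by (intro hol_at_pair) auto
  then show "diff_in_charts c e (\<lambda>x. x) q"
    using c e q unfolding hol_at_def by simp
qed

section \<open>Submanifolds\<close>

lemma submanifold_simps [simp]:
  "Top (submanifold M A) = subtopology (Top M) A"
  "Atlas (submanifold M A) = {\<lparr>cdim = k, cdom = cdom c \<inter> A, cmap = cmap c\<rparr> | c k.
     c \<in> maximal_atlas M \<and> k \<le> cdim c \<and> cmap c ` (cdom c \<inter> A) = cmap c ` cdom c \<inter> Ec k}"
  by (simp_all add: submanifold_def topspace_cspace)

lemma submanifold_cong:
  assumes "pts M \<inter> A = pts M \<inter> B"
  shows "submanifold M A = submanifold M B"
proof -
  have "cdom c \<inter> A = cdom c \<inter> B" if "c \<in> maximal_atlas M" for c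
    using chart_subset_topspace[OF maximal_atlasD(1)[OF that]] assms by blast
  moreover have "subtopology (Top M) A = subtopology (Top M) B"
    using assms by (metis subtopology_restrict)
  ultimately show ?thesis unfolding submanifold_def by (auto cong: conj_cong)
qed

lemma cdist_slice:
  assumes "k \<le> n" "z \<in> Ec k" "w \<in> Ec k"
  shows "cdist n z w = cdist k z w"
proof -
  have "n = k + (n - k)" using assms by simp
  then have "cdist n z w = (\<Sum>i<k. cmod (z i - w i)) + (\<Sum>i<n - k. cmod (z (k + i) - w (k + i)))"
    unfolding cdist_def cnorm_def using sum_lessThan_add[of "\<lambda>i. cmod (z i - w i)" k "n - k"] by simp
  moreover have "(\<Sum>i<n - k. cmod (z (k + i) - w (k + i))) = 0"
    using assms by (intro sum.neutral) (auto simp: Ec_def)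
  ultimately show ?thesis by (simp add: cdist_def cnorm_def)
qed

lemma cdiff_slice:
  assumes "cdiff n \<kappa> W u a" "k \<le> n" "\<And>y. y \<in> W ==> \<kappa> y \<in> Ec k" "\<kappa> a \<in> Ec k"
  shows "cdiff k \<kappa> W u a"
proof -
  obtain A where A: "has_row n \<kappa> W u a A" using assms(1) unfolding cdiff_def by blast
  have n: "n = k + (n - k)" using assms by simp
  have S: "(\<Sum>i<n. A i * (\<kappa> y i - \<kappa> a i)) = (\<Sum>i<k. A i * (\<kappa> y i - \<kappa> a i))" if "y \<in> W" for y
  proof -
    have "(\<Sum>i<n. A i * (\<kappa> y i - \<kappa> a i)) = (\<Sum>i<k. A i * (\<kappa> y i - \<kappa> a i)) +
        (\<Sum>i<n - k. A (k + i) * (\<kappa> y (k + i) - \<kappa> a (k + i)))"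
      using sum_lessThan_add[of "\<lambda>i. A i * (\<kappa> y i - \<kappa> a i)" k "n - k"] n by simp
    moreover have "(\<Sum>i<n - k. A (k + i) * (\<kappa> y (k + i) - \<kappa> a (k + i))) = 0"
      using assms(3)[OF that] assms(4) by (intro sum.neutral) (auto simp: Ec_def)
    ultimately show ?thesis by simp
  qed
  have "has_row k \<kappa> W u a A"
    using A S cdist_slice[OF assms(2) assms(3) assms(4)]
    unfolding has_row_def negligible_at_def by simp
  then show ?thesis unfolding cdiff_def by blast
qed

lemma is_chart_slice:
  assumes c: "is_chart T c" and k: "k \<le> cdim c" "cmap c ` (cdom c \<inter> A) = cmap c ` cdom c \<inter> Ec k"
  shows "is_chart (subtopology T A) \<lparr>cdim = k, cdom = cdom c \<inter> A, cmap = cmap c\<rparr>" (is "is_chart _ ?c")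
proof (rule is_chartI)
  let ?n = "cdim c"
  have E: "cmap c x \<in> Ec k" if "x \<in> cdom c \<inter> A" for x using k that by blast
  show "openin (subtopology T A) (cdom ?c)" using is_chartD(1)[OF c] by (simp add: openin_subtopology_Int)
  show "inj_on (cmap ?c) (cdom ?c)" using is_chartD(3)[OF c] by (simp add: inj_on_def)
  show "cmap ?c ` cdom ?c \<subseteq> Ec (cdim ?c)" using E by auto
  {
  fix x W assume x: "x \<in> cdom ?c" and W: "openin (subtopology T A) W" "x \<in> W"
  obtain W0 where W0: "openin T W0" "W = W0 \<inter> A" using W unfolding openin_subtopology by blast
  have xc: "x \<in> cdom c" "x \<in> W0" using x W W0 by auto
  obtain \<delta> where \<delta>: "\<delta> > 0" "\<forall>y\<in>cdom c. cdist ?n (cmap c y) (cmap c x) < \<delta> --> y \<in> W0"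
    "{z \<in> Ec ?n. cdist ?n z (cmap c x) < \<delta>} \<subseteq> cmap c ` (W0 \<inter> cdom c)"
    by (rule chart_nbhd[OF c xc(1) W0(1) xc(2)])
  have "z \<in> cmap c ` (W \<inter> (cdom c \<inter> A))" if z: "z \<in> Ec k" "cdist k z (cmap c x) < \<delta>" for z
  proof -
    have "cdist ?n z (cmap c x) = cdist k z (cmap c x)" using x E z k by (intro cdist_slice) auto
    then have "z \<in> cmap c ` (W0 \<inter> cdom c)" using \<delta>(3) z Ec_mono[OF k(1)] by auto
    then obtain y where y: "z = cmap c y" "y \<in> W0" "y \<in> cdom c" by blast
    then have "z \<in> cmap c ` (cdom c \<inter> A)" using k(2) z by blast
    then obtain y' where y': "z = cmap c y'" "y' \<in> cdom c" "y' \<in> A" by blast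
    have "y = y'" using inj_onD[OF is_chartD(3)[OF c] _ y(3) y'(2)] y y' by simp
    then show ?thesis using y y' W0 by blast
  qed
  then show "\<exists>\<delta>>0. {z \<in> Ec (cdim ?c). cdist (cdim ?c) z (cmap ?c x) < \<delta>} \<subseteq> cmap ?c ` (W \<inter> cdom ?c)"
    using \<delta>(1) by (intro exI[of _ \<delta>]) auto
  }
  fix x and \<delta> :: real assume x: "x \<in> cdom ?c" and "\<delta> > 0"
  have E: "cmap c y \<in> Ec k" if "y \<in> cdom c \<inter> A" for y using k that by blast
  let ?W = "{y \<in> cdom c. cdist ?n (cmap c y) (cmap c x) < \<delta>}"
  have "openin (subtopology T A) (?W \<inter> A)"
    by (rule openin_subtopology_Int[OF chart_ball_open[OF c]])
  moreover have "x \<in> ?W \<inter> A" using x \<open>\<delta> > 0\<close> by simp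
  moreover have "cdist k (cmap c y) (cmap c x) < \<delta>" if "y \<in> ?W \<inter> A" for y
    using that cdist_slice[OF k(1) E E, of y x] x by auto
  ultimately show "\<exists>W. openin (subtopology T A) W \<and> x \<in> W \<and>
      (\<forall>y\<in>W \<inter> cdom ?c. cdist (cdim ?c) (cmap ?c y) (cmap ?c x) < \<delta>)"
    by (intro exI[of _ "?W \<inter> A"]) auto
qed

lemma charted_submanifold: "charted (submanifold M A)"
  unfolding charted_def by (auto simp: maximal_atlasD(1) is_chart_slice)

lemma diff_in_charts_slice:
  assumes "diff_in_charts c d (\<lambda>x. x) x" "x \<in> cdom c \<inter> A"
    and k: "k \<le> cdim c" "cmap c ` (cdom c \<inter> A) = cmap c ` cdom c \<inter> Ec k" and l: "l \<le> cdim d"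
  shows "diff_in_charts \<lparr>cdim = k, cdom = cdom c \<inter> A, cmap = cmap c\<rparr>
     \<lparr>cdim = l, cdom = cdom d \<inter> B, cmap = cmap d\<rparr> (\<lambda>x. x) x"
  (is "diff_in_charts ?c ?d _ _")
  unfolding diff_in_charts_def
proof (intro allI impI)
  fix j assume "j < cdim ?d"
  then have "j < cdim d" using l by simp
  from diff_in_chartsD[OF assms(1) this]
  have 1: "cdiff (cdim c) (cmap c) {y \<in> cdom c \<inter> A. y \<in> cdom d \<inter> B} (\<lambda>y. cmap d y j) x"
    by (rule cdiff_subset) auto
  have E: "cmap c y \<in> Ec k" if "y \<in> cdom c \<inter> A" for y using k that by blast
  have "cdiff k (cmap c) {y \<in> cdom c \<inter> A. y \<in> cdom d \<inter> B} (\<lambda>y. cmap d y j) x"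
    by (rule cdiff_slice[OF 1 k(1)]) (use E assms(2) in auto)
  then show "cdiff (cdim ?c) (cmap ?c) {y \<in> cdom ?c. y \<in> cdom ?d} (\<lambda>y. cmap ?d y j) x" by simp
qed

lemma cont_at_subtopology:
  assumes "x \<in> topspace T \<inter> A" shows "cont_at (subtopology T A) T (\<lambda>x. x) x"
  using assms continuous_map_iff_cont_at[of "subtopology T A" T "\<lambda>x. x"]
  by (simp add: continuous_map_from_subtopology)

lemma hol_at_submanifold_inclusion:
  assumes M: "complex_manifold M" and x: "x \<in> pts M \<inter> A"
  shows "hol_at (submanifold M A) M (\<lambda>x. x) x"
  unfolding hol_at_def
proof (intro conjI ballI impI)
  show "cont_at (Top (submanifold M A)) (Top M) (\<lambda>x. x) x" using cont_at_subtopology[OF x] by simp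
  fix c' d assume "c' \<in> Atlas (submanifold M A)" and d: "d \<in> Atlas M" and x: "x \<in> cdom c' \<and> x \<in> cdom d"
  then obtain c k where c: "c \<in> maximal_atlas M" "k \<le> cdim c" "cmap c ` (cdom c \<inter> A) = cmap c ` cdom c \<inter> Ec k"
    "c' = \<lparr>cdim = k, cdom = cdom c \<inter> A, cmap = cmap c\<rparr>" by auto
  have "diff_in_charts c d (\<lambda>x. x) x" using x c maximal_atlasD(2)[OF c(1) d] by auto
  from diff_in_charts_slice[where A=A and l="cdim d" and B=UNIV, OF this _ c(2,3)] show "diff_in_charts c' d (\<lambda>x. x) x"
    using x c(4) by (cases d) simp
qed

text \<open>
  The charts of a submanifold are restrictions of charts of the ambient manifold, so a map has the
  same coordinates in both.
\<close>

lemma hol_at_into_submanifold: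
  assumes M: "charted M" and P: "complex_manifold P" and g: "hol_at M P g x"
    and W: "openin (Top M) W" "x \<in> W" "g ` W \<subseteq> A"
  shows "hol_at M (submanifold P A) g x"
  unfolding hol_at_def
proof (intro conjI ballI impI)
  have cg: "cont_at (Top M) (Top P) g x" using g by (rule hol_at_cont)
  show "cont_at (Top M) (Top (submanifold P A)) g x"
    unfolding cont_at_def
  proof (intro conjI allI impI)
    show "x \<in> pts M" "g x \<in> pts (submanifold P A)"
      using cg W by (auto simp: cont_at_def)
    fix V assume V: "openin (Top (submanifold P A)) V \<and> g x \<in> V"
    then obtain V0 where V0: "openin (Top P) V0" "V = V0 \<inter> A"
      unfolding submanifold_simps openin_subtopology by blast
    have gV0: "g x \<in> V0" using V V0 by blast
    obtain W' where "openin (Top M) W'" "x \<in> W'" "g ` W' \<subseteq> V0" by (rule cont_atD[OF cg V0(1) gV0])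
    then show "\<exists>W. openin (Top M) W \<and> x \<in> W \<and> g ` W \<subseteq> V"
      using W V0 by (intro exI[of _ "W \<inter> W'"]) auto
  qed
  fix c d' assume c: "c \<in> Atlas M" and "d' \<in> Atlas (submanifold P A)" and x: "x \<in> cdom c \<and> g x \<in> cdom d'"
  then obtain d k where d: "d \<in> maximal_atlas P" "k \<le> cdim d"
    "d' = \<lparr>cdim = k, cdom = cdom d \<inter> A, cmap = cmap d\<rparr>" by auto
  have dg: "diff_in_charts c d g x"
    using hol_at_target_chart[OF M P g c _ d(1)] x d by simp
  show "diff_in_charts c d' g x"
    unfolding diff_in_charts_def
  proof (intro allI impI)
    fix j assume "j < cdim d'"
    then have "j < cdim d" using d by simp
    from diff_in_chartsD[OF dg this]
    show "cdiff (cdim c) (cmap c) {y \<in> cdom c. g y \<in> cdom d'} (\<lambda>y. cmap d' (g y) j) x"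
      unfolding d(3) by (simp, rule cdiff_subset) auto
  qed
qed

lemma coords_transfer:
  assumes c: "inj_on \<kappa> D" and W: "W \<subseteq> D" "x \<in> W"
  shows "has_row n (\<lambda>z. z) (\<kappa> ` W) (\<lambda>z. u (inv_into D \<kappa> z)) (\<kappa> x) A \<longleftrightarrow> has_row n \<kappa> W u x A"
proof -
  have "inv_into D \<kappa> (\<kappa> y) = y" if "y \<in> W" for y using c W that by (auto simp: inv_into_f_f)
  then show ?thesis using W unfolding has_row_def negligible_at_def by auto
qed

text \<open>A biholomorphic change of coordinates turns a chart into another chart of the maximal atlas.\<close>

lemma chart_change_coordinates:
  assumes M: "complex_manifold M" and c: "c \<in> maximal_atlas M"
    and b: "bihol (cdim c) U V \<Phi> \<Psi>" and U: "U \<subseteq> cmap c ` cdom c"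
  shows "\<lparr>cdim = cdim c, cdom = {y \<in> cdom c. cmap c y \<in> U}, cmap = (\<lambda>y. \<Phi> (cmap c y))\<rparr> \<in> maximal_atlas M"
    (is "?c \<in> _")
proof -
  let ?n = "cdim c"
  have cc: "is_chart (Top M) c" using c by (rule maximal_atlasD)
  have oU: "openin (cspace ?n) U" and oV: "openin (cspace ?n) V" and im: "\<Phi> ` U \<subseteq> V" "\<Psi> ` V \<subseteq> U"
    and i1: "\<And>z. z \<in> U ==> \<Psi> (\<Phi> z) = z" and i2: "\<And>w. w \<in> V ==> \<Phi> (\<Psi> w) = w"
    using b unfolding bihol_def by auto
  have ts: "topspace (subtopology (cspace ?n) U) = U" "topspace (subtopology (cspace ?n) V) = V"
    using openin_subset[OF oU] openin_subset[OF oV] by auto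
  have pre\<Phi>: "openin (cspace ?n) {z \<in> U. \<Phi> z \<in> O'}" if "openin (cspace ?n) O'" for O'
    using openin_trans_full[OF openin_continuous_map_preimage[OF bihol_continuous(1)[OF b] that] oU]
    unfolding ts .
  have pre\<Psi>: "openin (cspace ?n) {z \<in> V. \<Psi> z \<in> O'}" if "openin (cspace ?n) O'" for O'
    using openin_trans_full[OF openin_continuous_map_preimage[OF bihol_continuous(2)[OF b] that] oV]
    unfolding ts .
  have V: "V \<subseteq> Ec ?n" using openin_subset[OF oV] by (simp add: topspace_cspace)
  have chart: "is_chart (Top M) ?c"
  proof (rule is_chartI)
    show "openin (Top M) (cdom ?c)" using is_chartD(5)[OF cc oU] by simp
    show "inj_on (cmap ?c) (cdom ?c)"
    proof (rule inj_onI, simp)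
      fix x y assume x: "x \<in> cdom c \<and> cmap c x \<in> U" and y: "y \<in> cdom c \<and> cmap c y \<in> U" "\<Phi> (cmap c x) = \<Phi> (cmap c y)"
      then have "cmap c x = cmap c y" using i1 by metis
      then show "x = y" using inj_onD[OF is_chartD(3)[OF cc]] x y by blast
    qed
    show "cmap ?c ` cdom ?c \<subseteq> Ec (cdim ?c)" using im V by auto
    fix x W assume x: "x \<in> cdom ?c" and W: "openin (Top M) W" "x \<in> W"
    let ?O = "{w \<in> V. \<Psi> w \<in> cmap c ` (W \<inter> cdom c)}"
    have "openin (cspace ?n) ?O" by (rule pre\<Psi>[OF is_chartD(6)[OF cc W(1)]])
    moreover have "\<Phi> (cmap c x) \<in> ?O" using x W im i1 by auto
    ultimately obtain \<delta> where \<delta>: "\<delta> > 0" "\<forall>z\<in>Ec ?n. cdist ?n z (\<Phi> (cmap c x)) < \<delta> --> z \<in> ?O"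
      unfolding openin_cspace by blast
    have "?O \<subseteq> (\<lambda>y. \<Phi> (cmap c y)) ` (W \<inter> {y \<in> cdom c. cmap c y \<in> U})"
    proof
      fix w assume "w \<in> ?O"
      then obtain y where y: "w \<in> V" "\<Psi> w = cmap c y" "y \<in> W" "y \<in> cdom c" by blast
      then have "w = \<Phi> (cmap c y)" "cmap c y \<in> U" using i2[OF y(1)] im(2) by auto
      then show "w \<in> (\<lambda>y. \<Phi> (cmap c y)) ` (W \<inter> {y \<in> cdom c. cmap c y \<in> U})" using y by blast
    qed
    then show "\<exists>\<delta>>0. {z \<in> Ec (cdim ?c). cdist (cdim ?c) z (cmap ?c x) < \<delta>} \<subseteq> cmap ?c ` (W \<inter> cdom ?c)"
      using \<delta> by (intro exI[of _ \<delta>]) auto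
  next
    fix x and \<delta> :: real assume x: "x \<in> cdom ?c" and "\<delta> > 0"
    let ?O = "{z \<in> U. \<Phi> z \<in> {w \<in> Ec ?n. cdist ?n w (\<Phi> (cmap c x)) < \<delta>}}"
    have "openin (Top M) {y \<in> cdom c. cmap c y \<in> ?O}"
      by (rule is_chartD(5)[OF cc pre\<Phi>[OF openin_cspace_cball]])
    moreover have "\<Phi> (cmap c x) \<in> Ec ?n" using x im V by auto
    ultimately show "\<exists>W. openin (Top M) W \<and> x \<in> W \<and>
        (\<forall>y\<in>W \<inter> cdom ?c. cdist (cdim ?c) (cmap ?c y) (cmap ?c x) < \<delta>)"
      using x \<open>\<delta> > 0\<close> by (intro exI[of _ "{y \<in> cdom c. cmap c y \<in> ?O}"]) auto
  qed
  have 1: "diff_in_charts ?c d (\<lambda>x. x) x" if d: "d \<in> Atlas M" and x: "x \<in> cdom ?c" "x \<in> cdom d" for d x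
    unfolding diff_in_charts_def
  proof (intro allI impI)
    fix j assume j: "j < cdim d"
    have "diff_in_charts c d (\<lambda>x. x) x" using maximal_atlasD(2)[OF c d] x by simp
    from diff_in_chartsD[OF this j]
    have u: "cdiff ?n (cmap c) {y \<in> cdom c. y \<in> cdom d} (\<lambda>y. cmap d y j) x" .
    have "cdiff ?n (\<lambda>y. \<Phi> (cmap c y)) {y \<in> cdom ?c. y \<in> cdom d} (\<lambda>y. cmap d y j) x"
    proof (rule cdiff_compose[where m="?n" and l="cmap c" and f="\<lambda>x. x" and u="\<lambda>y. cmap d y j"
          and V="{y \<in> cdom c. y \<in> cdom d}", OF u])
      fix i assume i: "i < ?n"
      have "cdiff ?n (\<lambda>y. \<Phi> (cmap c y)) {y \<in> cdom ?c. y \<in> cdom d} (\<lambda>y. \<Psi> (\<Phi> (cmap c y)) i) x"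
      proof (rule cdiff_compose[where m="?n" and l="\<lambda>z. z" and f="\<lambda>y. \<Phi> (cmap c y)" and u="\<lambda>w. \<Psi> w i" and V=V])
        show "cdiff ?n (\<lambda>z. z) V (\<lambda>w. \<Psi> w i) (\<Phi> (cmap c x))"
          using bihol_cdiff(2)[OF b _ i, of "\<Phi> (cmap c x)"] x im by auto
        show "cdiff ?n (\<lambda>y. \<Phi> (cmap c y)) {y \<in> cdom ?c. y \<in> cdom d} (\<lambda>y. \<Phi> (cmap c y) k) x" if "k < ?n" for k
          by (rule cdiff_coord[OF that])
      qed (use im in auto)
      then show "cdiff ?n (\<lambda>y. \<Phi> (cmap c y)) {y \<in> cdom ?c. y \<in> cdom d} (\<lambda>y. cmap c y i) x"
        by (rule cdiff_cong) (use x i1 in auto)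
    qed auto
    then show "cdiff (cdim ?c) (cmap ?c) {y \<in> cdom ?c. y \<in> cdom d} (\<lambda>y. cmap d y j) x" by simp
  qed
  have 2: "diff_in_charts d ?c (\<lambda>x. x) x" if d: "d \<in> Atlas M" and x: "x \<in> cdom ?c" "x \<in> cdom d" for d x
    unfolding diff_in_charts_def
  proof (intro allI impI)
    fix j assume "j < cdim ?c"
    then have j: "j < ?n" by simp
    have dc: "diff_in_charts d c (\<lambda>x. x) x" using maximal_atlasD(3)[OF c M d] x by simp
    have "cdiff (cdim d) (cmap d) {y \<in> cdom d. y \<in> cdom ?c} (\<lambda>y. \<Phi> (cmap c y) j) x"
    proof (rule cdiff_compose[where m="?n" and l="\<lambda>z. z" and f="cmap c" and u="\<lambda>w. \<Phi> w j" and V=U])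
      show "cdiff ?n (\<lambda>z. z) U (\<lambda>w. \<Phi> w j) (cmap c x)"
        using bihol_cdiff(1)[OF b _ j, of "cmap c x"] x by auto
      show "cdiff (cdim d) (cmap d) {y \<in> cdom d. y \<in> cdom ?c} (\<lambda>y. cmap c y k) x" if "k < ?n" for k
        using diff_in_chartsD[OF dc that] by (rule cdiff_subset) auto
    qed auto
    then show "cdiff (cdim d) (cmap d) {y \<in> cdom d. y \<in> cdom ?c} (\<lambda>y. cmap ?c y j) x" by simp
  qed
  have "holomorphic_in_charts ?c d id \<and> holomorphic_in_charts d ?c id" if d: "d \<in> Atlas M" for d
    unfolding holomorphic_in_charts_iff[OF is_chartD(3)[OF chart]]
      holomorphic_in_charts_iff[OF is_chartD(3)[OF manifold_chart_open(1)[OF M d]]]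
    using 1[OF d] 2[OF d] by (simp add: id_def)
  then show ?thesis unfolding maximal_atlas_def using chart by blast
qed

text \<open>Functions with independent differentials at a point are coordinates near it.\<close>

lemma chart_adapted_to_submersion:
  assumes M: "complex_manifold M" and c: "c \<in> maximal_atlas M" "x \<in> cdom c"
    and W: "openin (Top M) W" "x \<in> W"
    and diff: "\<And>y j. y \<in> W \<inter> cdom c ==> j < m ==> cdiff (cdim c) (cmap c) (W \<inter> cdom c) (\<lambda>y. F y j) y"
    and row: "\<And>j. j < m ==> has_row (cdim c) (cmap c) (W \<inter> cdom c) (\<lambda>y. F y j) x (A j)"
    and sur: "\<And>w. \<exists>v. \<forall>j<m. (\<Sum>i<cdim c. A j i * v i) = w j"
  obtains c' where "c' \<in> maximal_atlas M" "x \<in> cdom c'" "cdom c' \<subseteq> W" "m \<le> cdim c'"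
    "\<And>y j. y \<in> cdom c' ==> j < m ==> cmap c' y (cdim c' - 1 - j) = F y j"
proof -
  let ?n = "cdim c" and ?inv = "inv_into (cdom c) (cmap c)"
  have cc: "is_chart (Top M) c" by (rule maximal_atlasD(1)[OF c(1)])
  have inj: "inj_on (cmap c) (cdom c)" by (rule is_chartD(3)[OF cc])
  define U where "U = cmap c ` (W \<inter> cdom c)"
  have oU: "openin (cspace ?n) U" unfolding U_def by (rule is_chartD(6)[OF cc W(1)])
  have xU: "cmap c x \<in> U" using W c by (auto simp: U_def)
  have d: "cdiff ?n (\<lambda>z. z) U (\<lambda>z. F (?inv z) j) z" if z: "z \<in> U" "j < m" for z j
  proof -
    obtain y where y: "y \<in> W \<inter> cdom c" "z = cmap c y" using z by (auto simp: U_def)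
    obtain B where "has_row ?n (cmap c) (W \<inter> cdom c) (\<lambda>y. F y j) y B"
      using diff[OF y(1) z(2)] unfolding cdiff_def by blast
    then have "has_row ?n (\<lambda>z. z) U (\<lambda>z. F (?inv z) j) z B"
      using coords_transfer[OF inj, of "W \<inter> cdom c" y ?n "\<lambda>y. F y j" B] y by (simp add: U_def)
    then show ?thesis unfolding cdiff_def by blast
  qed
  have r: "has_row ?n (\<lambda>z. z) U (\<lambda>z. F (?inv z) j) (cmap c x) (A j)" if "j < m" for j
    using coords_transfer[OF inj, of "W \<inter> cdom c" x ?n "\<lambda>y. F y j" "A j"] row[OF that] W c by (simp add: U_def)
  have "m \<le> ?n \<and> (\<exists>U' V \<Phi> \<Psi>. bihol ?n U' V \<Phi> \<Psi> \<and> cmap c x \<in> U' \<and> U' \<subseteq> U \<and>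
      (\<forall>z\<in>U'. \<forall>j<m. \<Phi> z (?n - 1 - j) = F (?inv z) j))"
    by (rule submersion_normal_form_coords[where F="\<lambda>z. F (?inv z)" and A=A, OF oU xU],
        erule (1) d, erule r, rule sur)
  then obtain U' V \<Phi> \<Psi> where mn: "m \<le> ?n" and b: "bihol ?n U' V \<Phi> \<Psi>" and xU': "cmap c x \<in> U'" and U': "U' \<subseteq> U"
    and nf: "\<forall>z\<in>U'. \<forall>j<m. \<Phi> z (?n - 1 - j) = F (?inv z) j"
    by (elim conjE exE) (rule that)
  let ?c = "\<lparr>cdim = ?n, cdom = {y \<in> cdom c. cmap c y \<in> U'}, cmap = (\<lambda>y. \<Phi> (cmap c y))\<rparr>"
  have "U' \<subseteq> cmap c ` cdom c" using U' by (auto simp: U_def)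
  then have "?c \<in> maximal_atlas M" by (rule chart_change_coordinates[OF M c(1) b])
  moreover have "x \<in> cdom ?c" using c xU' by simp
  moreover have "cdom ?c \<subseteq> W"
  proof
    fix y assume "y \<in> cdom ?c"
    then have y: "y \<in> cdom c" "cmap c y \<in> U" using U' by auto
    then obtain y' where "y' \<in> W \<inter> cdom c" "cmap c y = cmap c y'" by (auto simp: U_def)
    then show "y \<in> W" using inj_onD[OF inj] y by blast
  qed
  moreover have "m \<le> cdim ?c" using mn by simp
  moreover have "cmap ?c y (cdim ?c - 1 - j) = F y j" if "y \<in> cdom ?c" "j < m" for y j
    using nf that by (simp add: inv_into_f_f[OF inj])
  ultimately show thesis by (rule that)
qed

text \<open>
  A subset that is locally the zero set of functions with independent differentials is a
  submanifold: such functions serve as the last coordinates of slice charts.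
\<close>

lemma manifold_submanifold:
  assumes M: "complex_manifold M"
    and cut: "\<And>x. x \<in> pts M ==> x \<in> A ==>
      \<exists>c W (m::nat) F B. c \<in> maximal_atlas M \<and> x \<in> cdom c \<and> openin (Top M) W \<and> x \<in> W \<and>
        (\<forall>y\<in>W \<inter> cdom c. \<forall>j<m. cdiff (cdim c) (cmap c) (W \<inter> cdom c) (\<lambda>y. F y j) y) \<and>
        (\<forall>j<m. has_row (cdim c) (cmap c) (W \<inter> cdom c) (\<lambda>y. F y j) x (B j)) \<and>
        (\<forall>w. \<exists>v. \<forall>j<m. (\<Sum>i<cdim c. B j i * v i) = w j) \<and>
        (\<forall>y\<in>W \<inter> cdom c. y \<in> A \<longleftrightarrow> (\<forall>j<m. F y j = 0))"
  shows "complex_manifold (submanifold M A)"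
proof (rule complex_manifoldI)
  show "Hausdorff_space (Top (submanifold M A))" "second_countable (Top (submanifold M A))"
    using M by (simp_all add: complex_manifold_def Hausdorff_space_subtopology second_countable_subtopology)
  show "charted (submanifold M A)" by (rule charted_submanifold)
  show "pts (submanifold M A) \<subseteq> (\<Union>c\<in>Atlas (submanifold M A). cdom c)"
  proof
    fix x assume "x \<in> pts (submanifold M A)"
    then have x: "x \<in> pts M" "x \<in> A" by auto
    obtain c W F B and m :: nat where c: "c \<in> maximal_atlas M" "x \<in> cdom c" and W: "openin (Top M) W" "x \<in> W"
      and diff: "\<forall>y\<in>W \<inter> cdom c. \<forall>j<m. cdiff (cdim c) (cmap c) (W \<inter> cdom c) (\<lambda>y. F y j) y"
      and row: "\<forall>j<m. has_row (cdim c) (cmap c) (W \<inter> cdom c) (\<lambda>y. F y j) x (B j)"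
      and sur: "\<forall>w. \<exists>v. \<forall>j<m. (\<Sum>i<cdim c. B j i * v i) = w j"
      and zero: "\<forall>y\<in>W \<inter> cdom c. y \<in> A \<longleftrightarrow> (\<forall>j<m. F y j = 0)"
      using cut[OF x] by (elim exE conjE) (rule that)
    have W': "openin (Top M) (W \<inter> cdom c)" "x \<in> W \<inter> cdom c"
      using W c is_chartD(1)[OF maximal_atlasD(1)[OF c(1)]] by auto
    obtain d where d: "d \<in> maximal_atlas M" "x \<in> cdom d" "cdom d \<subseteq> W \<inter> cdom c" "m \<le> cdim d"
      "\<And>y j. y \<in> cdom d ==> j < m ==> cmap d y (cdim d - 1 - j) = F y j"
    proof (rule chart_adapted_to_submersion[OF M c W', of m F B])
      show "cdiff (cdim c) (cmap c) (W \<inter> cdom c \<inter> cdom c) (\<lambda>y. F y j) y"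
        if "y \<in> W \<inter> cdom c \<inter> cdom c" "j < m" for y j using diff that by (simp add: Int_assoc)
      show "has_row (cdim c) (cmap c) (W \<inter> cdom c \<inter> cdom c) (\<lambda>y. F y j) x (B j)" if "j < m" for j
        using row that by (simp add: Int_assoc)
      show "\<exists>v. \<forall>j<m. (\<Sum>i<cdim c. B j i * v i) = w j" for w using sur by blast
    qed (rule that)
    let ?k = "cdim d - m"
    have E: "cmap d y \<in> Ec (cdim d)" if "y \<in> cdom d" for y
      using is_chartD(4)[OF maximal_atlasD(1)[OF d(1)]] that by blast
    have slice: "y \<in> A \<longleftrightarrow> cmap d y \<in> Ec ?k" if y: "y \<in> cdom d" for y
    proof -
      have "y \<in> A \<longleftrightarrow> (\<forall>j<m. cmap d y (cdim d - 1 - j) = 0)" using zero d(3,5) y by auto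
      also have "\<dots> \<longleftrightarrow> cmap d y \<in> Ec ?k"
      proof
        assume L: "\<forall>j<m. cmap d y (cdim d - 1 - j) = 0"
        have "cmap d y i = 0" if "i \<ge> ?k" for i
        proof (cases "i < cdim d")
          case True
          then have "cdim d - 1 - i < m" "cdim d - 1 - (cdim d - 1 - i) = i" using that d(4) by linarith+
          then show ?thesis using L by metis
        next
          case False
          then show ?thesis using E[OF y] by (simp add: Ec_def)
        qed
        then show "cmap d y \<in> Ec ?k" by (simp add: Ec_def)
      next
        assume R: "cmap d y \<in> Ec ?k"
        show "\<forall>j<m. cmap d y (cdim d - 1 - j) = 0"
        proof (intro allI impI)
          fix j assume "j < m"
          then have "cdim d - 1 - j \<ge> ?k" using d(4) by linarith
          then show "cmap d y (cdim d - 1 - j) = 0" using R by (simp add: Ec_def)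
        qed
      qed
      finally show ?thesis .
    qed
    have "cmap d ` (cdom d \<inter> A) = cmap d ` cdom d \<inter> Ec ?k" using slice by blast
    then have "\<lparr>cdim = ?k, cdom = cdom d \<inter> A, cmap = cmap d\<rparr> \<in> Atlas (submanifold M A)"
      unfolding submanifold_simps using d(1) by (auto intro!: exI[of _ d])
    moreover have "x \<in> cdom \<lparr>cdim = ?k, cdom = cdom d \<inter> A, cmap = cmap d\<rparr>" using d(2) x(2) by simp
    ultimately show "x \<in> (\<Union>c\<in>Atlas (submanifold M A). cdom c)" by blast
  qed
  fix c' d' x assume "c' \<in> Atlas (submanifold M A)" "d' \<in> Atlas (submanifold M A)" and x: "x \<in> cdom c'" "x \<in> cdom d'"
  then obtain c k d l where c: "c \<in> maximal_atlas M" "k \<le> cdim c" "cmap c ` (cdom c \<inter> A) = cmap c ` cdom c \<inter> Ec k"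
    "c' = \<lparr>cdim = k, cdom = cdom c \<inter> A, cmap = cmap c\<rparr>" and d: "d \<in> maximal_atlas M" "l \<le> cdim d"
    "d' = \<lparr>cdim = l, cdom = cdom d \<inter> A, cmap = cmap d\<rparr>" by auto
  have "diff_in_charts c d (\<lambda>x. x) x" using x c d by (intro maximal_atlas_compatible[OF M]) auto
  from diff_in_charts_slice[where A=A and B=A, OF this _ c(2,3) d(2)] show "diff_in_charts c' d' (\<lambda>x. x) x"
    using x c(4) d(3) by simp
qed

lemma manifold_open_submanifold:
  assumes M: "complex_manifold M" and D: "openin (Top M) D"
  shows "complex_manifold (submanifold M D)"
proof (rule manifold_submanifold[OF M])
  fix x assume x: "x \<in> pts M" "x \<in> D"
  obtain c where c: "c \<in> Atlas M" "x \<in> cdom c" by (rule manifold_chart_at[OF M x(1)])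
  show "\<exists>c W (m::nat) F B. c \<in> maximal_atlas M \<and> x \<in> cdom c \<and> openin (Top M) W \<and> x \<in> W \<and>
        (\<forall>y\<in>W \<inter> cdom c. \<forall>j<m. cdiff (cdim c) (cmap c) (W \<inter> cdom c) (\<lambda>y. F y j) y) \<and>
        (\<forall>j<m. has_row (cdim c) (cmap c) (W \<inter> cdom c) (\<lambda>y. F y j) x (B j)) \<and>
        (\<forall>w. \<exists>v. \<forall>j<m. (\<Sum>i<cdim c. B j i * v i) = w j) \<and>
        (\<forall>y\<in>W \<inter> cdom c. y \<in> D \<longleftrightarrow> (\<forall>j<m. F y j = 0))"
    using c D x Atlas_subset_maximal[OF M c(1)]
    by (intro exI[of _ c] exI[of _ D] exI[of _ "0::nat"]) auto
qed

section \<open>Local homeomorphisms\<close>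

definition sheet :: "'a topology => 'b topology => ('a => 'b) => 'a set => bool" where
  "sheet T T' f W \<longleftrightarrow> openin T W \<and> openin T' (f ` W) \<and>
     homeomorphic_map (subtopology T W) (subtopology T' (f ` W)) f"

definition local_homeo :: "'a topology => 'b topology => ('a => 'b) => bool" where
  "local_homeo T T' f \<longleftrightarrow> (\<forall>x\<in>topspace T. \<exists>W. sheet T T' f W \<and> x \<in> W)"

lemma sheetD:
  assumes "sheet T T' f W"
  shows "openin T W" "openin T' (f ` W)" "inj_on f W"
    and "\<And>O'. openin T' O' ==> openin T {x \<in> W. f x \<in> O'}"
    and "\<And>V. openin T V ==> openin T' (f ` (V \<inter> W))"
proof -
  have 1: "openin T W" and 2: "openin T' (f ` W)"
    and h: "homeomorphic_map (subtopology T W) (subtopology T' (f ` W)) f"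
    using assms unfolding sheet_def by auto
  show "openin T W" "openin T' (f ` W)" by fact+
  have ts: "topspace (subtopology T W) = W" using openin_subset[OF 1] by auto
  show "inj_on f W" using homeomorphic_imp_injective_map[OF h] ts by simp
  have c: "continuous_map (subtopology T W) T' f"
    using homeomorphic_imp_continuous_map[OF h] by (rule continuous_map_into_fulltopology)
  show "openin T {x \<in> W. f x \<in> O'}" if "openin T' O'" for O'
    using openin_trans_full[OF openin_continuous_map_preimage[OF c that] 1] unfolding ts .
  show "openin T' (f ` (V \<inter> W))" if "openin T V" for V
  proof -
    have "openin (subtopology T W) (V \<inter> W)" by (rule openin_subtopology_Int[OF that])
    then have "openin (subtopology T' (f ` W)) (f ` (V \<inter> W))"
      using homeomorphic_imp_open_map[OF h] by (simp add: open_map_def)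
    from openin_trans_full[OF this 2] show ?thesis .
  qed
qed

lemma local_homeo_cont_at:
  assumes "local_homeo T T' f" "x \<in> topspace T"
  shows "cont_at T T' f x"
proof -
  obtain W where W: "sheet T T' f W" "x \<in> W" using assms unfolding local_homeo_def by blast
  show ?thesis unfolding cont_at_def
  proof (intro conjI allI impI)
    show "f x \<in> topspace T'" using openin_subset[OF sheetD(2)[OF W(1)]] W(2) by blast
    fix V assume V: "openin T' V \<and> f x \<in> V"
    then have "openin T {x \<in> W. f x \<in> V}" using sheetD(4)[OF W(1)] by blast
    then show "\<exists>W. openin T W \<and> x \<in> W \<and> f ` W \<subseteq> V" using V W(2) by (intro exI[of _ "{x \<in> W. f x \<in> V}"]) auto
  qed (use assms in simp)
qed

lemma local_homeo_manifold_simps [simp]: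
  "Top (local_homeo_manifold T f N) = T"
  "Atlas (local_homeo_manifold T f N) = {\<lparr>cdim = cdim d, cdom = {x \<in> W. f x \<in> cdom d}, cmap = cmap d \<circ> f\<rparr> | W d.
     sheet T (Top N) f W \<and> d \<in> Atlas N}"
  by (simp_all add: local_homeo_manifold_def sheet_def)

lemma is_chart_sheet:
  assumes W: "sheet T T' f W" and d: "is_chart T' d"
  shows "is_chart T \<lparr>cdim = cdim d, cdom = {x \<in> W. f x \<in> cdom d}, cmap = cmap d \<circ> f\<rparr>" (is "is_chart T ?c")
proof (rule is_chartI)
  let ?n = "cdim d"
  show "openin T (cdom ?c)" using sheetD(4)[OF W is_chartD(1)[OF d]] by simp
  show "inj_on (cmap ?c) (cdom ?c)"
  proof (rule inj_onI)
    fix x y assume "x \<in> cdom ?c" "y \<in> cdom ?c" "cmap ?c x = cmap ?c y"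
    then have *: "x \<in> W" "y \<in> W" "f x \<in> cdom d" "f y \<in> cdom d" "cmap d (f x) = cmap d (f y)" by auto
    from inj_onD[OF is_chartD(3)[OF d] *(5,3,4)] inj_onD[OF sheetD(3)[OF W] _ *(1,2)]
    show "x = y" by blast
  qed
  show "cmap ?c ` cdom ?c \<subseteq> Ec (cdim ?c)" using is_chartD(4)[OF d] by auto
  {
    fix x V assume x: "x \<in> cdom ?c" and V: "openin T V" "x \<in> V"
    have fx: "f x \<in> cdom d" "f x \<in> f ` (V \<inter> W)" using x V by auto
    obtain \<delta> where \<delta>: "\<delta> > 0" "\<forall>y\<in>cdom d. cdist ?n (cmap d y) (cmap d (f x)) < \<delta> --> y \<in> f ` (V \<inter> W)"
      "{z \<in> Ec ?n. cdist ?n z (cmap d (f x)) < \<delta>} \<subseteq> cmap d ` (f ` (V \<inter> W) \<inter> cdom d)"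
      by (rule chart_nbhd[OF d fx(1) sheetD(5)[OF W V(1)] fx(2)])
    have "cmap d ` (f ` (V \<inter> W) \<inter> cdom d) \<subseteq> cmap ?c ` (V \<inter> cdom ?c)" by auto
    then show "\<exists>\<delta>>0. {z \<in> Ec (cdim ?c). cdist (cdim ?c) z (cmap ?c x) < \<delta>} \<subseteq> cmap ?c ` (V \<inter> cdom ?c)"
      using \<delta>(1,3) by (intro exI[of _ \<delta>]) auto
  }
  fix x and \<delta> :: real assume x: "x \<in> cdom ?c" and "\<delta> > 0"
  let ?V = "{y \<in> W. f y \<in> {y \<in> cdom d. cdist ?n (cmap d y) (cmap d (f x)) < \<delta>}}"
  have "openin T ?V" by (rule sheetD(4)[OF W chart_ball_open[OF d]])
  then show "\<exists>V. openin T V \<and> x \<in> V \<and> (\<forall>y\<in>V \<inter> cdom ?c. cdist (cdim ?c) (cmap ?c y) (cmap ?c x) < \<delta>)"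
    using x \<open>\<delta> > 0\<close> by (intro exI[of _ ?V]) auto
qed

lemma diff_in_charts_sheet:
  assumes "diff_in_charts d e (\<lambda>y. y) (f x)"
  shows "diff_in_charts \<lparr>cdim = cdim d, cdom = {x \<in> W. f x \<in> cdom d}, cmap = cmap d \<circ> f\<rparr> e f x"
    (is "diff_in_charts ?c _ _ _")
  unfolding diff_in_charts_def
proof (intro allI impI)
  fix j assume j: "j < cdim e"
  have "cdiff (cdim d) (cmap d \<circ> f) {y \<in> cdom ?c. f y \<in> cdom e} (\<lambda>y. cmap e (f y) j) x"
  proof (rule cdiff_compose[where m="cdim d" and l="cmap d" and f=f and u="\<lambda>y. cmap e y j"
        and V="{y \<in> cdom d. y \<in> cdom e}"])
    show "cdiff (cdim d) (cmap d) {y \<in> cdom d. y \<in> cdom e} (\<lambda>y. cmap e y j) (f x)"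
      by (rule diff_in_chartsD[OF assms j])
    show "cdiff (cdim d) (cmap d \<circ> f) {y \<in> cdom ?c. f y \<in> cdom e} (\<lambda>y. cmap d (f y) k) x" if "k < cdim d" for k
      using cdiff_coord[OF that, of "cmap d \<circ> f"] by simp
  qed auto
  then show "cdiff (cdim ?c) (cmap ?c) {y \<in> cdom ?c. f y \<in> cdom e} (\<lambda>y. cmap e (f y) j) x" by simp
qed

lemma hol_at_local_homeo:
  assumes N: "complex_manifold N" and f: "local_homeo T (Top N) f" and x: "x \<in> topspace T"
  shows "hol_at (local_homeo_manifold T f N) N f x"
  unfolding hol_at_def
proof (intro conjI ballI impI)
  show "cont_at (Top (local_homeo_manifold T f N)) (Top N) f x"
    using local_homeo_cont_at[OF f x] by simp
  fix c e assume "c \<in> Atlas (local_homeo_manifold T f N)" and e: "e \<in> Atlas N" and x: "x \<in> cdom c \<and> f x \<in> cdom e"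
  then obtain W d where d: "d \<in> Atlas N" "c = \<lparr>cdim = cdim d, cdom = {x \<in> W. f x \<in> cdom d}, cmap = cmap d \<circ> f\<rparr>"
    by auto
  have "diff_in_charts d e (\<lambda>y. y) (f x)"
    using x d Atlas_subset_maximal[OF N] e by (intro maximal_atlas_compatible[OF N]) auto
  from diff_in_charts_sheet[where f=f and x=x and W=W, OF this] show "diff_in_charts c e f x" unfolding d(2) .
qed

lemma hol_at_into_local_homeo:
  assumes g: "cont_at (Top M) T g x" and fg: "hol_at M N (\<lambda>y. f (g y)) x"
  shows "hol_at M (local_homeo_manifold T f N) g x"
  unfolding hol_at_def
proof (intro conjI ballI impI)
  show "cont_at (Top M) (Top (local_homeo_manifold T f N)) g x" using g by simp
  fix c e assume c: "c \<in> Atlas M" and "e \<in> Atlas (local_homeo_manifold T f N)" and x: "x \<in> cdom c \<and> g x \<in> cdom e"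
  then obtain W d where d: "d \<in> Atlas N" "e = \<lparr>cdim = cdim d, cdom = {x \<in> W. f x \<in> cdom d}, cmap = cmap d \<circ> f\<rparr>"
    by auto
  have dg: "diff_in_charts c d (\<lambda>y. f (g y)) x"
    using hol_atD[OF fg c d(1)] x d by simp
  show "diff_in_charts c e g x"
    unfolding diff_in_charts_def
  proof (intro allI impI)
    fix j assume "j < cdim e"
    then have "j < cdim d" using d by simp
    from diff_in_chartsD[OF dg this]
    show "cdiff (cdim c) (cmap c) {y \<in> cdom c. g y \<in> cdom e} (\<lambda>y. cmap e (g y) j) x"
      unfolding d(2) by (simp, rule cdiff_subset) auto
  qed
qed

lemma manifold_local_homeo:
  assumes N: "complex_manifold N" and f: "local_homeo T (Top N) f"
    and T: "Hausdorff_space T" "second_countable T"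
  shows "complex_manifold (local_homeo_manifold T f N)" (is "complex_manifold ?M")
proof (rule complex_manifoldI)
  show "charted ?M"
    unfolding charted_def by (auto intro: is_chart_sheet manifold_chart_open(1)[OF N])
  show "pts ?M \<subseteq> (\<Union>c\<in>Atlas ?M. cdom c)"
  proof
    fix x assume "x \<in> pts ?M"
    then have x: "x \<in> topspace T" by simp
    obtain W where W: "sheet T (Top N) f W" "x \<in> W" using f x unfolding local_homeo_def by blast
    have "f x \<in> pts N" using local_homeo_cont_at[OF f x] by (simp add: cont_at_def)
    then obtain d where d: "d \<in> Atlas N" "f x \<in> cdom d" by (rule manifold_chart_at[OF N])
    have "\<lparr>cdim = cdim d, cdom = {x \<in> W. f x \<in> cdom d}, cmap = cmap d \<circ> f\<rparr> \<in> Atlas ?M"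
      using W(1) d(1) by auto
    moreover have "x \<in> cdom \<lparr>cdim = cdim d, cdom = {x \<in> W. f x \<in> cdom d}, cmap = cmap d \<circ> f\<rparr>"
      using W(2) d(2) by simp
    ultimately show "x \<in> (\<Union>c\<in>Atlas ?M. cdom c)" by blast
  qed
  fix c e x assume c: "c \<in> Atlas ?M" and e: "e \<in> Atlas ?M" and x: "x \<in> cdom c" "x \<in> cdom e"
  have xt: "x \<in> topspace T"
  proof -
    obtain W where "sheet T (Top N) f W" "x \<in> W" using c x by auto
    then show ?thesis using openin_subset[OF sheetD(1)] by blast
  qed
  have "hol_at ?M ?M (\<lambda>y. y) x"
    by (rule hol_at_into_local_homeo) (simp_all add: cont_at_id[OF xt] hol_at_local_homeo[OF N f xt])
  from hol_atD[OF this c e x] show "diff_in_charts c e (\<lambda>y. y) x" .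
qed (use T in simp_all)

section \<open>Submersions and local sections\<close>

text \<open>
  A holomorphic local right inverse through \<open>x\<close>. For submersions this replaces the surjectivity of
  the differential, and it composes without linear algebra.
\<close>

definition section_at :: "'a cmanifold => 'b cmanifold => ('a => 'b) => 'a => bool" where
  "section_at M N f x \<longleftrightarrow> (\<exists>\<sigma> V. hol_at N M \<sigma> (f x) \<and> \<sigma> (f x) = x \<and>
     openin (Top N) V \<and> f x \<in> V \<and> (\<forall>y\<in>V. f (\<sigma> y) = y))"

lemma section_atI:
  assumes "hol_at N M \<sigma> (f x)" "\<sigma> (f x) = x" "openin (Top N) V" "f x \<in> V" "\<And>y. y \<in> V ==> f (\<sigma> y) = y"
  shows "section_at M N f x"
  unfolding section_at_def using assms(2-) by (intro exI[of _ \<sigma>] exI[of _ V] conjI assms(1)) auto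

lemma section_atE:
  assumes "section_at M N f x"
  obtains \<sigma> V where "hol_at N M \<sigma> (f x)" "\<sigma> (f x) = x" "openin (Top N) V" "f x \<in> V" "\<And>y. y \<in> V ==> f (\<sigma> y) = y"
proof -
  obtain \<sigma> V where *: "hol_at N M \<sigma> (f x)" "\<sigma> (f x) = x" "openin (Top N) V" "f x \<in> V" "\<forall>y\<in>V. f (\<sigma> y) = y"
    using assms unfolding section_at_def by (elim exE conjE) (rule that)
  show thesis by (rule that[OF *(1-4)]) (use *(5) in blast)
qed

lemma section_at_compose:
  assumes N: "complex_manifold N" and P: "complex_manifold P"
    and f: "section_at M N f x" and g: "section_at N P g (f x)"
  shows "section_at M P (\<lambda>y. g (f y)) x"
proof -
  obtain \<sigma> V where s: "hol_at N M \<sigma> (f x)" "\<sigma> (f x) = x" "openin (Top N) V" "f x \<in> V" "\<And>y. y \<in> V ==> f (\<sigma> y) = y"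
    by (rule section_atE[OF f]) (rule that)
  obtain \<tau> V' where t: "hol_at P N \<tau> (g (f x))" "\<tau> (g (f x)) = f x" "openin (Top P) V'" "g (f x) \<in> V'"
    "\<And>y. y \<in> V' ==> g (\<tau> y) = y"
    by (rule section_atE[OF g]) (rule that)
  have tv: "\<tau> (g (f x)) \<in> V" using t(2) s(4) by simp
  obtain W where W: "openin (Top P) W" "g (f x) \<in> W" "\<tau> ` W \<subseteq> V"
    by (rule cont_atD[OF hol_at_cont[OF t(1)] s(3) tv])
  have s1: "hol_at N M \<sigma> (\<tau> (g (f x)))" using s(1) t(2) by simp
  show ?thesis
  proof (rule section_atI)
    show "hol_at P M (\<lambda>y. \<sigma> (\<tau> y)) (g (f x))"
      by (rule hol_at_compose[OF charted_manifold[OF P] N t(1) s1])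
    show "openin (Top P) (W \<inter> V')" using W t by blast
    fix y assume y: "y \<in> W \<inter> V'"
    then have "\<tau> y \<in> V" using W by blast
    then show "g (f (\<sigma> (\<tau> y))) = y" using s(5) t(5) y by simp
  qed (use W t s in auto)
qed

lemma section_at_local_homeo:
  assumes N: "complex_manifold N" and f: "local_homeo T (Top N) f" and x: "x \<in> topspace T"
  shows "section_at (local_homeo_manifold T f N) N f x"
proof -
  obtain W where W: "sheet T (Top N) f W" "x \<in> W" using f x unfolding local_homeo_def by blast
  define \<psi> where "\<psi> = inv_into W f"
  have r: "f (\<psi> y) = y" if "y \<in> f ` W" for y using that by (simp add: \<psi>_def f_inv_into_f)
  have l: "\<psi> (f y) = y" if "y \<in> W" for y using sheetD(3)[OF W(1)] that by (simp add: \<psi>_def)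
  have fx: "f x \<in> pts N" "f x \<in> f ` W"
    using local_homeo_cont_at[OF f x] W by (auto simp: cont_at_def)
  have c: "cont_at (Top N) T \<psi> (f x)"
    unfolding cont_at_def
  proof (intro conjI allI impI)
    show "f x \<in> pts N" "\<psi> (f x) \<in> topspace T" using fx l[OF W(2)] x by auto
    fix V assume V: "openin T V \<and> \<psi> (f x) \<in> V"
    then have "openin (Top N) (f ` (V \<inter> W))" using sheetD(5)[OF W(1)] by blast
    moreover have "f x \<in> f ` (V \<inter> W)" using V W l[OF W(2)] by auto
    moreover have "\<psi> ` (f ` (V \<inter> W)) \<subseteq> V" using l by auto
    ultimately show "\<exists>W. openin (Top N) W \<and> f x \<in> W \<and> \<psi> ` W \<subseteq> V" by blast
  qed
  have "hol_at N N (\<lambda>y. f (\<psi> y)) (f x)"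
    by (rule hol_at_cong[OF charted_manifold[OF N] hol_at_id[OF N fx(1)] sheetD(2)[OF W(1)] fx(2)]) (rule r)
  from hol_at_into_local_homeo[OF c this] show ?thesis
    by (rule section_atI[where \<sigma>=\<psi> and V="f ` W"]) (use l[OF W(2)] sheetD(2)[OF W(1)] fx(2) r in auto)
qed

lemma section_at_fst:
  assumes "complex_manifold M" "complex_manifold N" "q \<in> pts (M \<times>\<^sub>M N)"
  shows "section_at (M \<times>\<^sub>M N) M fst q"
proof (rule section_atI)
  have q: "fst q \<in> pts M" "snd q \<in> pts N" using assms(3) by auto
  show "hol_at M (M \<times>\<^sub>M N) (\<lambda>y. (y, snd q)) (fst q)"
    by (rule hol_at_pair[OF hol_at_id[OF assms(1) q(1)] hol_at_const[OF q]])
  show "openin (Top M) (pts M)" by simp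
qed (use assms in auto)

lemma section_at_snd:
  assumes "complex_manifold M" "complex_manifold N" "q \<in> pts (M \<times>\<^sub>M N)"
  shows "section_at (M \<times>\<^sub>M N) N snd q"
proof (rule section_atI)
  have q: "fst q \<in> pts M" "snd q \<in> pts N" using assms(3) by auto
  show "hol_at N (M \<times>\<^sub>M N) (\<lambda>y. (fst q, y)) (snd q)"
    by (rule hol_at_pair[OF hol_at_const[OF q(2,1)] hol_at_id[OF assms(2) q(2)]])
  show "openin (Top N) (pts N)" by simp
qed (use assms in auto)

lemma diff_in_charts_rows:
  assumes "diff_in_charts c d f x"
  obtains A where "\<And>j. j < cdim d ==> has_row (cdim c) (cmap c) {y \<in> cdom c. f y \<in> cdom d} (\<lambda>y. cmap d (f y) j) x (A j)"
proof -
  have "\<forall>j\<in>{..<cdim d}. \<exists>A. has_row (cdim c) (cmap c) {y \<in> cdom c. f y \<in> cdom d} (\<lambda>y. cmap d (f y) j) x A"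
    using assms unfolding diff_in_charts_def cdiff_def by simp
  from bchoice[OF this] obtain A where "\<forall>j\<in>{..<cdim d}. has_row (cdim c) (cmap c) {y \<in> cdom c. f y \<in> cdom d} (\<lambda>y. cmap d (f y) j) x (A j)"
    by (rule exE)
  then show thesis by (intro that[of A]) simp
qed

text \<open>By the chain rule, a map with local sections has surjective differentials.\<close>

lemma submersion_from_sections:
  assumes M: "complex_manifold M" and N: "complex_manifold N"
    and h: "\<And>x. x \<in> pts M ==> hol_at M N f x"
    and s: "\<And>x. x \<in> pts M ==> section_at M N f x"
  shows "holomorphic_submersion M N f"
  unfolding holomorphic_submersion_def
proof (intro conjI ballI impI)
  show "holomorphic_map M N f" using h holomorphic_map_iff_hol_at[OF charted_manifold[OF M]] by blast
  fix x c d assume x: "x \<in> pts M" and c: "c \<in> Atlas M" and d: "d \<in> Atlas N" and xcd: "x \<in> cdom c \<and> f x \<in> cdom d"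
  let ?n = "cdim c" and ?m = "cdim d"
  have cc: "is_chart (Top M) c" and dd: "is_chart (Top N) d" using manifold_chart_open(1) M N c d by blast+
  have df: "diff_in_charts c d f x" by (rule hol_atD[OF h[OF x] c d conjunct1[OF xcd] conjunct2[OF xcd]])
  obtain A where A: "\<And>j. j < ?m ==> has_row ?n (cmap c) {y \<in> cdom c. f y \<in> cdom d} (\<lambda>y. cmap d (f y) j) x (A j)"
    by (rule diff_in_charts_rows[OF df]) (rule that)
  obtain \<sigma> V where s: "hol_at N M \<sigma> (f x)" "\<sigma> (f x) = x" "openin (Top N) V" "f x \<in> V" "\<And>y. y \<in> V ==> f (\<sigma> y) = y"
    by (rule section_atE[OF s[OF x]]) (rule that)
  have sx: "\<sigma> (f x) \<in> cdom c" using s xcd by simp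
  have ds: "diff_in_charts d c \<sigma> (f x)" by (rule hol_atD[OF s(1) d c conjunct2[OF xcd] sx])
  obtain B where B: "\<And>i. i < ?n ==> has_row ?m (cmap d) {y \<in> cdom d. \<sigma> y \<in> cdom c} (\<lambda>y. cmap c (\<sigma> y) i) (f x) (B i)"
    by (rule diff_in_charts_rows[OF ds]) (rule that)
  obtain W where W: "openin (Top N) W" "f x \<in> W" "\<sigma> ` W \<subseteq> cdom c"
    by (rule cont_atD[OF hol_at_cont[OF s(1)] is_chartD(1)[OF cc] sx])
  define W1 where "W1 = W \<inter> V"
  have W1: "openin (Top N) W1" "f x \<in> W1" using W s by (auto simp: W1_def)
  obtain \<delta> where \<delta>: "\<delta> > 0" "\<forall>y\<in>cdom d. cdist ?m (cmap d y) (cmap d (f x)) < \<delta> --> y \<in> W1"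
    "{z \<in> Ec ?m. cdist ?m z (cmap d (f x)) < \<delta>} \<subseteq> cmap d ` (W1 \<inter> cdom d)"
    by (rule chart_nbhd[OF dd conjunct2[OF xcd] W1])
  have E: "cmap d (f x) \<in> Ec ?m" using is_chartD(4)[OF dd] xcd by blast
  have key: "(\<Sum>i<?n. A j i * B i k) = (if k = j then 1 else 0)" if j: "j < ?m" and k: "k < ?m" for j k
  proof -
    have "has_row ?m (cmap d) (W1 \<inter> cdom d) (\<lambda>y. cmap d (f (\<sigma> y)) j) (f x) (\<lambda>k. \<Sum>i<?n. A j i * B i k)"
    proof (rule has_row_compose[where V="{y \<in> cdom c. f y \<in> cdom d}" and l="cmap c" and f=\<sigma> and u="\<lambda>y. cmap d (f y) j"])
      show "has_row ?n (cmap c) {y \<in> cdom c. f y \<in> cdom d} (\<lambda>y. cmap d (f y) j) (\<sigma> (f x)) (A j)"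
        using A[OF j] s(2) by simp
      show "has_row ?m (cmap d) (W1 \<inter> cdom d) (\<lambda>y. cmap c (\<sigma> y) i) (f x) (B i)" if "i < ?n" for i
        by (rule has_row_subset[OF B[OF that]]) (use W in \<open>auto simp: W1_def\<close>)
      show "\<sigma> ` (W1 \<inter> cdom d) \<subseteq> {y \<in> cdom c. f y \<in> cdom d}" using W s(5) by (auto simp: W1_def)
    qed
    then have 1: "has_row ?m (cmap d) (W1 \<inter> cdom d) (\<lambda>y. cmap d y j) (f x) (\<lambda>k. \<Sum>i<?n. A j i * B i k)"
      by (rule has_row_local[where d=1]) (use s W1 in \<open>auto simp: W1_def\<close>)
    have 2: "has_row ?m (cmap d) (W1 \<inter> cdom d) (\<lambda>y. cmap d y j) (f x) (\<lambda>i. if i = j then 1 else 0)"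
      by (rule has_row_coord[OF j])
    from has_row_unique[OF 1 2 \<delta>(1,3) E k] show ?thesis by simp
  qed
  show "\<exists>A. has_cderiv ?n ?m (coord_dom c d f) (coord_rep c d f) (cmap c x) A \<and>
          (\<forall>w. \<exists>v. \<forall>j<?m. (\<Sum>i<?n. A j i * v i) = w j)"
  proof (intro exI conjI)
    show "has_cderiv ?n ?m (coord_dom c d f) (coord_rep c d f) (cmap c x) A"
      unfolding has_cderiv_charts[OF is_chartD(3)[OF cc] conjunct1[OF xcd]] using A by blast
    show "\<forall>w. \<exists>v. \<forall>j<?m. (\<Sum>i<?n. A j i * v i) = w j"
    proof (rule allI, rule exI, intro allI impI)
      fix w :: "nat => complex" and j
      let ?v = "\<lambda>i. \<Sum>k<?m. B i k * w k"
      assume j: "j < ?m"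
      have "(\<Sum>i<?n. A j i * ?v i) = (\<Sum>k<?m. (\<Sum>i<?n. A j i * B i k) * w k)"
        unfolding sum_distrib_left sum_distrib_right by (subst sum.swap) (simp add: mult.assoc)
      also have "\<dots> = (\<Sum>k<?m. if k = j then w j else 0)"
        by (rule sum.cong) (auto simp: key[OF j])
      finally show "(\<Sum>i<?n. A j i * ?v i) = w j" using j by simp
    qed
  qed
qed

lemma submersion_at:
  assumes M: "complex_manifold M" and N: "complex_manifold N" and f: "holomorphic_submersion M N f"
    and x: "x \<in> pts M"
  obtains c d W A where "c \<in> Atlas M" "x \<in> cdom c" "d \<in> Atlas N" "f x \<in> cdom d"
    "openin (Top M) W" "x \<in> W" "f ` W \<subseteq> cdom d"
    "\<And>y j. y \<in> W \<inter> cdom c ==> j < cdim d ==> cdiff (cdim c) (cmap c) (W \<inter> cdom c) (\<lambda>y. cmap d (f y) j) y"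
    "\<And>j. j < cdim d ==> has_row (cdim c) (cmap c) (W \<inter> cdom c) (\<lambda>y. cmap d (f y) j) x (A j)"
    "\<And>w. \<exists>v. \<forall>j<cdim d. (\<Sum>i<cdim c. A j i * v i) = w j"
proof -
  have h: "hol_at M N f y" if "y \<in> pts M" for y
    using f that holomorphic_map_iff_hol_at[OF charted_manifold[OF M]] unfolding holomorphic_submersion_def by blast
  have fx: "f x \<in> pts N" using hol_at_cont[OF h[OF x]] by (simp add: cont_at_def)
  obtain c where c: "c \<in> Atlas M" "x \<in> cdom c" by (rule manifold_chart_at[OF M x])
  obtain d where d: "d \<in> Atlas N" "f x \<in> cdom d" by (rule manifold_chart_at[OF N fx])
  have cc: "is_chart (Top M) c" and dd: "is_chart (Top N) d" using manifold_chart_open(1) M N c d by blast+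
  obtain W where W: "openin (Top M) W" "x \<in> W" "f ` W \<subseteq> cdom d"
    by (rule cont_atD[OF hol_at_cont[OF h[OF x]] is_chartD(1)[OF dd] d(2)])
  obtain A where A: "has_cderiv (cdim c) (cdim d) (coord_dom c d f) (coord_rep c d f) (cmap c x) A"
    and sur: "\<forall>w. \<exists>v. \<forall>j<cdim d. (\<Sum>i<cdim c. A j i * v i) = w j"
    using f x c d unfolding holomorphic_submersion_def by blast
  have row: "\<forall>j<cdim d. has_row (cdim c) (cmap c) {y \<in> cdom c. f y \<in> cdom d} (\<lambda>y. cmap d (f y) j) x (A j)"
    using A has_cderiv_charts[OF is_chartD(3)[OF cc] c(2), of d f A] by blast
  show thesis
  proof (rule that[OF c d W])
    fix y j assume y: "y \<in> W \<inter> cdom c" and j: "j < cdim d"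
    have yt: "y \<in> pts M" using y openin_subset[OF W(1)] by blast
    have "diff_in_charts c d f y" using y W by (intro hol_atD[OF h[OF yt] c(1) d(1)]) auto
    from diff_in_chartsD[OF this j]
    show "cdiff (cdim c) (cmap c) (W \<inter> cdom c) (\<lambda>y. cmap d (f y) j) y"
      by (rule cdiff_subset) (use W in auto)
  next
    fix j assume "j < cdim d"
    with row have "has_row (cdim c) (cmap c) {y \<in> cdom c. f y \<in> cdom d} (\<lambda>y. cmap d (f y) j) x (A j)" by blast
    then show "has_row (cdim c) (cmap c) (W \<inter> cdom c) (\<lambda>y. cmap d (f y) j) x (A j)"
      by (rule has_row_subset) (use W in auto)
  next
    show "\<exists>v. \<forall>j<cdim d. (\<Sum>i<cdim c. A j i * v i) = w j" for w using sur by blast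
  qed
qed

text \<open>Conversely, in a chart adapted to a submersion the section keeps the remaining coordinates constant.\<close>

lemma section_of_submersion:
  assumes M: "complex_manifold M" and N: "complex_manifold N" and f: "holomorphic_submersion M N f"
    and x: "x \<in> pts M"
  shows "section_at M N f x"
proof -
  obtain c d W A where c: "c \<in> Atlas M" "x \<in> cdom c" and d: "d \<in> Atlas N" "f x \<in> cdom d"
    and W: "openin (Top M) W" "x \<in> W" "f ` W \<subseteq> cdom d"
    and diff: "\<And>y j. y \<in> W \<inter> cdom c ==> j < cdim d ==> cdiff (cdim c) (cmap c) (W \<inter> cdom c) (\<lambda>y. cmap d (f y) j) y"
    and row: "\<And>j. j < cdim d ==> has_row (cdim c) (cmap c) (W \<inter> cdom c) (\<lambda>y. cmap d (f y) j) x (A j)"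
    and sur: "\<And>w. \<exists>v. \<forall>j<cdim d. (\<Sum>i<cdim c. A j i * v i) = w j"
    by (rule submersion_at[OF M N f x]) (rule that)
  let ?m = "cdim d"
  have cM: "c \<in> maximal_atlas M" and dN: "d \<in> maximal_atlas N" using Atlas_subset_maximal M N c d by blast+
  obtain c' where c': "c' \<in> maximal_atlas M" "x \<in> cdom c'" "cdom c' \<subseteq> W" "?m \<le> cdim c'"
    "\<And>y j. y \<in> cdom c' ==> j < ?m ==> cmap c' y (cdim c' - 1 - j) = cmap d (f y) j"
    by (rule chart_adapted_to_submersion[OF M cM c(2) W(1,2), of ?m "\<lambda>y. cmap d (f y)" A, OF diff row sur]) (assumption | rule that)+
  let ?n = "cdim c'"
  have cc: "is_chart (Top M) c'" and dd: "is_chart (Top N) d"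
    using maximal_atlasD(1)[OF c'(1)] maximal_atlasD(1)[OF dN] by auto
  define vec where "vec s = (\<lambda>i. if i < ?n \<and> ?n - ?m \<le> i then cmap d s (?n - 1 - i) else cmap c' x i)" for s
  define \<sigma> where "\<sigma> s = inv_into (cdom c') (cmap c') (vec s)" for s
  have E: "cmap c' x \<in> Ec ?n" using is_chartD(4)[OF cc] c'(2) by blast
  have vE: "vec s \<in> Ec ?n" for s using E by (simp add: vec_def Ec_def)
  have idx: "?n - 1 - i < ?m" "?n - 1 - (?n - 1 - i) = i" if "i < ?n" "?n - ?m \<le> i" for i
    using that c'(4) by linarith+
  have v0: "vec (f x) = cmap c' x"
  proof
    fix i show "vec (f x) i = cmap c' x i"
      using c'(5)[OF c'(2), of "?n - 1 - i"] idx[of i] by (auto simp: vec_def)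
  qed
  have dv: "cdiff ?m (cmap d) V (\<lambda>s. vec s i) s0" for V i s0
  proof (cases "i < ?n \<and> ?n - ?m \<le> i")
    case True
    then have "vec s i = cmap d s (?n - 1 - i)" for s by (simp add: vec_def)
    then show ?thesis using cdiff_coord[OF idx(1), of i "cmap d" V s0] True by simp
  next
    case False
    then have "vec s i = cmap c' x i" for s by (auto simp: vec_def)
    then show ?thesis by (simp add: cdiff_const)
  qed
  obtain r L where L: "r > 0" "L \<ge> 0" "\<forall>s\<in>UNIV. cdist ?m (cmap d s) (cmap d (f x)) < r -->
      cdist ?n (vec s) (vec (f x)) \<le> L * cdist ?m (cmap d s) (cmap d (f x))"
    using cdiff_Lipschitz[of ?n ?m "cmap d" UNIV vec "f x", OF dv] by (elim exE conjE) (rule that)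
  have xtop: "openin (Top M) (pts M)" by simp
  obtain \<delta> where \<delta>: "\<delta> > 0" "\<forall>y\<in>cdom c'. cdist ?n (cmap c' y) (cmap c' x) < \<delta> --> y \<in> pts M"
    "{z \<in> Ec ?n. cdist ?n z (cmap c' x) < \<delta>} \<subseteq> cmap c' ` (pts M \<inter> cdom c')"
    by (rule chart_nbhd[OF cc c'(2) xtop x])
  define \<rho> where "\<rho> = min r (\<delta> / (L + 1))"
  have \<rho>: "\<rho> > 0" using L \<delta> by (simp add: \<rho>_def)
  define V where "V = {s \<in> cdom d. cdist ?m (cmap d s) (cmap d (f x)) < \<rho>}"
  have V: "openin (Top N) V" "f x \<in> V" "V \<subseteq> cdom d"
    using chart_ball_open[OF dd] d(2) \<rho> by (auto simp: V_def)
  have img: "vec s \<in> cmap c' ` cdom c'" if "s \<in> V" for s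
  proof -
    have s: "cdist ?m (cmap d s) (cmap d (f x)) < r" "cdist ?m (cmap d s) (cmap d (f x)) < \<delta> / (L + 1)"
      using that by (auto simp: V_def \<rho>_def)
    have "cdist ?n (vec s) (cmap c' x) \<le> L * cdist ?m (cmap d s) (cmap d (f x))"
      using L(3) s(1) v0 by simp
    also have "\<dots> \<le> (L + 1) * cdist ?m (cmap d s) (cmap d (f x))" by (simp add: mult_right_mono)
    also have "\<dots> < \<delta>" using s(2) L by (simp add: field_simps)
    finally show ?thesis using \<delta>(3) vE[of s] by auto
  qed
  have \<sigma>c: "\<sigma> s \<in> cdom c'" "cmap c' (\<sigma> s) = vec s" if "s \<in> V" for s
    using img[OF that] by (simp_all add: \<sigma>_def inv_into_into f_inv_into_f)
  have sec: "f (\<sigma> s) = s" if s: "s \<in> V" for s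
  proof -
    have fd: "f (\<sigma> s) \<in> cdom d" using \<sigma>c(1)[OF s] c'(3) W(3) by blast
    have sd: "s \<in> cdom d" using s V by blast
    have "cmap d (f (\<sigma> s)) j = cmap d s j" for j
    proof (cases "j < ?m")
      case True
      then have i: "?n - 1 - j < ?n \<and> ?n - ?m \<le> ?n - 1 - j" "?n - 1 - (?n - 1 - j) = j" using c'(4) by linarith+
      have "cmap d (f (\<sigma> s)) j = vec s (?n - 1 - j)" using c'(5)[OF \<sigma>c(1)[OF s] True] \<sigma>c(2)[OF s] by simp
      then show ?thesis using i by (simp add: vec_def)
    next
      case False
      have "cmap d (f (\<sigma> s)) \<in> Ec ?m" "cmap d s \<in> Ec ?m" using is_chartD(4)[OF dd] fd sd by auto
      then show ?thesis using False by (simp add: Ec_def)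
    qed
    then have "cmap d (f (\<sigma> s)) = cmap d s" by (rule ext)
    from inj_onD[OF is_chartD(3)[OF dd] this fd sd] show ?thesis .
  qed
  have "hol_at N M \<sigma> (f x)"
  proof (rule hol_atI[OF N M dN d(2) c'(1) V])
    show "\<sigma> ` V \<subseteq> cdom c'" using \<sigma>c(1) by blast
    show "cdiff ?m (cmap d) V (\<lambda>s. cmap c' (\<sigma> s) i) (f x)" if "i < ?n" for i
      by (rule cdiff_cong[OF dv V(2)]) (simp add: \<sigma>c(2))
  qed
  moreover have "\<sigma> (f x) = x" using v0 c'(2) by (simp add: \<sigma>_def inv_into_f_f[OF is_chartD(3)[OF cc]])
  ultimately show ?thesis
    by (rule section_atI[where \<sigma>=\<sigma> and V=V]) (use V(1,2) sec in auto)
qed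

text \<open>
  In a chart \<open>d\<close> of \<open>N\<close> the fibre is the zero set of the components of \<open>d \<circ> f\<close> minus a constant.
\<close>

lemma manifold_fibre:
  assumes M: "complex_manifold M" and N: "complex_manifold N" and f: "holomorphic_submersion M N f"
  shows "complex_manifold (fibre M f y)"
  unfolding fibre_def
proof (rule manifold_submanifold[OF M])
  fix x assume x: "x \<in> pts M" "x \<in> {x. f x = y}"
  obtain c d W A where c: "c \<in> Atlas M" "x \<in> cdom c" and d: "d \<in> Atlas N" "f x \<in> cdom d"
    and W: "openin (Top M) W" "x \<in> W" "f ` W \<subseteq> cdom d"
    and diff: "\<And>y j. y \<in> W \<inter> cdom c ==> j < cdim d ==> cdiff (cdim c) (cmap c) (W \<inter> cdom c) (\<lambda>y. cmap d (f y) j) y"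
    and row: "\<And>j. j < cdim d ==> has_row (cdim c) (cmap c) (W \<inter> cdom c) (\<lambda>y. cmap d (f y) j) x (A j)"
    and sur: "\<And>w. \<exists>v. \<forall>j<cdim d. (\<Sum>i<cdim c. A j i * v i) = w j"
    by (rule submersion_at[OF M N f x(1)]) (rule that)
  let ?m = "cdim d"
  let ?F = "\<lambda>y j. cmap d (f y) j - cmap d (f x) j"
  have dd: "is_chart (Top N) d" using manifold_chart_open(1) N d by blast
  have dF: "cdiff (cdim c) (cmap c) (W \<inter> cdom c) (\<lambda>y. ?F y j) z" if z: "z \<in> W \<inter> cdom c" "j < ?m" for z j
  proof -
    obtain B where "has_row (cdim c) (cmap c) (W \<inter> cdom c) (\<lambda>y. cmap d (f y) j) z B"
      using diff[OF z] unfolding cdiff_def by (rule exE)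
    from has_row_diff[OF this has_row_const[of "cdim c" "cmap c" "W \<inter> cdom c" "cmap d (f x) j"]]
    show ?thesis by (rule cdiffI)
  qed
  have rF: "has_row (cdim c) (cmap c) (W \<inter> cdom c) (\<lambda>y. ?F y j) x (A j)" if "j < ?m" for j
    using has_row_diff[OF row[OF that] has_row_const] by simp
  have zero: "z \<in> {x. f x = y} \<longleftrightarrow> (\<forall>j<?m. ?F z j = 0)" if z: "z \<in> W \<inter> cdom c" for z
  proof
    assume "\<forall>j<?m. ?F z j = 0"
    moreover have fz: "f z \<in> cdom d" using z W by blast
    then have "cmap d (f z) \<in> Ec ?m" "cmap d (f x) \<in> Ec ?m" using is_chartD(4)[OF dd] d by auto
    ultimately have "cmap d (f z) j = cmap d (f x) j" for j by (cases "j < ?m") (auto simp: Ec_def)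
    then have "cmap d (f z) = cmap d (f x)" by (rule ext)
    from inj_onD[OF is_chartD(3)[OF dd] this fz d(2)] show "z \<in> {x. f x = y}" using x(2) by simp
  qed (use x in simp)
  show "\<exists>c W (m::nat) F B. c \<in> maximal_atlas M \<and> x \<in> cdom c \<and> openin (Top M) W \<and> x \<in> W \<and>
        (\<forall>y\<in>W \<inter> cdom c. \<forall>j<m. cdiff (cdim c) (cmap c) (W \<inter> cdom c) (\<lambda>y. F y j) y) \<and>
        (\<forall>j<m. has_row (cdim c) (cmap c) (W \<inter> cdom c) (\<lambda>y. F y j) x (B j)) \<and>
        (\<forall>w. \<exists>v. \<forall>j<m. (\<Sum>i<cdim c. B j i * v i) = w j) \<and>
        (\<forall>z\<in>W \<inter> cdom c. z \<in> {x. f x = y} \<longleftrightarrow> (\<forall>j<m. F z j = 0))"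
    by (intro exI[of _ c] exI[of _ W] exI[of _ ?m] exI[of _ ?F] exI[of _ A] conjI ballI allI impI
        Atlas_subset_maximal[OF M c(1)] c(2) W(1,2) dF rF sur zero)
qed

lemma manifold_complex_line: "complex_manifold complex_line"
proof (rule complex_manifoldI)
  let ?e = "\<lparr>cdim = 1, cdom = UNIV, cmap = (\<lambda>z i. if i = 0 then z else 0)\<rparr> :: complex chart"
  have A: "Atlas complex_line = {?e}" and T: "Top complex_line = euclidean"
    by (simp_all add: complex_line_def)
  show "Hausdorff_space (Top complex_line)" unfolding T by (simp add: Hausdorff_space_euclidean)
  show "second_countable (Top complex_line)"
  proof -
    obtain B :: "complex set set" where B: "countable B" "topological_basis B"
      using ex_countable_basis by blast
    have "\<exists>V\<in>B. x \<in> V \<and> V \<subseteq> U" if "open U" "x \<in> U" for U :: "complex set" and x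
      using topological_basisE[OF B(2) that] by blast
    then show ?thesis unfolding T second_countable_def
      using B by (intro exI[of _ B]) (auto simp: topological_basis_open)
  qed
  have dist1: "cdist 1 (\<lambda>i. if i = 0 then z else 0) w = cmod (z - w 0)" for z and w :: "nat => complex"
    by (simp add: cdist_def cnorm_def)
  have "is_chart euclidean ?e"
  proof (rule is_chartI)
    show "inj_on (cmap ?e) (cdom ?e)" by (rule inj_onI) (auto dest: fun_cong[of _ _ 0])
    show "cmap ?e ` cdom ?e \<subseteq> Ec (cdim ?e)" by (auto simp: Ec_def)
    {
      fix x :: complex and W assume W: "openin euclidean W" "x \<in> W"
      then obtain \<delta> where \<delta>: "\<delta> > 0" "\<And>y. cmod (y - x) < \<delta> ==> y \<in> W"
        unfolding open_openin[symmetric] open_dist dist_norm by blast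
      have "z \<in> cmap ?e ` (W \<inter> cdom ?e)" if z: "z \<in> Ec 1" "cdist 1 z (cmap ?e x) < \<delta>" for z
      proof -
        have "z = cmap ?e (z 0)" using z by (auto simp: Ec_def)
        moreover have "z 0 \<in> W" using \<delta>(2)[of "z 0"] z(2) by (simp add: cdist_def cnorm_def)
        ultimately show ?thesis by auto
      qed
      then show "\<exists>\<delta>>0. {z \<in> Ec (cdim ?e). cdist (cdim ?e) z (cmap ?e x) < \<delta>} \<subseteq> cmap ?e ` (W \<inter> cdom ?e)"
        using \<delta>(1) by (intro exI[of _ \<delta>]) auto
    }
    fix x :: complex and \<delta> :: real assume "\<delta> > 0"
    then show "\<exists>W. openin euclidean W \<and> x \<in> W \<and> (\<forall>y\<in>W \<inter> cdom ?e. cdist (cdim ?e) (cmap ?e y) (cmap ?e x) < \<delta>)"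
      by (intro exI[of _ "ball x \<delta>"]) (auto simp: dist_norm norm_minus_commute cdist_def cnorm_def)
  qed simp
  then show "charted complex_line" unfolding charted_def A T by simp
  show "pts complex_line \<subseteq> (\<Union>c\<in>Atlas complex_line. cdom c)" unfolding A by simp
  fix c d x assume "c \<in> Atlas complex_line" "d \<in> Atlas complex_line"
  then have "c = ?e" "d = ?e" unfolding A by auto
  then show "diff_in_charts c d (\<lambda>x. x) x"
    unfolding diff_in_charts_def using cdiff_coord[of _ 1 "cmap ?e"] by simp
qed

section \<open>Path classes\<close>

lemma continuous_map_top_of_set_compose:
  assumes "continuous_map (top_of_set B) Y k" "continuous_on A u" "\<And>x. x \<in> A ==> u x \<in> B"
  shows "continuous_map (top_of_set A) Y (\<lambda>x. k (u x))"
proof -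
  have "continuous_map (top_of_set A) (top_of_set B) u" using assms(2,3) by auto
  from continuous_map_compose[OF this assms(1)] show ?thesis by (simp add: o_def)
qed

lemma continuous_map_glue:
  fixes p :: "'c::topological_space => real"
  assumes "continuous_on A p" "continuous_map (top_of_set {x \<in> A. p x \<le> c}) Y f"
    "continuous_map (top_of_set {x \<in> A. c \<le> p x}) Y g" "\<And>x. x \<in> A ==> p x = c ==> f x = g x"
  shows "continuous_map (top_of_set A) Y (\<lambda>x. if p x \<le> c then f x else g x)"
proof (rule continuous_map_cases_le)
  have "A \<inter> {x. x \<in> topspace (top_of_set A) \<and> p x \<le> c} = {x \<in> A. p x \<le> c}"
    "A \<inter> {x. x \<in> topspace (top_of_set A) \<and> c \<le> p x} = {x \<in> A. c \<le> p x}" by auto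
  then show "continuous_map (subtopology (top_of_set A) {x \<in> topspace (top_of_set A). p x \<le> c}) Y f"
    "continuous_map (subtopology (top_of_set A) {x \<in> topspace (top_of_set A). c \<le> p x}) Y g"
    using assms(2,3) by (simp_all only: subtopology_subtopology)
qed (use assms in auto)

definition path_homotopic :: "'a topology => (real => 'a) => (real => 'a) => bool" where
  "path_homotopic Y \<alpha> \<beta> \<longleftrightarrow> homotopic_with (\<lambda>r. r 0 = \<alpha> 0 \<and> r 1 = \<alpha> 1) (top_of_set {0..1}) Y \<alpha> \<beta>"

lemma path_homotopic_iff:
  fixes Y :: "'a topology"
  shows
  "path_homotopic Y \<alpha> \<beta> \<longleftrightarrow> (\<exists>h :: real \<times> real => 'a. continuous_map (top_of_set square) Y h \<and>
     (\<forall>s\<in>{0..1}. h (0, s) = \<alpha> s) \<and> (\<forall>s\<in>{0..1}. h (1, s) = \<beta> s) \<and>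
     (\<forall>t\<in>{0..1}. h (t, 0) = \<alpha> 0 \<and> h (t, 1) = \<alpha> 1))"
  unfolding path_homotopic_def by (subst homotopic_with) auto

lemma path_homotopicI:
  fixes h :: "real \<times> real => 'a"
  assumes "continuous_map (top_of_set square) Y h"
    "\<And>s. s \<in> {0..1} ==> h (0, s) = \<alpha> s" "\<And>s. s \<in> {0..1} ==> h (1, s) = \<beta> s"
    "\<And>t. t \<in> {0..1} ==> h (t, 0) = \<alpha> 0" "\<And>t. t \<in> {0..1} ==> h (t, 1) = \<alpha> 1"
  shows "path_homotopic Y \<alpha> \<beta>"
  unfolding path_homotopic_iff using assms by (intro exI[of _ h]) auto

lemma path_homotopic_ends:
  "path_homotopic Y \<alpha> \<beta> ==> \<beta> 0 = \<alpha> 0 \<and> \<beta> 1 = \<alpha> 1"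
  unfolding path_homotopic_def using homotopic_with_imp_property by blast

lemma path_homotopic_refl: "pathin Y \<alpha> ==> path_homotopic Y \<alpha> \<alpha>"
  unfolding path_homotopic_def pathin_def by simp

lemma path_homotopic_sym: "path_homotopic Y \<alpha> \<beta> ==> path_homotopic Y \<beta> \<alpha>"
  using path_homotopic_ends[of Y \<alpha> \<beta>] unfolding path_homotopic_def by (simp add: homotopic_with_symD)

lemma path_homotopic_trans: "path_homotopic Y \<alpha> \<beta> ==> path_homotopic Y \<beta> \<gamma> ==> path_homotopic Y \<alpha> \<gamma>"
  using path_homotopic_ends[of Y \<alpha> \<beta>] unfolding path_homotopic_def
  by (auto intro: homotopic_with_trans)

lemma mem_path_class: "\<beta> \<in> path_class Y \<alpha> \<longleftrightarrow> path_homotopic Y \<alpha> \<beta>"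
  by (simp add: path_class_def path_homotopic_def)

lemma path_class_eqI: "path_homotopic Y \<alpha> \<beta> ==> path_class Y \<alpha> = path_class Y \<beta>"
  by (rule set_eqI) (metis mem_path_class path_homotopic_sym path_homotopic_trans)

lemma path_class_eqD: "pathin Y \<beta> ==> path_class Y \<alpha> = path_class Y \<beta> ==> path_homotopic Y \<alpha> \<beta>"
  using mem_path_class[of \<beta> Y \<alpha>] mem_path_class[of \<beta> Y \<beta>] path_homotopic_refl by blast

lemma path_class_cong:
  assumes "pathin Y \<alpha>" "\<And>s. s \<in> {0..1} ==> \<alpha> s = \<beta> s"
  shows "path_class Y \<alpha> = path_class Y \<beta>"
proof (rule path_class_eqI, rule path_homotopicI)
  show "continuous_map (top_of_set ({0..1} \<times> {0..1::real})) Y (\<lambda>q. \<alpha> (snd q))"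
    using assms(1) unfolding pathin_def
    by (rule continuous_map_top_of_set_compose) (auto intro!: continuous_intros)
qed (use assms(2) in auto)

text \<open>
  Every identity between path classes below comes from a map out of a convex set, in which paths
  with the same ends are homotopic along straight lines.
\<close>

lemma path_class_convex:
  fixes C :: "'c::real_normed_vector set"
  assumes "convex C" and k: "continuous_map (top_of_set C) Y k"
    and u: "continuous_on {0..1} u" "\<And>s. s \<in> {0..1} ==> u s \<in> C"
    and v: "continuous_on {0..1} v" "\<And>s. s \<in> {0..1} ==> v s \<in> C"
    and ends: "u 0 = v 0" "u 1 = v 1"
  shows "path_class Y (\<lambda>s. k (u s)) = path_class Y (\<lambda>s. k (v s))"
proof (rule path_class_eqI, rule path_homotopicI)
  let ?h = "\<lambda>q. (1 - fst q) *\<^sub>R u (snd q) + fst q *\<^sub>R v (snd q)"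
  have cu: "continuous_on square (\<lambda>q::real\<times>real. u (snd q))"
    by (rule continuous_on_compose2[OF u(1)]) (auto intro!: continuous_intros)
  have cv: "continuous_on square (\<lambda>q::real\<times>real. v (snd q))"
    by (rule continuous_on_compose2[OF v(1)]) (auto intro!: continuous_intros)
  show "continuous_map (top_of_set square) Y (\<lambda>q. k (?h q))"
  proof (rule continuous_map_top_of_set_compose[OF k])
    show "continuous_on square ?h"
      by (intro continuous_intros cu cv)
    show "?h q \<in> C" if "q \<in> square" for q
      using that u(2) v(2) by (intro convexD[OF assms(1)]) auto
  qed
qed (use ends in \<open>auto simp: algebra_simps simp flip: scaleR_add_left\<close>)

lemma path_class_reparam:
  assumes "pathin Y \<alpha>" "continuous_on {0..1} u" "\<And>s. s \<in> {0..1} ==> u s \<in> {0..1}"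
    "continuous_on {0..1} v" "\<And>s. s \<in> {0..1} ==> v s \<in> {0..1}" "u 0 = v 0" "u 1 = v 1"
  shows "path_class Y (\<lambda>s. \<alpha> (u s)) = path_class Y (\<lambda>s. \<alpha> (v s))"
  by (rule path_class_convex[of "{0..1::real}"]) (use assms in \<open>auto simp: pathin_def\<close>)

lemma path_class_reparam_id:
  assumes "pathin Y \<alpha>" "continuous_on {0..1} u" "\<And>s. s \<in> {0..1} ==> u s \<in> {0..1}" "u 0 = 0" "u 1 = 1"
  shows "path_class Y (\<lambda>s. \<alpha> (u s)) = path_class Y \<alpha>"
  using path_class_reparam[OF assms(1-3), of "\<lambda>s. s"] assms(4,5) by auto

lemma pathin_reparam:
  assumes "pathin Y \<alpha>" "continuous_on {0..1} u" "\<And>s. s \<in> {0..1} ==> u s \<in> {0..1}"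
  shows "pathin Y (\<lambda>s. \<alpha> (u s))"
  unfolding pathin_def by (rule continuous_map_top_of_set_compose[OF assms(1)[unfolded pathin_def] assms(2,3)])

lemma pathin_cat:
  assumes a: "pathin Y \<alpha>" and b: "pathin Y \<beta>" and "\<alpha> 1 = \<beta> 0"
  shows "pathin Y (path_cat \<alpha> \<beta>)"
  unfolding pathin_def path_cat_def
proof (rule continuous_map_glue)
  show "continuous_map (top_of_set {x \<in> {0..1}. x \<le> 1/2}) Y (\<lambda>s. \<alpha> (2 * s))"
    by (rule continuous_map_top_of_set_compose[OF a[unfolded pathin_def]]) (auto intro!: continuous_intros)
  show "continuous_map (top_of_set {x \<in> {0..1}. 1/2 \<le> x}) Y (\<lambda>s. \<beta> (2 * s - 1))"
    by (rule continuous_map_top_of_set_compose[OF b[unfolded pathin_def]]) (auto intro!: continuous_intros)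
  show "\<alpha> (2 * x) = \<beta> (2 * x - 1)" if "x = 1/2" for x using assms(3) unfolding that by simp
qed simp

lemma path_cat_ends [simp]: "path_cat \<alpha> \<beta> 0 = \<alpha> 0" "path_cat \<alpha> \<beta> 1 = \<beta> 1"
  by (simp_all add: path_cat_def)

lemma path_cat_compose: "path_cat (\<lambda>s. k (u s)) (\<lambda>s. k (v s)) = (\<lambda>s. k (path_cat u v s))"
  by (auto simp: path_cat_def)

lemma path_homotopic_cat:
  assumes a: "path_homotopic Y \<alpha> \<alpha>'" and b: "path_homotopic Y \<beta> \<beta>'" and e: "\<alpha> 1 = \<beta> 0"
  shows "path_homotopic Y (path_cat \<alpha> \<beta>) (path_cat \<alpha>' \<beta>')"
proof -
  obtain h :: "real \<times> real => _" where h: "continuous_map (top_of_set square) Y h"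
     "\<forall>s\<in>{0..1}. h (0, s) = \<alpha> s" "\<forall>s\<in>{0..1}. h (1, s) = \<alpha>' s"
     "\<forall>t\<in>{0..1}. h (t, 0) = \<alpha> 0 \<and> h (t, 1) = \<alpha> 1" using a unfolding path_homotopic_iff by blast
  obtain g :: "real \<times> real => _" where g: "continuous_map (top_of_set square) Y g"
     "\<forall>s\<in>{0..1}. g (0, s) = \<beta> s" "\<forall>s\<in>{0..1}. g (1, s) = \<beta>' s"
     "\<forall>t\<in>{0..1}. g (t, 0) = \<beta> 0 \<and> g (t, 1) = \<beta> 1" using b unfolding path_homotopic_iff by blast
  show ?thesis
  proof (rule path_homotopicI)
    show "continuous_map (top_of_set square) Y
        (\<lambda>q. if snd q \<le> 1/2 then h (fst q, 2 * snd q) else g (fst q, 2 * snd q - 1))"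
    proof (rule continuous_map_glue)
      show "continuous_map (top_of_set {x \<in> square. snd x \<le> 1/2}) Y (\<lambda>q. h (fst q, 2 * snd q))"
        by (rule continuous_map_top_of_set_compose[OF h(1)]) (auto intro!: continuous_intros)
      show "continuous_map (top_of_set {x \<in> square. 1/2 \<le> snd x}) Y (\<lambda>q. g (fst q, 2 * snd q - 1))"
        by (rule continuous_map_top_of_set_compose[OF g(1)]) (auto intro!: continuous_intros)
      show "continuous_on square (snd :: real \<times> real => real)" by (intro continuous_intros)
      fix x :: "real \<times> real" assume x: "x \<in> square" "snd x = 1/2"
      then have "h (fst x, 1) = \<alpha> 1" "g (fst x, 0) = \<beta> 0" using h(4) g(4) by auto
      then show "h (fst x, 2 * snd x) = g (fst x, 2 * snd x - 1)" unfolding x(2) using e by simp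
    qed
  qed (use h g in \<open>auto simp: path_cat_def\<close>)
qed

text \<open>
  The two ways around a square are homotopic because the square is convex.
\<close>

lemma square_lemma:
  fixes k :: "real \<times> real => 'a"
  assumes k: "continuous_map (top_of_set square) Y k"
  shows "path_class Y (path_cat (\<lambda>s. k (s, 0)) (\<lambda>t. k (1, t))) =
         path_class Y (path_cat (\<lambda>t. k (0, t)) (\<lambda>s. k (s, 1)))"
proof -
  let ?u = "path_cat (\<lambda>s. (s, 0)) (\<lambda>t. (1, t)) :: real => real \<times> real"
  let ?v = "path_cat (\<lambda>t. (0, t)) (\<lambda>s. (s, 1)) :: real => real \<times> real"
  have "pathin (top_of_set square) ?u" "pathin (top_of_set square) ?v"
    by (rule pathin_cat; auto simp: pathin_def intro!: continuous_intros)+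
  then have uv: "continuous_on {0..1} ?u" "?u \<in> {0..1} \<rightarrow> square"
    "continuous_on {0..1} ?v" "?v \<in> {0..1} \<rightarrow> square"
    unfolding pathin_def continuous_map_subtopology_eu by auto
  have "convex ({0..1} \<times> {0..1} :: (real \<times> real) set)" by (intro convex_Times) auto
  then have "path_class Y (\<lambda>s. k (?u s)) = path_class Y (\<lambda>s. k (?v s))"
    by (rule path_class_convex[OF _ k uv(1) funcset_mem[OF uv(2)] uv(3) funcset_mem[OF uv(4)]]) simp_all
  then show ?thesis
    unfolding path_cat_compose[of k "\<lambda>s. (s, 0)" "\<lambda>t. (1, t)"] path_cat_compose[of k "\<lambda>t. (0, t)" "\<lambda>s. (s, 1)"] .
qed

subsection \<open>The groupoid of path classes\<close>

lemma path_classesE: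
  assumes "c \<in> path_classes Y"
  obtains \<alpha> where "pathin Y \<alpha>" "c = path_class Y \<alpha>"
  using assms unfolding path_classes_def by blast

lemma path_class_in: "pathin Y \<alpha> ==> path_class Y \<alpha> \<in> path_classes Y"
  unfolding path_classes_def by blast

lemma class_ends [simp]:
  assumes "pathin Y \<alpha>"
  shows "class_start (path_class Y \<alpha>) = \<alpha> 0" "class_end (path_class Y \<alpha>) = \<alpha> 1"
proof -
  have "\<alpha> \<in> path_class Y \<alpha>" using assms by (simp add: mem_path_class path_homotopic_refl)
  then have "(SOME \<beta>. \<beta> \<in> path_class Y \<alpha>) \<in> path_class Y \<alpha>" by (rule someI[of "\<lambda>\<beta>. \<beta> \<in> path_class Y \<alpha>"])
  then show "class_start (path_class Y \<alpha>) = \<alpha> 0" "class_end (path_class Y \<alpha>) = \<alpha> 1"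
    unfolding class_start_def class_end_def mem_path_class using path_homotopic_ends by blast+
qed

lemma pathin_topspace: "pathin Y \<alpha> ==> s \<in> {0..1} ==> \<alpha> s \<in> topspace Y"
  unfolding pathin_def continuous_map_def by auto

lemma class_ends_in:
  assumes "c \<in> path_classes Y"
  shows "class_start c \<in> topspace Y" "class_end c \<in> topspace Y"
proof -
  obtain \<alpha> where a: "pathin Y \<alpha>" "c = path_class Y \<alpha>" using assms by (rule path_classesE)
  show "class_start c \<in> topspace Y" "class_end c \<in> topspace Y"
    unfolding a(2) class_ends[OF a(1)] by (rule pathin_topspace[OF a(1)]; simp)+
qed

lemma class_mul_path:
  assumes a: "pathin Y \<alpha>" and b: "pathin Y \<beta>" and e: "\<alpha> 1 = \<beta> 0"
  shows "class_mul Y (path_class Y \<alpha>) (path_class Y \<beta>) = path_class Y (path_cat \<alpha> \<beta>)"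
proof -
  have "path_class Y (path_cat \<alpha>' \<beta>') = path_class Y (path_cat \<alpha> \<beta>)"
    if "\<alpha>' \<in> path_class Y \<alpha>" "\<beta>' \<in> path_class Y \<beta>" for \<alpha>' \<beta>'
    using path_class_eqI[OF path_homotopic_cat[of Y \<alpha> \<alpha>' \<beta> \<beta>']] that e by (simp add: mem_path_class)
  moreover have "\<alpha> \<in> path_class Y \<alpha>" "\<beta> \<in> path_class Y \<beta>"
    using a b by (simp_all add: mem_path_class path_homotopic_refl)
  ultimately show ?thesis unfolding class_mul_def by blast
qed

lemma pathin_rev: "pathin Y \<alpha> ==> pathin Y (\<lambda>t. \<alpha> (1 - t))"
  by (rule pathin_reparam) (auto intro!: continuous_intros)

lemma class_inv_path:
  assumes a: "pathin Y \<alpha>"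
  shows "class_inv Y (path_class Y \<alpha>) = path_class Y (\<lambda>t. \<alpha> (1 - t))"
proof -
  have "path_class Y (\<lambda>t. \<alpha>' (1 - t)) = path_class Y (\<lambda>t. \<alpha> (1 - t))" if m: "\<alpha>' \<in> path_class Y \<alpha>" for \<alpha>'
  proof -
    obtain h :: "real \<times> real => _" where h: "continuous_map (top_of_set square) Y h"
     "\<forall>s\<in>{0..1}. h (0, s) = \<alpha> s" "\<forall>s\<in>{0..1}. h (1, s) = \<alpha>' s"
     "\<forall>t\<in>{0..1}. h (t, 0) = \<alpha> 0 \<and> h (t, 1) = \<alpha> 1"
      using m unfolding mem_path_class path_homotopic_iff by blast
    have "path_homotopic Y (\<lambda>t. \<alpha> (1 - t)) (\<lambda>t. \<alpha>' (1 - t))"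
    proof (rule path_homotopicI)
      show "continuous_map (top_of_set square) Y (\<lambda>q. h (fst q, 1 - snd q))"
        by (rule continuous_map_top_of_set_compose[OF h(1)]) (auto intro!: continuous_intros)
    qed (use h in auto)
    from path_class_eqI[OF this] show ?thesis by simp
  qed
  moreover have "\<alpha> \<in> path_class Y \<alpha>" using a by (simp add: mem_path_class path_homotopic_refl)
  ultimately show ?thesis unfolding class_inv_def by blast
qed

lemma class_map_path:
  assumes a: "pathin Y \<alpha>" and f: "continuous_map Y Y' f"
  shows "class_map Y' f (path_class Y \<alpha>) = path_class Y' (\<lambda>s. f (\<alpha> s))"
proof -
  have "path_class Y' (f \<circ> \<alpha>') = path_class Y' (\<lambda>s. f (\<alpha> s))" if m: "\<alpha>' \<in> path_class Y \<alpha>" for \<alpha>'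
  proof -
    obtain h :: "real \<times> real => _" where h: "continuous_map (top_of_set square) Y h"
     "\<forall>s\<in>{0..1}. h (0, s) = \<alpha> s" "\<forall>s\<in>{0..1}. h (1, s) = \<alpha>' s"
     "\<forall>t\<in>{0..1}. h (t, 0) = \<alpha> 0 \<and> h (t, 1) = \<alpha> 1"
      using m unfolding mem_path_class path_homotopic_iff by blast
    have "path_homotopic Y' (\<lambda>s. f (\<alpha> s)) (f \<circ> \<alpha>')"
    proof (rule path_homotopicI)
      show "continuous_map (top_of_set square) Y' (\<lambda>q. f (h q))"
        using continuous_map_compose[OF h(1) f] by (simp add: o_def)
    qed (use h in auto)
    from path_class_eqI[OF this] show ?thesis by simp
  qed
  moreover have "\<alpha> \<in> path_class Y \<alpha>" using a by (simp add: mem_path_class path_homotopic_refl)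
  ultimately show ?thesis unfolding class_map_def by blast
qed

lemma pathin_map: "pathin Y \<alpha> ==> continuous_map Y Y' f ==> pathin Y' (\<lambda>s. f (\<alpha> s))"
  using pathin_compose[of Y \<alpha> Y' f] by (simp add: o_def)

lemma class_mul_in:
  assumes "c \<in> path_classes Y" "d \<in> path_classes Y" "class_end c = class_start d"
  shows "class_mul Y c d \<in> path_classes Y" "class_start (class_mul Y c d) = class_start c"
    "class_end (class_mul Y c d) = class_end d"
proof -
  obtain \<alpha> where a: "pathin Y \<alpha>" "c = path_class Y \<alpha>" using assms(1) by (rule path_classesE)
  obtain \<beta> where b: "pathin Y \<beta>" "d = path_class Y \<beta>" using assms(2) by (rule path_classesE)
  have e: "\<alpha> 1 = \<beta> 0" using assms(3) a b by simp
  show "class_mul Y c d \<in> path_classes Y" "class_start (class_mul Y c d) = class_start c"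
    "class_end (class_mul Y c d) = class_end d"
    unfolding a(2) b(2) class_mul_path[OF a(1) b(1) e]
    using a b pathin_cat[OF a(1) b(1) e] by (simp_all add: path_class_in)
qed

lemma class_mul_assoc:
  assumes "c \<in> path_classes Y" "d \<in> path_classes Y" "e \<in> path_classes Y"
    "class_end c = class_start d" "class_end d = class_start e"
  shows "class_mul Y (class_mul Y c d) e = class_mul Y c (class_mul Y d e)"
proof -
  obtain \<alpha> where a: "pathin Y \<alpha>" "c = path_class Y \<alpha>" using assms(1) by (rule path_classesE)
  obtain \<beta> where b: "pathin Y \<beta>" "d = path_class Y \<beta>" using assms(2) by (rule path_classesE)
  obtain \<gamma> where g: "pathin Y \<gamma>" "e = path_class Y \<gamma>" using assms(3) by (rule path_classesE)
  have ab: "\<alpha> 1 = \<beta> 0" and bg: "\<beta> 1 = \<gamma> 0" using assms(4,5) a b g by simp_all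
  note pab = pathin_cat[OF a(1) b(1) ab] and pbg = pathin_cat[OF b(1) g(1) bg]
  have p: "pathin Y (path_cat \<alpha> (path_cat \<beta> \<gamma>))" by (rule pathin_cat[OF a(1) pbg]) (simp add: ab)
  define u where "u s = min (2 * s) (min (s + 1/4) (s/2 + 1/2))" for s :: real
  have "path_cat (path_cat \<alpha> \<beta>) \<gamma> = (\<lambda>s. path_cat \<alpha> (path_cat \<beta> \<gamma>) (u s))"
  proof
    fix s :: real
    consider "s \<le> 1/4" | "1/4 < s" "s \<le> 1/2" | "1/2 < s" by linarith
    then show "path_cat (path_cat \<alpha> \<beta>) \<gamma> s = path_cat \<alpha> (path_cat \<beta> \<gamma>) (u s)"
    proof cases
      case 1
      then have "u s = 2 * s" by (simp add: u_def min_def)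
      then show ?thesis using 1 by (simp add: path_cat_def)
    next
      case 2
      then have "u s = s + 1/4" by (simp add: u_def min_def)
      then show ?thesis using 2 by (simp add: path_cat_def algebra_simps)
    next
      case 3
      then have "u s = s/2 + 1/2" by (simp add: u_def min_def)
      then show ?thesis using 3 by (simp add: path_cat_def)
    qed
  qed
  moreover have "path_class Y (\<lambda>s. path_cat \<alpha> (path_cat \<beta> \<gamma>) (u s)) = path_class Y (path_cat \<alpha> (path_cat \<beta> \<gamma>))"
    by (rule path_class_reparam_id[OF p]) (auto simp: u_def intro!: continuous_intros)
  ultimately show ?thesis
    unfolding a(2) b(2) g(2) using a(1) b(1) g(1) ab bg pab pbg by (simp add: class_mul_path)
qed

lemma pathin_const_iff: "pathin Y (\<lambda>_. y) \<longleftrightarrow> y \<in> topspace Y"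
  by (simp add: pathin_def)

lemma class_mul_idl:
  assumes "c \<in> path_classes Y"
  shows "class_mul Y (path_class Y (\<lambda>_. class_start c)) c = c"
proof -
  obtain \<alpha> where a: "pathin Y \<alpha>" "c = path_class Y \<alpha>" using assms by (rule path_classesE)
  have "path_cat (\<lambda>_. \<alpha> 0) \<alpha> = (\<lambda>s. \<alpha> (max 0 (2 * s - 1)))"
  proof
    fix s :: real
    consider "s < 1/2" | "s = 1/2" | "s > 1/2" by linarith
    then show "path_cat (\<lambda>_. \<alpha> 0) \<alpha> s = \<alpha> (max 0 (2 * s - 1))"
    proof cases
      case 2
      show ?thesis unfolding 2 by (simp add: path_cat_def)
    qed (simp_all add: path_cat_def max_def)
  qed
  moreover have "path_class Y (\<lambda>s. \<alpha> (max 0 (2 * s - 1))) = path_class Y \<alpha>"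
    by (rule path_class_reparam_id[OF a(1)]) (auto intro!: continuous_intros)
  ultimately show ?thesis
    unfolding a(2) using a(1) pathin_topspace[OF a(1), of 0] by (simp add: class_mul_path pathin_const_iff)
qed

lemma class_mul_idr:
  assumes "c \<in> path_classes Y"
  shows "class_mul Y c (path_class Y (\<lambda>_. class_end c)) = c"
proof -
  obtain \<alpha> where a: "pathin Y \<alpha>" "c = path_class Y \<alpha>" using assms by (rule path_classesE)
  have "path_cat \<alpha> (\<lambda>_. \<alpha> 1) = (\<lambda>s. \<alpha> (min 1 (2 * s)))"
  proof
    fix s :: real
    consider "s < 1/2" | "s = 1/2" | "s > 1/2" by linarith
    then show "path_cat \<alpha> (\<lambda>_. \<alpha> 1) s = \<alpha> (min 1 (2 * s))"
    proof cases
      case 2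
      show ?thesis unfolding 2 by (simp add: path_cat_def)
    qed (simp_all add: path_cat_def min_def)
  qed
  moreover have "path_class Y (\<lambda>s. \<alpha> (min 1 (2 * s))) = path_class Y \<alpha>"
    by (rule path_class_reparam_id[OF a(1)]) (auto intro!: continuous_intros)
  ultimately show ?thesis
    unfolding a(2) using a(1) pathin_topspace[OF a(1), of 1] by (simp add: class_mul_path pathin_const_iff)
qed

lemma class_inv_in:
  assumes "c \<in> path_classes Y"
  shows "class_inv Y c \<in> path_classes Y" "class_start (class_inv Y c) = class_end c"
    "class_end (class_inv Y c) = class_start c"
proof -
  obtain \<alpha> where a: "pathin Y \<alpha>" "c = path_class Y \<alpha>" using assms by (rule path_classesE)
  show "class_inv Y c \<in> path_classes Y" "class_start (class_inv Y c) = class_end c"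
    "class_end (class_inv Y c) = class_start c"
    unfolding a(2) class_inv_path[OF a(1)] using a(1) pathin_rev[OF a(1)] by (simp_all add: path_class_in)
qed

lemma class_mul_inv_right:
  assumes "c \<in> path_classes Y"
  shows "class_mul Y c (class_inv Y c) = path_class Y (\<lambda>_. class_start c)"
proof -
  obtain \<alpha> where a: "pathin Y \<alpha>" "c = path_class Y \<alpha>" using assms by (rule path_classesE)
  have "path_cat \<alpha> (\<lambda>t. \<alpha> (1 - t)) = (\<lambda>s. \<alpha> (min (2 * s) (2 - 2 * s)))"
    by (auto simp: path_cat_def min_def)
  moreover have "path_class Y (\<lambda>s. \<alpha> (min (2 * s) (2 - 2 * s))) = path_class Y (\<lambda>s. \<alpha> 0)"
    by (rule path_class_reparam[OF a(1)]) (auto intro!: continuous_intros)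
  ultimately show ?thesis
    unfolding a(2) using a(1) pathin_rev[OF a(1)] by (simp add: class_mul_path class_inv_path)
qed

lemma class_mul_inv_left:
  assumes "c \<in> path_classes Y"
  shows "class_mul Y (class_inv Y c) c = path_class Y (\<lambda>_. class_end c)"
proof -
  obtain \<alpha> where a: "pathin Y \<alpha>" "c = path_class Y \<alpha>" using assms by (rule path_classesE)
  have "path_cat (\<lambda>t. \<alpha> (1 - t)) \<alpha> = (\<lambda>s. \<alpha> \<bar>1 - 2 * s\<bar>)"
    by (auto simp: path_cat_def)
  moreover have "path_class Y (\<lambda>s. \<alpha> \<bar>1 - 2 * s\<bar>) = path_class Y (\<lambda>s. \<alpha> 1)"
    by (rule path_class_reparam[OF a(1)]) (auto intro!: continuous_intros)
  ultimately show ?thesis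
    unfolding a(2) using a(1) pathin_rev[OF a(1)] by (simp add: class_mul_path class_inv_path)
qed

lemma class_mul_inv_cancel:
  assumes c: "c \<in> path_classes Y" and d: "d \<in> path_classes Y"
  shows "class_end c = class_start d ==> class_mul Y (class_mul Y c d) (class_inv Y d) = c"
    and "class_end c = class_end d ==> class_mul Y (class_mul Y c (class_inv Y d)) d = c"
    and "class_end c = class_start d ==> class_mul Y (class_inv Y c) (class_mul Y c d) = d"
    and "class_start c = class_start d ==> class_mul Y c (class_mul Y (class_inv Y c) d) = d"
proof -
  note inv = class_inv_in[OF c] class_inv_in[OF d]
  show "class_mul Y (class_mul Y c d) (class_inv Y d) = c" if e: "class_end c = class_start d"
    using class_mul_assoc[OF c d inv(4)] class_mul_inv_right[OF d] class_mul_idr[OF c] inv e by simp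
  show "class_mul Y (class_mul Y c (class_inv Y d)) d = c" if e: "class_end c = class_end d"
    using class_mul_assoc[OF c inv(4) d] class_mul_inv_left[OF d] class_mul_idr[OF c] inv e by simp
  show "class_mul Y (class_inv Y c) (class_mul Y c d) = d" if e: "class_end c = class_start d"
    using class_mul_assoc[OF inv(1) c d] class_mul_inv_left[OF c] class_mul_idl[OF d] inv e by simp
  show "class_mul Y c (class_mul Y (class_inv Y c) d) = d" if e: "class_start c = class_start d"
    using class_mul_assoc[OF c inv(1) d] class_mul_inv_right[OF c] class_mul_idl[OF d] inv e by simp
qed

lemma class_mul_cancel_left:
  assumes "c \<in> path_classes Y" "d \<in> path_classes Y" "d' \<in> path_classes Y"
    "class_end c = class_start d" "class_end c = class_start d'" "class_mul Y c d = class_mul Y c d'"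
  shows "d = d'"
  using class_mul_inv_cancel(3)[OF assms(1,2,4)] class_mul_inv_cancel(3)[OF assms(1,3,5)] assms(6) by metis

lemma class_mul_cancel_right:
  assumes "c \<in> path_classes Y" "d \<in> path_classes Y" "d' \<in> path_classes Y"
    "class_end d = class_start c" "class_end d' = class_start c" "class_mul Y d c = class_mul Y d' c"
  shows "d = d'"
  using class_mul_inv_cancel(1)[OF assms(2,1,4)] class_mul_inv_cancel(1)[OF assms(3,1,5)] assms(6) by metis

lemma class_map_in:
  assumes "c \<in> path_classes Y" "continuous_map Y Y' f"
  shows "class_map Y' f c \<in> path_classes Y'" "class_start (class_map Y' f c) = f (class_start c)"
    "class_end (class_map Y' f c) = f (class_end c)"
proof -
  obtain \<alpha> where a: "pathin Y \<alpha>" "c = path_class Y \<alpha>" using assms(1) by (rule path_classesE)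
  show "class_map Y' f c \<in> path_classes Y'" "class_start (class_map Y' f c) = f (class_start c)"
    "class_end (class_map Y' f c) = f (class_end c)"
    unfolding a(2) class_map_path[OF a(1) assms(2)] using a(1) pathin_map[OF a(1) assms(2)]
    by (simp_all add: path_class_in)
qed

lemma class_map_mul:
  assumes "c \<in> path_classes Y" "d \<in> path_classes Y" "class_end c = class_start d" and f: "continuous_map Y Y' f"
  shows "class_map Y' f (class_mul Y c d) = class_mul Y' (class_map Y' f c) (class_map Y' f d)"
proof -
  obtain \<alpha> where a: "pathin Y \<alpha>" "c = path_class Y \<alpha>" using assms(1) by (rule path_classesE)
  obtain \<beta> where b: "pathin Y \<beta>" "d = path_class Y \<beta>" using assms(2) by (rule path_classesE)
  have e: "\<alpha> 1 = \<beta> 0" using assms(3) a b by simp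
  have "class_map Y' f (class_mul Y c d) = path_class Y' (\<lambda>s. f (path_cat \<alpha> \<beta> s))"
    unfolding a(2) b(2) class_mul_path[OF a(1) b(1) e] by (rule class_map_path[OF pathin_cat[OF a(1) b(1) e] f])
  moreover have "class_mul Y' (class_map Y' f c) (class_map Y' f d) = path_class Y' (path_cat (\<lambda>s. f (\<alpha> s)) (\<lambda>s. f (\<beta> s)))"
    unfolding a(2) b(2) class_map_path[OF a(1) f] class_map_path[OF b(1) f]
    using class_mul_path[OF pathin_map[OF a(1) f] pathin_map[OF b(1) f]] e by simp
  ultimately show ?thesis unfolding path_cat_compose[of f] by simp
qed

lemma class_map_id:
  assumes "y \<in> topspace Y" "continuous_map Y Y' f"
  shows "class_map Y' f (path_class Y (\<lambda>_. y)) = path_class Y' (\<lambda>_. f y)"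
  using class_map_path[of Y "\<lambda>_. y" Y' f] assms by (simp add: pathin_const_iff)

section \<open>The topology on path classes\<close>

lemma path_nbhd_mono: "U' \<subseteq> U ==> V' \<subseteq> V ==> path_nbhd Y U' V' \<alpha> \<subseteq> path_nbhd Y U V \<alpha>"
  using path_nbhd_Int[of Y U U' V V' \<alpha>] by (simp add: Int_absorb1)

lemma pathin_subtopologyD: "pathin (subtopology Y U) \<beta> ==> pathin Y \<beta>"
  "pathin (subtopology Y U) \<beta> ==> s \<in> {0..1} ==> \<beta> s \<in> U"
  unfolding pathin_def continuous_map_in_subtopology by auto

lemma pathin_subtopologyI: "pathin Y \<beta> ==> (\<And>s. s \<in> {0..1} ==> \<beta> s \<in> U) ==> pathin (subtopology Y U) \<beta>"
  unfolding pathin_def continuous_map_in_subtopology by auto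

text \<open>
  Membership in \<open>path_nbhd\<close> in terms of the groupoid. We write \<open>U\<close>-small for a class with a
  representative in \<open>U\<close>.
\<close>

definition small_class :: "'a topology => 'a set => (real => 'a) set => bool" where
  "small_class Y U b \<longleftrightarrow> (\<exists>\<beta>. pathin (subtopology Y U) \<beta> \<and> b = path_class Y \<beta>)"

lemma small_classD:
  assumes "small_class Y U b"
  shows "b \<in> path_classes Y" "class_start b \<in> U" "class_end b \<in> U"
proof -
  obtain \<beta> where b: "pathin (subtopology Y U) \<beta>" "b = path_class Y \<beta>" using assms unfolding small_class_def by blast
  show "b \<in> path_classes Y" "class_start b \<in> U" "class_end b \<in> U"
    unfolding b(2) using pathin_subtopologyD[OF b(1)] by (simp_all add: path_class_in)
qed

lemma small_class_mono: "small_class Y U b ==> U \<subseteq> V ==> small_class Y V b"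
  unfolding small_class_def using pathin_subtopologyD pathin_subtopologyI by (metis subsetD)

lemma small_class_mul:
  assumes "small_class Y U b" "small_class Y U c" "class_end b = class_start c"
  shows "small_class Y U (class_mul Y b c)"
proof -
  obtain \<beta> where b: "pathin (subtopology Y U) \<beta>" "b = path_class Y \<beta>" using assms(1) unfolding small_class_def by blast
  obtain \<gamma> where c: "pathin (subtopology Y U) \<gamma>" "c = path_class Y \<gamma>" using assms(2) unfolding small_class_def by blast
  note bY = pathin_subtopologyD(1)[OF b(1)] and cY = pathin_subtopologyD(1)[OF c(1)]
  have e: "\<beta> 1 = \<gamma> 0" using assms(3) bY cY by (simp add: b c)
  show ?thesis unfolding small_class_def b(2) c(2) class_mul_path[OF bY cY e]
    using pathin_cat[OF b(1) c(1) e] by blast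
qed

lemma small_class_inv:
  assumes "small_class Y U b"
  shows "small_class Y U (class_inv Y b)"
proof -
  obtain \<beta> where b: "pathin (subtopology Y U) \<beta>" "b = path_class Y \<beta>" using assms(1) unfolding small_class_def by blast
  show ?thesis unfolding small_class_def b(2) class_inv_path[OF pathin_subtopologyD(1)[OF b(1)]]
    using pathin_rev[OF b(1)] by blast
qed

lemma small_class_const:
  assumes "y \<in> topspace Y" "y \<in> U"
  shows "small_class Y U (path_class Y (\<lambda>_. y))"
proof -
  have "pathin (subtopology Y U) (\<lambda>_. y)" using assms by (simp add: pathin_const_iff)
  then show ?thesis unfolding small_class_def by blast
qed

lemma path_nbhd_iff:
  assumes a: "pathin Y \<alpha>"
  shows "c \<in> path_nbhd Y U V \<alpha> \<longleftrightarrow> (\<exists>b d. small_class Y U b \<and> small_class Y V d \<and>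
     class_end b = \<alpha> 0 \<and> class_start d = \<alpha> 1 \<and> c = class_mul Y b (class_mul Y (path_class Y \<alpha>) d))"
    (is "_ \<longleftrightarrow> ?R")
proof
  assume "c \<in> path_nbhd Y U V \<alpha>"
  then obtain \<beta> \<delta> where *: "pathin (subtopology Y U) \<beta>" "\<beta> 1 = \<alpha> 0" "pathin (subtopology Y V) \<delta>" "\<delta> 0 = \<alpha> 1"
    "c = path_class Y (path_cat \<beta> (path_cat \<alpha> \<delta>))" unfolding path_nbhd_def by blast
  note b = pathin_subtopologyD(1)[OF *(1)] and d = pathin_subtopologyD(1)[OF *(3)]
  have "c = class_mul Y (path_class Y \<beta>) (class_mul Y (path_class Y \<alpha>) (path_class Y \<delta>))"
    using *(2,4,5) a b d pathin_cat[OF a d] by (simp add: class_mul_path)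
  moreover have "small_class Y U (path_class Y \<beta>)" "small_class Y V (path_class Y \<delta>)"
    using * unfolding small_class_def by blast+
  ultimately show ?R using b d *(2,4) by (intro exI[of _ "path_class Y \<beta>"] exI[of _ "path_class Y \<delta>"]) simp
next
  assume ?R
  then obtain b d where bd: "small_class Y U b" "small_class Y V d" "class_end b = \<alpha> 0" "class_start d = \<alpha> 1"
    "c = class_mul Y b (class_mul Y (path_class Y \<alpha>) d)" by blast
  obtain \<beta> where \<beta>: "pathin (subtopology Y U) \<beta>" "b = path_class Y \<beta>" using bd(1) unfolding small_class_def by blast
  obtain \<delta> where \<delta>: "pathin (subtopology Y V) \<delta>" "d = path_class Y \<delta>" using bd(2) unfolding small_class_def by blast
  note b = pathin_subtopologyD(1)[OF \<beta>(1)] and d = pathin_subtopologyD(1)[OF \<delta>(1)]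
  have e: "\<beta> 1 = \<alpha> 0" "\<delta> 0 = \<alpha> 1" using bd(3,4) b d by (simp_all add: \<beta> \<delta>)
  then have "c = path_class Y (path_cat \<beta> (path_cat \<alpha> \<delta>))"
    using a b d pathin_cat[OF a d] unfolding bd(5) \<beta>(2) \<delta>(2) by (simp add: class_mul_path)
  then show "c \<in> path_nbhd Y U V \<alpha>" unfolding path_nbhd_def using \<beta>(1) \<delta>(1) e by blast
qed

lemma path_nbhd_facts:
  assumes a: "a \<in> path_classes Y" and b: "small_class Y U b" and d: "small_class Y V d"
    and e: "class_end b = class_start a" "class_start d = class_end a"
  shows "class_mul Y b (class_mul Y a d) \<in> path_classes Y"
    "class_start (class_mul Y b (class_mul Y a d)) = class_start b"
    "class_end (class_mul Y b (class_mul Y a d)) = class_end d"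
  using assms small_classD(1)[OF b] small_classD(1)[OF d] by (simp_all add: class_mul_in)

lemma path_nbhd_subset: "pathin Y \<alpha> ==> path_nbhd Y U V \<alpha> \<subseteq> path_classes Y"
proof
  fix c assume p: "pathin Y \<alpha>" and "c \<in> path_nbhd Y U V \<alpha>"
  then obtain b d where bd: "small_class Y U b" "small_class Y V d" "class_end b = \<alpha> 0" "class_start d = \<alpha> 1"
    "c = class_mul Y b (class_mul Y (path_class Y \<alpha>) d)" unfolding path_nbhd_iff[OF p] by blast
  show "c \<in> path_classes Y"
    unfolding bd(5) by (rule path_nbhd_facts(1)[OF path_class_in[OF p] bd(1,2)]) (simp_all add: bd(3,4) p)
qed

lemma path_nbhd_self:
  assumes "pathin Y \<alpha>" "\<alpha> 0 \<in> U" "\<alpha> 1 \<in> V"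
  shows "path_class Y \<alpha> \<in> path_nbhd Y U V \<alpha>"
proof -
  have t: "\<alpha> 0 \<in> topspace Y" "\<alpha> 1 \<in> topspace Y" using pathin_topspace[OF assms(1)] by auto
  have c: "path_class Y \<alpha> \<in> path_classes Y" by (rule path_class_in[OF assms(1)])
  have "path_class Y \<alpha> = class_mul Y (path_class Y (\<lambda>_. \<alpha> 0)) (class_mul Y (path_class Y \<alpha>) (path_class Y (\<lambda>_. \<alpha> 1)))"
    using class_mul_idl[OF c] class_mul_idr[OF c] assms(1) by simp
  then show ?thesis
    unfolding path_nbhd_iff[OF assms(1)]
    using small_class_const[OF t(1) assms(2)] small_class_const[OF t(2) assms(3)] t
    by (intro exI[of _ "path_class Y (\<lambda>_. \<alpha> 0)"] exI[of _ "path_class Y (\<lambda>_. \<alpha> 1)"]) (simp add: pathin_const_iff)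
qed

lemma path_nbhd_trans:
  assumes a: "pathin Y \<alpha>" and g: "pathin Y \<gamma>" and m: "path_class Y \<gamma> \<in> path_nbhd Y U V \<alpha>"
  shows "path_nbhd Y U V \<gamma> \<subseteq> path_nbhd Y U V \<alpha>"
proof
  fix c assume "c \<in> path_nbhd Y U V \<gamma>"
  then obtain b d where bd: "small_class Y U b" "small_class Y V d" "class_end b = \<gamma> 0" "class_start d = \<gamma> 1"
    "c = class_mul Y b (class_mul Y (path_class Y \<gamma>) d)" unfolding path_nbhd_iff[OF g] by blast
  obtain b' d' where bd': "small_class Y U b'" "small_class Y V d'" "class_end b' = \<alpha> 0" "class_start d' = \<alpha> 1"
    "path_class Y \<gamma> = class_mul Y b' (class_mul Y (path_class Y \<alpha>) d')" using m unfolding path_nbhd_iff[OF a] by blast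
  note ins = small_classD(1)[OF bd(1)] small_classD(1)[OF bd(2)] small_classD(1)[OF bd'(1)] small_classD(1)[OF bd'(2)]
    path_class_in[OF a]
  have e: "class_start b' = \<gamma> 0" "class_end d' = \<gamma> 1"
    using path_nbhd_facts(2,3)[OF path_class_in[OF a] bd'(1,2)] bd'(3-5) a class_ends[OF g] by simp_all
  have "c = class_mul Y (class_mul Y b b') (class_mul Y (path_class Y \<alpha>) (class_mul Y d' d))"
    unfolding bd(5) bd'(5) using ins e bd bd' a by (simp add: class_mul_assoc class_mul_in)
  moreover have "small_class Y U (class_mul Y b b')" "small_class Y V (class_mul Y d' d)"
    using bd bd' e by (simp_all add: small_class_mul)
  moreover have "class_end (class_mul Y b b') = \<alpha> 0" "class_start (class_mul Y d' d) = \<alpha> 1"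
    using ins bd bd' e by (simp_all add: class_mul_in)
  ultimately show "c \<in> path_nbhd Y U V \<alpha>" unfolding path_nbhd_iff[OF a] by blast
qed

text \<open>
  A set \<open>path_nbhd Y U V \<alpha>\<close> contains, around each of its elements \<open>[\<gamma>]\<close>, the set
  \<open>path_nbhd Y U V \<gamma>\<close>.
\<close>

lemma path_nbhd_open:
  assumes a: "pathin Y \<alpha>" and U: "openin Y U" and V: "openin Y V"
  shows "path_class_open Y (path_nbhd Y U V \<alpha>)"
  unfolding path_class_open_def
proof (intro conjI allI impI)
  show "path_nbhd Y U V \<alpha> \<subseteq> path_classes Y" by (rule path_nbhd_subset[OF a])
  fix \<gamma> assume g: "pathin Y \<gamma> \<and> path_class Y \<gamma> \<in> path_nbhd Y U V \<alpha>"
  then obtain b d where bd: "small_class Y U b" "small_class Y V d" "class_end b = \<alpha> 0" "class_start d = \<alpha> 1"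
    "path_class Y \<gamma> = class_mul Y b (class_mul Y (path_class Y \<alpha>) d)" unfolding path_nbhd_iff[OF a] by blast
  have "class_start b = \<gamma> 0" "class_end d = \<gamma> 1"
    using path_nbhd_facts(2,3)[OF path_class_in[OF a] bd(1,2)] bd(3-5) a class_ends[OF conjunct1[OF g]] by simp_all
  then have "\<gamma> 0 \<in> U" "\<gamma> 1 \<in> V" using small_classD[OF bd(1)] small_classD[OF bd(2)] by auto
  then show "\<exists>U' V'. openin Y U' \<and> openin Y V' \<and> \<gamma> 0 \<in> U' \<and> \<gamma> 1 \<in> V' \<and> path_nbhd Y U' V' \<gamma> \<subseteq> path_nbhd Y U V \<alpha>"
    using path_nbhd_trans[OF a] g U V by blast
qed

lemma topspace_path_class_top [simp]: "topspace (path_class_top Y) = path_classes Y"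
proof -
  have "path_class_open Y (path_classes Y)"
    unfolding path_class_open_def
  proof (intro conjI allI impI)
    fix \<alpha> assume "pathin Y \<alpha> \<and> path_class Y \<alpha> \<in> path_classes Y"
    then show "\<exists>U V. openin Y U \<and> openin Y V \<and> \<alpha> 0 \<in> U \<and> \<alpha> 1 \<in> V \<and> path_nbhd Y U V \<alpha> \<subseteq> path_classes Y"
      using path_nbhd_subset[of Y \<alpha> "topspace Y" "topspace Y"] pathin_topspace[of Y \<alpha> 0] pathin_topspace[of Y \<alpha> 1]
      by (intro exI[of _ "topspace Y"]) auto
  qed simp
  then show ?thesis
    unfolding topspace_def openin_path_class_top by (auto simp: path_class_open_def)
qed

text \<open>Continuity at a class in terms of the neighbourhoods \<open>path_nbhd\<close>.\<close>

lemma path_class_openD: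
  assumes "path_class_open Y W" "pathin Y \<alpha>" "path_class Y \<alpha> \<in> W"
  obtains U V where "openin Y U" "openin Y V" "\<alpha> 0 \<in> U" "\<alpha> 1 \<in> V" "path_nbhd Y U V \<alpha> \<subseteq> W"
  using assms unfolding path_class_open_def by blast

definition endpts :: "(real => 'a) set => 'a \<times> 'a" where
  "endpts c = (class_end c, class_start c)"

lemma cont_at_endpts:
  assumes "c \<in> path_classes Y"
  shows "cont_at (path_class_top Y) (prod_topology Y Y) endpts c"
  unfolding cont_at_def
proof (intro conjI allI impI)
  show "c \<in> topspace (path_class_top Y)" "endpts c \<in> topspace (prod_topology Y Y)"
    using assms class_ends_in by (auto simp: endpts_def)
  fix O' assume O': "openin (prod_topology Y Y) O' \<and> endpts c \<in> O'"
  obtain \<alpha> where a: "pathin Y \<alpha>" "c = path_class Y \<alpha>" using assms by (rule path_classesE)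
  have e: "(\<alpha> 1, \<alpha> 0) \<in> O'" using O' a by (simp add: endpts_def)
  obtain V U where VU: "openin Y V" "openin Y U" "\<alpha> 1 \<in> V" "\<alpha> 0 \<in> U" "V \<times> U \<subseteq> O'"
    by (rule openin_prod_topology_box[OF conjunct1[OF O'] e])
  have "endpts x \<in> O'" if x: "x \<in> path_nbhd Y U V \<alpha>" for x
  proof -
    obtain b d where bd: "small_class Y U b" "small_class Y V d" "class_end b = \<alpha> 0" "class_start d = \<alpha> 1"
      "x = class_mul Y b (class_mul Y (path_class Y \<alpha>) d)" using x unfolding path_nbhd_iff[OF a(1)] by blast
    have "class_start x = class_start b" "class_end x = class_end d"
      using path_nbhd_facts(2,3)[OF path_class_in[OF a(1)] bd(1,2)] bd(3-5) a by auto
    then show ?thesis using small_classD[OF bd(1)] small_classD[OF bd(2)] VU(5) by (auto simp: endpts_def)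
  qed
  then show "\<exists>W. openin (path_class_top Y) W \<and> c \<in> W \<and> endpts ` W \<subseteq> O'"
    using path_nbhd_open[OF a(1) VU(2,1)] path_nbhd_self[OF a(1) VU(4,3)] a(2)
    by (intro exI[of _ "path_nbhd Y U V \<alpha>"]) auto
qed

text \<open>
  Uniqueness refers to homotopies in \<open>Y\<close>, not in \<open>U\<close>, so that \<open>locally_nice\<close> amounts to local path
  connectedness together with semilocal simple connectedness.
\<close>

definition nice :: "'a topology => 'a set => bool" where
  "nice Y U \<longleftrightarrow>
     (\<forall>x\<in>U. \<forall>y\<in>U. \<exists>b. small_class Y U b \<and> class_start b = x \<and> class_end b = y) \<and>
     (\<forall>b c. small_class Y U b \<and> small_class Y U c \<and> class_start b = class_start c \<and> class_end b = class_end c --> b = c)"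

lemma nice_join:
  assumes "nice Y U" "x \<in> U" "y \<in> U"
  obtains b where "small_class Y U b" "class_start b = x" "class_end b = y"
  using assms unfolding nice_def by blast

lemma nice_unique:
  "nice Y U ==> small_class Y U b ==> small_class Y U c ==> class_start b = class_start c ==>
     class_end b = class_end c ==> b = c"
  unfolding nice_def by blast

definition locally_nice :: "'a topology => bool" where
  "locally_nice Y \<longleftrightarrow> (\<forall>U x. openin Y U \<and> x \<in> U --> (\<exists>V. openin Y V \<and> x \<in> V \<and> V \<subseteq> U \<and> nice Y V))"

lemma locally_niceE:
  assumes "locally_nice Y" "openin Y U" "x \<in> U"
  obtains V where "openin Y V" "x \<in> V" "V \<subseteq> U" "nice Y V"
  using assms unfolding locally_nice_def by blast

text \<open>
  In nice neighbourhoods of the ends of \<open>\<alpha>\<close>, the small classes that extend \<open>\<alpha>\<close> exist and are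
  determined by their ends. This makes the end point map a local homeomorphism.
\<close>

lemma path_nbhd_nice:
  assumes a: "pathin Y \<alpha>" and U: "nice Y U" "\<alpha> 0 \<in> U" and V: "nice Y V" "\<alpha> 1 \<in> V"
  shows "inj_on endpts (path_nbhd Y U V \<alpha>)" "endpts ` path_nbhd Y U V \<alpha> = V \<times> U"
proof -
  let ?a = "path_class Y \<alpha>"
  have aY: "?a \<in> path_classes Y" by (rule path_class_in[OF a])
  have ends: "endpts (class_mul Y b (class_mul Y ?a d)) = (class_end d, class_start b)"
    if "small_class Y U b" "small_class Y V d" "class_end b = \<alpha> 0" "class_start d = \<alpha> 1" for b d
    using path_nbhd_facts(2,3)[OF aY that(1,2)] that a by (simp add: endpts_def)
  show "inj_on endpts (path_nbhd Y U V \<alpha>)"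
  proof (rule inj_onI)
    fix c c' assume c: "c \<in> path_nbhd Y U V \<alpha>" and c': "c' \<in> path_nbhd Y U V \<alpha>" and eq: "endpts c = endpts c'"
    obtain b d where bd: "small_class Y U b" "small_class Y V d" "class_end b = \<alpha> 0" "class_start d = \<alpha> 1"
      "c = class_mul Y b (class_mul Y ?a d)" using c unfolding path_nbhd_iff[OF a] by blast
    obtain b' d' where bd': "small_class Y U b'" "small_class Y V d'" "class_end b' = \<alpha> 0" "class_start d' = \<alpha> 1"
      "c' = class_mul Y b' (class_mul Y ?a d')" using c' unfolding path_nbhd_iff[OF a] by blast
    have e: "class_end d = class_end d'" "class_start b = class_start b'"
      using eq ends[OF bd(1-4)] ends[OF bd'(1-4)] unfolding bd(5) bd'(5) by auto
    have "b = b'" by (rule nice_unique[OF U(1) bd(1) bd'(1)]) (simp_all add: e bd bd')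
    moreover have "d = d'" by (rule nice_unique[OF V(1) bd(2) bd'(2)]) (simp_all add: e bd bd')
    ultimately show "c = c'" by (simp add: bd bd')
  qed
  show "endpts ` path_nbhd Y U V \<alpha> = V \<times> U"
  proof (rule subset_antisym; rule subsetI)
    fix e assume "e \<in> endpts ` path_nbhd Y U V \<alpha>"
    then obtain b d where bd: "small_class Y U b" "small_class Y V d" "class_end b = \<alpha> 0" "class_start d = \<alpha> 1"
      "e = endpts (class_mul Y b (class_mul Y ?a d))" unfolding path_nbhd_iff[OF a] by (auto simp: path_nbhd_iff[OF a])
    then show "e \<in> V \<times> U" using ends[OF bd(1-4)] small_classD[OF bd(1)] small_classD[OF bd(2)] by simp
  next
    fix e assume e: "e \<in> V \<times> U"
    obtain b where b: "small_class Y U b" "class_start b = snd e" "class_end b = \<alpha> 0"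
      by (rule nice_join[OF U(1) _ U(2), of "snd e"]) (use e in auto)
    obtain d where d: "small_class Y V d" "class_start d = \<alpha> 1" "class_end d = fst e"
      by (rule nice_join[OF V(1) V(2), of "fst e"]) (use e in auto)
    have "class_mul Y b (class_mul Y ?a d) \<in> path_nbhd Y U V \<alpha>" unfolding path_nbhd_iff[OF a] using b d by blast
    moreover have "endpts (class_mul Y b (class_mul Y ?a d)) = e" using ends[OF b(1) d(1)] b d by simp
    ultimately show "e \<in> endpts ` path_nbhd Y U V \<alpha>" by (metis image_eqI)
  qed
qed

lemma openin_endpts_image:
  assumes nY: "locally_nice Y" and W: "openin (path_class_top Y) W"
  shows "openin (prod_topology Y Y) (endpts ` W)"
proof (subst openin_subopen, rule ballI)
  fix e assume "e \<in> endpts ` W"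
  then obtain c where c: "c \<in> W" "e = endpts c" by blast
  have W': "path_class_open Y W" using W by simp
  then have "c \<in> path_classes Y" using c unfolding path_class_open_def by blast
  then obtain \<alpha> where a: "pathin Y \<alpha>" "c = path_class Y \<alpha>" by (rule path_classesE)
  have cW: "path_class Y \<alpha> \<in> W" using c a by simp
  obtain U V where UV: "openin Y U" "openin Y V" "\<alpha> 0 \<in> U" "\<alpha> 1 \<in> V" "path_nbhd Y U V \<alpha> \<subseteq> W"
    by (rule path_class_openD[OF W' a(1) cW])
  obtain U' where U': "openin Y U'" "\<alpha> 0 \<in> U'" "U' \<subseteq> U" "nice Y U'" by (rule locally_niceE[OF nY UV(1,3)])
  obtain V' where V': "openin Y V'" "\<alpha> 1 \<in> V'" "V' \<subseteq> V" "nice Y V'" by (rule locally_niceE[OF nY UV(2,4)])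
  have "V' \<times> U' = endpts ` path_nbhd Y U' V' \<alpha>" using path_nbhd_nice(2)[OF a(1) U'(4,2) V'(4,2)] by simp
  also have "\<dots> \<subseteq> endpts ` W" using path_nbhd_mono[OF U'(3) V'(3), of Y \<alpha>] UV(5) by blast
  finally have sub: "V' \<times> U' \<subseteq> endpts ` W" .
  have "openin (prod_topology Y Y) (V' \<times> U')" using U' V' by (simp add: openin_prod_Times_iff)
  moreover have "e \<in> V' \<times> U'" using c a U' V' by (simp add: endpts_def)
  ultimately show "\<exists>T. openin (prod_topology Y Y) T \<and> e \<in> T \<and> T \<subseteq> endpts ` W" using sub by blast
qed

lemma sheet_path_nbhd:
  assumes nY: "locally_nice Y" and a: "pathin Y \<alpha>" and U: "openin Y U" "nice Y U" "\<alpha> 0 \<in> U"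
    and V: "openin Y V" "nice Y V" "\<alpha> 1 \<in> V"
  shows "sheet (path_class_top Y) (prod_topology Y Y) endpts (path_nbhd Y U V \<alpha>)"
proof -
  let ?W = "path_nbhd Y U V \<alpha>" and ?T = "path_class_top Y"
  have oW: "openin ?T ?W" using path_nbhd_open[OF a U(1) V(1)] by simp
  have ts: "topspace (subtopology ?T ?W) = ?W" using openin_subset[OF oW] by auto
  have oi: "openin (prod_topology Y Y) (endpts ` ?W)" by (rule openin_endpts_image[OF nY oW])
  have ts2: "topspace (subtopology (prod_topology Y Y) (endpts ` ?W)) = endpts ` ?W"
    using openin_subset[OF oi] by auto
  have "homeomorphic_map (subtopology ?T ?W) (subtopology (prod_topology Y Y) (endpts ` ?W)) endpts"
  proof (rule bijective_open_imp_homeomorphic_map)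
    have "continuous_map ?T (prod_topology Y Y) endpts"
      unfolding continuous_map_iff_cont_at by (intro ballI cont_at_endpts) simp
    then show "continuous_map (subtopology ?T ?W) (subtopology (prod_topology Y Y) (endpts ` ?W)) endpts"
      unfolding continuous_map_in_subtopology using continuous_map_from_subtopology by auto
    show "open_map (subtopology ?T ?W) (subtopology (prod_topology Y Y) (endpts ` ?W)) endpts"
      unfolding open_map_def
    proof (intro allI impI)
      fix X assume X: "openin (subtopology ?T ?W) X"
      have "openin ?T X" by (rule openin_trans_full[OF X oW])
      then have "openin (prod_topology Y Y) (endpts ` X)" by (rule openin_endpts_image[OF nY])
      moreover have "X \<subseteq> ?W" using openin_subset[OF X] ts by simp
      ultimately show "openin (subtopology (prod_topology Y Y) (endpts ` ?W)) (endpts ` X)"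
        unfolding openin_open_subtopology[OF oi] by blast
    qed
  qed (simp_all only: ts ts2 path_nbhd_nice(1)[OF a U(2,3) V(2,3)])
  then show ?thesis unfolding sheet_def using oW oi by blast
qed

lemma local_homeo_endpts:
  assumes nY: "locally_nice Y"
  shows "local_homeo (path_class_top Y) (prod_topology Y Y) endpts"
  unfolding local_homeo_def
proof
  fix c assume "c \<in> topspace (path_class_top Y)"
  then have "c \<in> path_classes Y" by simp
  then obtain \<alpha> where a: "pathin Y \<alpha>" "c = path_class Y \<alpha>" by (rule path_classesE)
  have t: "\<alpha> 0 \<in> topspace Y" "\<alpha> 1 \<in> topspace Y" using pathin_topspace[OF a(1)] by auto
  obtain U where U: "openin Y U" "\<alpha> 0 \<in> U" "U \<subseteq> topspace Y" "nice Y U" by (rule locally_niceE[OF nY openin_topspace t(1)])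
  obtain V where V: "openin Y V" "\<alpha> 1 \<in> V" "V \<subseteq> topspace Y" "nice Y V" by (rule locally_niceE[OF nY openin_topspace t(2)])
  show "\<exists>W. sheet (path_class_top Y) (prod_topology Y Y) endpts W \<and> c \<in> W"
    using sheet_path_nbhd[OF nY a(1) U(1,4,2) V(1,4,2)] path_nbhd_self[OF a(1) U(2) V(2)] a(2) by blast
qed

text \<open>
  Classes with different ends are separated by their ends. Two classes with the same ends have
  neighbourhoods over the same nice sets; a common element would extend both by the same small
  classes, which could then be cancelled.
\<close>

lemma Hausdorff_path_class_top:
  assumes nY: "locally_nice Y" and H: "Hausdorff_space Y"
  shows "Hausdorff_space (path_class_top Y)"
  unfolding Hausdorff_space_def
proof (intro allI impI)
  fix c c' assume "c \<in> topspace (path_class_top Y) \<and> c' \<in> topspace (path_class_top Y) \<and> c \<noteq> c'"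
  then have c: "c \<in> path_classes Y" "c' \<in> path_classes Y" and ne: "c \<noteq> c'" by auto
  show "\<exists>W W'. openin (path_class_top Y) W \<and> openin (path_class_top Y) W' \<and> c \<in> W \<and> c' \<in> W' \<and> disjnt W W'"
  proof (cases "endpts c = endpts c'")
    case False
    have "Hausdorff_space (prod_topology Y Y)" using H by (simp add: Hausdorff_space_prod_topology)
    moreover have "endpts c \<in> topspace (prod_topology Y Y)" "endpts c' \<in> topspace (prod_topology Y Y)"
      using c class_ends_in by (auto simp: endpts_def)
    ultimately obtain O1 O2 where O: "openin (prod_topology Y Y) O1" "openin (prod_topology Y Y) O2"
      "endpts c \<in> O1" "endpts c' \<in> O2" "disjnt O1 O2" using False unfolding Hausdorff_space_def by blast
    obtain W1 where W1: "openin (path_class_top Y) W1" "c \<in> W1" "endpts ` W1 \<subseteq> O1"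
      by (rule cont_atD[OF cont_at_endpts[OF c(1)] O(1,3)])
    obtain W2 where W2: "openin (path_class_top Y) W2" "c' \<in> W2" "endpts ` W2 \<subseteq> O2"
      by (rule cont_atD[OF cont_at_endpts[OF c(2)] O(2,4)])
    have "disjnt W1 W2" using W1(3) W2(3) O(5) unfolding disjnt_iff by blast
    then show ?thesis using W1 W2 by blast
  next
    case True
    obtain \<alpha> where a: "pathin Y \<alpha>" "c = path_class Y \<alpha>" using c(1) by (rule path_classesE)
    obtain \<beta> where b: "pathin Y \<beta>" "c' = path_class Y \<beta>" using c(2) by (rule path_classesE)
    have e: "\<beta> 0 = \<alpha> 0" "\<beta> 1 = \<alpha> 1" using True a b by (auto simp: endpts_def)
    have t: "\<alpha> 0 \<in> topspace Y" "\<alpha> 1 \<in> topspace Y" using pathin_topspace[OF a(1)] by auto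
    obtain U where U: "openin Y U" "\<alpha> 0 \<in> U" "U \<subseteq> topspace Y" "nice Y U" by (rule locally_niceE[OF nY openin_topspace t(1)])
    obtain V where V: "openin Y V" "\<alpha> 1 \<in> V" "V \<subseteq> topspace Y" "nice Y V" by (rule locally_niceE[OF nY openin_topspace t(2)])
    let ?W = "path_nbhd Y U V \<alpha>" and ?W' = "path_nbhd Y U V \<beta>"
    have "disjnt ?W ?W'"
      unfolding disjnt_iff
    proof (intro allI notI)
      fix x assume x: "x \<in> ?W \<and> x \<in> ?W'"
      obtain g d where gd: "small_class Y U g" "small_class Y V d" "class_end g = \<alpha> 0" "class_start d = \<alpha> 1"
        "x = class_mul Y g (class_mul Y c d)" using x unfolding path_nbhd_iff[OF a(1)] a(2) by blast
      obtain g' d' where gd': "small_class Y U g'" "small_class Y V d'" "class_end g' = \<alpha> 0" "class_start d' = \<alpha> 1"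
        "x = class_mul Y g' (class_mul Y c' d')" using x unfolding path_nbhd_iff[OF b(1)] b(2) e by blast
      have ce: "class_start c = \<alpha> 0" "class_end c = \<alpha> 1" "class_start c' = \<alpha> 0" "class_end c' = \<alpha> 1"
        using a b e by auto
      note f = path_nbhd_facts[OF c(1) gd(1,2)] and f' = path_nbhd_facts[OF c(2) gd'(1,2)]
      have s: "class_start g = class_start g'" "class_end d = class_end d'"
        using f(2,3) f'(2,3) gd gd' ce by auto
      have "g = g'" by (rule nice_unique[OF U(4) gd(1) gd'(1)]) (simp_all add: s gd gd')
      moreover have "d = d'" by (rule nice_unique[OF V(4) gd(2) gd'(2)]) (simp_all add: s gd gd')
      ultimately have eq: "class_mul Y g (class_mul Y c d) = class_mul Y g (class_mul Y c' d)" using gd(5) gd'(5) by simp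
      have gY: "g \<in> path_classes Y" "d \<in> path_classes Y" using small_classD gd by blast+
      have "class_mul Y c d = class_mul Y c' d"
        by (rule class_mul_cancel_left[OF gY(1) _ _ _ _ eq]) (use gY c ce gd in \<open>simp_all add: class_mul_in\<close>)
      then have "c = c'"
        by (rule class_mul_cancel_right[OF gY(2) c(1) c(2), rotated 2]) (use ce gd in simp_all)
      then show False using ne by blast
    qed
    moreover have "openin (path_class_top Y) ?W" "openin (path_class_top Y) ?W'"
      using path_nbhd_open[OF a(1) U(1) V(1)] path_nbhd_open[OF b(1) U(1) V(1)] by simp_all
    moreover have "c \<in> ?W" "c' \<in> ?W'"
      using path_nbhd_self[OF a(1) U(2) V(2)] path_nbhd_self[OF b(1), of U V] e U(2) V(2) a(2) b(2) by auto
    ultimately show ?thesis by blast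
  qed
qed

subsection \<open>Continuity of the groupoid operations\<close>

text \<open>
  Where the two factors meet, both are modified inside one nice set, and the modifications cancel.
\<close>

lemma cont_at_class_mul:
  assumes nY: "locally_nice Y" and c: "c \<in> path_classes Y" and d: "d \<in> path_classes Y" and e: "class_end c = class_start d"
  shows "cont_at (subtopology (prod_topology (path_class_top Y) (path_class_top Y)) {(c, d). class_end c = class_start d})
     (path_class_top Y) (\<lambda>(c, d). class_mul Y c d) (c, d)"
  unfolding cont_at_def
proof (intro conjI allI impI)
  show "(c, d) \<in> topspace (subtopology (prod_topology (path_class_top Y) (path_class_top Y)) {(c, d). class_end c = class_start d})"
    using c d e by simp
  show "(case (c, d) of (c, d) => class_mul Y c d) \<in> topspace (path_class_top Y)"
    using class_mul_in[OF c d e] by simp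
  fix W assume W: "openin (path_class_top Y) W \<and> (case (c, d) of (c, d) => class_mul Y c d) \<in> W"
  obtain \<alpha> where a: "pathin Y \<alpha>" "c = path_class Y \<alpha>" using c by (rule path_classesE)
  obtain \<beta> where b: "pathin Y \<beta>" "d = path_class Y \<beta>" using d by (rule path_classesE)
  have e': "\<alpha> 1 = \<beta> 0" using e a b by simp
  have p: "pathin Y (path_cat \<alpha> \<beta>)" by (rule pathin_cat[OF a(1) b(1) e'])
  have m: "class_mul Y c d = path_class Y (path_cat \<alpha> \<beta>)" using class_mul_path[OF a(1) b(1) e'] a b by simp
  have oW: "path_class_open Y W" "path_class Y (path_cat \<alpha> \<beta>) \<in> W" using W m by auto
  obtain U V where UV: "openin Y U" "openin Y V" "path_cat \<alpha> \<beta> 0 \<in> U" "path_cat \<alpha> \<beta> 1 \<in> V" "path_nbhd Y U V (path_cat \<alpha> \<beta>) \<subseteq> W"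
    by (rule path_class_openD[OF oW(1) p oW(2)])
  have t: "\<alpha> 1 \<in> topspace Y" using pathin_topspace[OF a(1)] by auto
  obtain N where N: "openin Y N" "\<alpha> 1 \<in> N" "N \<subseteq> topspace Y" "nice Y N" by (rule locally_niceE[OF nY openin_topspace t])
  let ?A = "path_nbhd Y U N \<alpha>" and ?B = "path_nbhd Y N V \<beta>"
  have "class_mul Y x y \<in> W" if x: "x \<in> ?A" and y: "y \<in> ?B" and xy: "class_end x = class_start y" for x y
  proof -
    obtain g h where gh: "small_class Y U g" "small_class Y N h" "class_end g = \<alpha> 0" "class_start h = \<alpha> 1"
      "x = class_mul Y g (class_mul Y c h)" using x unfolding path_nbhd_iff[OF a(1)] a(2) by blast
    obtain h' k where hk: "small_class Y N h'" "small_class Y V k" "class_end h' = \<beta> 0" "class_start k = \<beta> 1"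
      "y = class_mul Y h' (class_mul Y d k)" using y unfolding path_nbhd_iff[OF b(1)] b(2) by blast
    have ce: "class_start c = \<alpha> 0" "class_end c = \<alpha> 1" "class_start d = \<alpha> 1" "class_end d = \<beta> 1"
      using a b e' by auto
    have s: "class_end h = class_start h'"
      using path_nbhd_facts(3)[OF c gh(1,2)] path_nbhd_facts(2)[OF d hk(1,2)] gh hk ce e' xy by simp
    note ins = small_classD(1)[OF gh(1)] small_classD(1)[OF gh(2)] small_classD(1)[OF hk(1)] small_classD(1)[OF hk(2)]
    have hh: "class_mul Y h h' = path_class Y (\<lambda>_. \<alpha> 1)"
    proof (rule nice_unique[OF N(4)])
      show "small_class Y N (class_mul Y h h')" by (rule small_class_mul[OF gh(2) hk(1) s])
      show "small_class Y N (path_class Y (\<lambda>_. \<alpha> 1))" by (rule small_class_const[OF t N(2)])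
      show "class_start (class_mul Y h h') = class_start (path_class Y (\<lambda>_. \<alpha> 1))"
        "class_end (class_mul Y h h') = class_end (path_class Y (\<lambda>_. \<alpha> 1))"
        using ins s gh hk e' t by (simp_all add: class_mul_in pathin_const_iff)
    qed
    have "class_mul Y x y = class_mul Y g (class_mul Y c (class_mul Y (class_mul Y h h') (class_mul Y d k)))"
      unfolding gh(5) hk(5) using ins c d s gh hk ce e' by (simp add: class_mul_assoc class_mul_in)
    also have "class_mul Y (class_mul Y h h') (class_mul Y d k) = class_mul Y d k"
      unfolding hh using class_mul_idl[of "class_mul Y d k" Y] ins d hk ce by (simp add: class_mul_in)
    also have "class_mul Y g (class_mul Y c (class_mul Y d k)) = class_mul Y g (class_mul Y (class_mul Y c d) k)"
      using ins c d gh hk ce by (simp add: class_mul_assoc)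
    also have "\<dots> \<in> path_nbhd Y U V (path_cat \<alpha> \<beta>)"
      unfolding path_nbhd_iff[OF p] m using gh hk by (intro exI[of _ g] exI[of _ k]) simp
    finally show ?thesis using UV(5) by blast
  qed
  moreover have "openin (subtopology (prod_topology (path_class_top Y) (path_class_top Y)) {(c, d). class_end c = class_start d})
     ((?A \<times> ?B) \<inter> {(c, d). class_end c = class_start d})"
    using path_nbhd_open[OF a(1) UV(1) N(1)] path_nbhd_open[OF b(1) N(1) UV(2)]
    by (intro openin_subtopology_Int) (simp add: openin_prod_Times_iff)
  moreover have "(c, d) \<in> (?A \<times> ?B) \<inter> {(c, d). class_end c = class_start d}"
    using path_nbhd_self[OF a(1), of U N] path_nbhd_self[OF b(1), of N V] UV(3,4) N(2) e e' a(2) b(2) by simp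
  ultimately show "\<exists>X. openin (subtopology (prod_topology (path_class_top Y) (path_class_top Y)) {(c, d). class_end c = class_start d}) X \<and>
      (c, d) \<in> X \<and> (\<lambda>(c, d). class_mul Y c d) ` X \<subseteq> W"
    by (intro exI[of _ "(?A \<times> ?B) \<inter> {(c, d). class_end c = class_start d}"]) auto
qed

lemma cont_at_class_inv:
  assumes c: "c \<in> path_classes Y"
  shows "cont_at (path_class_top Y) (path_class_top Y) (class_inv Y) c"
  unfolding cont_at_def
proof (intro conjI allI impI)
  show "c \<in> topspace (path_class_top Y)" "class_inv Y c \<in> topspace (path_class_top Y)" using c class_inv_in by auto
  fix W assume W: "openin (path_class_top Y) W \<and> class_inv Y c \<in> W"
  obtain \<alpha> where a: "pathin Y \<alpha>" "c = path_class Y \<alpha>" using c by (rule path_classesE)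
  have p: "pathin Y (\<lambda>t. \<alpha> (1 - t))" by (rule pathin_rev[OF a(1)])
  have ic: "class_inv Y c = path_class Y (\<lambda>t. \<alpha> (1 - t))" unfolding a(2) by (rule class_inv_path[OF a(1)])
  have oW: "path_class_open Y W" "path_class Y (\<lambda>t. \<alpha> (1 - t)) \<in> W" using W ic by auto
  obtain U V where UV: "openin Y U" "openin Y V" "\<alpha> (1 - 0) \<in> U" "\<alpha> (1 - 1) \<in> V" "path_nbhd Y U V (\<lambda>t. \<alpha> (1 - t)) \<subseteq> W"
    by (rule path_class_openD[OF oW(1) p oW(2)])
  have "class_inv Y x \<in> W" if x: "x \<in> path_nbhd Y V U \<alpha>" for x
  proof -
    obtain g h where gh: "small_class Y V g" "small_class Y U h" "class_end g = \<alpha> 0" "class_start h = \<alpha> 1"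
      "x = class_mul Y g (class_mul Y c h)" using x unfolding path_nbhd_iff[OF a(1)] a(2) by blast
    note ins = small_classD(1)[OF gh(1)] small_classD(1)[OF gh(2)] c
    have ce: "class_start c = \<alpha> 0" "class_end c = \<alpha> 1" using a by auto
    let ?y = "class_mul Y (class_inv Y h) (class_mul Y (class_inv Y c) (class_inv Y g))"
    note iv = class_inv_in[OF ins(1)] class_inv_in[OF ins(2)] class_inv_in[OF ins(3)]
    have xin: "x \<in> path_classes Y" "class_start x = class_start g" "class_end x = class_end h"
      using path_nbhd_facts[OF c gh(1,2)] gh ce by auto
    have yin: "?y \<in> path_classes Y" "class_start ?y = class_end h" "class_end ?y = class_start g"
      using iv gh ce by (simp_all add: class_mul_in)
    have "class_mul Y x ?y = class_mul Y g (class_mul Y c (class_mul Y (class_mul Y h (class_inv Y h)) (class_mul Y (class_inv Y c) (class_inv Y g))))"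
      unfolding gh(5) using ins iv gh ce by (simp add: class_mul_assoc class_mul_in)
    also have "class_mul Y (class_mul Y h (class_inv Y h)) (class_mul Y (class_inv Y c) (class_inv Y g)) = class_mul Y (class_inv Y c) (class_inv Y g)"
      unfolding class_mul_inv_right[OF ins(2)] using class_mul_idl[of "class_mul Y (class_inv Y c) (class_inv Y g)" Y] iv gh ce
      by (simp add: class_mul_in)
    also have "class_mul Y g (class_mul Y c (class_mul Y (class_inv Y c) (class_inv Y g))) = class_mul Y g (class_mul Y (class_mul Y c (class_inv Y c)) (class_inv Y g))"
      using ins iv gh ce by (simp add: class_mul_assoc)
    also have "class_mul Y (class_mul Y c (class_inv Y c)) (class_inv Y g) = class_inv Y g"
      unfolding class_mul_inv_right[OF c] using class_mul_idl[OF iv(1)] iv gh ce by simp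
    also have "class_mul Y g (class_inv Y g) = class_mul Y x (class_inv Y x)"
      using class_mul_inv_right[OF ins(1)] class_mul_inv_right[OF xin(1)] xin(2) by simp
    finally have "?y = class_inv Y x"
      by (rule class_mul_cancel_left[OF xin(1) yin(1) class_inv_in(1)[OF xin(1)], rotated 2]) (simp_all add: yin xin class_inv_in)
    moreover have "?y \<in> path_nbhd Y U V (\<lambda>t. \<alpha> (1 - t))"
      unfolding path_nbhd_iff[OF p] ic[symmetric]
      using small_class_inv[OF gh(1)] small_class_inv[OF gh(2)] iv gh
      by (intro exI[of _ "class_inv Y h"] exI[of _ "class_inv Y g"]) simp
    ultimately show ?thesis using UV(5) by auto
  qed
  then show "\<exists>X. openin (path_class_top Y) X \<and> c \<in> X \<and> class_inv Y ` X \<subseteq> W"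
    using path_nbhd_open[OF a(1) UV(2,1)] path_nbhd_self[OF a(1), of V U] UV(3,4) a(2)
    by (intro exI[of _ "path_nbhd Y V U \<alpha>"]) auto
qed

lemma cont_at_class_map:
  assumes c: "c \<in> path_classes Y" and f: "continuous_map Y Y' f"
  shows "cont_at (path_class_top Y) (path_class_top Y') (class_map Y' f) c"
  unfolding cont_at_def
proof (intro conjI allI impI)
  show "c \<in> topspace (path_class_top Y)" "class_map Y' f c \<in> topspace (path_class_top Y')"
    using c class_map_in[OF c f] by auto
  fix W assume W: "openin (path_class_top Y') W \<and> class_map Y' f c \<in> W"
  obtain \<alpha> where a: "pathin Y \<alpha>" "c = path_class Y \<alpha>" using c by (rule path_classesE)
  have p: "pathin Y' (\<lambda>t. f (\<alpha> t))" by (rule pathin_map[OF a(1) f])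
  have mc: "class_map Y' f c = path_class Y' (\<lambda>t. f (\<alpha> t))" unfolding a(2) by (rule class_map_path[OF a(1) f])
  have oW: "path_class_open Y' W" "path_class Y' (\<lambda>t. f (\<alpha> t)) \<in> W" using W mc by auto
  obtain U V where UV: "openin Y' U" "openin Y' V" "f (\<alpha> 0) \<in> U" "f (\<alpha> 1) \<in> V" "path_nbhd Y' U V (\<lambda>t. f (\<alpha> t)) \<subseteq> W"
    by (rule path_class_openD[OF oW(1) p oW(2)])
  let ?U = "{x \<in> topspace Y. f x \<in> U}" and ?V = "{x \<in> topspace Y. f x \<in> V}"
  have sm: "small_class Y' N (class_map Y' f g)" if g: "small_class Y {x \<in> topspace Y. f x \<in> N} g" for g N
  proof -
    obtain \<gamma> where \<gamma>: "pathin (subtopology Y {x \<in> topspace Y. f x \<in> N}) \<gamma>" "g = path_class Y \<gamma>"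
      using g unfolding small_class_def by blast
    note gY = pathin_subtopologyD(1)[OF \<gamma>(1)]
    have "pathin (subtopology Y' N) (\<lambda>s. f (\<gamma> s))"
      by (rule pathin_subtopologyI[OF pathin_map[OF gY f]]) (use pathin_subtopologyD(2)[OF \<gamma>(1)] in auto)
    then show ?thesis unfolding small_class_def \<gamma>(2) class_map_path[OF gY f] by blast
  qed
  have "class_map Y' f x \<in> W" if x: "x \<in> path_nbhd Y ?U ?V \<alpha>" for x
  proof -
    obtain g h where gh: "small_class Y ?U g" "small_class Y ?V h" "class_end g = \<alpha> 0" "class_start h = \<alpha> 1"
      "x = class_mul Y g (class_mul Y c h)" using x unfolding path_nbhd_iff[OF a(1)] a(2) by blast
    note ins = small_classD(1)[OF gh(1)] small_classD(1)[OF gh(2)] c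
    have ce: "class_start c = \<alpha> 0" "class_end c = \<alpha> 1" using a by auto
    have "class_map Y' f x = class_mul Y' (class_map Y' f g) (class_mul Y' (class_map Y' f c) (class_map Y' f h))"
      unfolding gh(5) using ins gh ce f by (simp add: class_map_mul class_mul_in)
    also have "\<dots> \<in> path_nbhd Y' U V (\<lambda>t. f (\<alpha> t))"
      unfolding path_nbhd_iff[OF p] mc[symmetric] using sm[OF gh(1)] sm[OF gh(2)] class_map_in[OF ins(1) f] class_map_in[OF ins(2) f] gh
      by (intro exI[of _ "class_map Y' f g"] exI[of _ "class_map Y' f h"]) simp
    finally show ?thesis using UV(5) by blast
  qed
  moreover have "openin Y ?U" "openin Y ?V" using openin_continuous_map_preimage[OF f] UV by blast+
  moreover have "\<alpha> 0 \<in> ?U" "\<alpha> 1 \<in> ?V" using UV pathin_topspace[OF a(1)] by auto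
  ultimately show "\<exists>X. openin (path_class_top Y) X \<and> c \<in> X \<and> class_map Y' f ` X \<subseteq> W"
    using path_nbhd_open[OF a(1), of ?U ?V] path_nbhd_self[OF a(1), of ?U ?V] a(2)
    by (intro exI[of _ "path_nbhd Y ?U ?V \<alpha>"]) auto
qed

lemma cont_at_class_id:
  assumes nY: "locally_nice Y" and y: "y \<in> topspace Y"
  shows "cont_at Y (path_class_top Y) (\<lambda>y. path_class Y (\<lambda>_. y)) y"
  unfolding cont_at_def
proof (intro conjI allI impI)
  have p: "pathin Y (\<lambda>_. y)" using y by (simp add: pathin_const_iff)
  show "path_class Y (\<lambda>_. y) \<in> topspace (path_class_top Y)" using path_class_in[OF p] by simp
  fix W assume W: "openin (path_class_top Y) W \<and> path_class Y (\<lambda>_. y) \<in> W"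
  then have oW: "path_class_open Y W" "path_class Y (\<lambda>_. y) \<in> W" by auto
  obtain U V where UV: "openin Y U" "openin Y V" "y \<in> U" "y \<in> V" "path_nbhd Y U V (\<lambda>_. y) \<subseteq> W"
    by (rule path_class_openD[OF oW(1) p oW(2)])
  have "openin Y (U \<inter> V)" "y \<in> U \<inter> V" using UV by auto
  then obtain N where N: "openin Y N" "y \<in> N" "N \<subseteq> U \<inter> V" "nice Y N" by (rule locally_niceE[OF nY])
  have "path_class Y (\<lambda>_. z) \<in> W" if z: "z \<in> N" for z
  proof -
    have zt: "z \<in> topspace Y" using z N(1) openin_subset by blast
    obtain b where b: "small_class Y N b" "class_start b = z" "class_end b = y" by (rule nice_join[OF N(4) z N(2)])
    note bY = small_classD(1)[OF b(1)] and ib = class_inv_in[OF small_classD(1)[OF b(1)]]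
    have "class_mul Y b (class_mul Y (path_class Y (\<lambda>_. y)) (class_inv Y b)) = path_class Y (\<lambda>_. z)"
      using class_mul_idl[OF ib(1)] class_mul_inv_right[OF bY] ib b by simp
    moreover have "class_mul Y b (class_mul Y (path_class Y (\<lambda>_. y)) (class_inv Y b)) \<in> path_nbhd Y U V (\<lambda>_. y)"
      unfolding path_nbhd_iff[OF p] using small_class_mono[OF b(1), of U] small_class_mono[OF small_class_inv[OF b(1)], of V] N(3) b ib
      by (intro exI[of _ b] exI[of _ "class_inv Y b"]) simp
    ultimately show ?thesis using UV(5) by auto
  qed
  then show "\<exists>X. openin Y X \<and> y \<in> X \<and> (\<lambda>y. path_class Y (\<lambda>_. y)) ` X \<subseteq> W"
    using N by (intro exI[of _ N]) auto
qed (rule y)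

subsection \<open>Countably many classes between nice sets\<close>

lemma countable_nice_basis:
  assumes "second_countable Y" "locally_nice Y"
  obtains b :: "nat => 'a set" where "\<And>n. openin Y (b n)" "\<And>n. nice Y (b n)"
    "\<And>U x. openin Y U ==> x \<in> U ==> \<exists>n. x \<in> b n \<and> b n \<subseteq> U"
proof -
  obtain \<B> where B: "countable \<B>" "\<forall>V\<in>\<B>. openin Y V" "\<forall>U x. openin Y U \<and> x \<in> U --> (\<exists>V\<in>\<B>. x \<in> V \<and> V \<subseteq> U)"
    using assms(1) unfolding second_countable_def by (elim exE conjE) (rule that)
  define P where "P = {(A, B). A \<in> \<B> \<and> B \<in> \<B> \<and> (\<exists>N. openin Y N \<and> nice Y N \<and> A \<subseteq> N \<and> N \<subseteq> B)}"
  have "\<forall>q\<in>P. \<exists>N. openin Y N \<and> nice Y N \<and> fst q \<subseteq> N \<and> N \<subseteq> snd q" by (auto simp: P_def)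
  from bchoice[OF this] obtain N where N: "\<forall>q\<in>P. openin Y (N q) \<and> nice Y (N q) \<and> fst q \<subseteq> N q \<and> N q \<subseteq> snd q" by (rule exE)
  define \<N> where "\<N> = insert {} (N ` P)"
  have "P \<subseteq> \<B> \<times> \<B>" by (auto simp: P_def)
  then have "countable P" using B(1) countable_SIGMA[of \<B> "\<lambda>_. \<B>"] countable_subset by blast
  then have cN: "countable \<N>" "\<N> \<noteq> {}" by (auto simp: \<N>_def)
  have nice_empty: "nice Y {}"
    unfolding nice_def using small_classD(2)[of Y "{}"] by blast
  have mem: "from_nat_into \<N> n \<in> \<N>" for n using cN(2) by (rule from_nat_into)
  have both: "openin Y M \<and> nice Y M" if "M \<in> \<N>" for M
    using that N nice_empty unfolding \<N>_def by auto
  show thesis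
  proof (rule that[of "from_nat_into \<N>"])
    show "openin Y (from_nat_into \<N> n)" "nice Y (from_nat_into \<N> n)" for n using both[OF mem] by blast+
    fix U x assume U: "openin Y U" "x \<in> U"
    obtain B where B': "B \<in> \<B>" "x \<in> B" "B \<subseteq> U" using B(3)[rule_format, of U x] U by blast
    have oB: "openin Y B" using B(2) B'(1) by blast
    obtain M where M: "openin Y M" "x \<in> M" "M \<subseteq> B" "nice Y M" by (rule locally_niceE[OF assms(2) oB B'(2)])
    obtain A where A: "A \<in> \<B>" "x \<in> A" "A \<subseteq> M" using B(3)[rule_format, of M x] M by blast
    have AB: "(A, B) \<in> P" unfolding P_def using A B' M by blast
    then have NAB: "N (A, B) \<in> \<N>" "x \<in> N (A, B)" "N (A, B) \<subseteq> U" using N[rule_format, OF AB] AB A(2) B'(3) by (auto simp: \<N>_def)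
    obtain n where "from_nat_into \<N> n = N (A, B)" using from_nat_into_surj[OF cN(1) NAB(1)] by blast
    then show "\<exists>n. x \<in> from_nat_into \<N> n \<and> from_nat_into \<N> n \<subseteq> U" using NAB by (intro exI[of _ n]) simp
  qed
qed

text \<open>
  An itinerary records how a path runs through nice sets from a countable list: a leaf is a
  path inside one of them, a node a concatenation at a point of a nice set contained in the two
  sets that meet there. It determines the path class up to the position of the two ends.
\<close>

datatype itinerary = Leaf nat | Node itinerary nat itinerary

instance itinerary :: countable
  by countable_datatype

primrec first_set :: "(nat => 'a set) => itinerary => 'a set" where
  "first_set b (Leaf n) = b n"
| "first_set b (Node L w R) = first_set b L"

primrec last_set :: "(nat => 'a set) => itinerary => 'a set" where
  "last_set b (Leaf n) = b n"
| "last_set b (Node L w R) = last_set b R"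

primrec follows :: "'a topology => (nat => 'a set) => itinerary => (real => 'a) set => bool" where
  "follows Y b (Leaf n) c \<longleftrightarrow> small_class Y (b n) c"
| "follows Y b (Node L w R) c \<longleftrightarrow> (\<exists>c1 c2. follows Y b L c1 \<and> follows Y b R c2 \<and>
     class_end c1 = class_start c2 \<and> class_end c1 \<in> b w \<and> b w \<subseteq> last_set b L \<and> b w \<subseteq> first_set b R \<and>
     c = class_mul Y c1 c2)"

lemma follows_in:
  "follows Y b T c ==> c \<in> path_classes Y \<and> class_start c \<in> first_set b T \<and> class_end c \<in> last_set b T"
proof (induction T arbitrary: c)
  case (Leaf n)
  then show ?case using small_classD by auto
next
  case (Node L w R)
  then obtain c1 c2 where c: "follows Y b L c1" "follows Y b R c2" "class_end c1 = class_start c2" "c = class_mul Y c1 c2"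
    by auto
  show ?case using Node.IH(1)[OF c(1)] Node.IH(2)[OF c(2)] c by (simp add: class_mul_in)
qed

lemma first_last_set: "\<exists>n. first_set b T = b n" "\<exists>n. last_set b T = b n"
  by (induction T) auto

lemma follows_unique:
  assumes nice: "\<And>n. nice Y (b n)"
  shows "follows Y b T c ==> follows Y b T c' ==>
    small_class Y (first_set b T) d ==> class_start d = class_start c ==> class_end d = class_start c' ==>
    small_class Y (last_set b T) d' ==> class_start d' = class_end c ==> class_end d' = class_end c' ==>
    class_mul Y d c' = class_mul Y c d'"
proof (induction T arbitrary: c c' d d')
  case (Leaf n)
  show ?case
  proof (rule nice_unique[OF nice[of n]])
    show "small_class Y (b n) (class_mul Y d c')" "small_class Y (b n) (class_mul Y c d')"
      using Leaf by (simp_all add: small_class_mul)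
    show "class_start (class_mul Y d c') = class_start (class_mul Y c d')"
      "class_end (class_mul Y d c') = class_end (class_mul Y c d')"
      using Leaf follows_in[OF Leaf(1)] follows_in[OF Leaf(2)] small_classD(1)[OF Leaf(3)] small_classD(1)[OF Leaf(6)]
      by (simp_all add: class_mul_in)
  qed
next
  case (Node L w R)
  obtain c1 c2 where c: "follows Y b L c1" "follows Y b R c2" "class_end c1 = class_start c2" "class_end c1 \<in> b w"
    "b w \<subseteq> last_set b L" "b w \<subseteq> first_set b R" "c = class_mul Y c1 c2" using Node.prems(1) by auto
  obtain c1' c2' where c': "follows Y b L c1'" "follows Y b R c2'" "class_end c1' = class_start c2'" "class_end c1' \<in> b w"
    "c' = class_mul Y c1' c2'" using Node.prems(2) by auto
  obtain m where m: "small_class Y (b w) m" "class_start m = class_end c1" "class_end m = class_end c1'"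
    by (rule nice_join[OF nice c(4) c'(4)])
  note ins = conjunct1[OF follows_in[OF c(1)]] conjunct1[OF follows_in[OF c(2)]]
    conjunct1[OF follows_in[OF c'(1)]] conjunct1[OF follows_in[OF c'(2)]]
    small_classD(1)[OF Node.prems(3)] small_classD(1)[OF Node.prems(6)] small_classD(1)[OF m(1)]
  have e: "class_start d = class_start c1" "class_end d = class_start c1'" "class_start d' = class_end c2" "class_end d' = class_end c2'"
    using Node.prems ins c c' by (simp_all add: class_mul_in)
  have 1: "class_mul Y d c1' = class_mul Y c1 m"
    using Node.prems(3) e m small_class_mono[OF m(1) c(5)] by (intro Node.IH(1)[OF c(1) c'(1)]) simp_all
  have 2: "class_mul Y m c2' = class_mul Y c2 d'"
    using Node.prems(6) e m c(3) c'(3) small_class_mono[OF m(1) c(6)] by (intro Node.IH(2)[OF c(2) c'(2)]) simp_all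
  have "class_mul Y d c' = class_mul Y (class_mul Y d c1') c2'"
    unfolding c' using ins e c' by (simp add: class_mul_assoc)
  also have "\<dots> = class_mul Y c1 (class_mul Y m c2')"
    unfolding 1 using ins m c c' by (simp add: class_mul_assoc)
  also have "\<dots> = class_mul Y c d'"
    unfolding 2 c using ins e c by (simp add: class_mul_assoc)
  finally show ?case .
qed

text \<open>
  By bisection of the interval: a path too long for a single nice set is the concatenation of its
  halves.
\<close>

lemma follows_exists:
  assumes b: "\<And>n. openin Y (b n)" and basis: "\<And>U x. openin Y U ==> x \<in> U ==> \<exists>n. x \<in> b n \<and> b n \<subseteq> U"
    and a: "pathin Y \<alpha>"
  shows "\<exists>T. follows Y b T (path_class Y \<alpha>)"
proof -
  define seg where "seg s t = (\<lambda>r. \<alpha> (s + r * (t - s)))" for s t :: real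
  have lin: "s + r * (t - s) \<in> {s..t}" if "s \<le> t" "r \<in> {0..1}" for s t r :: real
    using that mult_left_le_one_le[of "t - s" r] by (auto simp: mult_nonneg_nonneg)
  have pseg: "pathin Y (seg s t)" if "0 \<le> s" "s \<le> t" "t \<le> 1" for s t
    unfolding seg_def
  proof (rule pathin_reparam[OF a])
    show "s + r * (t - s) \<in> {0..1}" if "r \<in> {0..1}" for r using lin[OF \<open>s \<le> t\<close> that] \<open>0 \<le> s\<close> \<open>t \<le> 1\<close> by auto
  qed (intro continuous_intros)
  define P where "P s t \<longleftrightarrow> (0 \<le> s \<and> s \<le> t \<and> t \<le> 1 --> (\<exists>T. follows Y b T (path_class Y (seg s t))))" for s t
  have "P 0 1"
  proof (rule Bolzano)
    fix r s t assume "P r s" "P s t" and rst: "r \<le> s" "s \<le> t"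
    show "P r t"
      unfolding P_def
    proof
      assume rt: "0 \<le> r \<and> r \<le> t \<and> t \<le> 1"
      obtain L where L: "follows Y b L (path_class Y (seg r s))" using \<open>P r s\<close> rt rst unfolding P_def by auto
      obtain R where R: "follows Y b R (path_class Y (seg s t))" using \<open>P s t\<close> rt rst unfolding P_def by auto
      have p: "pathin Y (seg r s)" "pathin Y (seg s t)" using rt rst by (auto intro: pseg)
      have e: "seg r s 1 = \<alpha> s" "seg s t 0 = \<alpha> s" by (simp_all add: seg_def)
      obtain m where m: "last_set b L = b m" using first_last_set(2)[of b L] by (rule exE)
      obtain n where n: "first_set b R = b n" using first_last_set(1)[of b R] by (rule exE)
      have "\<alpha> s \<in> b m \<inter> b n" using follows_in[OF L] follows_in[OF R] p e m n by auto
      moreover have "openin Y (b m \<inter> b n)" using b by auto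
      ultimately obtain w where w: "\<alpha> s \<in> b w" "b w \<subseteq> b m \<inter> b n" using basis[of "b m \<inter> b n" "\<alpha> s"] by auto
      have "follows Y b (Node L w R) (class_mul Y (path_class Y (seg r s)) (path_class Y (seg s t)))"
        unfolding follows.simps
        using L R w m n class_ends[OF p(1)] class_ends[OF p(2)] e by (intro exI[of _ "path_class Y (seg r s)"] exI[of _ "path_class Y (seg s t)"]) simp
      moreover have "class_mul Y (path_class Y (seg r s)) (path_class Y (seg s t)) = path_class Y (seg r t)"
      proof -
        let ?u = "path_cat (\<lambda>x. r + x * (s - r)) (\<lambda>x. s + x * (t - s))"
        have pu: "pathin (top_of_set {0..1}) ?u"
          by (rule pathin_cat) (use lin[of r s] lin[of s t] rt rst in \<open>force simp: pathin_def intro!: continuous_intros\<close>)+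
        then have u: "continuous_on {0..1} ?u" "?u \<in> {0..1} \<rightarrow> {0..1}"
          unfolding pathin_def continuous_map_subtopology_eu by auto
        have "path_class Y (\<lambda>x. \<alpha> (?u x)) = path_class Y (\<lambda>x. \<alpha> (r + x * (t - r)))"
        proof (rule path_class_reparam[OF a u(1) funcset_mem[OF u(2)]])
          show "r + x * (t - r) \<in> {0..1}" if "x \<in> {0..1}" for x using lin[of r t x] that rt by auto
        qed (auto intro!: continuous_intros)
        moreover have "path_cat (seg r s) (seg s t) = (\<lambda>x. \<alpha> (?u x))"
          unfolding seg_def by (rule path_cat_compose)
        ultimately show ?thesis using class_mul_path[OF p] e by (simp add: seg_def)
      qed
      ultimately show "\<exists>T. follows Y b T (path_class Y (seg r t))" by (intro exI[of _ "Node L w R"]) simp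
    qed
  next
    fix x :: real assume x: "0 \<le> x" "x \<le> 1"
    have "\<alpha> x \<in> topspace Y" using pathin_topspace[OF a] x by auto
    then obtain n where n: "\<alpha> x \<in> b n" using basis[OF openin_topspace] by blast
    have "openin (top_of_set {0..1}) {s \<in> topspace (top_of_set {0..1}). \<alpha> s \<in> b n}"
      by (rule openin_continuous_map_preimage[OF a[unfolded pathin_def] b])
    then have "openin (top_of_set {0..1}) {s \<in> {0..1}. \<alpha> s \<in> b n}" by simp
    then obtain d where d: "d > 0" "\<And>s. s \<in> {0..1} ==> dist s x < d ==> \<alpha> s \<in> b n"
    proof -
      have "\<exists>e>0. \<forall>x'\<in>{0..1}. dist x' x < e --> x' \<in> {s \<in> {0..1}. \<alpha> s \<in> b n}"
        using \<open>openin (top_of_set {0..1}) {s \<in> {0..1}. \<alpha> s \<in> b n}\<close> x n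
        unfolding openin_euclidean_subtopology_iff by simp
      then obtain e where "e > 0" "\<forall>x'\<in>{0..1}. dist x' x < e --> x' \<in> {s \<in> {0..1}. \<alpha> s \<in> b n}" by blast
      then show thesis by (intro that[of e]) auto
    qed
    have "P s t" if st: "s \<le> x" "x \<le> t" "t - s < d" for s t
      unfolding P_def
    proof
      assume st': "0 \<le> s \<and> s \<le> t \<and> t \<le> 1"
      have "seg s t r \<in> b n" if r: "r \<in> {0..1}" for r
      proof -
        have l: "s \<le> s + r * (t - s)" "s + r * (t - s) \<le> t" using lin[of s t r] r st by auto
        show ?thesis unfolding seg_def
        proof (rule d(2))
          show "s + r * (t - s) \<in> {0..1}" using l st' by auto
          show "dist (s + r * (t - s)) x < d" using l st unfolding dist_real_def abs_less_iff by linarith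
        qed
      qed
      then have "pathin (subtopology Y (b n)) (seg s t)" using pseg st' by (intro pathin_subtopologyI) auto
      then have "follows Y b (Leaf n) (path_class Y (seg s t))" by (auto simp: small_class_def)
      then show "\<exists>T. follows Y b T (path_class Y (seg s t))" by blast
    qed
    then show "\<exists>d>0. \<forall>s t. s \<le> x \<and> x \<le> t \<and> t - s < d --> P s t" using d(1) by blast
  qed simp
  moreover have "seg 0 1 = \<alpha>" by (simp add: seg_def)
  ultimately show ?thesis unfolding P_def by simp
qed

lemma second_countable_countable_open_cover:
  assumes "countable \<W>" "\<And>W. W \<in> \<W> ==> openin X W" "\<And>W. W \<in> \<W> ==> second_countable (subtopology X W)"
    "topspace X \<subseteq> \<Union>\<W>"
  shows "second_countable X"
proof -
  have "\<forall>W\<in>\<W>. \<exists>\<B>. countable \<B> \<and> (\<forall>V\<in>\<B>. openin (subtopology X W) V) \<and>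
      (\<forall>U x. openin (subtopology X W) U \<and> x \<in> U --> (\<exists>V\<in>\<B>. x \<in> V \<and> V \<subseteq> U))"
    using assms(3) unfolding second_countable_def by blast
  from bchoice[OF this] obtain \<B> where B: "\<forall>W\<in>\<W>. countable (\<B> W) \<and> (\<forall>V\<in>\<B> W. openin (subtopology X W) V) \<and>
      (\<forall>U x. openin (subtopology X W) U \<and> x \<in> U --> (\<exists>V\<in>\<B> W. x \<in> V \<and> V \<subseteq> U))" by (rule exE)
  let ?C = "\<Union>W\<in>\<W>. \<B> W"
  have "countable ?C" using assms(1) B by blast
  moreover have "\<forall>V\<in>?C. openin X V" using B assms(2) openin_trans_full by blast
  moreover have "\<forall>U x. openin X U \<and> x \<in> U --> (\<exists>V\<in>?C. x \<in> V \<and> V \<subseteq> U)"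
  proof (intro allI impI)
    fix U x assume U: "openin X U \<and> x \<in> U"
    then have "x \<in> topspace X" using openin_subset by blast
    then obtain W where W: "W \<in> \<W>" "x \<in> W" using assms(4) by blast
    have "openin (subtopology X W) (U \<inter> W)" using U by (simp add: openin_subtopology_Int)
    moreover have "x \<in> U \<inter> W" using U W by blast
    ultimately obtain V where "V \<in> \<B> W" "x \<in> V" "V \<subseteq> U \<inter> W"
      using B W(1) by meson
    then show "\<exists>V\<in>?C. x \<in> V \<and> V \<subseteq> U" using W(1) by blast
  qed
  ultimately show ?thesis unfolding second_countable_def by (intro exI[of _ ?C] conjI)
qed

text \<open>
  For each itinerary that is followed at all, one class following it is chosen. All others that
  follow it lie in the sheet around the chosen one, so countably many sheets cover the space, and a
  sheet is homeomorphic to a subspace of \<open>Y \<times> Y\<close>.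
\<close>

lemma second_countable_path_class_top:
  assumes Y: "second_countable Y" and nY: "locally_nice Y"
  shows "second_countable (path_class_top Y)"
proof -
  obtain b :: "nat => _" where b: "\<And>n. openin Y (b n)" "\<And>n. nice Y (b n)"
    "\<And>U x. openin Y U ==> x \<in> U ==> \<exists>n. x \<in> b n \<and> b n \<subseteq> U"
    by (rule countable_nice_basis[OF Y nY]) (rule that)
  define C where "C = {T. \<exists>\<alpha>. pathin Y \<alpha> \<and> follows Y b T (path_class Y \<alpha>)}"
  have "\<forall>T\<in>C. \<exists>\<alpha>. pathin Y \<alpha> \<and> follows Y b T (path_class Y \<alpha>)" by (simp add: C_def)
  from bchoice[OF this] obtain A where A: "\<forall>T\<in>C. pathin Y (A T) \<and> follows Y b T (path_class Y (A T))" by (rule exE)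
  define N where "N T = path_nbhd Y (first_set b T) (last_set b T) (A T)" for T
  have sets: "openin Y (first_set b T)" "nice Y (first_set b T)" "openin Y (last_set b T)" "nice Y (last_set b T)" for T
    using first_last_set[of b T] b(1,2) by auto
  have ends: "A T 0 \<in> first_set b T" "A T 1 \<in> last_set b T" if "T \<in> C" for T
    using A that follows_in[of Y b T "path_class Y (A T)"] by auto
  have sh: "sheet (path_class_top Y) (prod_topology Y Y) endpts (N T)" if "T \<in> C" for T
    unfolding N_def using A that ends[OF that] sets by (intro sheet_path_nbhd[OF nY]) auto
  show ?thesis
  proof (rule second_countable_countable_open_cover[of "N ` C"])
    show "countable (N ` C)" by simp
    show "openin (path_class_top Y) W" if W: "W \<in> N ` C" for W using sheetD(1) sh W by blast
    show "second_countable (subtopology (path_class_top Y) W)" if W: "W \<in> N ` C" for W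
    proof -
      have "sheet (path_class_top Y) (prod_topology Y Y) endpts W" using sh W by blast
      then have "subtopology (path_class_top Y) W homeomorphic_space subtopology (prod_topology Y Y) (endpts ` W)"
        unfolding sheet_def using homeomorphic_map_imp_homeomorphic_space by blast
      then show ?thesis
        using homeomorphic_space_second_countability second_countable_subtopology[OF second_countable_prod_topology[OF Y Y]]
        by blast
    qed
    show "topspace (path_class_top Y) \<subseteq> \<Union>(N ` C)"
    proof
      fix c assume "c \<in> topspace (path_class_top Y)"
      then have c: "c \<in> path_classes Y" by simp
      then obtain \<alpha> where a: "pathin Y \<alpha>" "c = path_class Y \<alpha>" by (rule path_classesE)
      obtain T where T: "follows Y b T c" using follows_exists[OF b(1,3) a(1)] a(2) by blast
      then have TC: "T \<in> C" using a by (auto simp: C_def)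
      let ?r = "path_class Y (A T)"
      have r: "pathin Y (A T)" "follows Y b T ?r" using A TC by auto
      have rY: "?r \<in> path_classes Y" by (rule path_class_in[OF r(1)])
      have m: "class_start c \<in> first_set b T" "class_end c \<in> last_set b T" using follows_in[OF T] by auto
      obtain d where d: "small_class Y (first_set b T) d" "class_start d = class_start c" "class_end d = A T 0"
        by (rule nice_join[OF sets(2) m(1) ends(1)[OF TC]])
      obtain d' where d': "small_class Y (last_set b T) d'" "class_start d' = class_end c" "class_end d' = A T 1"
        by (rule nice_join[OF sets(4) m(2) ends(2)[OF TC]])
      have eq: "class_mul Y d ?r = class_mul Y c d'"
        by (rule follows_unique[OF b(2) T r(2) d(1,2) _ d'(1,2)]) (simp_all add: d d' r)
      note ins = c rY small_classD(1)[OF d(1)] small_classD(1)[OF d'(1)]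
      have "class_mul Y d (class_mul Y ?r (class_inv Y d')) = class_mul Y (class_mul Y d ?r) (class_inv Y d')"
        using ins d d' r by (simp add: class_mul_assoc class_inv_in)
      also have "\<dots> = class_mul Y c (class_mul Y d' (class_inv Y d'))"
        unfolding eq using ins d' by (simp add: class_mul_assoc class_inv_in)
      also have "\<dots> = c" unfolding class_mul_inv_right[OF ins(4)] using class_mul_idr[OF c] d' by simp
      finally have "c = class_mul Y d (class_mul Y ?r (class_inv Y d'))" by simp
      then have "c \<in> N T" unfolding N_def path_nbhd_iff[OF r(1)]
        using d d' small_class_inv[OF d'(1)] class_inv_in[OF ins(4)]
        by (intro exI[of _ d] exI[of _ "class_inv Y d'"]) simp
      then show "c \<in> \<Union>(N ` C)" using TC by blast
    qed
  qed
qed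

subsection \<open>Manifolds are locally simply connected\<close>

lemma chart_continuous:
  assumes c: "is_chart T c"
  shows "continuous_map (subtopology T (cdom c)) (cspace (cdim c)) (cmap c)"
  unfolding continuous_map
proof (intro conjI allI impI)
  have ts: "topspace (subtopology T (cdom c)) = cdom c" using openin_subset[OF is_chartD(1)[OF c]] by auto
  show "cmap c ` topspace (subtopology T (cdom c)) \<subseteq> topspace (cspace (cdim c))"
    unfolding ts topspace_cspace by (rule is_chartD(4)[OF c])
  fix U assume U: "openin (cspace (cdim c)) U"
  show "openin (subtopology T (cdom c)) {x \<in> topspace (subtopology T (cdom c)). cmap c x \<in> U}"
    unfolding ts openin_open_subtopology[OF is_chartD(1)[OF c]] using is_chartD(5)[OF c U] by auto
qed

lemma cdist_convex:
  assumes "cdist n z a < r" "cdist n w a < r" "t \<in> {0..1}"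
  shows "cdist n (\<lambda>i. of_real (1 - t) * z i + of_real t * w i) a < r"
proof -
  have "cmod (of_real (1 - t) * z i + of_real t * w i - a i) \<le> (1 - t) * cmod (z i - a i) + t * cmod (w i - a i)" for i
  proof -
    have "of_real (1 - t) * z i + of_real t * w i - a i = of_real (1 - t) * (z i - a i) + of_real t * (w i - a i)"
      by (simp add: algebra_simps)
    then show ?thesis
      using norm_triangle_ineq[of "of_real (1 - t) * (z i - a i)" "of_real t * (w i - a i)"] assms(3)
      by (simp add: norm_mult del: of_real_diff)
  qed
  then have "cdist n (\<lambda>i. of_real (1 - t) * z i + of_real t * w i) a \<le> (1 - t) * cdist n z a + t * cdist n w a"
    unfolding cdist_def cnorm_def sum_distrib_left sum.distrib[symmetric] by (rule sum_mono)
  also have "\<dots> < r"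
    using assms by (intro convex_bound_lt) auto
  finally show ?thesis .
qed

text \<open>
  Coordinate balls are convex.
\<close>

lemma manifold_locally_nice:
  assumes M: "complex_manifold M"
  shows "locally_nice (Top M)"
  unfolding locally_nice_def
proof (intro allI impI)
  fix U x assume U: "openin (Top M) U \<and> x \<in> U"
  then have xt: "x \<in> pts M" using openin_subset by blast
  obtain c where c: "c \<in> Atlas M" "x \<in> cdom c" by (rule manifold_chart_at[OF M xt])
  have cc: "is_chart (Top M) c" using manifold_chart_open(1)[OF M c(1)] .
  let ?n = "cdim c"
  obtain \<delta> where \<delta>: "\<delta> > 0" "\<forall>y\<in>cdom c. cdist ?n (cmap c y) (cmap c x) < \<delta> --> y \<in> U"
    "{z \<in> Ec ?n. cdist ?n z (cmap c x) < \<delta>} \<subseteq> cmap c ` (U \<inter> cdom c)"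
    by (rule chart_nbhd[OF cc c(2) conjunct1[OF U] conjunct2[OF U]])
  define V where "V = {y \<in> cdom c. cdist ?n (cmap c y) (cmap c x) < \<delta>}"
  define B where "B = {z \<in> Ec ?n. cdist ?n z (cmap c x) < \<delta>}"
  define g where "g = inv_into (cdom c) (cmap c)"
  have inj: "inj_on (cmap c) (cdom c)" by (rule is_chartD(3)[OF cc])
  have gB: "g z \<in> V" "cmap c (g z) = z" if "z \<in> B" for z
  proof -
    have "z \<in> cmap c ` cdom c" using that \<delta>(3) by (auto simp: B_def)
    then have "g z \<in> cdom c" "cmap c (g z) = z" unfolding g_def by (simp_all add: inv_into_into f_inv_into_f)
    then show "g z \<in> V" "cmap c (g z) = z" using that by (auto simp: V_def B_def)
  qed
  have gV: "g (cmap c y) = y" if "y \<in> V" for y using that inj by (simp add: g_def V_def inv_into_f_f)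
  have VB: "cmap c y \<in> B" if "y \<in> V" for y using that is_chartD(4)[OF cc] by (auto simp: V_def B_def)
  have oB: "openin (cspace ?n) B" unfolding B_def by (rule openin_cspace_cball)
  have tsB: "topspace (subtopology (cspace ?n) B) = B" using openin_subset[OF oB] by auto
  have gc: "continuous_map (subtopology (cspace ?n) B) (Top M) g"
    unfolding continuous_map tsB
  proof (intro conjI allI impI)
    show "g ` B \<subseteq> pts M" using gB(1) openin_subset[OF is_chartD(1)[OF cc]] by (auto simp: V_def)
    fix W assume W: "openin (Top M) W"
    have "{z \<in> B. g z \<in> W} = B \<inter> cmap c ` (W \<inter> cdom c)"
    proof (rule set_eqI)
      fix z show "z \<in> {z \<in> B. g z \<in> W} \<longleftrightarrow> z \<in> B \<inter> cmap c ` (W \<inter> cdom c)"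
      proof
        assume z: "z \<in> {z \<in> B. g z \<in> W}"
        then have "z = cmap c (g z)" "g z \<in> W \<inter> cdom c" using gB[of z] by (auto simp: V_def)
        then show "z \<in> B \<inter> cmap c ` (W \<inter> cdom c)" using z by blast
      next
        assume "z \<in> B \<inter> cmap c ` (W \<inter> cdom c)"
        then obtain y where y: "z \<in> B" "z = cmap c y" "y \<in> W" "y \<in> cdom c" by blast
        then have "g z = y" using inj by (simp add: g_def inv_into_f_f)
        then show "z \<in> {z \<in> B. g z \<in> W}" using y by simp
      qed
    qed
    then show "openin (subtopology (cspace ?n) B) {z \<in> B. g z \<in> W}"
      unfolding openin_open_subtopology[OF oB] using oB is_chartD(6)[OF cc W] by auto
  qed
  have Vt: "y \<in> pts M" if "y \<in> V" for y using that chart_subset_topspace[OF cc] by (simp add: V_def)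
  have coord: "continuous_on {0..1} (\<lambda>s. cmap c (\<beta> s) i)" if p: "pathin (subtopology (Top M) V) \<beta>" for \<beta> i
  proof -
    have "continuous_map (top_of_set {0..1}) (subtopology (Top M) (cdom c)) \<beta>"
      using pathin_subtopologyD[OF p] unfolding pathin_def continuous_map_in_subtopology by (auto simp: V_def)
    from continuous_map_compose[OF continuous_map_compose[OF this chart_continuous[OF cc]] continuous_map_cspace_coord[of ?n i]]
    show ?thesis by (simp add: o_def)
  qed
  let ?L = "\<lambda>t z w. (\<lambda>i. of_real (1 - t) * z i + of_real t * w i) :: nat => complex"
  have LB: "?L t z w \<in> B" if "z \<in> B" "w \<in> B" "t \<in> {0..1}" for t z w
    using that cdist_convex[of ?n z "cmap c x" \<delta> w t] by (auto simp: B_def Ec_def)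
  have toB: "continuous_map (top_of_set S) (Top M) (\<lambda>q. g (k q))"
    if k: "\<And>i. continuous_on S (\<lambda>q. k q i)" "\<And>q. q \<in> S ==> k q \<in> B" for S :: "'c::topological_space set" and k
  proof -
    have "continuous_map (top_of_set S) (subtopology (cspace ?n) B) k"
      unfolding continuous_map_in_subtopology continuous_map_into_cspace using k by (auto simp: B_def)
    from continuous_map_compose[OF this gc] show ?thesis by (simp add: o_def)
  qed
  have join: "\<exists>b. small_class (Top M) V b \<and> class_start b = y \<and> class_end b = z" if yz: "y \<in> V" "z \<in> V" for y z
  proof -
    let ?\<beta> = "\<lambda>t. g (?L t (cmap c y) (cmap c z))"
    have "pathin (Top M) ?\<beta>"
      unfolding pathin_def by (rule toB) (auto intro!: continuous_intros LB VB yz simp del: of_real_diff)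
    then have p: "pathin (subtopology (Top M) V) ?\<beta>"
      by (rule pathin_subtopologyI) (rule gB(1)[OF LB[OF VB[OF yz(1)] VB[OF yz(2)]]])
    have "?\<beta> 0 = y" "?\<beta> 1 = z" using gV yz by simp_all
    then show ?thesis unfolding small_class_def using p pathin_subtopologyD(1)[OF p]
      by (intro exI[of _ "path_class (Top M) ?\<beta>"] conjI exI[of _ ?\<beta>]) simp_all
  qed
  have unique: "b = b'" if b: "small_class (Top M) V b" "small_class (Top M) V b'" "class_start b = class_start b'" "class_end b = class_end b'" for b b'
  proof -
    obtain \<beta> where \<beta>: "pathin (subtopology (Top M) V) \<beta>" "b = path_class (Top M) \<beta>" using b(1) unfolding small_class_def by blast
    obtain \<beta>' where \<beta>': "pathin (subtopology (Top M) V) \<beta>'" "b' = path_class (Top M) \<beta>'" using b(2) unfolding small_class_def by blast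
    note pY = pathin_subtopologyD(1)[OF \<beta>(1)] pathin_subtopologyD(1)[OF \<beta>'(1)]
    have e: "\<beta> 0 = \<beta>' 0" "\<beta> 1 = \<beta>' 1" using b(3,4) pY by (simp_all add: \<beta>(2) \<beta>'(2))
    have in_V: "\<beta> s \<in> V" "\<beta>' s \<in> V" if "s \<in> {0..1}" for s
      using pathin_subtopologyD(2)[OF \<beta>(1) that] pathin_subtopologyD(2)[OF \<beta>'(1) that] by auto
    have same: "?L t z z = z" for t z by (auto simp: algebra_simps)
    have "path_homotopic (Top M) \<beta> \<beta>'"
    proof (rule path_homotopicI)
      show "continuous_map (top_of_set square) (Top M)
          (\<lambda>q. g (?L (fst q) (cmap c (\<beta> (snd q))) (cmap c (\<beta>' (snd q)))))"
      proof (rule toB)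
        fix i
        have "continuous_on square (\<lambda>q::real\<times>real. cmap c (\<gamma> (snd q)) i)" if "pathin (subtopology (Top M) V) \<gamma>" for \<gamma>
          by (rule continuous_on_compose2[OF coord[OF that, of i]]) (auto intro!: continuous_intros)
        from this[OF \<beta>(1)] this[OF \<beta>'(1)]
        show "continuous_on square (\<lambda>q::real\<times>real. ?L (fst q) (cmap c (\<beta> (snd q))) (cmap c (\<beta>' (snd q))) i)"
          by (intro continuous_intros)
      next
        show "?L (fst q) (cmap c (\<beta> (snd q))) (cmap c (\<beta>' (snd q))) \<in> B" if "q \<in> square" for q
          using that by (intro LB VB in_V) auto
      qed
    qed (use gV in_V e in \<open>simp_all add: same del: of_real_diff\<close>)
    from path_class_eqI[OF this] show ?thesis by (simp add: \<beta>(2) \<beta>'(2))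
  qed
  have "nice (Top M) V" unfolding nice_def using join unique by blast
  moreover have "openin (Top M) V" unfolding V_def by (rule chart_ball_open[OF cc])
  moreover have "x \<in> V" "V \<subseteq> U" using c \<delta> by (auto simp: V_def)
  ultimately show "\<exists>V. openin (Top M) V \<and> x \<in> V \<and> V \<subseteq> U \<and> nice (Top M) V" by blast
qed

section \<open>The fundamental groupoid is a Lie groupoid\<close>

lemma endpts_lambda: "(\<lambda>c. (class_end c, class_start c)) = endpts"
  by (simp add: endpts_def fun_eq_iff)

lemma fundamental_groupoid_simps [simp]:
  "Obj (\<Pi>\<^sub>1 Y) = Y" "gsrc (\<Pi>\<^sub>1 Y) = class_start" "gtgt (\<Pi>\<^sub>1 Y) = class_end"
  "gid (\<Pi>\<^sub>1 Y) = (\<lambda>y. path_class (Top Y) (\<lambda>_. y))" "gmul (\<Pi>\<^sub>1 Y) = class_mul (Top Y)"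
  "ginv (\<Pi>\<^sub>1 Y) = class_inv (Top Y)" "Top (Path Y) = path_class_top (Top Y)"
  by (simp_all add: fundamental_groupoid_def)

lemma Arr_fundamental_groupoid:
  "Path Y = local_homeo_manifold (path_class_top (Top Y)) endpts (Y \<times>\<^sub>M Y)"
  by (simp add: fundamental_groupoid_def endpts_lambda)

context
  fixes Y :: "'a cmanifold"
  assumes Y: "complex_manifold Y"
begin

lemma local_homeo_endpts_manifold: "local_homeo (path_class_top (Top Y)) (Top (Y \<times>\<^sub>M Y)) endpts"
  using local_homeo_endpts[OF manifold_locally_nice[OF Y]] by simp

lemma manifold_Arr: "complex_manifold (Path Y)"
  unfolding Arr_fundamental_groupoid
proof (rule manifold_local_homeo[OF manifold_prod[OF Y Y] local_homeo_endpts_manifold])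
  have "Hausdorff_space (Top Y)" "second_countable (Top Y)" using Y by (auto simp: complex_manifold_def)
  then show "Hausdorff_space (path_class_top (Top Y))" "second_countable (path_class_top (Top Y))"
    using Hausdorff_path_class_top second_countable_path_class_top manifold_locally_nice[OF Y] by blast+
qed

lemma hol_at_endpts: "c \<in> path_classes (Top Y) ==> hol_at (Path Y) (Y \<times>\<^sub>M Y) endpts c"
  unfolding Arr_fundamental_groupoid
  by (rule hol_at_local_homeo[OF manifold_prod[OF Y Y] local_homeo_endpts_manifold]) simp

lemma section_at_endpts: "c \<in> path_classes (Top Y) ==> section_at (Path Y) (Y \<times>\<^sub>M Y) endpts c"
  unfolding Arr_fundamental_groupoid
  by (rule section_at_local_homeo[OF manifold_prod[OF Y Y] local_homeo_endpts_manifold]) simp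

lemma endpts_in: "c \<in> path_classes (Top Y) ==> endpts c \<in> pts (Y \<times>\<^sub>M Y)"
  using class_ends_in by (auto simp: endpts_def)

lemma hol_at_class_start: "c \<in> path_classes (Top Y) ==> hol_at (Path Y) Y class_start c"
  using hol_at_compose[OF charted_manifold[OF manifold_Arr] manifold_prod[OF Y Y] hol_at_endpts
      hol_at_snd[OF Y endpts_in]] by (simp add: endpts_def)

lemma hol_at_class_end: "c \<in> path_classes (Top Y) ==> hol_at (Path Y) Y class_end c"
  using hol_at_compose[OF charted_manifold[OF manifold_Arr] manifold_prod[OF Y Y] hol_at_endpts
      hol_at_fst[OF Y endpts_in]] by (simp add: endpts_def)

lemma section_at_class_start: "c \<in> path_classes (Top Y) ==> section_at (Path Y) Y class_start c"
  using section_at_compose[OF manifold_prod[OF Y Y] Y section_at_endpts section_at_snd[OF Y Y endpts_in]]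
  by (simp add: endpts_def)

lemma section_at_class_end: "c \<in> path_classes (Top Y) ==> section_at (Path Y) Y class_end c"
  using section_at_compose[OF manifold_prod[OF Y Y] Y section_at_endpts section_at_fst[OF Y Y endpts_in]]
  by (simp add: endpts_def)

end

text \<open>
  The complex structure on path classes is pulled back along the end point map.
\<close>

lemma hol_at_into_Arr:
  assumes "cont_at (Top M) (path_class_top (Top Y)) f x"
    "hol_at M Y (\<lambda>y. class_end (f y)) x" "hol_at M Y (\<lambda>y. class_start (f y)) x"
  shows "hol_at M (Path Y) f x"
  unfolding Arr_fundamental_groupoid
  by (rule hol_at_into_local_homeo[OF assms(1)]) (use hol_at_pair[OF assms(2,3)] in \<open>simp add: endpts_def\<close>)

lemma fibre_prod_simps [simp]:
  "Top (fibre_prod M N f g) = subtopology (prod_topology (Top M) (Top N)) {(x, y). f x = g y}"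
  by (simp add: fibre_prod_def)

lemma charted_fibre_prod: "charted (fibre_prod M N f g)"
  unfolding fibre_prod_def by (rule charted_submanifold)

lemma hol_at_fibre_prod_proj:
  assumes M: "complex_manifold M" and N: "complex_manifold N" and q: "q \<in> pts (fibre_prod M N f g)"
  shows "hol_at (fibre_prod M N f g) M fst q" "hol_at (fibre_prod M N f g) N snd q"
proof -
  have P: "complex_manifold (M \<times>\<^sub>M N)" by (rule manifold_prod[OF M N])
  have qt: "q \<in> pts (M \<times>\<^sub>M N)" "q \<in> pts (M \<times>\<^sub>M N) \<inter> {(x, y). f x = g y}" using q by auto
  have i: "hol_at (fibre_prod M N f g) (M \<times>\<^sub>M N) (\<lambda>x. x) q"
    unfolding fibre_prod_def by (rule hol_at_submanifold_inclusion[OF P qt(2)])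
  show "hol_at (fibre_prod M N f g) M fst q"
    using hol_at_compose[OF charted_fibre_prod P i, of M fst] hol_at_fst[OF M qt(1)] by simp
  show "hol_at (fibre_prod M N f g) N snd q"
    using hol_at_compose[OF charted_fibre_prod P i, of N snd] hol_at_snd[OF N qt(1)] by simp
qed

lemma hol_at_cong_topspace:
  assumes "charted M" "hol_at M N f x" "\<And>y. y \<in> pts M ==> g y = f y"
  shows "hol_at M N g x"
proof (rule hol_at_cong[OF assms(1,2) openin_topspace])
  show "x \<in> pts M" using hol_at_cont[OF assms(2)] by (simp add: cont_at_def)
qed (rule assms(3))

lemma hol_at_class_mul:
  assumes Y: "complex_manifold Y"
    and q: "q \<in> pts (fibre_prod (Path Y) (Path Y) class_end class_start)"
  shows "hol_at (fibre_prod (Path Y) (Path Y) class_end class_start) (Path Y)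
           (\<lambda>(g, h). class_mul (Top Y) g h) q" (is "hol_at ?F _ _ _")
proof (rule hol_at_into_Arr)
  have A: "complex_manifold (Path Y)" by (rule manifold_Arr[OF Y])
  have ch: "charted ?F" by (rule charted_fibre_prod)
  have q': "fst q \<in> path_classes (Top Y)" "snd q \<in> path_classes (Top Y)" "class_end (fst q) = class_start (snd q)"
    using q by auto
  show "cont_at (Top ?F) (path_class_top (Top Y)) (\<lambda>(g, h). class_mul (Top Y) g h) q"
    using cont_at_class_mul[OF manifold_locally_nice[OF Y] q'] by simp
  have "hol_at ?F Y (\<lambda>x. class_end (snd x)) q"
    by (rule hol_at_compose[OF ch A hol_at_fibre_prod_proj(2)[OF A A q] hol_at_class_end[OF Y q'(2)]])
  then show "hol_at ?F Y (\<lambda>x. class_end (case x of (g, h) => class_mul (Top Y) g h)) q"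
    by (rule hol_at_cong_topspace[OF ch]) (auto simp: class_mul_in)
  have "hol_at ?F Y (\<lambda>x. class_start (fst x)) q"
    by (rule hol_at_compose[OF ch A hol_at_fibre_prod_proj(1)[OF A A q] hol_at_class_start[OF Y q'(1)]])
  then show "hol_at ?F Y (\<lambda>x. class_start (case x of (g, h) => class_mul (Top Y) g h)) q"
    by (rule hol_at_cong_topspace[OF ch]) (auto simp: class_mul_in)
qed

lemma hol_at_class_inv:
  assumes Y: "complex_manifold Y" and c: "c \<in> path_classes (Top Y)"
  shows "hol_at (Path Y) (Path Y) (class_inv (Top Y)) c"
proof (rule hol_at_into_Arr)
  have ch: "charted (Path Y)" by (rule charted_manifold[OF manifold_Arr[OF Y]])
  show "cont_at (Top (Path Y)) (path_class_top (Top Y)) (class_inv (Top Y)) c" using cont_at_class_inv[OF c] by simp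
  show "hol_at (Path Y) Y (\<lambda>y. class_end (class_inv (Top Y) y)) c"
    by (rule hol_at_cong_topspace[OF ch hol_at_class_start[OF Y c]]) (simp add: class_inv_in)
  show "hol_at (Path Y) Y (\<lambda>y. class_start (class_inv (Top Y) y)) c"
    by (rule hol_at_cong_topspace[OF ch hol_at_class_end[OF Y c]]) (simp add: class_inv_in)
qed

theorem lie_groupoid_fundamental_groupoid:
  assumes Y: "complex_manifold Y"
  shows "lie_groupoid (\<Pi>\<^sub>1 Y)"
proof -
  have A: "complex_manifold (Path Y)" by (rule manifold_Arr[OF Y])
  note chA = charted_manifold[OF A] and chY = charted_manifold[OF Y]
  have 1: "holomorphic_submersion (Path Y) Y class_start"
    by (rule submersion_from_sections[OF A Y]) (simp_all add: hol_at_class_start[OF Y] section_at_class_start[OF Y])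
  have 2: "holomorphic_submersion (Path Y) Y class_end"
    by (rule submersion_from_sections[OF A Y]) (simp_all add: hol_at_class_end[OF Y] section_at_class_end[OF Y])
  have 3: "holomorphic_map Y (Path Y) (\<lambda>y. path_class (Top Y) (\<lambda>_. y))"
  proof (rule iffD2[OF holomorphic_map_iff_hol_at[OF chY]], rule ballI)
    fix y assume y: "y \<in> pts Y"
    show "hol_at Y (Path Y) (\<lambda>y. path_class (Top Y) (\<lambda>_. y)) y"
    proof (rule hol_at_into_Arr)
      show "hol_at Y Y (\<lambda>y. class_end (path_class (Top Y) (\<lambda>_. y))) y"
        by (rule hol_at_cong_topspace[OF chY hol_at_id[OF Y y]]) (simp add: pathin_const_iff)
      show "hol_at Y Y (\<lambda>y. class_start (path_class (Top Y) (\<lambda>_. y))) y"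
        by (rule hol_at_cong_topspace[OF chY hol_at_id[OF Y y]]) (simp add: pathin_const_iff)
    qed (rule cont_at_class_id[OF manifold_locally_nice[OF Y] y])
  qed
  have 4: "holomorphic_map (fibre_prod (Path Y) (Path Y) class_end class_start) (Path Y)
       (\<lambda>(g, h). class_mul (Top Y) g h)"
    by (rule iffD2[OF holomorphic_map_iff_hol_at[OF charted_fibre_prod]], rule ballI, rule hol_at_class_mul[OF Y])
  have 5: "holomorphic_map (Path Y) (Path Y) (class_inv (Top Y))"
    by (rule iffD2[OF holomorphic_map_iff_hol_at[OF chA]], rule ballI, rule hol_at_class_inv[OF Y]) simp
  show ?thesis
    unfolding lie_groupoid_def using Y A 1 2 3 4 5
    by (simp add: class_mul_in class_mul_assoc class_mul_idl class_mul_idr class_inv_in class_mul_inv_left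
        class_mul_inv_right pathin_const_iff)
qed

section \<open>Serre fibrations\<close>

lemma serre_fibration_pullback:
  assumes p: "serre_fibration E B p" and g: "continuous_map T B g"
  shows "serre_fibration (subtopology (prod_topology E T) {(x, y). p x = g y}) T snd"
    (is "serre_fibration ?Z T snd")
  unfolding serre_fibration_def
proof (intro conjI allI impI)
  show "continuous_map ?Z T snd" by (intro continuous_map_from_subtopology continuous_map_snd)
  fix n f h
  assume *: "continuous_map (unit_cube n) ?Z f \<and>
    continuous_map (prod_topology (unit_cube n) (top_of_set {0..1::real})) T h \<and>
    (\<forall>x\<in>topspace (unit_cube n). h (x, 0) = snd (f x))"
  then have f: "continuous_map (unit_cube n) (prod_topology E T) f" "\<And>x. x \<in> topspace (unit_cube n) ==> p (fst (f x)) = g (snd (f x))"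
    unfolding continuous_map_in_subtopology by (auto simp: Pi_iff case_prod_beta)
  have "continuous_map (unit_cube n) E (\<lambda>x. fst (f x))"
    using continuous_map_compose[OF f(1) continuous_map_fst] by (simp add: o_def)
  moreover have "continuous_map (prod_topology (unit_cube n) (top_of_set {0..1::real})) B (\<lambda>q. g (h q))"
    using continuous_map_compose[OF conjunct1[OF conjunct2[OF *]] g] by (simp add: o_def)
  moreover have "\<forall>x\<in>topspace (unit_cube n). g (h (x, 0)) = p (fst (f x))" using * f(2) by simp
  ultimately obtain k where k: "continuous_map (prod_topology (unit_cube n) (top_of_set {0..1::real})) E k"
    "\<forall>x\<in>topspace (unit_cube n). k (x, 0) = fst (f x)"
    "\<forall>x\<in>topspace (unit_cube n). \<forall>t\<in>{0..1}. p (k (x, t)) = g (h (x, t))"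
    using p[unfolded serre_fibration_def, THEN conjunct2, rule_format,
        of n "\<lambda>x. fst (f x)" "\<lambda>q. g (h q)"] by blast
  have "continuous_map (prod_topology (unit_cube n) (top_of_set {0..1::real})) ?Z (\<lambda>q. (k q, h q))"
    unfolding continuous_map_in_subtopology
    using k(1,3) * by (auto intro: continuous_map_pairedI)
  moreover have "\<forall>x\<in>topspace (unit_cube n). (k (x, 0), h (x, 0)) = f x" using k(2) * by simp
  ultimately show "\<exists>k. continuous_map (prod_topology (unit_cube n) (top_of_set {0..1::real})) ?Z k \<and>
      (\<forall>x\<in>topspace (unit_cube n). k (x, 0) = f x) \<and>
      (\<forall>x\<in>topspace (unit_cube n). \<forall>t\<in>{0..1}. snd (k (x, t)) = h (x, t))"
    by (intro exI[of _ "\<lambda>q. (k q, h q)"]) simp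
qed

text \<open>Homotopies are lifted over any space homeomorphic to a cube.\<close>

lemma serre_fibration_lift:
  assumes q: "serre_fibration E B q"
    and e: "continuous_map A (unit_cube n) e" and r: "continuous_map (unit_cube n) A r"
    and re: "\<And>a. a \<in> topspace A ==> r (e a) = a"
    and f: "continuous_map A E f" and h: "continuous_map (prod_topology A (top_of_set {0..1::real})) B h"
    and hf: "\<And>a. a \<in> topspace A ==> h (a, 0) = q (f a)"
  obtains k where "continuous_map (prod_topology A (top_of_set {0..1::real})) E k"
    "\<And>a. a \<in> topspace A ==> k (a, 0) = f a"
    "\<And>a t. a \<in> topspace A ==> t \<in> {0..1} ==> q (k (a, t)) = h (a, t)"
proof -
  let ?I = "top_of_set {0..1::real}" and ?C = "unit_cube n"
  have fr: "continuous_map ?C E (\<lambda>x. f (r x))" using continuous_map_compose[OF r f] by (simp add: o_def)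
  have "continuous_map (prod_topology ?C ?I) (prod_topology A ?I) (\<lambda>y. (r (fst y), snd y))"
    using continuous_map_compose[OF continuous_map_fst r, of ?I]
    by (intro continuous_map_pairedI continuous_map_snd) (simp add: o_def)
  then have hr: "continuous_map (prod_topology ?C ?I) B (\<lambda>y. h (r (fst y), snd y))"
    using continuous_map_compose[OF _ h] by (fastforce simp: o_def)
  have rC: "r x \<in> topspace A" if "x \<in> topspace ?C" for x using r that by (auto simp: continuous_map_def)
  have "\<forall>x\<in>topspace ?C. h (r (fst (x, 0::real)), snd (x, 0::real)) = q (f (r x))" using hf rC by simp
  then obtain k where k: "continuous_map (prod_topology ?C ?I) E k" "\<forall>x\<in>topspace ?C. k (x, 0) = f (r x)"
    "\<forall>x\<in>topspace ?C. \<forall>t\<in>{0..1}. q (k (x, t)) = h (r (fst (x, t)), snd (x, t))"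
    using q[unfolded serre_fibration_def, THEN conjunct2, rule_format, of n "\<lambda>x. f (r x)" "\<lambda>y. h (r (fst y), snd y)"] fr hr
    by blast
  have eC: "e a \<in> topspace ?C" if "a \<in> topspace A" for a using e that by (auto simp: continuous_map_def)
  have ce: "continuous_map (prod_topology A ?I) (prod_topology ?C ?I) (\<lambda>y. (e (fst y), snd y))"
    using continuous_map_compose[OF continuous_map_fst e, of ?I]
    by (intro continuous_map_pairedI continuous_map_snd) (simp add: o_def)
  show thesis
  proof (rule that[of "\<lambda>y. k (e (fst y), snd y)"])
    show "continuous_map (prod_topology A ?I) E (\<lambda>y. k (e (fst y), snd y))"
      using continuous_map_compose[OF ce k(1)] by (simp add: o_def)
  qed (use k(2,3) eC re in auto)
qed

lemma lift_path:
  assumes q: "serre_fibration E B q" and b: "pathin B \<beta>" and e: "x \<in> topspace E" "q x = \<beta> 0"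
  obtains \<alpha> where "pathin E \<alpha>" "\<alpha> 0 = x" "\<And>t. t \<in> {0..1} ==> q (\<alpha> t) = \<beta> t"
proof -
  let ?A = "top_of_set {0::real}"
  have h: "continuous_map (prod_topology ?A (top_of_set {0..1::real})) B (\<lambda>y. \<beta> (snd y))"
    using continuous_map_compose[OF continuous_map_snd b[unfolded pathin_def], of ?A] by (simp add: o_def)
  have u: "continuous_map ?A (unit_cube 0) (\<lambda>_ _. undefined)" "continuous_map (unit_cube 0) ?A (\<lambda>_. 0)"
    by (simp_all add: unit_cube_def)
  have f: "continuous_map ?A E (\<lambda>_. x)" using e by simp
  obtain k where k: "continuous_map (prod_topology ?A (top_of_set {0..1::real})) E k"
    "\<And>a. a \<in> topspace ?A ==> k (a, 0) = x"
    "\<And>a t. a \<in> topspace ?A ==> t \<in> {0..1} ==> q (k (a, t)) = \<beta> (snd (a, t))"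
    by (rule serre_fibration_lift[OF q u _ f h]) (use e that in auto)
  show thesis
  proof (rule that[of "\<lambda>t. k (0, t)"])
    have "continuous_map (top_of_set ({0} \<times> {0..1})) E k" using k(1) by simp
    then show "pathin E (\<lambda>t. k (0, t))" unfolding pathin_def
      by (rule continuous_map_top_of_set_compose) (auto intro!: continuous_intros)
  qed (use k(2,3) in auto)
qed

lemma continuous_map_into_cube:
  assumes "\<And>i. i < n ==> continuous_map A (top_of_set {0..1::real}) (\<lambda>a. f a i)" "\<And>a. f a \<in> extensional {..<n}"
  shows "continuous_map A (unit_cube n) f"
  unfolding unit_cube_def continuous_map_componentwise using assms by auto

lemma continuous_map_cube_coord: "i < n ==> continuous_map (unit_cube n) (top_of_set {0..1::real}) (\<lambda>x. x i)"
  unfolding unit_cube_def by (rule continuous_map_product_projection) simp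

lemma lift_homotopy:
  fixes f :: "real => 'e" and h :: "real \<times> real => 'b"
  assumes q: "serre_fibration E B q" and f: "pathin E f"
    and h: "continuous_map (top_of_set square) B h" "\<And>s. s \<in> {0..1} ==> h (s, 0) = q (f s)"
  obtains k where "continuous_map (top_of_set square) E k" "\<And>s. s \<in> {0..1} ==> k (s, 0) = f s"
    "\<And>s t. s \<in> {0..1} ==> t \<in> {0..1} ==> q (k (s, t)) = h (s, t)"
proof -
  let ?A = "top_of_set {0..1::real}"
  have e: "continuous_map ?A (unit_cube 1) (\<lambda>s. \<lambda>i\<in>{..<1}. s)"
    by (rule continuous_map_into_cube) auto
  have r: "continuous_map (unit_cube 1) ?A (\<lambda>x. x 0)" by (rule continuous_map_cube_coord) simp
  show thesis
    by (rule serre_fibration_lift[OF q e r _ f[unfolded pathin_def], of h]) (use h that in auto)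
qed

lemma lift_homotopy2:
  fixes f :: "real \<times> real => 'e" and h :: "(real \<times> real) \<times> real => 'b"
  assumes q: "serre_fibration E B q" and f: "continuous_map (top_of_set square) E f"
    and h: "continuous_map (top_of_set (square \<times> {0..1})) B h"
      "\<And>s. s \<in> square ==> h (s, 0) = q (f s)"
  obtains k where "continuous_map (top_of_set (square \<times> {0..1})) E k"
    "\<And>s. s \<in> square ==> k (s, 0) = f s"
    "\<And>s t. s \<in> square ==> t \<in> {0..1} ==> q (k (s, t)) = h (s, t)"
proof -
  let ?A = "top_of_set ({0..1} \<times> {0..1} :: (real \<times> real) set)"
  have e: "continuous_map ?A (unit_cube 2) (\<lambda>s. \<lambda>i\<in>{..<2}. if i = 0 then fst s else snd s)"
  proof (rule continuous_map_into_cube)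
    fix i :: nat assume "i < 2"
    then consider "i = 0" | "i = 1" by linarith
    then show "continuous_map ?A (top_of_set {0..1}) (\<lambda>s. (\<lambda>i\<in>{..<2}. if i = 0 then fst s else snd s) i)"
      by cases (auto intro!: continuous_intros)
  qed auto
  have r: "continuous_map (unit_cube 2) ?A (\<lambda>x. (x 0, x 1))"
    unfolding prod_topology_subtopology_eu[symmetric]
    by (intro continuous_map_pairedI continuous_map_cube_coord) auto
  show thesis
    by (rule serre_fibration_lift[OF q e r _ f, of h]) (use h that in auto)
qed

section \<open>Contractible bases\<close>

text \<open>
  A contraction yields a path class \<open>\<kappa> z\<close> from each point \<open>z\<close> to the centre. Dragging a path along
  the contraction shows \<open>c.\<kappa>(end of c) = \<kappa>(start of c)\<close>, so the ends determine \<open>c\<close>.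
\<close>

lemma contractible_classes_unique:
  assumes D: "contractible_space D" and c: "c \<in> path_classes D" "c' \<in> path_classes D"
    and e: "class_start c = class_start c'" "class_end c = class_end c'"
  shows "c = c'"
proof -
  obtain c0 K where K: "continuous_map (prod_topology (top_of_set {0..1::real}) D) D K"
    "\<And>z. K (0, z) = z" "\<And>z. K (1, z) = c0"
    using D unfolding contractible_space_def homotopic_with_def by auto
  define \<kappa> where "\<kappa> z = path_class D (\<lambda>t. K (t, z))" for z
  have pK: "pathin D (\<lambda>t. K (t, z))" if "z \<in> topspace D" for z
  proof -
    have "continuous_map (top_of_set {0..1::real}) (prod_topology (top_of_set {0..1::real}) D) (\<lambda>t. (t, z))"
      using that by (intro continuous_map_pairedI) auto
    from continuous_map_compose[OF this K(1)] show ?thesis by (simp add: pathin_def o_def)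
  qed
  have key: "class_mul D c (\<kappa> (class_end c)) = \<kappa> (class_start c)" if c: "c \<in> path_classes D" for c
  proof -
    obtain \<alpha> where a: "pathin D \<alpha>" "c = path_class D \<alpha>" using c by (rule path_classesE)
    let ?k = "\<lambda>q. K (snd q, \<alpha> (fst q))"
    have "continuous_map (top_of_set square) D (\<lambda>q::real\<times>real. \<alpha> (fst q))"
      by (rule continuous_map_top_of_set_compose[OF a(1)[unfolded pathin_def]]) (auto intro!: continuous_intros)
    then have "continuous_map (top_of_set square) (prod_topology (top_of_set {0..1::real}) D) (\<lambda>q. (snd q, \<alpha> (fst q)))"
      by (intro continuous_map_pairedI) (auto intro!: continuous_intros)
    from continuous_map_compose[OF this K(1)]
    have "continuous_map (top_of_set square) D ?k" by (simp add: o_def)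
    from square_lemma[OF this]
    have sq: "path_class D (path_cat \<alpha> (\<lambda>t. K (t, \<alpha> 1))) = path_class D (path_cat (\<lambda>t. K (t, \<alpha> 0)) (\<lambda>_. c0))"
      using K by simp
    have t: "\<alpha> 0 \<in> topspace D" "\<alpha> 1 \<in> topspace D" using pathin_topspace[OF a(1)] by auto
    have c0: "pathin D (\<lambda>_. c0)" using pathin_topspace[OF pK[OF t(1)], of 1] K(3) by (simp add: pathin_const_iff)
    have "class_mul D c (\<kappa> (class_end c)) = path_class D (path_cat \<alpha> (\<lambda>t. K (t, \<alpha> 1)))"
      unfolding a(2) \<kappa>_def using class_mul_path[OF a(1) pK[OF t(2)]] a K by simp
    also have "\<dots> = class_mul D (\<kappa> (\<alpha> 0)) (path_class D (\<lambda>_. c0))"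
      unfolding sq \<kappa>_def using class_mul_path[OF pK[OF t(1)] c0] K by simp
    also have "\<dots> = \<kappa> (\<alpha> 0)"
      using class_mul_idr[OF path_class_in[OF pK[OF t(1)]]] pK[OF t(1)] K by (simp add: \<kappa>_def)
    finally show ?thesis using a by simp
  qed
  have t: "class_end c \<in> topspace D" using class_ends_in[OF c(1)] by simp
  have k: "\<kappa> (class_end c) \<in> path_classes D" "class_start (\<kappa> (class_end c)) = class_end c"
    using path_class_in[OF pK[OF t]] pK[OF t] K(2) by (simp_all add: \<kappa>_def)
  show ?thesis
    by (rule class_mul_cancel_right[OF k(1) c(1,2)]) (use key[OF c(1)] key[OF c(2)] e k in simp_all)
qed

text \<open>
  \<open>bump\<close> and \<open>clamp01\<close> are the ingredients of a collar: \<open>clamp01\<close> stretches the middle third of the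
  interval over the whole interval, and \<open>bump\<close> is \<open>1\<close> there and drops to \<open>0\<close> at the ends.
\<close>

definition clamp01 :: "real => real" where
  "clamp01 s = max 0 (min 1 (3 * s - 1))"

definition bump :: "real => real" where
  "bump s = min 1 (min (3 * s) (3 * (1 - s)))"

lemma clamp01_props: "clamp01 s \<in> {0..1}" "clamp01 0 = 0" "clamp01 1 = 1" "continuous_on A clamp01"
  unfolding clamp01_def by (auto intro!: continuous_intros)

lemma bump_props: "s \<in> {0..1} ==> bump s \<in> {0..1}" "bump 0 = 0" "bump 1 = 0" "continuous_on A bump"
  unfolding bump_def by (auto intro!: continuous_intros)

lemma bump_less_1: "bump s < 1 ==> clamp01 s = 0 \<or> clamp01 s = 1"
  unfolding bump_def clamp01_def by (auto simp: min_def max_def split: if_splits)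

section \<open>Classes of paths with ends in a fibre\<close>

text \<open>
  Let \<open>q\<close> from \<open>E\<close> to \<open>D\<close> be a fibration over a contractible base. A path of \<open>E\<close> with
  ends in the fibre over \<open>d\<close> can be pushed into that fibre, and a homotopy can be pushed into it
  as well, because \<open>\<pi>\<^sub>2(D) = 0\<close>.
\<close>

locale contractible_fibration =
  fixes E :: "'e topology" and D :: "'b topology" and q :: "'e => 'b" and d :: 'b
  assumes fib: "serre_fibration E D q" and contr: "contractible_space D"
begin

abbreviation F :: "'e topology" where "F \<equiv> subtopology E {x. q x = d}"

abbreviation incl :: "(real => 'e) set => (real => 'e) set" where "incl \<equiv> class_map E (\<lambda>x. x)"

lemma continuous_incl: "continuous_map F E (\<lambda>x. x)"
  by (rule continuous_map_from_subtopology) simp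

lemma continuous_q: "continuous_map E D q"
  using fib unfolding serre_fibration_def by blast

lemma pathin_F: "pathin E \<alpha> ==> (\<And>t. t \<in> {0..1} ==> q (\<alpha> t) = d) ==> pathin F \<alpha>"
  by (rule pathin_subtopologyI) auto

lemma incl_path: "pathin F \<alpha> ==> incl (path_class F \<alpha>) = path_class E \<alpha>"
  using class_map_path[OF _ continuous_incl] by simp

text \<open>
  The projection of a path \<open>\<alpha>\<close> with ends in the fibre is homotopic to a constant path. Lifting this
  homotopy from \<open>\<alpha>\<close> gives a square whose other three sides lie in the fibre; \<open>\<alpha>\<close> is homotopic to
  their concatenation.
\<close>

lemma incl_surj:
  assumes c: "c \<in> path_classes E" "q (class_start c) = d" "q (class_end c) = d"
  obtains g where "g \<in> path_classes F" "incl g = c"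
proof -
  obtain \<alpha> where a: "pathin E \<alpha>" "c = path_class E \<alpha>" using c(1) by (rule path_classesE)
  have ends: "q (\<alpha> 0) = d" "q (\<alpha> 1) = d" using c a by auto
  have pq: "pathin D (\<lambda>s. q (\<alpha> s))" by (rule pathin_map[OF a(1) continuous_q])
  have dt: "d \<in> topspace D" using pathin_topspace[OF pq, of 0] ends by simp
  then have pd: "pathin D (\<lambda>_. d)" by (simp add: pathin_const_iff)
  have "path_class D (\<lambda>s. q (\<alpha> s)) = path_class D (\<lambda>_. d)"
    by (rule contractible_classes_unique[OF contr path_class_in[OF pq] path_class_in[OF pd]])
       (simp_all add: class_ends[OF pq] class_ends[OF pd] ends)
  then have "path_homotopic D (\<lambda>s. q (\<alpha> s)) (\<lambda>_. d)" by (rule path_class_eqD[OF pd])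
  then obtain h :: "real \<times> real => _" where h: "continuous_map (top_of_set square) D h"
     "\<forall>s\<in>{0..1}. h (0, s) = q (\<alpha> s)" "\<forall>s\<in>{0..1}. h (1, s) = d"
     "\<forall>t\<in>{0..1}. h (t, 0) = q (\<alpha> 0) \<and> h (t, 1) = q (\<alpha> 1)" unfolding path_homotopic_iff by blast
  have h': "continuous_map (top_of_set square) D (\<lambda>z. h (snd z, fst z))"
    by (rule continuous_map_top_of_set_compose[OF h(1)]) (auto intro!: continuous_intros)
  obtain k where k: "continuous_map (top_of_set square) E k" "\<And>s. s \<in> {0..1} ==> k (s, 0) = \<alpha> s"
    "\<And>s t. s \<in> {0..1} ==> t \<in> {0..1} ==> q (k (s, t)) = h (snd (s, t), fst (s, t))"
    by (rule lift_homotopy[OF fib a(1) h']) (use h that in auto)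
  have pe: "pathin E (\<lambda>t. k (u t))" if "continuous_on {0..1} u" "\<And>t. t \<in> {0..1} ==> u t \<in> square" for u
    unfolding pathin_def by (rule continuous_map_top_of_set_compose[OF k(1) that])
  have pr: "pathin F (\<lambda>t. k (1, t))"
    by (rule pathin_F, rule pe) (use k(3) h(4) ends in \<open>auto intro!: continuous_intros\<close>)
  have pl: "pathin F (\<lambda>t. k (0, t))"
    by (rule pathin_F, rule pe) (use k(3) h(4) ends in \<open>auto intro!: continuous_intros\<close>)
  have pt: "pathin F (\<lambda>s. k (s, 1))"
    by (rule pathin_F, rule pe) (use k(3) h(3) in \<open>auto intro!: continuous_intros\<close>)
  let ?r = "path_class F (\<lambda>t. k (1, t))" and ?l = "path_class F (\<lambda>t. k (0, t))" and ?t = "path_class F (\<lambda>s. k (s, 1))"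
  note rlt = path_class_in[OF pr] path_class_in[OF pl] path_class_in[OF pt]
  have "continuous_on {0..1} (\<lambda>s::real. (s, 0::real))" by (intro continuous_intros)
  then have k0: "pathin E (\<lambda>s. k (s, 0))" by (rule pe) auto
  have cat: "pathin E (path_cat \<alpha> (\<lambda>t. k (1, t)))" "pathin E (path_cat (\<lambda>s. k (s, 0)) (\<lambda>t. k (1, t)))"
    using k(2)[of 1] by (simp_all add: pathin_cat[OF a(1) pathin_subtopologyD(1)[OF pr]]
      pathin_cat[OF k0 pathin_subtopologyD(1)[OF pr]])
  have "path_class E (path_cat \<alpha> (\<lambda>t. k (1, t))) = path_class E (path_cat (\<lambda>s. k (s, 0)) (\<lambda>t. k (1, t)))"
    by (rule path_class_cong[OF cat(1)]) (use k(2) in \<open>auto simp: path_cat_def\<close>)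
  also have "\<dots> = path_class E (path_cat (\<lambda>t. k (0, t)) (\<lambda>s. k (s, 1)))" by (rule square_lemma[OF k(1)])
  finally have eq: "class_mul E c (incl ?r) = class_mul E (incl ?l) (incl ?t)"
    unfolding a(2) incl_path[OF pr] incl_path[OF pl] incl_path[OF pt]
    using class_mul_path[OF a(1) pathin_subtopologyD(1)[OF pr]] k(2)[of 1]
      class_mul_path[OF pathin_subtopologyD(1)[OF pl] pathin_subtopologyD(1)[OF pt]] by simp
  have e: "class_end ?l = class_start ?t" "class_end ?t = class_end ?r" "class_end c = class_start ?r"
    using class_ends[OF pr] class_ends[OF pl] class_ends[OF pt] a k(2)[of 1] by simp_all
  let ?g = "class_mul F (class_mul F ?l ?t) (class_inv F ?r)"
  have g: "?g \<in> path_classes F" using rlt e by (simp add: class_mul_in class_inv_in)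
  note ir = class_map_in[OF rlt(1) continuous_incl] class_map_in[OF rlt(2) continuous_incl] class_map_in[OF rlt(3) continuous_incl]
  have "class_mul F ?g ?r = class_mul F (class_mul F ?l ?t) (class_mul F (class_inv F ?r) ?r)"
    by (rule class_mul_assoc) (use rlt e in \<open>simp_all add: class_mul_in class_inv_in\<close>)
  also have "\<dots> = class_mul F (class_mul F ?l ?t) (path_class F (\<lambda>_. class_end (class_mul F ?l ?t)))"
    using class_mul_inv_left[OF rlt(1)] class_mul_in(3)[OF rlt(2,3) e(1)] e(2) by simp
  also have "\<dots> = class_mul F ?l ?t" by (rule class_mul_idr[OF class_mul_in(1)[OF rlt(2,3) e(1)]])
  finally have inv: "class_mul F ?g ?r = class_mul F ?l ?t" .
  have "class_mul E (incl ?g) (incl ?r) = incl (class_mul F ?g ?r)"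
    using g rlt e continuous_incl by (simp add: class_map_mul class_mul_in class_inv_in)
  also have "\<dots> = class_mul E c (incl ?r)"
    unfolding inv eq using rlt e continuous_incl by (simp add: class_map_mul)
  finally have "incl ?g = c"
    by (rule class_mul_cancel_right[OF ir(1) class_map_in(1)[OF g continuous_incl] c(1), rotated 2])
       (use class_map_in[OF g continuous_incl] ir e rlt in \<open>simp_all add: class_mul_in class_inv_in\<close>)
  with g show thesis by (rule that)
qed

text \<open>
  Let \<open>H\<close> be a homotopy in \<open>E\<close> between paths \<open>a\<close> and \<open>b\<close> of the fibre. Its projection is a map of
  the square that sends the boundary to \<open>d\<close>. The contraction \<open>K\<close> deforms it to the constant map:
  go along \<open>K\<close> to the centre, then back along the track of \<open>d\<close>. To keep the boundary at \<open>d\<close>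
  meanwhile, \<open>H\<close> is first reparametrised to a map \<open>G\<close> with a collar on which it runs inside the
  fibre, and \<open>\<rho>\<close> slows the deformation down across the collar. The deformation \<open>h\<close> is lifted from
  \<open>G\<close>; the top and the four vertical sides of the lifted cube lie in the fibre, and reading off
  the classes of their edges shows that \<open>a\<close> and \<open>b\<close> are homotopic there.
\<close>

lemma incl_inj:
  assumes g: "g \<in> path_classes F" "g' \<in> path_classes F" and eq: "incl g = incl g'"
  shows "g = g'"
proof -
  obtain a where a: "pathin F a" "g = path_class F a" using g(1) by (rule path_classesE)
  obtain b where b: "pathin F b" "g' = path_class F b" using g(2) by (rule path_classesE)
  note aE = pathin_subtopologyD(1)[OF a(1)] and bE = pathin_subtopologyD(1)[OF b(1)]
  have ad: "q (a s) = d" "q (b s) = d" if "s \<in> {0..1}" for s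
    using pathin_subtopologyD(2)[OF a(1) that] pathin_subtopologyD(2)[OF b(1) that] by auto
  have "path_class E a = path_class E b" using eq incl_path[OF a(1)] incl_path[OF b(1)] a(2) b(2) by simp
  then have "path_homotopic E a b" by (rule path_class_eqD[OF bE])
  then obtain H :: "real \<times> real => _" where H: "continuous_map (top_of_set square) E H"
     "\<forall>s\<in>{0..1}. H (0, s) = a s" "\<forall>s\<in>{0..1}. H (1, s) = b s"
     "\<forall>t\<in>{0..1}. H (t, 0) = a 0 \<and> H (t, 1) = a 1" unfolding path_homotopic_iff by blast
  have ab: "b 0 = a 0" "b 1 = a 1" using H(3,4) by (metis atLeastAtMost_iff order_refl zero_le_one)+
  obtain c0 K where K: "continuous_map (prod_topology (top_of_set {0..1::real}) D) D K"
    "\<And>z. K (0, z) = z" "\<And>z. K (1, z) = c0"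
    using contr unfolding contractible_space_def homotopic_with_def by auto
  define G where "G z = H (clamp01 (fst z), clamp01 (snd z))" for z
  define \<rho> where "\<rho> z = min (bump (fst z)) (bump (snd z))" for z
  have G: "continuous_map (top_of_set square) E G"
    unfolding G_def using clamp01_props
    by (intro continuous_map_top_of_set_compose[OF H(1)])
       (auto intro!: continuous_intros continuous_on_compose2[OF clamp01_props(4)[of UNIV]])
  have \<rho>c: "continuous_on A \<rho>" for A
    unfolding \<rho>_def by (auto intro!: continuous_intros continuous_on_compose2[OF bump_props(4)[of UNIV]])
  have \<rho>I: "\<rho> z \<in> {0..1}" if "z \<in> square" for z
    using bump_props(1)[of "fst z"] bump_props(1)[of "snd z"] that by (auto simp: \<rho>_def min_def)
  have Gd: "q (G z) = d" if "\<rho> z < 1" for z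
  proof -
    have "bump (fst z) < 1 \<or> bump (snd z) < 1" using that by (auto simp: \<rho>_def)
    then have "clamp01 (fst z) = 0 \<or> clamp01 (fst z) = 1 \<or> clamp01 (snd z) = 0 \<or> clamp01 (snd z) = 1"
      using bump_less_1 by blast
    then show ?thesis
      using H(2-4) ad ab clamp01_props(1)[of "fst z"] clamp01_props(1)[of "snd z"] unfolding G_def by auto
  qed
  have dt: "d \<in> topspace D"
    using pathin_topspace[OF pathin_map[OF aE continuous_q], of 0] ad(1)[of 0] by simp
  have Kc: "continuous_map (top_of_set A) D (\<lambda>z. K (u z, v z))"
    if "continuous_on A u" "\<And>z. z \<in> A ==> u z \<in> {0..1}" "continuous_map (top_of_set A) D v"
    for A :: "((real \<times> real) \<times> real) set" and u v
  proof -
    have "continuous_map (top_of_set A) (prod_topology (top_of_set {0..1::real}) D) (\<lambda>z. (u z, v z))"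
      using that by (intro continuous_map_pairedI) auto
    from continuous_map_compose[OF this K(1)] show ?thesis by (simp add: o_def)
  qed
  let ?C = "square \<times> {0..1} :: ((real \<times> real) \<times> real) set"
  define h where "h = (\<lambda>z :: (real \<times> real) \<times> real. if snd z \<le> 1/2 then K (2 * snd z * \<rho> (fst z), q (G (fst z)))
      else K ((2 - 2 * snd z) * \<rho> (fst z), d))"
  have \<rho>f: "continuous_on A (\<lambda>z::(real \<times> real) \<times> real. \<rho> (fst z))" for A
    by (rule continuous_on_compose2[OF \<rho>c[of UNIV]]) (auto intro!: continuous_intros)
  have hc: "continuous_map (top_of_set ?C) D h"
    unfolding h_def
  proof (rule continuous_map_glue)
    have qG: "continuous_map (top_of_set square) D (\<lambda>z. q (G z))"
      using continuous_map_compose[OF G continuous_q] by (simp add: o_def)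
    show "continuous_map (top_of_set {x \<in> ?C. snd x \<le> 1/2}) D (\<lambda>z. K (2 * snd z * \<rho> (fst z), q (G (fst z))))"
    proof (rule Kc)
      show "continuous_on {x \<in> ?C. snd x \<le> 1/2} (\<lambda>z. 2 * snd z * \<rho> (fst z))" by (intro continuous_intros \<rho>f)
      show "2 * snd z * \<rho> (fst z) \<in> {0..1}" if "z \<in> {x \<in> ?C. snd x \<le> 1/2}" for z
        using that \<rho>I[of "fst z"] mult_le_one[of "2 * snd z" "\<rho> (fst z)"] by auto
      show "continuous_map (top_of_set {x \<in> ?C. snd x \<le> 1/2}) D (\<lambda>z. q (G (fst z)))"
        by (rule continuous_map_top_of_set_compose[OF qG]) (auto intro!: continuous_intros)
    qed
    show "continuous_map (top_of_set {x \<in> ?C. 1/2 \<le> snd x}) D (\<lambda>z. K ((2 - 2 * snd z) * \<rho> (fst z), d))"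
    proof (rule Kc)
      show "continuous_on {x \<in> ?C. 1/2 \<le> snd x} (\<lambda>z. (2 - 2 * snd z) * \<rho> (fst z))" by (intro continuous_intros \<rho>f)
      show "(2 - 2 * snd z) * \<rho> (fst z) \<in> {0..1}" if "z \<in> {x \<in> ?C. 1/2 \<le> snd x}" for z
        using that \<rho>I[of "fst z"] mult_le_one[of "2 - 2 * snd z" "\<rho> (fst z)"] by auto
    qed (use dt in simp)
    fix z assume z: "z \<in> ?C" "snd z = 1/2"
    show "K (2 * snd z * \<rho> (fst z), q (G (fst z))) = K ((2 - 2 * snd z) * \<rho> (fst z), d)"
    proof (cases "\<rho> (fst z) < 1")
      case True
      then show ?thesis unfolding z(2) using Gd by simp
    next
      case False
      then have "\<rho> (fst z) = 1" using \<rho>I[of "fst z"] z(1) by auto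
      then show ?thesis unfolding z(2) using K(3) by simp
    qed
  qed (intro continuous_intros)
  have h0: "h (z, 0) = q (G z)" for z using K(2) by (simp add: h_def)
  have h1: "h (z, 1) = d" for z using K(2) by (simp add: h_def)
  have hb: "h (z, u) = d" if "\<rho> z = 0" for z u
    using that Gd[of z] K(2) by (simp add: h_def)
  obtain k where k: "continuous_map (top_of_set ?C) E k" "\<And>z. z \<in> square ==> k (z, 0) = G z"
    "\<And>z u. z \<in> square ==> u \<in> {0..1} ==> q (k (z, u)) = h (z, u)"
    by (rule lift_homotopy2[OF fib G hc h0]) (rule that)
  have b0: "\<rho> (0, s) = 0" "\<rho> (1, s) = 0" "\<rho> (s, 0) = 0" "\<rho> (s, 1) = 0" if "s \<in> {0..1}" for s
    using bump_props(1)[OF that] bump_props(2,3) by (auto simp: \<rho>_def min_def)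
  have sq: "continuous_map (top_of_set square) F (\<lambda>z. k (w z))"
    if "continuous_on square w" "\<And>z. z \<in> square ==> w z \<in> ?C"
      "\<And>z. z \<in> square ==> h (w z) = d" for w :: "real \<times> real => _"
    unfolding continuous_map_in_subtopology
  proof
    show "continuous_map (top_of_set square) E (\<lambda>z. k (w z))"
      by (rule continuous_map_top_of_set_compose[OF k(1) that(1,2)])
    have "q (k (w z)) = d" if z: "z \<in> square" for z
      using k(3)[of "fst (w z)" "snd (w z)"] \<open>\<And>z. z \<in> square ==> w z \<in> ?C\<close>[OF z]
        \<open>\<And>z. z \<in> square ==> h (w z) = d\<close>[OF z] by (auto simp: mem_Times_iff)
    then show "(\<lambda>z. k (w z)) \<in> topspace (top_of_set square) \<rightarrow> {x. q x = d}" by auto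
  qed
  have edge: "pathin F (\<lambda>t. k (w t))"
    if "continuous_on {0..1} w" "\<And>t. t \<in> {0..1} ==> w t \<in> ?C" "\<And>t. t \<in> {0..1} ==> h (w t) = d" for w :: "real => _"
  proof (rule pathin_F)
    show "pathin E (\<lambda>t. k (w t))" unfolding pathin_def by (rule continuous_map_top_of_set_compose[OF k(1) that(1,2)])
    show "q (k (w t)) = d" if t: "t \<in> {0..1}" for t
      using k(3)[of "fst (w t)" "snd (w t)"] \<open>\<And>t. t \<in> {0..1} ==> w t \<in> ?C\<close>[OF t]
        \<open>\<And>t. t \<in> {0..1} ==> h (w t) = d\<close>[OF t] by (auto simp: mem_Times_iff)
  qed
  define A where "A = (\<lambda>s::real. k ((0, s), 0))"
  define B where "B = (\<lambda>s::real. k ((1, s), 0))"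
  define x where "x = (\<lambda>t::real. k ((t, 0), 0))"
  define y where "y = (\<lambda>t::real. k ((t, 1), 0))"
  define e0 where "e0 = (\<lambda>u::real. k ((0, 0), u))"
  define e1 where "e1 = (\<lambda>u::real. k ((0, 1), u))"
  define f0 where "f0 = (\<lambda>u::real. k ((1, 0), u))"
  define f1 where "f1 = (\<lambda>u::real. k ((1, 1), u))"
  define A' where "A' = (\<lambda>s::real. k ((0, s), 1))"
  define B' where "B' = (\<lambda>s::real. k ((1, s), 1))"
  define L where "L = (\<lambda>t::real. k ((t, 0), 1))"
  define R where "R = (\<lambda>t::real. k ((t, 1), 1))"
  note defs = A_def B_def x_def y_def e0_def e1_def f0_def f1_def A'_def B'_def L_def R_def
  have paths: "pathin F A" "pathin F B" "pathin F x" "pathin F y" "pathin F e0" "pathin F e1" "pathin F f0" "pathin F f1"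
    "pathin F A'" "pathin F B'" "pathin F L" "pathin F R"
    unfolding defs by (rule edge; use b0 hb h1 in \<open>auto intro!: continuous_intros\<close>)+
  \<comment> \<open>The four sides and the top of the lifted cube lie in the fibre.\<close>
  have s1: "path_class F (path_cat A e1) = path_class F (path_cat e0 A')"
    unfolding defs by (rule square_lemma[of F "\<lambda>z. k ((0, fst z), snd z)", simplified], rule sq)
      (use b0 hb in \<open>auto intro!: continuous_intros\<close>)
  have s2: "path_class F (path_cat B f1) = path_class F (path_cat f0 B')"
    unfolding defs by (rule square_lemma[of F "\<lambda>z. k ((1, fst z), snd z)", simplified], rule sq)
      (use b0 hb in \<open>auto intro!: continuous_intros\<close>)
  have s3: "path_class F (path_cat x f0) = path_class F (path_cat e0 L)"
    unfolding defs by (rule square_lemma[of F "\<lambda>z. k ((fst z, 0), snd z)", simplified], rule sq)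
      (use b0 hb in \<open>auto intro!: continuous_intros\<close>)
  have s4: "path_class F (path_cat y f1) = path_class F (path_cat e1 R)"
    unfolding defs by (rule square_lemma[of F "\<lambda>z. k ((fst z, 1), snd z)", simplified], rule sq)
      (use b0 hb in \<open>auto intro!: continuous_intros\<close>)
  have s5: "path_class F (path_cat A' R) = path_class F (path_cat L B')"
    unfolding defs by (rule square_lemma[of F "\<lambda>z. k ((snd z, fst z), 1)", simplified], rule sq)
      (use h1 in \<open>auto intro!: continuous_intros\<close>)
  let ?c = "path_class F"
  note ins = paths[THEN path_class_in]
  note ends = paths[THEN class_ends(1)] paths[THEN class_ends(2)]
  have m: "class_mul F (?c A) (?c e1) = class_mul F (?c e0) (?c A')" "class_mul F (?c B) (?c f1) = class_mul F (?c f0) (?c B')"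
    "class_mul F (?c x) (?c f0) = class_mul F (?c e0) (?c L)" "class_mul F (?c y) (?c f1) = class_mul F (?c e1) (?c R)"
    "class_mul F (?c A') (?c R) = class_mul F (?c L) (?c B')"
    using s1 s2 s3 s4 s5 paths by (simp_all add: class_mul_path defs)
  have corner: "k ((t, s), 0) = H (clamp01 t, clamp01 s)" if "t \<in> {0..1}" "s \<in> {0..1}" for t s
    using k(2)[of "(t, s)"] that by (simp add: G_def)
  have "?c x = ?c (\<lambda>_. a 0)"
    by (rule path_class_cong[OF paths(3)]) (use corner H(4) clamp01_props in \<open>auto simp: x_def\<close>)
  then have cx: "?c x = ?c (\<lambda>_. class_start (?c f0))"
    using paths(7) corner[of 1 0] H(4) clamp01_props by (simp add: f0_def)
  have "?c y = ?c (\<lambda>_. a 1)"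
    by (rule path_class_cong[OF paths(4)]) (use corner H(4) clamp01_props in \<open>auto simp: y_def\<close>)
  then have cy: "?c y = ?c (\<lambda>_. class_start (?c f1))"
    using paths(8) corner[of 1 1] H(4) clamp01_props by (simp add: f1_def)
  have f0': "?c f0 = class_mul F (?c e0) (?c L)" using m(3) class_mul_idl[OF ins(7)] cx by simp
  have f1': "?c f1 = class_mul F (?c e1) (?c R)" using m(4) class_mul_idl[OF ins(8)] cy by simp
  have "class_mul F (?c B) (?c f1) = class_mul F (?c e0) (class_mul F (?c L) (?c B'))"
    unfolding m(2) f0' using ins ends by (simp add: class_mul_assoc defs)
  also have "\<dots> = class_mul F (class_mul F (?c A) (?c e1)) (?c R)"
    unfolding m(5)[symmetric] m(1) using ins ends by (simp add: class_mul_assoc defs)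
  also have "\<dots> = class_mul F (?c A) (?c f1)"
    unfolding f1' using ins ends by (simp add: class_mul_assoc defs)
  finally have BA: "?c B = ?c A"
  proof (rule class_mul_cancel_right[OF ins(8,2,1), rotated 2])
    show "class_end (?c B) = class_start (?c f1)" using ends by (simp add: defs)
    show "class_end (?c A) = class_start (?c f1)"
      using ends corner[of 0 1] corner[of 1 1] H(4) clamp01_props by (simp add: defs)
  qed
  have "?c A = ?c (\<lambda>s. a (clamp01 s))"
    by (rule path_class_cong[OF paths(1)]) (use corner H(2) clamp01_props in \<open>auto simp: A_def\<close>)
  also have "\<dots> = ?c a" by (rule path_class_reparam_id[OF a(1)]) (use clamp01_props in auto)
  finally have "?c A = g" using a by simp
  moreover have "?c B = ?c (\<lambda>s. b (clamp01 s))"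
    by (rule path_class_cong[OF paths(2)]) (use corner H(3) clamp01_props in \<open>auto simp: B_def\<close>)
  moreover have "?c (\<lambda>s. b (clamp01 s)) = ?c b" by (rule path_class_reparam_id[OF b(1)]) (use clamp01_props in auto)
  ultimately show ?thesis using BA b by simp
qed

text \<open>
  A small class of \<open>E\<close> with ends in the fibre comes from a small class of the fibre: over a small
  enough set both are determined by their ends.
\<close>

lemma small_class_in_fibre:
  assumes nE: "locally_nice E" and nF: "locally_nice F" and U: "openin F U" "x \<in> U"
  obtains U' where "openin E U'" "x \<in> U'"
    "\<And>b. small_class E U' b ==> q (class_start b) = d ==> q (class_end b) = d ==>
       \<exists>b'. small_class F U b' \<and> incl b' = b"
proof -
  have x: "x \<in> topspace E" using openin_subset[OF U(1)] U(2) by auto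
  obtain N where N: "openin E N" "x \<in> N" "nice E N" by (rule locally_niceE[OF nE openin_topspace x])
  have "openin F (U \<inter> ({x. q x = d} \<inter> N))" by (intro openin_Int U(1) openin_subtopology_Int2 N(1))
  moreover have "x \<in> U \<inter> ({x. q x = d} \<inter> N)" using U N(2) openin_subset[OF U(1)] by auto
  ultimately obtain U1 where U1: "openin F U1" "x \<in> U1" "U1 \<subseteq> U \<inter> ({x. q x = d} \<inter> N)" "nice F U1"
    by (rule locally_niceE[OF nF])
  obtain O' where O': "openin E O'" "U1 = O' \<inter> {x. q x = d}" using U1(1) unfolding openin_subtopology by blast
  show thesis
  proof (rule that[of "N \<inter> O'"])
    show "openin E (N \<inter> O')" by (rule openin_Int[OF N(1) O'(1)])
    show "x \<in> N \<inter> O'" using N(2) U1(2) O'(2) by auto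
    fix b assume b: "small_class E (N \<inter> O') b" "q (class_start b) = d" "q (class_end b) = d"
    have e: "class_start b \<in> U1" "class_end b \<in> U1" using small_classD[OF b(1)] b(2,3) O'(2) by auto
    obtain b' where b': "small_class F U1 b'" "class_start b' = class_start b" "class_end b' = class_end b"
      by (rule nice_join[OF U1(4) e])
    obtain \<beta> where \<beta>: "pathin (subtopology F U1) \<beta>" "b' = path_class F \<beta>"
      using b'(1) unfolding small_class_def by blast
    note \<beta>F = pathin_subtopologyD(1)[OF \<beta>(1)]
    have "pathin (subtopology E N) \<beta>"
      by (rule pathin_subtopologyI[OF pathin_subtopologyD(1)[OF \<beta>F]]) (use pathin_subtopologyD(2)[OF \<beta>(1)] U1(3) in blast)
    then have "small_class E N (incl b')" unfolding small_class_def \<beta>(2) incl_path[OF \<beta>F] by blast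
    moreover have "small_class E N b" by (rule small_class_mono[OF b(1)]) simp
    ultimately have "incl b' = b"
      by (rule nice_unique[OF N(3)]) (use class_map_in[OF small_classD(1)[OF b'(1)] continuous_incl] b' in simp_all)
    moreover have "small_class F U b'" by (rule small_class_mono[OF b'(1)]) (use U1(3) in blast)
    ultimately show "\<exists>b'. small_class F U b' \<and> incl b' = b" by blast
  qed
qed

text \<open>
  Near \<open>incl g\<close>, every class with ends in the fibre extends \<open>g\<close> by small classes with ends in the
  fibre, and these come from small classes of the fibre.
\<close>

lemma cont_at_incl_inverse:
  assumes nE: "locally_nice E" and nF: "locally_nice F" and g: "g \<in> path_classes F"
    and j: "\<And>g. g \<in> path_classes F ==> j (incl g) = g"
  shows "cont_at (subtopology (path_class_top E) {c. q (class_start c) = d \<and> q (class_end c) = d})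
    (path_class_top F) j (incl g)"
  unfolding cont_at_def
proof (intro conjI allI impI)
  let ?S = "{c. q (class_start c) = d \<and> q (class_end c) = d}"
  note ig = class_map_in[OF g continuous_incl]
  have gF: "q (class_start g) = d" "q (class_end g) = d" using class_ends_in[OF g] by auto
  show iS: "incl g \<in> topspace (subtopology (path_class_top E) ?S)" using ig gF by simp
  show "j (incl g) \<in> topspace (path_class_top F)" using j[OF g] g by simp
  fix W assume W: "openin (path_class_top F) W \<and> j (incl g) \<in> W"
  obtain \<alpha> where a: "pathin F \<alpha>" "g = path_class F \<alpha>" using g by (rule path_classesE)
  note aE = pathin_subtopologyD(1)[OF a(1)]
  have aI: "path_class E \<alpha> = incl g" unfolding a(2) by (rule incl_path[OF a(1), symmetric])
  have oW: "path_class_open F W" "path_class F \<alpha> \<in> W" using W j[OF g] a(2) by auto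
  obtain U V where UV: "openin F U" "openin F V" "\<alpha> 0 \<in> U" "\<alpha> 1 \<in> V" "path_nbhd F U V \<alpha> \<subseteq> W"
    by (rule path_class_openD[OF oW(1) a(1) oW(2)])
  obtain U' where U': "openin E U'" "\<alpha> 0 \<in> U'"
    "\<And>b. small_class E U' b ==> q (class_start b) = d ==> q (class_end b) = d ==> \<exists>b'. small_class F U b' \<and> incl b' = b"
    by (rule small_class_in_fibre[OF nE nF UV(1,3)]) (rule that)
  obtain V' where V': "openin E V'" "\<alpha> 1 \<in> V'"
    "\<And>b. small_class E V' b ==> q (class_start b) = d ==> q (class_end b) = d ==> \<exists>b'. small_class F V b' \<and> incl b' = b"
    by (rule small_class_in_fibre[OF nE nF UV(2,4)]) (rule that)
  have "j x \<in> W" if x: "x \<in> path_nbhd E U' V' \<alpha>" "x \<in> ?S" for x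
  proof -
    obtain b c where bc: "small_class E U' b" "small_class E V' c" "class_end b = \<alpha> 0" "class_start c = \<alpha> 1"
      "x = class_mul E b (class_mul E (incl g) c)" using x(1) unfolding path_nbhd_iff[OF aE] aI by blast
    have ae: "class_start g = \<alpha> 0" "class_end g = \<alpha> 1" using a by auto
    have "class_start x = class_start b" "class_end x = class_end c" unfolding bc(5)
      using path_nbhd_facts(2,3)[OF ig(1) bc(1,2)] bc(3,4) ig ae by auto
    then have qe: "q (class_start b) = d" "q (class_end b) = d" "q (class_start c) = d" "q (class_end c) = d"
      using x(2) bc(3,4) gF ae by auto
    obtain b' where b': "small_class F U b'" "incl b' = b" using U'(3)[OF bc(1) qe(1,2)] by blast
    obtain c' where c': "small_class F V c'" "incl c' = c" using V'(3)[OF bc(2) qe(3,4)] by blast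
    note ins = small_classD(1)[OF b'(1)] small_classD(1)[OF c'(1)]
    have e: "class_end b' = \<alpha> 0" "class_start c' = \<alpha> 1"
      using class_map_in[OF ins(1) continuous_incl] class_map_in[OF ins(2) continuous_incl] b' c' bc(3,4) by auto
    let ?y = "class_mul F b' (class_mul F g c')"
    have "incl ?y = x" unfolding bc(5) b'(2)[symmetric] c'(2)[symmetric]
      using ins e ae g continuous_incl by (simp add: class_map_mul class_mul_in)
    moreover have "?y \<in> path_classes F" using ins e ae g by (simp add: class_mul_in)
    ultimately have "j x = ?y" using j by blast
    also have "?y \<in> path_nbhd F U V \<alpha>" unfolding path_nbhd_iff[OF a(1)] a(2)[symmetric]
      using b'(1) c'(1) e by blast
    finally show ?thesis using UV(5) by blast
  qed
  moreover have "openin (subtopology (path_class_top E) ?S) (?S \<inter> path_nbhd E U' V' \<alpha>)"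
    by (rule openin_subtopology_Int2) (simp add: path_nbhd_open[OF aE U'(1) V'(1)])
  moreover have "incl g \<in> ?S \<inter> path_nbhd E U' V' \<alpha>"
    using path_nbhd_self[OF aE U'(2) V'(2)] aI iS by simp
  ultimately show "\<exists>W'. openin (subtopology (path_class_top E) ?S) W' \<and> incl g \<in> W' \<and> j ` W' \<subseteq> W"
    by (intro exI[of _ "?S \<inter> path_nbhd E U' V' \<alpha>"]) auto
qed

end

section \<open>Fibre products and induced maps\<close>

lemma has_row_fst:
  assumes u: "has_row (cdim c) (cmap c) W u x A" and V: "V \<subseteq> {q. fst q \<in> W}"
  shows "has_row (cdim (chart_prod c d)) (cmap (chart_prod c d)) V (\<lambda>q. u (fst q)) (x, y)
    (\<lambda>i. \<Sum>j<cdim c. A j * (if i = j then 1 else 0))"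
proof (rule has_row_compose[where m="cdim c" and l="cmap c" and V=W and f=fst and u=u])
  fix j assume j: "j < cdim c"
  then have "cmap c (fst q) j = cmap (chart_prod c d) q j" for q by (cases q) simp
  then show "has_row (cdim (chart_prod c d)) (cmap (chart_prod c d)) V (\<lambda>q. cmap c (fst q) j) (x, y) (\<lambda>i. if i = j then 1 else 0)"
    using has_row_coord[of j "cdim (chart_prod c d)" "cmap (chart_prod c d)"] j by simp
qed (use assms in auto)

lemma has_row_snd:
  assumes u: "has_row (cdim d) (cmap d) W u y A" and V: "V \<subseteq> {q. snd q \<in> W}"
  shows "has_row (cdim (chart_prod c d)) (cmap (chart_prod c d)) V (\<lambda>q. u (snd q)) (x, y)
    (\<lambda>i. \<Sum>j<cdim d. A j * (if i = cdim c + j then 1 else 0))"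
proof (rule has_row_compose[where m="cdim d" and l="cmap d" and V=W and f=snd and u=u])
  fix j assume j: "j < cdim d"
  then have "cmap d (snd q) j = cmap (chart_prod c d) q (cdim c + j)" for q by (cases q) simp
  then show "has_row (cdim (chart_prod c d)) (cmap (chart_prod c d)) V (\<lambda>q. cmap d (snd q) j) (x, y) (\<lambda>i. if i = cdim c + j then 1 else 0)"
    using has_row_coord[of "cdim c + j" "cdim (chart_prod c d)" "cmap (chart_prod c d)"] j by simp
qed (use assms in auto)

text \<open>
  The fibre product is locally cut out by the components of \<open>d (p x) - d (g y)\<close> for a chart \<open>d\<close>, and
  already their derivatives in the direction of \<open>x\<close> are independent.
\<close>

lemma manifold_fibre_prod:
  assumes X: "complex_manifold X" and Y: "complex_manifold Y" and S: "complex_manifold S"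
    and p: "holomorphic_submersion X S p" and g: "\<And>y. y \<in> pts Y ==> hol_at Y S g y"
  shows "complex_manifold (fibre_prod X Y p g)"
  unfolding fibre_prod_def
proof (rule manifold_submanifold[OF manifold_prod[OF X Y]])
  fix q assume "q \<in> pts (X \<times>\<^sub>M Y)" "q \<in> {(x, y). p x = g y}"
  then obtain x y where q: "q = (x, y)" "x \<in> pts X" "y \<in> pts Y" "p x = g y" by auto
  obtain c d W A where c: "c \<in> Atlas X" "x \<in> cdom c" and d: "d \<in> Atlas S" "p x \<in> cdom d"
    and W: "openin (Top X) W" "x \<in> W" "p ` W \<subseteq> cdom d"
    and dif: "\<And>y j. y \<in> W \<inter> cdom c ==> j < cdim d ==> cdiff (cdim c) (cmap c) (W \<inter> cdom c) (\<lambda>y. cmap d (p y) j) y"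
    and row: "\<And>j. j < cdim d ==> has_row (cdim c) (cmap c) (W \<inter> cdom c) (\<lambda>y. cmap d (p y) j) x (A j)"
    and sur: "\<And>w. \<exists>v. \<forall>j<cdim d. (\<Sum>i<cdim c. A j i * v i) = w j"
    by (rule submersion_at[OF X S p q(2)]) (rule that)
  obtain e where e: "e \<in> Atlas Y" "y \<in> cdom e" by (rule manifold_chart_at[OF Y q(3)])
  note dch = manifold_chart_open[OF S d(1)]
  obtain V where V: "openin (Top Y) V" "y \<in> V" "g ` V \<subseteq> cdom d"
    by (rule cont_atD[OF hol_at_cont[OF g[OF q(3)]] dch(2)]) (use q(4) d(2) in auto)
  have gdif: "cdiff (cdim e) (cmap e) (V \<inter> cdom e) (\<lambda>y. cmap d (g y) j) y'"
    if "y' \<in> V \<inter> cdom e" "j < cdim d" for y' j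
  proof -
    have y': "y' \<in> pts Y" using that openin_subset[OF V(1)] by auto
    have "diff_in_charts e d g y'" by (rule hol_atD[OF g[OF y'] e(1) d(1)]) (use that V in auto)
    from diff_in_chartsD[OF this that(2)] show ?thesis by (rule cdiff_subset) (use V in auto)
  qed
  have "\<forall>j. \<exists>B. j < cdim d --> has_row (cdim e) (cmap e) (V \<inter> cdom e) (\<lambda>y. cmap d (g y) j) y B"
    using gdif[of y] V(2) e(2) unfolding cdiff_def by blast
  then obtain B where B: "\<And>j. j < cdim d ==> has_row (cdim e) (cmap e) (V \<inter> cdom e) (\<lambda>y. cmap d (g y) j) y (B j)"
    by metis
  let ?c = "chart_prod c e" and ?W = "W \<times> V" and ?F = "\<lambda>q j. cmap d (p (fst q)) j - cmap d (g (snd q)) j"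
  let ?R = "\<lambda>j i. (\<Sum>k<cdim c. A j k * (if i = k then 1 else 0)) - (\<Sum>k<cdim e. B j k * (if i = cdim c + k then 1 else 0))"
  have sub: "?W \<inter> cdom ?c \<subseteq> {q. fst q \<in> W \<inter> cdom c}" "?W \<inter> cdom ?c \<subseteq> {q. snd q \<in> V \<inter> cdom e}" by auto
  have Fdif: "cdiff (cdim ?c) (cmap ?c) (?W \<inter> cdom ?c) (\<lambda>q. ?F q j) q'"
    if q': "q' \<in> ?W \<inter> cdom ?c" and j: "j < cdim d" for q' j
  proof -
    obtain a b where ab: "q' = (a, b)" by (cases q')
    have m: "a \<in> W \<inter> cdom c" "b \<in> V \<inter> cdom e" using q' ab by auto
    obtain A1 where A1: "has_row (cdim c) (cmap c) (W \<inter> cdom c) (\<lambda>y. cmap d (p y) j) a A1"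
      using dif[OF m(1) j] unfolding cdiff_def by blast
    obtain B1 where B1: "has_row (cdim e) (cmap e) (V \<inter> cdom e) (\<lambda>y. cmap d (g y) j) b B1"
      using gdif[OF m(2) j] unfolding cdiff_def by blast
    show ?thesis unfolding ab
      by (rule cdiffI[OF has_row_diff[OF has_row_fst[OF A1 sub(1)] has_row_snd[OF B1 sub(2)]]])
  qed
  have Frow: "has_row (cdim ?c) (cmap ?c) (?W \<inter> cdom ?c) (\<lambda>q. ?F q j) q (?R j)" if j: "j < cdim d" for j
    unfolding q(1) by (rule has_row_diff[OF has_row_fst[OF row[OF j] sub(1)] has_row_snd[OF B[OF j] sub(2)]])
  have Fsur: "\<exists>v. \<forall>j<cdim d. (\<Sum>i<cdim ?c. ?R j i * v i) = w j" for w
  proof -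
    obtain v where v: "\<forall>j<cdim d. (\<Sum>i<cdim c. A j i * v i) = w j" using sur by blast
    have "(\<Sum>i<cdim ?c. ?R j i * (if i < cdim c then v i else 0)) = (\<Sum>i<cdim c. A j i * v i)" for j
      unfolding chart_prod_simps sum_lessThan_add
      by (simp add: if_distrib[of "\<lambda>z. _ * z"] sum.delta cong: if_cong)
    then show ?thesis using v by (intro exI[of _ "\<lambda>i. if i < cdim c then v i else 0"]) simp
  qed
  have Fzero: "q' \<in> {(x, y). p x = g y} \<longleftrightarrow> (\<forall>j<cdim d. ?F q' j = 0)" if "q' \<in> ?W \<inter> cdom ?c" for q'
  proof -
    obtain a b where ab: "q' = (a, b)" by (cases q')
    have m: "p a \<in> cdom d" "g b \<in> cdom d" using that ab W V by auto
    have "p a = g b \<longleftrightarrow> cmap d (p a) = cmap d (g b)" using inj_on_eq_iff[OF is_chartD(3)[OF dch(1)] m] by simp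
    also have "\<dots> \<longleftrightarrow> (\<forall>j<cdim d. cmap d (p a) j = cmap d (g b) j)"
    proof -
      have "cmap d (p a) \<in> Ec (cdim d)" "cmap d (g b) \<in> Ec (cdim d)" using is_chartD(4)[OF dch(1)] m by auto
      then have "cmap d (p a) j = cmap d (g b) j" if "\<not> j < cdim d" for j using that by (simp add: Ec_def)
      then show ?thesis by (auto simp: fun_eq_iff)
    qed
    finally show ?thesis unfolding ab by simp
  qed
  have "?c \<in> maximal_atlas (X \<times>\<^sub>M Y)"
    by (rule Atlas_subset_maximal[OF manifold_prod[OF X Y]]) (use c e in auto)
  moreover have "openin (Top (X \<times>\<^sub>M Y)) ?W" using W(1) V(1) by (simp add: openin_prod_Times_iff)
  moreover have "q \<in> ?W" "q \<in> cdom ?c" using q(1) W V c e by auto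
  ultimately show "\<exists>c W (m::nat) F B. c \<in> maximal_atlas (X \<times>\<^sub>M Y) \<and> q \<in> cdom c \<and> openin (Top (X \<times>\<^sub>M Y)) W \<and> q \<in> W \<and>
        (\<forall>y\<in>W \<inter> cdom c. \<forall>j<m. cdiff (cdim c) (cmap c) (W \<inter> cdom c) (\<lambda>y. F y j) y) \<and>
        (\<forall>j<m. has_row (cdim c) (cmap c) (W \<inter> cdom c) (\<lambda>y. F y j) q (B j)) \<and>
        (\<forall>w. \<exists>v. \<forall>j<m. (\<Sum>i<cdim c. B j i * v i) = w j) \<and>
        (\<forall>y\<in>W \<inter> cdom c. y \<in> {(x, y). p x = g y} \<longleftrightarrow> (\<forall>j<m. F y j = 0))"
    using Fdif Frow Fsur Fzero
    by (intro exI[of _ ?c] exI[of _ ?W] exI[of _ "cdim d"] exI[of _ ?F] exI[of _ ?R] conjI) blast+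
qed

lemma hol_at_topspace: "hol_at M N f x ==> x \<in> pts M" "hol_at M N f x ==> f x \<in> pts N"
  unfolding hol_at_def cont_at_def by auto

lemma hol_at_into_fibre_prod:
  assumes M: "charted M" and N: "complex_manifold N1" "complex_manifold N2"
    and f: "hol_at M N1 f x" and g: "hol_at M N2 g x"
    and e: "\<And>y. y \<in> pts M ==> \<phi> (f y) = \<psi> (g y)"
  shows "hol_at M (fibre_prod N1 N2 \<phi> \<psi>) (\<lambda>y. (f y, g y)) x"
  unfolding fibre_prod_def
  by (rule hol_at_into_submanifold[OF M manifold_prod[OF N] hol_at_pair[OF f g] openin_topspace])
    (use e hol_at_topspace(1)[OF f] in auto)

lemma section_at_prod:
  assumes N: "complex_manifold N" "complex_manifold N'"
    and f: "section_at M N f x" and f': "section_at M' N' f' x'"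
  shows "section_at (M \<times>\<^sub>M M') (N \<times>\<^sub>M N') (\<lambda>q. (f (fst q), f' (snd q))) (x, x')"
proof -
  obtain s V where s: "hol_at N M s (f x)" "s (f x) = x" "openin (Top N) V" "f x \<in> V" "\<And>y. y \<in> V ==> f (s y) = y"
    by (rule section_atE[OF f]) (rule that)
  obtain s' V' where s': "hol_at N' M' s' (f' x')" "s' (f' x') = x'" "openin (Top N') V'" "f' x' \<in> V'"
    "\<And>y. y \<in> V' ==> f' (s' y) = y"
    by (rule section_atE[OF f']) (rule that)
  have t: "(f x, f' x') \<in> pts (N \<times>\<^sub>M N')"
    using hol_at_topspace(1)[OF s(1)] hol_at_topspace(1)[OF s'(1)] by simp
  note ch = charted_manifold[OF manifold_prod[OF N]]
  have h: "hol_at (N \<times>\<^sub>M N') M (\<lambda>q. s (fst q)) (f x, f' x')"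
    by (rule hol_at_compose[where g=s and f=fst, OF ch N(1) hol_at_fst[OF N(1) t]]) (simp add: s(1))
  have h': "hol_at (N \<times>\<^sub>M N') M' (\<lambda>q. s' (snd q)) (f x, f' x')"
    by (rule hol_at_compose[where g=s' and f=snd, OF ch N(2) hol_at_snd[OF N(2) t]]) (simp add: s'(1))
  show ?thesis
  proof (rule section_atI[where \<sigma>="\<lambda>q. (s (fst q), s' (snd q))" and V="V \<times> V'"])
    show "hol_at (N \<times>\<^sub>M N') (M \<times>\<^sub>M M') (\<lambda>q. (s (fst q), s' (snd q))) (f (fst (x, x')), f' (snd (x, x')))"
      using hol_at_pair[OF h h'] by simp
  qed (use s s' in \<open>auto simp: openin_prod_Times_iff\<close>)
qed

text \<open>
  Continuity holds for path classes of any spaces, and the ends are moved by \<open>f\<close>.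
\<close>

lemma hol_at_class_map:
  assumes Y: "complex_manifold Y" "complex_manifold Y'" and f: "\<And>y. y \<in> pts Y ==> hol_at Y Y' f y"
    and c: "c \<in> path_classes (Top Y)"
  shows "hol_at (Path Y) (Path Y') (class_map (Top Y') f) c"
proof (rule hol_at_into_Arr)
  have cf: "continuous_map (Top Y) (Top Y') f"
    unfolding continuous_map_iff_cont_at by (intro ballI hol_at_cont f)
  have ch: "charted (Path Y)" by (rule charted_manifold[OF manifold_Arr[OF Y(1)]])
  show "cont_at (Top (Path Y)) (path_class_top (Top Y')) (class_map (Top Y') f) c"
    using cont_at_class_map[OF c cf] by simp
  have "hol_at (Path Y) Y' (\<lambda>y. f (class_end y)) c"
    by (rule hol_at_compose[where f=class_end and g=f, OF ch Y(1) hol_at_class_end[OF Y(1) c] f]) (rule class_ends_in(2)[OF c])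
  then show "hol_at (Path Y) Y' (\<lambda>y. class_end (class_map (Top Y') f y)) c"
    by (rule hol_at_cong_topspace[OF ch]) (simp add: class_map_in[OF _ cf])
  have "hol_at (Path Y) Y' (\<lambda>y. f (class_start y)) c"
    by (rule hol_at_compose[where f=class_start and g=f, OF ch Y(1) hol_at_class_start[OF Y(1) c] f]) (rule class_ends_in(1)[OF c])
  then show "hol_at (Path Y) Y' (\<lambda>y. class_start (class_map (Top Y') f y)) c"
    by (rule hol_at_cong_topspace[OF ch]) (simp add: class_map_in[OF _ cf])
qed

lemma class_map_compose:
  assumes c: "c \<in> path_classes Y" and f: "continuous_map Y Y' f" and g: "continuous_map Y' Y'' g"
  shows "class_map Y'' g (class_map Y' f c) = class_map Y'' (\<lambda>y. g (f y)) c"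
proof -
  obtain \<alpha> where a: "pathin Y \<alpha>" "c = path_class Y \<alpha>" using c by (rule path_classesE)
  have gf: "continuous_map Y Y'' (\<lambda>y. g (f y))" using continuous_map_compose[OF f g] by (simp add: o_def)
  show ?thesis
    unfolding a(2) class_map_path[OF a(1) f] class_map_path[OF pathin_map[OF a(1) f] g] class_map_path[OF a(1) gf] ..
qed

lemma class_map_eq_self:
  assumes c: "c \<in> path_classes Y" and f: "continuous_map Y Y f" "\<And>y. y \<in> topspace Y ==> f y = y"
  shows "class_map Y f c = c"
proof -
  obtain \<alpha> where a: "pathin Y \<alpha>" "c = path_class Y \<alpha>" using c by (rule path_classesE)
  show ?thesis unfolding a(2) class_map_path[OF a(1) f(1)]
    by (rule path_class_cong[OF pathin_map[OF a(1) f(1)]]) (use f(2) pathin_topspace[OF a(1)] in auto)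
qed

lemma submersion_class_end:
  "complex_manifold Y ==> holomorphic_submersion (Path Y) Y class_end"
  by (rule submersion_from_sections[OF manifold_Arr]) (simp_all add: hol_at_class_end section_at_class_end)

text \<open>
  Products of holomorphic families of arrows are holomorphic. The fibre product over which the
  multiplication is defined must be a manifold for the chain rule to apply there.
\<close>

lemma hol_at_mul_maps:
  assumes Y: "complex_manifold Y" and M: "charted M"
    and f: "hol_at M (Path Y) f x" and g: "hol_at M (Path Y) g x"
    and e: "\<And>y. y \<in> pts M ==> class_end (f y) = class_start (g y)"
  shows "hol_at M (Path Y) (\<lambda>y. class_mul (Top Y) (f y) (g y)) x"
proof -
  note A = manifold_Arr[OF Y]
  let ?P = "fibre_prod (Path Y) (Path Y) class_end class_start"
  have P: "complex_manifold ?P"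
    by (rule manifold_fibre_prod[OF A A Y submersion_class_end[OF Y]]) (simp add: hol_at_class_start[OF Y])
  have fg: "hol_at M ?P (\<lambda>y. (f y, g y)) x"
    by (rule hol_at_into_fibre_prod[where f=f and g=g and \<phi>=class_end and \<psi>=class_start, OF M A A f g e])
  show ?thesis
    using hol_at_compose[OF M P fg hol_at_class_mul[OF Y hol_at_topspace(2)[OF fg]]] by simp
qed

lemma hol_at_inv_map:
  assumes Y: "complex_manifold Y" and M: "charted M" and f: "hol_at M (Path Y) f x"
  shows "hol_at M (Path Y) (\<lambda>y. class_inv (Top Y) (f y)) x"
  by (rule hol_at_compose[OF M manifold_Arr[OF Y] f hol_at_class_inv[OF Y]])
    (use hol_at_topspace(2)[OF f] in simp)

text \<open>
  A local section of \<open>p\<close> pulls back to one of the projection.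
\<close>

lemma submersion_fibre_prod_snd:
  assumes X: "complex_manifold X" and Y: "complex_manifold Y" and S: "complex_manifold S"
    and p: "holomorphic_submersion X S p" and g: "\<And>y. y \<in> pts Y ==> hol_at Y S g y"
  shows "holomorphic_submersion (fibre_prod X Y p g) Y snd"
proof (rule submersion_from_sections[OF manifold_fibre_prod[OF assms] Y])
  fix q assume q: "q \<in> pts (fibre_prod X Y p g)"
  then show "hol_at (fibre_prod X Y p g) Y snd q" by (rule hol_at_fibre_prod_proj(2)[OF X Y])
  obtain x y where xy: "q = (x, y)" "x \<in> pts X" "y \<in> pts Y" "p x = g y" using q by auto
  obtain s V where s: "hol_at S X s (p x)" "s (p x) = x" "openin (Top S) V" "p x \<in> V" "\<And>y. y \<in> V ==> p (s y) = y"
    by (rule section_atE[OF section_of_submersion[OF X S p xy(2)]]) (rule that)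
  obtain V' where V': "openin (Top Y) V'" "y \<in> V'" "g ` V' \<subseteq> V"
    by (rule cont_atD[OF hol_at_cont[OF g[OF xy(3)]] s(3)]) (use xy(4) s(4) in auto)
  have sg: "hol_at Y X (\<lambda>y. s (g y)) y"
    by (rule hol_at_compose[where f=g and g=s, OF charted_manifold[OF Y] S g[OF xy(3)]]) (use s(1) xy(4) in simp)
  have "hol_at Y (fibre_prod X Y p g) (\<lambda>y. (s (g y), y)) y" unfolding fibre_prod_def
    by (rule hol_at_into_submanifold[OF charted_manifold[OF Y] manifold_prod[OF X Y]
          hol_at_pair[OF sg hol_at_id[OF Y xy(3)]] V'(1,2)]) (use V'(3) s(5) in auto)
  then show "section_at (fibre_prod X Y p g) Y snd q"
    by (intro section_atI[where \<sigma>="\<lambda>y. (s (g y), y)" and V=V']) (use xy s V' in auto)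
qed

lemma cont_at_into_subtopology:
  assumes f: "cont_at T T' f x" and A: "f ` topspace T \<subseteq> A"
  shows "cont_at T (subtopology T' A) f x"
  unfolding cont_at_def
proof (intro conjI allI impI)
  show x: "x \<in> topspace T" "f x \<in> topspace (subtopology T' A)" using f A by (auto simp: cont_at_def)
  fix V assume V: "openin (subtopology T' A) V \<and> f x \<in> V"
  then obtain V' where V': "openin T' V'" "V = V' \<inter> A" unfolding openin_subtopology by blast
  obtain W where W: "openin T W" "x \<in> W" "f ` W \<subseteq> V'" by (rule cont_atD[OF f V'(1)]) (use V V' in auto)
  have "f ` W \<subseteq> A" using openin_subset[OF W(1)] A by blast
  then show "\<exists>W. openin T W \<and> x \<in> W \<and> f ` W \<subseteq> V" using W V'(2) by blast
qed

section \<open>The bibundle of a path\<close>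

locale path_bibundle =
  fixes S :: "'s cmanifold" and X :: "'x cmanifold" and p :: "'x => 's"
    and \<gamma> :: "real => 's" and D :: "('s \<times> complex) set"
  assumes S: "complex_manifold S" and X: "complex_manifold X"
    and p: "holomorphic_submersion X S p"
    and fibration: "serre_fibration (Top X) (Top S) p"
    and \<gamma>: "pathin (Top S) \<gamma>"
    and D: "graph_nbhd S \<gamma> D"
begin

abbreviation Dm :: "('s \<times> complex) cmanifold" where "Dm \<equiv> dom_manifold S D"
abbreviation Z :: "('x \<times> 's \<times> complex) cmanifold" where "Z \<equiv> Gamma_pullback X S p D"
abbreviation A :: "(real => 'x \<times> 's \<times> complex) set cmanifold" where "A \<equiv> Path Z"
abbreviation Q :: "(real => 'x \<times> 's \<times> complex) set cmanifold" where "Q \<equiv> Q_path X S p D \<gamma>"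
abbreviation fib :: "real => 'x cmanifold" where "fib t \<equiv> fibre X p (\<gamma> t)"
abbreviation pt :: "real => 's \<times> complex" where "pt t \<equiv> (\<gamma> t, complex_of_real t)"
abbreviation \<iota> :: "real => (real => 'x) set => (real => 'x \<times> 's \<times> complex) set" where
  "\<iota> \<equiv> fibre_incl X S p D \<gamma>"
abbreviation mul (infixl \<open>\<bullet>\<^sub>Z\<close> 70) where "c \<bullet>\<^sub>Z c' \<equiv> class_mul (Top Z) c c'"
abbreviation inverse_class where "inverse_class c \<equiv> class_inv (Top Z) c"

lemma Top_Dm: "Top Dm = subtopology (prod_topology (Top S) (Top complex_line)) D"
  by (simp add: dom_manifold_def)

lemma manifold_Dm: "complex_manifold Dm"
  unfolding dom_manifold_def
  by (rule manifold_open_submanifold[OF manifold_prod[OF S manifold_complex_line]])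
    (use D in \<open>auto simp: graph_nbhd_def\<close>)

lemma hol_at_Dm_fst: "y \<in> pts Dm ==> hol_at Dm S fst y"
proof -
  assume y: "y \<in> pts Dm"
  note P = manifold_prod[OF S manifold_complex_line]
  have y': "y \<in> pts (S \<times>\<^sub>M complex_line) \<inter> D" using y by (simp add: Top_Dm)
  have "hol_at Dm (S \<times>\<^sub>M complex_line) (\<lambda>y. y) y"
    unfolding dom_manifold_def by (rule hol_at_submanifold_inclusion[OF P y'])
  then show ?thesis
    by (rule hol_at_compose[where f="\<lambda>y. y" and g=fst, OF charted_manifold[OF manifold_Dm] P])
       (rule hol_at_fst[OF S IntD1[OF y']])
qed

lemma manifold_Z: "complex_manifold Z"
  unfolding Gamma_pullback_def
  by (rule manifold_fibre_prod[OF X manifold_Dm S p hol_at_Dm_fst])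

lemma submersion_Z: "holomorphic_submersion Z Dm snd"
  unfolding Gamma_pullback_def
  by (rule submersion_fibre_prod_snd[OF X manifold_Dm S p hol_at_Dm_fst])

lemma Top_Z: "Top Z = subtopology (prod_topology (Top X) (Top Dm)) {(x, y). p x = fst y}"
  by (simp add: Gamma_pullback_def)

lemma topspace_Z: "(x, d) \<in> pts Z \<longleftrightarrow> x \<in> pts X \<and> d \<in> pts Dm \<and> p x = fst d"
  by (auto simp: Top_Z)

lemma Z_fibration: "contractible_fibration (Top Z) (Top Dm) snd"
proof
  have "continuous_map (Top Dm) (Top S) fst"
    unfolding continuous_map_iff_cont_at by (intro ballI hol_at_cont hol_at_Dm_fst)
  from serre_fibration_pullback[OF fibration this]
  show "serre_fibration (Top Z) (Top Dm) snd" by (simp add: Top_Z)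
  show "contractible_space (Top Dm)" using D by (simp add: graph_nbhd_def Top_Dm)
qed

lemma pathin_pt: "pathin (Top Dm) pt"
proof -
  have "continuous_map (top_of_set {0..1}) (Top complex_line) complex_of_real"
    by (auto simp: complex_line_def intro!: continuous_intros)
  then have "continuous_map (top_of_set {0..1}) (prod_topology (Top S) (Top complex_line)) pt"
    using \<gamma> by (intro continuous_map_pairedI) (simp_all add: pathin_def)
  then show ?thesis
    using D unfolding pathin_def Top_Dm continuous_map_in_subtopology by (auto simp: graph_nbhd_def)
qed

lemma pt_in: "t \<in> {0..1} ==> pt t \<in> pts Dm"
  by (rule pathin_topspace[OF pathin_pt])

lemma manifold_fib: "complex_manifold (fib t)"
  by (rule manifold_fibre[OF X S p])

lemma Top_fib: "Top (fib t) = subtopology (Top X) {x. p x = \<gamma> t}"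
  by (simp add: fibre_def)

lemma hol_at_Z_fst: "z \<in> pts Z ==> hol_at Z X fst z"
  unfolding Gamma_pullback_def by (rule hol_at_fibre_prod_proj(1)[OF X manifold_Dm])

lemma hol_at_into_fib:
  assumes M: "charted M" and f: "hol_at M Z f x" and e: "\<And>y. y \<in> pts M ==> f y \<in> pts Z \<and> snd (f y) = pt t"
  shows "hol_at M (fib t) (\<lambda>y. fst (f y)) x"
  unfolding fibre_def
proof (rule hol_at_into_submanifold[OF M X _ openin_topspace])
  show "hol_at M X (\<lambda>y. fst (f y)) x"
    by (rule hol_at_compose[OF M manifold_Z f hol_at_Z_fst[OF hol_at_topspace(2)[OF f]]])
  show "x \<in> pts M" by (rule hol_at_topspace(1)[OF f])
  have "p (fst (f y)) = \<gamma> t" if "y \<in> pts M" for y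
    using e[OF that] topspace_Z[of "fst (f y)" "snd (f y)"] by (metis fst_conv prod.collapse)
  then show "(\<lambda>y. fst (f y)) ` pts M \<subseteq> {x. p x = \<gamma> t}" by auto
qed

lemma hol_at_fib_into_Z:
  assumes t: "t \<in> {0..1}" and x: "x \<in> pts (fib t)"
  shows "hol_at (fib t) Z (\<lambda>x. (x, pt t)) x"
  unfolding Gamma_pullback_def
proof (rule hol_at_into_fibre_prod[where f="\<lambda>x. x" and g="\<lambda>_. pt t", OF charted_manifold[OF manifold_fib] X manifold_Dm])
  show "hol_at (fib t) X (\<lambda>x. x) x"
    unfolding fibre_def by (rule hol_at_submanifold_inclusion[OF X]) (use x in \<open>simp add: Top_fib\<close>)
  show "hol_at (fib t) Dm (\<lambda>_. pt t) x" by (rule hol_at_const[OF x pt_in[OF t]])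
qed (simp add: Top_fib)

lemma continuous_fib_into_Z: "t \<in> {0..1} ==> continuous_map (Top (fib t)) (Top Z) (\<lambda>x. (x, pt t))"
  unfolding continuous_map_iff_cont_at by (intro ballI hol_at_cont hol_at_fib_into_Z)

lemma incl_in:
  assumes t: "t \<in> {0..1}" and g: "g \<in> path_classes (Top (fib t))"
  shows "\<iota> t g \<in> path_classes (Top Z)" "class_start (\<iota> t g) = (class_start g, pt t)" "class_end (\<iota> t g) = (class_end g, pt t)"
  unfolding fibre_incl_def using class_map_in[OF g continuous_fib_into_Z[OF t]] by simp_all

lemma incl_mul:
  assumes t: "t \<in> {0..1}" and "g \<in> path_classes (Top (fib t))" "h \<in> path_classes (Top (fib t))" "class_end g = class_start h"
  shows "\<iota> t (class_mul (Top (fib t)) g h) = \<iota> t g \<bullet>\<^sub>Z \<iota> t h"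
  unfolding fibre_incl_def by (rule class_map_mul[OF assms(2-4) continuous_fib_into_Z[OF t]])

lemma incl_id:
  assumes t: "t \<in> {0..1}" and "x \<in> pts (fib t)"
  shows "\<iota> t (path_class (Top (fib t)) (\<lambda>_. x)) = path_class (Top Z) (\<lambda>_. (x, pt t))"
  unfolding fibre_incl_def by (rule class_map_id[OF assms(2) continuous_fib_into_Z[OF t]])

lemma hol_at_incl:
  assumes t: "t \<in> {0..1}" and g: "g \<in> path_classes (Top (fib t))"
  shows "hol_at (Path (fib t)) A (\<iota> t) g"
  unfolding fibre_incl_def
  by (rule hol_at_class_map[OF manifold_fib manifold_Z hol_at_fib_into_Z[OF t] g])

subsection \<open>Pushing classes into a fibre\<close>

abbreviation TF :: "real => ('x \<times> 's \<times> complex) topology" where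
  "TF t \<equiv> subtopology (Top Z) {z. snd z = pt t}"

text \<open>
  The inverse of \<open>\<iota> t\<close> on the classes with ends over \<open>pt t\<close>: such a class comes from the subspace
  \<open>TF t\<close> of \<open>Z\<close>, and \<open>TF t\<close> is the copy \<open>X\<^bsub>\<gamma>(t)\<^esub> \<times> {pt t}\<close> of the fibre.
\<close>

definition into_fibre :: "real => (real => 'x \<times> 's \<times> complex) set => (real => 'x) set" where
  "into_fibre t c = class_map (Top (fib t)) fst (inv_into (path_classes (TF t)) (class_map (Top Z) (\<lambda>z. z)) c)"

lemma continuous_fib_TF:
  "t \<in> {0..1} ==> continuous_map (Top (fib t)) (TF t) (\<lambda>x. (x, pt t))"
  using continuous_fib_into_Z by (auto simp: continuous_map_in_subtopology)

lemma continuous_TF_fib: "continuous_map (TF t) (Top (fib t)) fst"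
proof -
  have "continuous_map (Top Z) (Top X) fst"
    unfolding continuous_map_iff_cont_at by (intro ballI hol_at_cont hol_at_Z_fst)
  then have "continuous_map (TF t) (Top X) fst" by (rule continuous_map_from_subtopology)
  then show ?thesis by (auto simp: continuous_map_in_subtopology Top_Z Top_fib)
qed

lemma incl_factor:
  assumes t: "t \<in> {0..1}" and g: "g \<in> path_classes (Top (fib t))"
  shows "\<iota> t g = class_map (Top Z) (\<lambda>z. z) (class_map (TF t) (\<lambda>x. (x, pt t)) g)"
  unfolding fibre_incl_def
  by (rule class_map_compose[where g="\<lambda>z. z", OF g continuous_fib_TF[OF t], symmetric])
     (rule continuous_map_from_subtopology[OF continuous_map_id[unfolded id_def]])

lemma inv_incl_TF:
  assumes "g \<in> path_classes (TF t)"
  shows "inv_into (path_classes (TF t)) (class_map (Top Z) (\<lambda>z. z)) (class_map (Top Z) (\<lambda>z. z) g) = g"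
  by (rule inv_into_f_f[OF _ assms], rule inj_onI)
     (rule contractible_fibration.incl_inj[OF Z_fibration])

lemma into_fibre_incl:
  assumes t: "t \<in> {0..1}" and g: "g \<in> path_classes (Top (fib t))"
  shows "into_fibre t (\<iota> t g) = g"
proof -
  note h = class_map_in(1)[OF g continuous_fib_TF[OF t]]
  have "into_fibre t (\<iota> t g) = class_map (Top (fib t)) fst (class_map (TF t) (\<lambda>x. (x, pt t)) g)"
    unfolding into_fibre_def incl_factor[OF assms] inv_incl_TF[OF h] ..
  also have "\<dots> = class_map (Top (fib t)) (\<lambda>x. fst (x, pt t)) g"
    by (rule class_map_compose[OF g continuous_fib_TF[OF t] continuous_TF_fib])
  also have "\<dots> = class_map (Top (fib t)) (\<lambda>x. x) g" by (simp only: fst_conv)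
  also have "\<dots> = g"
    by (rule class_map_eq_self[where f="\<lambda>x. x", OF g continuous_map_id[unfolded id_def]]) (rule refl)
  finally show ?thesis .
qed

lemma into_fibre:
  assumes t: "t \<in> {0..1}" and c: "c \<in> path_classes (Top Z)" "snd (class_start c) = pt t" "snd (class_end c) = pt t"
  shows "into_fibre t c \<in> path_classes (Top (fib t))" "class_start (into_fibre t c) = fst (class_start c)"
    "class_end (into_fibre t c) = fst (class_end c)" "\<iota> t (into_fibre t c) = c"
proof -
  obtain g where g: "g \<in> path_classes (TF t)" "class_map (Top Z) (\<lambda>z. z) g = c"
    by (rule contractible_fibration.incl_surj[OF Z_fibration c]) (rule that)
  have j: "into_fibre t c = class_map (Top (fib t)) fst g"
    unfolding into_fibre_def g(2)[symmetric] inv_incl_TF[OF g(1)] ..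
  have e: "class_start c = class_start g" "class_end c = class_end g"
    unfolding g(2)[symmetric] using class_map_in(2,3)[OF g(1) contractible_fibration.continuous_incl[OF Z_fibration]] by simp_all
  note m = class_map_in[OF g(1) continuous_TF_fib]
  show j1: "into_fibre t c \<in> path_classes (Top (fib t))" and "class_start (into_fibre t c) = fst (class_start c)"
    "class_end (into_fibre t c) = fst (class_end c)" unfolding j e using m by simp_all
  have "\<iota> t (into_fibre t c) = class_map (Top Z) (\<lambda>z. z) (class_map (TF t) (\<lambda>x. (x, pt t)) (class_map (Top (fib t)) fst g))"
    using incl_factor[OF t j1] unfolding j .
  also have "class_map (TF t) (\<lambda>x. (x, pt t)) (class_map (Top (fib t)) fst g) = class_map (TF t) (\<lambda>z. (fst z, pt t)) g"
    by (rule class_map_compose[OF g(1) continuous_TF_fib continuous_fib_TF[OF t]])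
  also have "\<dots> = g"
  proof (rule class_map_eq_self[OF g(1)])
    show "continuous_map (TF t) (TF t) (\<lambda>z. (fst z, pt t))"
      using continuous_map_compose[OF continuous_TF_fib continuous_fib_TF[OF t]] by (simp add: o_def)
    show "(fst y, pt t) = y" if "y \<in> topspace (TF t)" for y using that by (cases y) auto
  qed
  finally show "\<iota> t (into_fibre t c) = c" using g(2) by simp
qed

text \<open>
  The preimage depends continuously on the class, and its ends are those of the class.
\<close>

lemma hol_at_into_fibre:
  assumes t: "t \<in> {0..1}" and M: "charted M" and f: "hol_at M A f x"
    and e: "\<And>y. y \<in> pts M ==> f y \<in> path_classes (Top Z) \<and> snd (class_start (f y)) = pt t \<and> snd (class_end (f y)) = pt t"
  shows "hol_at M (Path (fib t)) (\<lambda>y. into_fibre t (f y)) x"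
proof (rule hol_at_into_Arr)
  let ?S = "{c. snd (class_start c) = pt t \<and> snd (class_end c) = pt t}"
  note x = hol_at_topspace(1)[OF f]
  have fx: "f x \<in> path_classes (Top Z)" "snd (class_start (f x)) = pt t" "snd (class_end (f x)) = pt t" using e[OF x] by auto
  obtain g where g: "g \<in> path_classes (TF t)" "class_map (Top Z) (\<lambda>z. z) g = f x"
    by (rule contractible_fibration.incl_surj[OF Z_fibration fx]) (rule that)
  let ?j = "inv_into (path_classes (TF t)) (class_map (Top Z) (\<lambda>z. z))"
  have nF: "locally_nice (TF t)"
    using manifold_locally_nice[OF manifold_fibre[OF manifold_Z manifold_Dm submersion_Z, of "pt t"]]
    by (simp add: fibre_def)
  have "cont_at (Top M) (path_class_top (Top Z)) f x" using hol_at_cont[OF f] by simp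
  then have 1: "cont_at (Top M) (subtopology (path_class_top (Top Z)) ?S) f x"
    by (rule cont_at_into_subtopology) (use e in auto)
  have 2: "cont_at (subtopology (path_class_top (Top Z)) ?S) (path_class_top (TF t)) ?j (f x)"
    using contractible_fibration.cont_at_incl_inverse[where j="?j", OF Z_fibration
        manifold_locally_nice[OF manifold_Z] nF g(1) inv_incl_TF] unfolding g(2) .
  have 3: "cont_at (Top M) (path_class_top (TF t)) (\<lambda>y. ?j (f y)) x" by (rule cont_at_compose[OF 1 2])
  have jx: "?j (f x) \<in> path_classes (TF t)" using g inv_incl_TF[OF g(1)] by simp
  show "cont_at (Top M) (path_class_top (Top (fib t))) (\<lambda>y. into_fibre t (f y)) x"
    unfolding into_fibre_def by (rule cont_at_compose[OF 3 cont_at_class_map[OF jx continuous_TF_fib]])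
  have "hol_at M Z (\<lambda>y. class_end (f y)) x"
    by (rule hol_at_compose[OF M manifold_Arr[OF manifold_Z] f hol_at_class_end[OF manifold_Z fx(1)]])
  then have "hol_at M (fib t) (\<lambda>y. fst (class_end (f y))) x"
    by (rule hol_at_into_fib[OF M]) (use e class_ends_in in blast)
  then show "hol_at M (fib t) (\<lambda>y. class_end (into_fibre t (f y))) x"
    by (rule hol_at_cong_topspace[OF M]) (use e into_fibre(3)[OF t] in blast)
  have "hol_at M Z (\<lambda>y. class_start (f y)) x"
    by (rule hol_at_compose[OF M manifold_Arr[OF manifold_Z] f hol_at_class_start[OF manifold_Z fx(1)]])
  then have "hol_at M (fib t) (\<lambda>y. fst (class_start (f y))) x"
    by (rule hol_at_into_fib[OF M]) (use e class_ends_in in blast)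
  then show "hol_at M (fib t) (\<lambda>y. class_start (into_fibre t (f y))) x"
    by (rule hol_at_cong_topspace[OF M]) (use e into_fibre(2)[OF t] in blast)
qed

subsection \<open>The total space\<close>

text \<open>
  Since \<open>D\<close> is contractible, a path class of \<open>D\<close> is \<open>[e]\<close> if it has the ends of \<open>e\<close>.
\<close>

lemma Q_eq: "Q = submanifold A {c. snd (class_start c) = pt 0 \<and> snd (class_end c) = pt 1}"
  unfolding Q_path_def fibre_def
proof (rule submanifold_cong)
  note cs = contractible_fibration.continuous_q[OF Z_fibration]
  have "class_map (Top Dm) snd c = path_class (Top Dm) pt \<longleftrightarrow> snd (class_start c) = pt 0 \<and> snd (class_end c) = pt 1"
    if c: "c \<in> path_classes (Top Z)" for c
  proof
    assume "class_map (Top Dm) snd c = path_class (Top Dm) pt"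
    then show "snd (class_start c) = pt 0 \<and> snd (class_end c) = pt 1"
      using class_map_in(2,3)[OF c cs] class_ends[OF pathin_pt] by simp
  next
    assume "snd (class_start c) = pt 0 \<and> snd (class_end c) = pt 1"
    then show "class_map (Top Dm) snd c = path_class (Top Dm) pt"
      using class_map_in(2,3)[OF c cs] class_ends[OF pathin_pt]
      by (intro contractible_classes_unique[OF contractible_fibration.contr[OF Z_fibration]
            class_map_in(1)[OF c cs] path_class_in[OF pathin_pt]]) simp_all
  qed
  then show "pts A \<inter> {c. class_map (Top Dm) snd c = path_class (Top Dm) pt} =
      pts A \<inter> {c. snd (class_start c) = pt 0 \<and> snd (class_end c) = pt 1}" by auto
qed

lemma topspace_Q: "c \<in> pts Q \<longleftrightarrow>
    c \<in> path_classes (Top Z) \<and> snd (class_start c) = pt 0 \<and> snd (class_end c) = pt 1"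
  unfolding Q_eq by auto

text \<open>
  By \<open>Q_eq\<close>, \<open>Q\<close> is a fibre of the projection of both ends to \<open>D\<close>, which is a submersion as a
  composition of maps with local sections.
\<close>

lemma manifold_Q: "complex_manifold Q"
proof -
  note A = manifold_Arr[OF manifold_Z]
  note ZZ = manifold_prod[OF manifold_Z manifold_Z]
  note DD = manifold_prod[OF manifold_Dm manifold_Dm]
  have h: "hol_at Z Dm snd z" if "z \<in> pts Z" for z
    using submersion_Z that holomorphic_map_iff_hol_at[OF charted_manifold[OF manifold_Z], of Dm snd]
    unfolding holomorphic_submersion_def by blast
  have "holomorphic_submersion A (Dm \<times>\<^sub>M Dm) (\<lambda>c. (snd (class_end c), snd (class_start c)))"
  proof (rule submersion_from_sections[OF A DD])
    fix c assume "c \<in> pts A"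
    then have c: "c \<in> path_classes (Top Z)" by simp
    have "hol_at A Dm (\<lambda>c. snd (class_end c)) c"
      by (rule hol_at_compose[OF charted_manifold[OF A] manifold_Z hol_at_class_end[OF manifold_Z c] h])
        (rule class_ends_in(2)[OF c])
    moreover have "hol_at A Dm (\<lambda>c. snd (class_start c)) c"
      by (rule hol_at_compose[OF charted_manifold[OF A] manifold_Z hol_at_class_start[OF manifold_Z c] h])
        (rule class_ends_in(1)[OF c])
    ultimately show "hol_at A (Dm \<times>\<^sub>M Dm) (\<lambda>c. (snd (class_end c), snd (class_start c))) c" by (rule hol_at_pair)
    have s: "section_at Z Dm snd z" if "z \<in> pts Z" for z
      by (rule section_of_submersion[OF manifold_Z manifold_Dm submersion_Z that])
    have "section_at (Z \<times>\<^sub>M Z) (Dm \<times>\<^sub>M Dm) (\<lambda>q. (snd (fst q), snd (snd q))) (endpts c)"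
      unfolding endpts_def
      by (rule section_at_prod[OF manifold_Dm manifold_Dm s s]) (rule class_ends_in[OF c])+
    from section_at_compose[OF ZZ DD section_at_endpts[OF manifold_Z c] this]
    show "section_at A (Dm \<times>\<^sub>M Dm) (\<lambda>c. (snd (class_end c), snd (class_start c))) c"
      by (simp add: endpts_def)
  qed
  from manifold_fibre[OF A DD this, of "(pt 1, pt 0)"]
  have "complex_manifold (submanifold A {c. (snd (class_end c), snd (class_start c)) = (pt 1, pt 0)})"
    unfolding fibre_def .
  also have "{c. (snd (class_end c), snd (class_start c)) = (pt 1, pt 0)} =
      {c. snd (class_start c) = pt 0 \<and> snd (class_end c) = pt 1}" by auto
  finally show ?thesis unfolding Q_eq .
qed

lemma hol_at_Q_incl: "c \<in> pts Q ==> hol_at Q A (\<lambda>c. c) c"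
  unfolding Q_eq
  by (rule hol_at_submanifold_inclusion[OF manifold_Arr[OF manifold_Z]]) auto

lemma hol_at_into_Q:
  assumes M: "charted M" and f: "hol_at M A f x" and W: "openin (Top M) W" "x \<in> W"
    and e: "\<And>y. y \<in> W ==> snd (class_start (f y)) = pt 0 \<and> snd (class_end (f y)) = pt 1"
  shows "hol_at M Q f x"
  unfolding Q_eq
  by (rule hol_at_into_submanifold[OF M manifold_Arr[OF manifold_Z] f W]) (use e in auto)

lemma Q_ends:
  assumes c: "c \<in> pts Q"
  shows "c \<in> path_classes (Top Z)" "class_start c = (Q_left_moment c, pt 0)" "class_end c = (Q_right_moment c, pt 1)"
    "Q_left_moment c \<in> pts (fib 0)" "Q_right_moment c \<in> pts (fib 1)"
proof -
  show 1: "c \<in> path_classes (Top Z)" and 2: "class_start c = (Q_left_moment c, pt 0)" and 3: "class_end c = (Q_right_moment c, pt 1)"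
    using c unfolding topspace_Q Q_left_moment_def Q_right_moment_def by (auto intro: prod_eqI)
  show "Q_left_moment c \<in> pts (fib 0)" "Q_right_moment c \<in> pts (fib 1)"
    using class_ends_in[OF 1] unfolding 2 3 topspace_Z by (auto simp: Top_fib)
qed

lemma hol_at_moments:
  assumes c: "c \<in> pts Q"
  shows "hol_at Q (fib 0) Q_left_moment c" "hol_at Q (fib 1) Q_right_moment c"
proof -
  note ch = charted_manifold[OF manifold_Q]
  have "hol_at Q Z class_start c"
    by (rule hol_at_compose[where f="\<lambda>c. c" and g=class_start, OF ch manifold_Arr[OF manifold_Z]
        hol_at_Q_incl[OF c] hol_at_class_start[OF manifold_Z Q_ends(1)[OF c]]])
  then show "hol_at Q (fib 0) Q_left_moment c" unfolding Q_left_moment_def[abs_def]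
    by (rule hol_at_into_fib[OF ch]) (simp add: topspace_Q class_ends_in)
  have "hol_at Q Z class_end c"
    by (rule hol_at_compose[where f="\<lambda>c. c" and g=class_end, OF ch manifold_Arr[OF manifold_Z]
        hol_at_Q_incl[OF c] hol_at_class_end[OF manifold_Z Q_ends(1)[OF c]]])
  then show "hol_at Q (fib 1) Q_right_moment c" unfolding Q_right_moment_def[abs_def]
    by (rule hol_at_into_fib[OF ch]) (simp add: topspace_Q class_ends_in)
qed

lemma moments_onto:
  "Q_left_moment ` pts Q = pts (fib 0)"
  "Q_right_moment ` pts Q = pts (fib 1)"
proof -
  note lift = lift_path[OF contractible_fibration.fib[OF Z_fibration]]
  have "x \<in> Q_left_moment ` pts Q" if x: "x \<in> pts (fib 0)" for x
  proof -
    have z: "(x, pt 0) \<in> pts Z" using x pt_in[of 0] by (auto simp: topspace_Z Top_fib)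
    obtain \<alpha> where a: "pathin (Top Z) \<alpha>" "\<alpha> 0 = (x, pt 0)" "\<And>t. t \<in> {0..1} ==> snd (\<alpha> t) = pt t"
      by (rule lift[OF pathin_pt z]) (auto intro: that)
    have "path_class (Top Z) \<alpha> \<in> pts Q" using a path_class_in[OF a(1)] by (simp add: topspace_Q)
    moreover have "Q_left_moment (path_class (Top Z) \<alpha>) = x" using a by (simp add: Q_left_moment_def)
    ultimately show ?thesis by blast
  qed
  then show "Q_left_moment ` pts Q = pts (fib 0)" using Q_ends(4) by blast
  have "x \<in> Q_right_moment ` pts Q" if x: "x \<in> pts (fib 1)" for x
  proof -
    have z: "(x, pt 1) \<in> pts Z" using x pt_in[of 1] by (auto simp: topspace_Z Top_fib)
    obtain \<alpha> where a: "pathin (Top Z) \<alpha>" "\<alpha> 0 = (x, pt 1)" "\<And>t. t \<in> {0..1} ==> snd (\<alpha> t) = pt (1 - t)"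
      by (rule lift[OF pathin_rev[OF pathin_pt] z]) (auto intro: that)
    note b = pathin_rev[OF a(1)]
    have "path_class (Top Z) (\<lambda>t. \<alpha> (1 - t)) \<in> pts Q"
      using a(2) a(3)[of 1] path_class_in[OF b] class_ends[OF b] by (simp add: topspace_Q)
    moreover have "Q_right_moment (path_class (Top Z) (\<lambda>t. \<alpha> (1 - t))) = x"
      using a(2) class_ends[OF b] by (simp add: Q_right_moment_def)
    ultimately show ?thesis by blast
  qed
  then show "Q_right_moment ` pts Q = pts (fib 1)" using Q_ends(5) by blast
qed

text \<open>
  A family \<open>u\<close> of pairs of end points, one for each value of \<open>\<mu>\<close>, lifts along the local inverse of
  the end point map to a section of \<open>\<mu>\<close>.
\<close>

lemma section_of_moment:
  assumes c: "c \<in> pts Q" and F: "complex_manifold F" and m: "\<mu> c \<in> pts F"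
    and u: "\<And>x. x \<in> pts F ==> hol_at F (Z \<times>\<^sub>M Z) u x" and uc: "u (\<mu> c) = endpts c"
    and e: "\<And>x. snd (fst (u x)) = pt 1 \<and> snd (snd (u x)) = pt 0"
    and \<mu>: "\<And>x c'. endpts c' = u x ==> \<mu> c' = x"
  shows "section_at Q F \<mu> c"
proof -
  note ZZ = manifold_prod[OF manifold_Z manifold_Z] and ch = charted_manifold[OF F]
  obtain s V where s: "hol_at (Z \<times>\<^sub>M Z) A s (endpts c)" "s (endpts c) = c" "openin (Top (Z \<times>\<^sub>M Z)) V" "endpts c \<in> V"
    "\<And>y. y \<in> V ==> endpts (s y) = y" by (rule section_atE[OF section_at_endpts[OF manifold_Z Q_ends(1)[OF c]]]) (rule that)
  obtain W where W: "openin (Top F) W" "\<mu> c \<in> W" "u ` W \<subseteq> V"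
    by (rule cont_atD[OF hol_at_cont[OF u[OF m]] s(3)]) (use uc s(4) in simp_all)
  have ends: "endpts (s (u x)) = u x" if "x \<in> W" for x using s(5) W(3) that by blast
  have "hol_at F A (\<lambda>x. s (u x)) (\<mu> c)"
    by (rule hol_at_compose[where f=u and g=s, OF ch ZZ u[OF m]]) (use s(1) uc in simp)
  then have "hol_at F Q (\<lambda>x. s (u x)) (\<mu> c)"
  proof (rule hol_at_into_Q[OF ch _ W(1,2)])
    fix y assume "y \<in> W"
    note ends[OF this]
    then have "class_start (s (u y)) = snd (u y)" "class_end (s (u y)) = fst (u y)"
      unfolding endpts_def by (metis snd_conv, metis fst_conv)
    then show "snd (class_start (s (u y))) = pt 0 \<and> snd (class_end (s (u y))) = pt 1" using e[of y] by simp
  qed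
  then show ?thesis
    by (rule section_atI[where \<sigma>="\<lambda>x. s (u x)" and V=W]) (use W(1,2) s(2) uc \<mu>[OF ends] in simp_all)
qed

lemma submersion_moments:
  "holomorphic_submersion Q (fib 0) Q_left_moment" "holomorphic_submersion Q (fib 1) Q_right_moment"
proof -
  have "section_at Q (fib 0) Q_left_moment c" if c: "c \<in> pts Q" for c
  proof (rule section_of_moment[where u="\<lambda>x. (class_end c, (x, pt 0))" and \<mu>=Q_left_moment, OF c manifold_fib Q_ends(4)[OF c]])
    show "hol_at (fib 0) (Z \<times>\<^sub>M Z) (\<lambda>x. (class_end c, (x, pt 0))) x" if "x \<in> pts (fib 0)" for x
      by (rule hol_at_pair[OF hol_at_const[OF that class_ends_in(2)[OF Q_ends(1)[OF c]]] hol_at_fib_into_Z[OF _ that]]) simp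
  qed (use Q_ends(2,3)[OF c] in \<open>auto simp: endpts_def Q_left_moment_def\<close>)
  then show "holomorphic_submersion Q (fib 0) Q_left_moment"
    by (intro submersion_from_sections[OF manifold_Q manifold_fib hol_at_moments(1)])
  have "section_at Q (fib 1) Q_right_moment c" if c: "c \<in> pts Q" for c
  proof (rule section_of_moment[where u="\<lambda>x. ((x, pt 1), class_start c)" and \<mu>=Q_right_moment, OF c manifold_fib Q_ends(5)[OF c]])
    show "hol_at (fib 1) (Z \<times>\<^sub>M Z) (\<lambda>x. ((x, pt 1), class_start c)) x" if "x \<in> pts (fib 1)" for x
      by (rule hol_at_pair[OF hol_at_fib_into_Z[OF _ that] hol_at_const[OF that class_ends_in(1)[OF Q_ends(1)[OF c]]]]) simp
  qed (use Q_ends(2,3)[OF c] in \<open>auto simp: endpts_def Q_right_moment_def\<close>)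
  then show "holomorphic_submersion Q (fib 1) Q_right_moment"
    by (intro submersion_from_sections[OF manifold_Q manifold_fib hol_at_moments(2)])
qed

subsection \<open>The actions\<close>

lemma left_act_eq: "Q_left_act X S p D \<gamma> g c = \<iota> 0 g \<bullet>\<^sub>Z c"
  by (simp add: Q_left_act_def)

lemma right_act_eq: "Q_right_act X S p D \<gamma> c g = c \<bullet>\<^sub>Z \<iota> 1 g"
  by (simp add: Q_right_act_def)

lemma left_act_in:
  assumes g: "g \<in> path_classes (Top (fib 0))" and c: "c \<in> pts Q" and e: "class_end g = Q_left_moment c"
  shows "\<iota> 0 g \<in> path_classes (Top Z)" "class_end (\<iota> 0 g) = class_start c" "\<iota> 0 g \<bullet>\<^sub>Z c \<in> pts Q"
    "Q_left_moment (\<iota> 0 g \<bullet>\<^sub>Z c) = class_start g" "Q_right_moment (\<iota> 0 g \<bullet>\<^sub>Z c) = Q_right_moment c"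
proof -
  have i: "\<iota> 0 g \<in> path_classes (Top Z)" "class_start (\<iota> 0 g) = (class_start g, pt 0)" "class_end (\<iota> 0 g) = (class_end g, pt 0)"
    by (rule incl_in[OF _ g]; simp)+
  note cQ = Q_ends[OF c]
  show i1: "\<iota> 0 g \<in> path_classes (Top Z)" by (rule i(1))
  show ee: "class_end (\<iota> 0 g) = class_start c" unfolding i(3) cQ(2) e ..
  note m = class_mul_in[OF i(1) cQ(1) ee]
  show "\<iota> 0 g \<bullet>\<^sub>Z c \<in> pts Q" unfolding topspace_Q using m i cQ by simp
  show "Q_left_moment (\<iota> 0 g \<bullet>\<^sub>Z c) = class_start g" "Q_right_moment (\<iota> 0 g \<bullet>\<^sub>Z c) = Q_right_moment c"
    unfolding Q_left_moment_def Q_right_moment_def m i by simp_all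
qed

lemma right_act_in:
  assumes c: "c \<in> pts Q" and g: "g \<in> path_classes (Top (fib 1))" and e: "Q_right_moment c = class_start g"
  shows "\<iota> 1 g \<in> path_classes (Top Z)" "class_end c = class_start (\<iota> 1 g)" "c \<bullet>\<^sub>Z \<iota> 1 g \<in> pts Q"
    "Q_left_moment (c \<bullet>\<^sub>Z \<iota> 1 g) = Q_left_moment c" "Q_right_moment (c \<bullet>\<^sub>Z \<iota> 1 g) = class_end g"
proof -
  have i: "\<iota> 1 g \<in> path_classes (Top Z)" "class_start (\<iota> 1 g) = (class_start g, pt 1)" "class_end (\<iota> 1 g) = (class_end g, pt 1)"
    by (rule incl_in[OF _ g]; simp)+
  note cQ = Q_ends[OF c]
  show i1: "\<iota> 1 g \<in> path_classes (Top Z)" by (rule i(1))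
  show ee: "class_end c = class_start (\<iota> 1 g)" unfolding i(2) cQ(3) e ..
  note m = class_mul_in[OF cQ(1) i(1) ee]
  show "c \<bullet>\<^sub>Z \<iota> 1 g \<in> pts Q" unfolding topspace_Q using m i cQ by simp
  show "Q_left_moment (c \<bullet>\<^sub>Z \<iota> 1 g) = Q_left_moment c" "Q_right_moment (c \<bullet>\<^sub>Z \<iota> 1 g) = class_end g"
    unfolding Q_left_moment_def Q_right_moment_def m i by simp_all
qed

lemma hol_at_incl_map:
  assumes t: "t \<in> {0..1}" and M: "charted M" and f: "hol_at M (Path (fib t)) f x"
  shows "hol_at M A (\<lambda>y. \<iota> t (f y)) x"
  by (rule hol_at_compose[where f=f and g="\<iota> t", OF M manifold_Arr[OF manifold_fib] f hol_at_incl[OF t]])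
    (use hol_at_topspace(2)[OF f] in simp)

lemma hol_at_Q_incl_map:
  assumes M: "charted M" and f: "hol_at M Q f x"
  shows "hol_at M A f x"
  using hol_at_compose[where f=f and g="\<lambda>c. c", OF M manifold_Q f hol_at_Q_incl[OF hol_at_topspace(2)[OF f]]] .

lemma hol_at_into_Q_everywhere:
  assumes M: "charted M" and f: "hol_at M A f x" and e: "\<And>y. y \<in> pts M ==> f y \<in> pts Q"
  shows "hol_at M Q f x"
  by (rule hol_at_into_Q[OF M f openin_topspace hol_at_topspace(1)[OF f]]) (use e topspace_Q in blast)

lemma holomorphic_left_act:
  "holomorphic_map (fibre_prod (Path (fib 0)) Q class_end Q_left_moment) Q (\<lambda>q. \<iota> 0 (fst q) \<bullet>\<^sub>Z snd q)"
  (is "holomorphic_map ?P _ _")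
  unfolding holomorphic_map_iff_hol_at[OF charted_fibre_prod]
proof
  fix q assume q: "q \<in> pts ?P"
  have P: "fst y \<in> path_classes (Top (fib 0))" "snd y \<in> pts Q" "class_end (fst y) = Q_left_moment (snd y)"
    if "y \<in> pts ?P" for y using that by auto
  note ch = charted_fibre_prod[of "Path (fib 0)" Q class_end Q_left_moment]
  note proj = hol_at_fibre_prod_proj[OF manifold_Arr[OF manifold_fib] manifold_Q q]
  have h1: "hol_at ?P A (\<lambda>q. \<iota> 0 (fst q)) q" by (rule hol_at_incl_map[OF _ ch proj(1)]) simp
  note h2 = hol_at_Q_incl_map[OF ch proj(2)]
  have "hol_at ?P A (\<lambda>q. \<iota> 0 (fst q) \<bullet>\<^sub>Z snd q) q"
    by (rule hol_at_mul_maps[OF manifold_Z ch h1 h2]) (rule left_act_in(2)[OF P])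
  then show "hol_at ?P Q (\<lambda>q. \<iota> 0 (fst q) \<bullet>\<^sub>Z snd q) q"
    by (rule hol_at_into_Q_everywhere[OF ch]) (rule left_act_in(3)[OF P])
qed

lemma holomorphic_right_act:
  "holomorphic_map (fibre_prod Q (Path (fib 1)) Q_right_moment class_start) Q (\<lambda>q. fst q \<bullet>\<^sub>Z \<iota> 1 (snd q))"
  (is "holomorphic_map ?P _ _")
  unfolding holomorphic_map_iff_hol_at[OF charted_fibre_prod]
proof
  fix q assume q: "q \<in> pts ?P"
  have P: "fst y \<in> pts Q" "snd y \<in> path_classes (Top (fib 1))" "Q_right_moment (fst y) = class_start (snd y)"
    if "y \<in> pts ?P" for y using that by auto
  note ch = charted_fibre_prod[of Q "Path (fib 1)" Q_right_moment class_start]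
  note proj = hol_at_fibre_prod_proj[OF manifold_Q manifold_Arr[OF manifold_fib] q]
  have h2: "hol_at ?P A (\<lambda>q. \<iota> 1 (snd q)) q" by (rule hol_at_incl_map[OF _ ch proj(2)]) simp
  note h1 = hol_at_Q_incl_map[OF ch proj(1)]
  have "hol_at ?P A (\<lambda>q. fst q \<bullet>\<^sub>Z \<iota> 1 (snd q)) q"
    by (rule hol_at_mul_maps[OF manifold_Z ch h1 h2]) (rule right_act_in(2)[OF P])
  then show "hol_at ?P Q (\<lambda>q. fst q \<bullet>\<^sub>Z \<iota> 1 (snd q)) q"
    by (rule hol_at_into_Q_everywhere[OF ch]) (rule right_act_in(3)[OF P])
qed

lemma left_action_Q: "left_action (\<Pi>\<^sub>1 (fib 0)) Q Q_left_moment (Q_left_act X S p D \<gamma>)"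
  unfolding left_action_def left_act_eq fundamental_groupoid_simps topspace_path_class_top
proof (intro conjI ballI impI)
  show "holomorphic_map Q (fib 0) Q_left_moment"
    unfolding holomorphic_map_iff_hol_at[OF charted_manifold[OF manifold_Q]] by (intro ballI hol_at_moments(1))
  show "holomorphic_map (fibre_prod (Path (fib 0)) Q class_end Q_left_moment) Q (\<lambda>(g, x). \<iota> 0 g \<bullet>\<^sub>Z x)"
    using holomorphic_left_act by (simp add: case_prod_unfold)
next
  fix g x assume "g \<in> path_classes (Top (fib 0))" "x \<in> pts Q" "class_end g = Q_left_moment x"
  then show "Q_left_moment (\<iota> 0 g \<bullet>\<^sub>Z x) = class_start g" by (rule left_act_in(4))
next
  fix g g' x assume *: "g \<in> path_classes (Top (fib 0))" "g' \<in> path_classes (Top (fib 0))" "x \<in> pts Q"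
    "class_end g = class_start g' \<and> class_end g' = Q_left_moment x"
  have t: "0 \<in> {0..1::real}" by simp
  have e: "class_end (\<iota> 0 g) = class_start (\<iota> 0 g')"
    unfolding incl_in(3)[OF t *(1)] incl_in(2)[OF t *(2)] using *(4) by simp
  show "\<iota> 0 g \<bullet>\<^sub>Z (\<iota> 0 g' \<bullet>\<^sub>Z x) = \<iota> 0 (class_mul (Top (fib 0)) g g') \<bullet>\<^sub>Z x"
    unfolding incl_mul[OF t *(1,2) conjunct1[OF *(4)]]
    by (rule class_mul_assoc[OF incl_in(1)[OF t *(1)] incl_in(1)[OF t *(2)] Q_ends(1)[OF *(3)] e
          left_act_in(2)[OF *(2,3) conjunct2[OF *(4)]], symmetric])
next
  fix x assume x: "x \<in> pts Q"
  have t: "0 \<in> {0..1::real}" by simp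
  show "\<iota> 0 (path_class (Top (fib 0)) (\<lambda>_. Q_left_moment x)) \<bullet>\<^sub>Z x = x"
    unfolding incl_id[OF t Q_ends(4)[OF x]] Q_ends(2)[OF x, symmetric] by (rule class_mul_idl[OF Q_ends(1)[OF x]])
qed

lemma right_action_Q: "right_action (\<Pi>\<^sub>1 (fib 1)) Q Q_right_moment (Q_right_act X S p D \<gamma>)"
  unfolding right_action_def right_act_eq fundamental_groupoid_simps topspace_path_class_top
proof (intro conjI ballI impI)
  show "holomorphic_map Q (fib 1) Q_right_moment"
    unfolding holomorphic_map_iff_hol_at[OF charted_manifold[OF manifold_Q]] by (intro ballI hol_at_moments(2))
  show "holomorphic_map (fibre_prod Q (Path (fib 1)) Q_right_moment class_start) Q (\<lambda>(x, h). x \<bullet>\<^sub>Z \<iota> 1 h)"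
    using holomorphic_right_act by (simp add: case_prod_unfold)
next
  fix x h assume "x \<in> pts Q" "h \<in> path_classes (Top (fib 1))" "Q_right_moment x = class_start h"
  then show "Q_right_moment (x \<bullet>\<^sub>Z \<iota> 1 h) = class_end h" by (rule right_act_in(5))
next
  fix x h h' assume *: "x \<in> pts Q" "h \<in> path_classes (Top (fib 1))" "h' \<in> path_classes (Top (fib 1))"
    "Q_right_moment x = class_start h \<and> class_end h = class_start h'"
  have t: "1 \<in> {0..1::real}" by simp
  have e: "class_end (\<iota> 1 h) = class_start (\<iota> 1 h')"
    unfolding incl_in(3)[OF t *(2)] incl_in(2)[OF t *(3)] using *(4) by simp
  show "x \<bullet>\<^sub>Z \<iota> 1 h \<bullet>\<^sub>Z \<iota> 1 h' = x \<bullet>\<^sub>Z \<iota> 1 (class_mul (Top (fib 1)) h h')"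
    unfolding incl_mul[OF t *(2,3) conjunct2[OF *(4)]]
    by (rule class_mul_assoc[OF Q_ends(1)[OF *(1)] incl_in(1)[OF t *(2)] incl_in(1)[OF t *(3)]
          right_act_in(2)[OF *(1,2) conjunct1[OF *(4)]] e])
next
  fix x assume x: "x \<in> pts Q"
  have t: "1 \<in> {0..1::real}" by simp
  show "x \<bullet>\<^sub>Z \<iota> 1 (path_class (Top (fib 1)) (\<lambda>_. Q_right_moment x)) = x"
    unfolding incl_id[OF t Q_ends(5)[OF x]] Q_ends(3)[OF x, symmetric] by (rule class_mul_idr[OF Q_ends(1)[OF x]])
qed

subsection \<open>Principality\<close>

text \<open>
  The candidate for the arrow that carries \<open>c\<close> to \<open>c'\<close>, as a class of \<open>Z\<close>.
\<close>

lemma left_difference: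
  assumes c: "c \<in> pts Q" "c' \<in> pts Q" and e: "Q_right_moment c' = Q_right_moment c"
  shows "c' \<bullet>\<^sub>Z inverse_class c \<in> path_classes (Top Z)" "class_end c' = class_start (inverse_class c)"
    "class_start (c' \<bullet>\<^sub>Z inverse_class c) = (Q_left_moment c', pt 0)"
    "class_end (c' \<bullet>\<^sub>Z inverse_class c) = (Q_left_moment c, pt 0)"
proof -
  note c1 = Q_ends[OF c(1)] and c2 = Q_ends[OF c(2)]
  note i = class_inv_in[OF c1(1)]
  show ee: "class_end c' = class_start (inverse_class c)" unfolding i c1(3) c2(3) e ..
  note m = class_mul_in[OF c2(1) i(1) ee]
  show "c' \<bullet>\<^sub>Z inverse_class c \<in> path_classes (Top Z)"
    "class_start (c' \<bullet>\<^sub>Z inverse_class c) = (Q_left_moment c', pt 0)"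
    "class_end (c' \<bullet>\<^sub>Z inverse_class c) = (Q_left_moment c, pt 0)"
    using m i c1(2) c2(2) by simp_all
qed

lemma right_difference:
  assumes c: "c \<in> pts Q" "c' \<in> pts Q" and e: "Q_left_moment c = Q_left_moment c'"
  shows "inverse_class c \<bullet>\<^sub>Z c' \<in> path_classes (Top Z)" "class_end (inverse_class c) = class_start c'"
    "class_start (inverse_class c \<bullet>\<^sub>Z c') = (Q_right_moment c, pt 1)"
    "class_end (inverse_class c \<bullet>\<^sub>Z c') = (Q_right_moment c', pt 1)"
proof -
  note c1 = Q_ends[OF c(1)] and c2 = Q_ends[OF c(2)]
  note i = class_inv_in[OF c1(1)]
  show ee: "class_end (inverse_class c) = class_start c'" unfolding i c1(2) c2(2) e ..
  note m = class_mul_in[OF i(1) c2(1) ee]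
  show "inverse_class c \<bullet>\<^sub>Z c' \<in> path_classes (Top Z)"
    "class_start (inverse_class c \<bullet>\<^sub>Z c') = (Q_right_moment c, pt 1)"
    "class_end (inverse_class c \<bullet>\<^sub>Z c') = (Q_right_moment c', pt 1)"
    using m i c1(3) c2(3) by simp_all
qed

text \<open>
  The inverse of \<open>(g, c) \<mapsto> (g*c, c)\<close> sends \<open>(c', c)\<close> to the preimage of \<open>c'.c\<inverse>\<close> under \<open>\<iota> 0\<close>.
\<close>

lemma left_principal_Q:
  "left_principal_bundle (\<Pi>\<^sub>1 (fib 0)) Q Q_left_moment (Q_left_act X S p D \<gamma>) (fib 1) Q_right_moment"
proof -
  let ?P = "fibre_prod (Path (fib 0)) Q class_end Q_left_moment"
  let ?R = "fibre_prod Q Q Q_right_moment Q_right_moment"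
  let ?\<phi> = "\<lambda>q. (\<iota> 0 (fst q) \<bullet>\<^sub>Z snd q, snd q)"
  let ?\<psi> = "\<lambda>q. (into_fibre 0 (fst q \<bullet>\<^sub>Z inverse_class (snd q)), snd q)"
  have t: "0 \<in> {0..1::real}" by simp
  note AF = manifold_Arr[OF manifold_fib]
  have chP: "charted ?P" and chR: "charted ?R" by (rule charted_fibre_prod)+
  have P: "fst y \<in> path_classes (Top (fib 0))" "snd y \<in> pts Q" "class_end (fst y) = Q_left_moment (snd y)"
    if "y \<in> pts ?P" for y using that by auto
  have R: "snd y \<in> pts Q" "fst y \<in> pts Q" "Q_right_moment (fst y) = Q_right_moment (snd y)"
    if "y \<in> pts ?R" for y using that by auto
  have \<phi>: "holomorphic_map ?P ?R ?\<phi>"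
    unfolding holomorphic_map_iff_hol_at[OF chP]
  proof
    fix q assume q: "q \<in> pts ?P"
    have h: "hol_at ?P Q (\<lambda>q. \<iota> 0 (fst q) \<bullet>\<^sub>Z snd q) q"
      using holomorphic_left_act q unfolding holomorphic_map_iff_hol_at[OF chP] by blast
    show "hol_at ?P ?R ?\<phi> q"
      by (rule hol_at_into_fibre_prod[where f="\<lambda>q. \<iota> 0 (fst q) \<bullet>\<^sub>Z snd q" and g=snd, OF chP manifold_Q manifold_Q h
            hol_at_fibre_prod_proj(2)[OF AF manifold_Q q]]) (rule left_act_in(5)[OF P])
  qed
  have \<psi>: "holomorphic_map ?R ?P ?\<psi>"
    unfolding holomorphic_map_iff_hol_at[OF chR]
  proof
    fix q assume q: "q \<in> pts ?R"
    note proj = hol_at_fibre_prod_proj[OF manifold_Q manifold_Q q]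
    note h1 = hol_at_Q_incl_map[OF chR proj(1)] and h2 = hol_at_inv_map[OF manifold_Z chR hol_at_Q_incl_map[OF chR proj(2)]]
    have "hol_at ?R A (\<lambda>q. fst q \<bullet>\<^sub>Z inverse_class (snd q)) q"
      by (rule hol_at_mul_maps[OF manifold_Z chR h1 h2]) (rule left_difference(2)[OF R])
    then have h: "hol_at ?R (Path (fib 0)) (\<lambda>q. into_fibre 0 (fst q \<bullet>\<^sub>Z inverse_class (snd q))) q"
      by (rule hol_at_into_fibre[OF t chR]) (simp add: left_difference[OF R])
    show "hol_at ?R ?P ?\<psi> q"
      by (rule hol_at_into_fibre_prod[where f="\<lambda>q. into_fibre 0 (fst q \<bullet>\<^sub>Z inverse_class (snd q))" and g=snd,
            OF chR AF manifold_Q h proj(2)])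
         (simp add: into_fibre(3)[OF t] left_difference[OF R])
  qed
  have \<psi>\<phi>: "?\<psi> (?\<phi> q) = q" if q: "q \<in> pts ?P" for q
    using class_mul_inv_cancel(1)[OF left_act_in(1)[OF P[OF q]] Q_ends(1)[OF P(2)[OF q]] left_act_in(2)[OF P[OF q]]]
      into_fibre_incl[OF t P(1)[OF q]] by simp
  have \<phi>\<psi>: "?\<phi> (?\<psi> q) = q" if q: "q \<in> pts ?R" for q
  proof -
    have "class_end (fst q) = class_end (snd q)"
      unfolding Q_ends(3)[OF R(1)[OF q]] Q_ends(3)[OF R(2)[OF q]] R(3)[OF q] ..
    then show ?thesis
      using class_mul_inv_cancel(2)[OF Q_ends(1)[OF R(2)[OF q]] Q_ends(1)[OF R(1)[OF q]]]
        into_fibre(4)[OF t left_difference(1)[OF R[OF q]]] left_difference(3,4)[OF R[OF q]] by simp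
  qed
  have bih: "biholomorphic_map ?P ?R ?\<phi>"
    unfolding biholomorphic_map_def using \<phi> \<psi> \<psi>\<phi> \<phi>\<psi> by blast
  show ?thesis
    unfolding left_principal_bundle_def
  proof (intro conjI)
    show "\<forall>g\<in>arrows (\<Pi>\<^sub>1 (fib 0)). \<forall>x\<in>pts Q. gtgt (\<Pi>\<^sub>1 (fib 0)) g = Q_left_moment x -->
        Q_right_moment (Q_left_act X S p D \<gamma> g x) = Q_right_moment x"
      by (simp add: left_act_eq left_act_in)
    show "biholomorphic_map (fibre_prod (Path (fib 0)) Q (gtgt (\<Pi>\<^sub>1 (fib 0))) Q_left_moment) ?R
        (\<lambda>(g, x). (Q_left_act X S p D \<gamma> g x, x))"
      using bih by (simp add: left_act_eq case_prod_unfold)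
  qed (fact left_action_Q submersion_moments(2) moments_onto(2))+
qed

text \<open>
  The mirror image: the inverse of \<open>(c, g) \<mapsto> (c, c*g)\<close> sends \<open>(c, c')\<close> to the preimage of
  \<open>c\<inverse>.c'\<close> under \<open>\<iota> 1\<close>.
\<close>

lemma right_principal_Q:
  "right_principal_bundle (\<Pi>\<^sub>1 (fib 1)) Q Q_right_moment (Q_right_act X S p D \<gamma>) (fib 0) Q_left_moment"
proof -
  let ?P = "fibre_prod Q (Path (fib 1)) Q_right_moment class_start"
  let ?R = "fibre_prod Q Q Q_left_moment Q_left_moment"
  let ?\<phi> = "\<lambda>q. (fst q, fst q \<bullet>\<^sub>Z \<iota> 1 (snd q))"
  let ?\<psi> = "\<lambda>q. (fst q, into_fibre 1 (inverse_class (fst q) \<bullet>\<^sub>Z snd q))"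
  have t: "1 \<in> {0..1::real}" by simp
  note AF = manifold_Arr[OF manifold_fib]
  have chP: "charted ?P" and chR: "charted ?R" by (rule charted_fibre_prod)+
  have P: "fst y \<in> pts Q" "snd y \<in> path_classes (Top (fib 1))" "Q_right_moment (fst y) = class_start (snd y)"
    if "y \<in> pts ?P" for y using that by auto
  have R: "fst y \<in> pts Q" "snd y \<in> pts Q" "Q_left_moment (fst y) = Q_left_moment (snd y)"
    if "y \<in> pts ?R" for y using that by auto
  have \<phi>: "holomorphic_map ?P ?R ?\<phi>"
    unfolding holomorphic_map_iff_hol_at[OF chP]
  proof
    fix q assume q: "q \<in> pts ?P"
    have h: "hol_at ?P Q (\<lambda>q. fst q \<bullet>\<^sub>Z \<iota> 1 (snd q)) q"
      using holomorphic_right_act q unfolding holomorphic_map_iff_hol_at[OF chP] by blast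
    show "hol_at ?P ?R ?\<phi> q"
      by (rule hol_at_into_fibre_prod[where f=fst and g="\<lambda>q. fst q \<bullet>\<^sub>Z \<iota> 1 (snd q)", OF chP manifold_Q manifold_Q
            hol_at_fibre_prod_proj(1)[OF manifold_Q AF q] h]) (rule right_act_in(4)[OF P, symmetric])
  qed
  have \<psi>: "holomorphic_map ?R ?P ?\<psi>"
    unfolding holomorphic_map_iff_hol_at[OF chR]
  proof
    fix q assume q: "q \<in> pts ?R"
    note proj = hol_at_fibre_prod_proj[OF manifold_Q manifold_Q q]
    note h2 = hol_at_Q_incl_map[OF chR proj(2)] and h1 = hol_at_inv_map[OF manifold_Z chR hol_at_Q_incl_map[OF chR proj(1)]]
    have "hol_at ?R A (\<lambda>q. inverse_class (fst q) \<bullet>\<^sub>Z snd q) q"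
      by (rule hol_at_mul_maps[OF manifold_Z chR h1 h2]) (rule right_difference(2)[OF R])
    then have h: "hol_at ?R (Path (fib 1)) (\<lambda>q. into_fibre 1 (inverse_class (fst q) \<bullet>\<^sub>Z snd q)) q"
      by (rule hol_at_into_fibre[OF t chR]) (simp add: right_difference[OF R])
    show "hol_at ?R ?P ?\<psi> q"
      by (rule hol_at_into_fibre_prod[where f=fst and g="\<lambda>q. into_fibre 1 (inverse_class (fst q) \<bullet>\<^sub>Z snd q)",
            OF chR manifold_Q AF proj(1) h])
         (simp add: into_fibre(2)[OF t] right_difference[OF R])
  qed
  have \<psi>\<phi>: "?\<psi> (?\<phi> q) = q" if q: "q \<in> pts ?P" for q
    using class_mul_inv_cancel(3)[OF Q_ends(1)[OF P(1)[OF q]] right_act_in(1)[OF P[OF q]] right_act_in(2)[OF P[OF q]]]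
      into_fibre_incl[OF t P(2)[OF q]] by simp
  have \<phi>\<psi>: "?\<phi> (?\<psi> q) = q" if q: "q \<in> pts ?R" for q
  proof -
    have "class_start (fst q) = class_start (snd q)"
      unfolding Q_ends(2)[OF R(1)[OF q]] Q_ends(2)[OF R(2)[OF q]] R(3)[OF q] ..
    then show ?thesis
      using class_mul_inv_cancel(4)[OF Q_ends(1)[OF R(1)[OF q]] Q_ends(1)[OF R(2)[OF q]]]
        into_fibre(4)[OF t right_difference(1)[OF R[OF q]]] right_difference(3,4)[OF R[OF q]] by simp
  qed
  have bih: "biholomorphic_map ?P ?R ?\<phi>"
    unfolding biholomorphic_map_def using \<phi> \<psi> \<psi>\<phi> \<phi>\<psi> by blast
  show ?thesis
    unfolding right_principal_bundle_def
  proof (intro conjI)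
    show "\<forall>x\<in>pts Q. \<forall>h\<in>arrows (\<Pi>\<^sub>1 (fib 1)). Q_right_moment x = gsrc (\<Pi>\<^sub>1 (fib 1)) h -->
        Q_left_moment (Q_right_act X S p D \<gamma> x h) = Q_left_moment x"
      by (simp add: right_act_eq right_act_in)
    show "biholomorphic_map (fibre_prod Q (Path (fib 1)) Q_right_moment (gsrc (\<Pi>\<^sub>1 (fib 1)))) ?R
        (\<lambda>(x, h). (x, Q_right_act X S p D \<gamma> x h))"
      using bih by (simp add: right_act_eq case_prod_unfold)
  qed (fact right_action_Q submersion_moments(1) moments_onto(1))+
qed

lemma morita_equivalence_Q:
  "morita_equivalence (\<Pi>\<^sub>1 (fib 0)) (\<Pi>\<^sub>1 (fib 1)) Q
     Q_left_moment (Q_left_act X S p D \<gamma>) Q_right_moment (Q_right_act X S p D \<gamma>)"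
  unfolding morita_equivalence_def
proof (intro conjI ballI impI)
  fix g x h assume *: "g \<in> arrows (\<Pi>\<^sub>1 (fib 0))" "x \<in> pts Q" "h \<in> arrows (\<Pi>\<^sub>1 (fib 1))"
    "gtgt (\<Pi>\<^sub>1 (fib 0)) g = Q_left_moment x \<and> Q_right_moment x = gsrc (\<Pi>\<^sub>1 (fib 1)) h"
  then have g: "g \<in> path_classes (Top (fib 0))" "x \<in> pts Q" "class_end g = Q_left_moment x"
    and h: "x \<in> pts Q" "h \<in> path_classes (Top (fib 1))" "Q_right_moment x = class_start h" by simp_all
  show "Q_right_act X S p D \<gamma> (Q_left_act X S p D \<gamma> g x) h = Q_left_act X S p D \<gamma> g (Q_right_act X S p D \<gamma> x h)"
    unfolding left_act_eq right_act_eq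
    by (rule class_mul_assoc[OF left_act_in(1)[OF g] Q_ends(1)[OF g(2)] right_act_in(1)[OF h] left_act_in(2)[OF g] right_act_in(2)[OF h]])
next
  show "lie_groupoid (\<Pi>\<^sub>1 (fib 0))" "lie_groupoid (\<Pi>\<^sub>1 (fib 1))"
    by (rule lie_groupoid_fundamental_groupoid[OF manifold_fib])+
  show "left_principal_bundle (\<Pi>\<^sub>1 (fib 0)) Q Q_left_moment (Q_left_act X S p D \<gamma>) (Obj (\<Pi>\<^sub>1 (fib 1))) Q_right_moment"
    using left_principal_Q by simp
  show "right_principal_bundle (\<Pi>\<^sub>1 (fib 1)) Q Q_right_moment (Q_right_act X S p D \<gamma>) (Obj (\<Pi>\<^sub>1 (fib 0))) Q_left_moment"
    using right_principal_Q by simp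
qed (fact manifold_Q left_action_Q right_action_Q)+

end

theorem theorem3p6:
  fixes S :: "'s cmanifold" and X :: "'x cmanifold" and p :: "'x \<Rightarrow> 's"
    and \<gamma> :: "real \<Rightarrow> 's" and D :: "('s \<times> complex) set"
  assumes "complex_manifold S" and "complex_manifold X"
    and "holomorphic_submersion X S p"
    and "serre_fibration (Top X) (Top S) p"
    and "pathin (Top S) \<gamma>"
    and "graph_nbhd S \<gamma> D"
  shows "morita_equivalence (\<Pi>\<^sub>1 (fibre X p (\<gamma> 0))) (\<Pi>\<^sub>1 (fibre X p (\<gamma> 1))) (Q_path X S p D \<gamma>)
           Q_left_moment (Q_left_act X S p D \<gamma>) Q_right_moment (Q_right_act X S p D \<gamma>)"
  by (rule path_bibundle.morita_equivalence_Q) (unfold_locales, fact assms)+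

end
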